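(* Assume the standing assumption (A), Assumption (F1), Assumption (F2) and Assumption (SF). Then the process $(X,\Lambda)$ has the strong Feller property: for every $t>0$ and every bounded measurable $f:\mathbb R^d\times\mathbb S\to\mathbb R$, the map $(x,k)\mapsto\mathbb E_{x,k}[f(X(t),\Lambda(t))]$ is continuous on $\mathbb R^d\times\mathbb S$.
   Context: Let $d,n_0\ge1$ be integers, $\mathbb S=\{1,\dots,n_0\}$ (discrete topology), $\mathbb R^d_0=\mathbb R^d\setminus\{0\}$, $B(0,r)=\{x\in\mathbb R^d:|x|<r\}$, and fix $\varepsilon_0>0$. For each $(x,k)\in\mathbb R^d\times\mathbb S$ let $a(x,k)$ be a symmetric nonnegative definite real $d\times d$ matrix, $b(x,k)\in\mathbb R^d$, and $\nu(x,k,\cdot)$ a $\sigma$-finite measure on $\mathbb R^d_0$ with $\int|u|^2\mathbf 1_{B(0,\varepsilon_0)}(u)\nu(x,k,du)<\infty$ and $\nu(x,k,\mathbb R^d\setminus B(0,\varepsilon_0))<\infty$, all measurable in $(x,k)$. For $k\in\mathbb S$ and $g\in C^2(\mathbb R^d)$ let $\mathcal L_kg(x)=\frac12\mathrm{tr}(a(x,k)\nabla^2g(x))+\langle b(x,k),\nabla g(x)\rangle+\int_{\mathbb R^d_0}\big(g(x+u)-g(x)-\langle\nabla g(x),u\rangle\mathbf 1_{B(0,\varepsilon_0)}(u)\big)\nu(x,k,du)$. Let $Q(x)=(q_{kl}(x))_{k,l\in\mathbb S}$ be measurable in $x$, with $q_{kl}(x)\ge0$ for $k\ne l$ and $\sum_{l}q_{kl}(x)=0$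 for each $k$. For $f:\mathbb R^d\times\mathbb S\to\mathbb R$ with each $f(\cdot,k)\in C^2(\mathbb R^d)$, put $\mathcal Af(x,k)=\mathcal L_kf(\cdot,k)(x)+\sum_{l\in\mathbb S}q_{kl}(x)(f(x,l)-f(x,k))$. Let $\Omega=D([0,\infty),\mathbb R^d\times\mathbb S)$ (càdlàg paths, Skorohod topology), $(X(t),\Lambda(t))=\omega(t)$ the coordinate process, $\mathcal F_t$ the $\sigma$-field generated by the coordinates up to time $t$, $\mathcal F=\bigvee_t\mathcal F_t$. A probability $P$ on $(\Omega,\mathcal F)$ is a martingale solution for $\mathcal A$ starting from $(x,k)$ if $P((X(0),\Lambda(0))=(x,k))=1$ and, for every $f$ with $f(\cdot,k)\in C_c^\infty(\mathbb R^d)$ for all $k$, $f(X(t),\Lambda(t))-f(X(0),\Lambda(0))-\int_0^t\mathcal Af(X(s),\Lambda(s))ds$ is an $\{\mathcal F_t\}$-martingale under $P$. Martingale solutions for $\mathcal L_k$ starting from $x$ are defined analogously on $D([0,\infty),\mathbb R^d)$ with coordinate process $X$ and test functions $g\in C_c^\infty(\mathbb R^d)$. Standing assumption (A): (i) for each $k\in\mathbb S$ and $x\in\mathbb R^d$ the martingale problem for $\mathcal L_k$ starting from $x$ has a unique solution; (ii) each $q_{kk}$ is bounded from below; (iii) $\sup_{(x,k)}\int_{\mathbb R^d_0}(1\wedge|y|^2)\nu(x,k,dy)<\infty$. Under (A) the martingale problem for $\mathcal A$ has a unique solution $P^{(x,k)}$ from each $(x,k)$; $\mathbb E_{x,k}$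 denotes expectation under $P^{(x,k)}$. Assumption (F1): there exist a constant $H>0$ and a nondecreasing concave $\rho:[0,\infty)\to[0,\infty)$ with $\rho(r)>0$ for $r>0$ and $\int_{0+}dr/\rho(r)=\infty$, such that for all $k\in\mathbb S$ and $x,z\in\mathbb R^d$: $\|\sigma(x,k)-\sigma(z,k)\|^2+2\langle x-z,b(x,k)-b(z,k)\rangle\le H|x-z|\rho(|x-z|)$ and $\int_{\mathbb R^d_0}|u|\,\|\nu(x,k,\cdot)-\nu(z,k,\cdot)\|(du)\le H\rho(|x-z|)$, where $\sigma(x,k)$ is a $d\times d$ matrix with $\sigma\sigma^T=a$, $\|\cdot\|$ is the Hilbert–Schmidt norm for matrices and $\|\mu\|$ denotes the total variation measure of a signed measure $\mu$. Assumption (F2): $|q_{kl}(x)-q_{kl}(z)|\le H|x-z|$ for all $x,z\in\mathbb R^d$ and $k\ne l$, with the same $H$. Assumption (SF): there is $\lambda_0>0$ with $\langle\xi,a(x,k)\xi\rangle\ge\lambda_0|\xi|^2$ for all $x,\xi\in\mathbb R^d$, $k\in\mathbb S$; let $\sigma_{\lambda_0}(x,k)$ be the unique symmetric nonnegative definite matrix with $\sigma_{\lambda_0}(x,k)^2=a(x,k)-\lambda_0I$. Moreover there exist constants $\delta_0>0$, $H>0$ and a nonnegative function $\vartheta$ on $[0,\delta_0]$ with $\lim_{r\to0}\vartheta(r)=0$ such that for all $k\in\mathbb S$ and $x,z\in\mathbb R^d$ with $|x-z|\le\delta_0$: $2\langle x-z,b(x,k)-b(z,k)\rangle+\|\sigma_{\lambda_0}(x,k)-\sigma_{\lambda_0}(z,k)\|^2\le2H|x-z|\vartheta(|x-z|)$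 and $\int_{\mathbb R^d_0}|u|\,\|\nu(x,k,\cdot)-\nu(z,k,\cdot)\|(du)\le\frac H2\vartheta(|x-z|)$. *)

theory Defs
  imports "HOL-Probability.Probability"
begin

definition pd :: "'d::finite \<Rightarrow> (real^'d \<Rightarrow> real) \<Rightarrow> real^'d \<Rightarrow> real" where
  "pd i g x = deriv (\<lambda>h. g (x + h *\<^sub>R axis i 1)) 0"

fun iter_pd :: "'d::finite list \<Rightarrow> (real^'d \<Rightarrow> real) \<Rightarrow> real^'d \<Rightarrow> real" where
  "iter_pd [] g = g"
| "iter_pd (i # is) g = pd i (iter_pd is g)"

definition grad :: "(real^'d::finite \<Rightarrow> real) \<Rightarrow> real^'d \<Rightarrow> real^'d" where
  "grad g x = (\<chi> i. pd i g x)"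

definition smooth_fun :: "(real^'d::finite \<Rightarrow> real) \<Rightarrow> bool" where
  "smooth_fun g \<longleftrightarrow> (\<forall>is y. iter_pd is g differentiable (at y))"

definition Cc_inf :: "(real^'d::finite \<Rightarrow> real) \<Rightarrow> bool" where
  "Cc_inf g \<longleftrightarrow> smooth_fun g \<and> bounded {y. g y \<noteq> 0}"

definition sym_psd :: "real^'d^'d \<Rightarrow> bool" where
  "sym_psd m \<longleftrightarrow> transpose m = m \<and> (\<forall>\<xi>. 0 \<le> \<xi> \<bullet> (m *v \<xi>))"

definition psd_sqrt :: "real^'d^'d \<Rightarrow> real^'d^'d" where
  "psd_sqrt m = (THE s. sym_psd s \<and> s ** s = m)"

text \<open>Note: norm on real^'d^'d is the Hilbert-Schmidt (Frobenius) norm.\<close>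

definition msum :: "'a measure \<Rightarrow> 'a measure \<Rightarrow> 'a measure" where
  "msum \<mu>1 \<mu>2 = measure_of (space \<mu>1) (sets \<mu>1) (\<lambda>A. emeasure \<mu>1 A + emeasure \<mu>2 A)"

text \<open>\<open>tv_int \<mu>1 \<mu>2 g\<close> is the integral of g against the total variation measure
  of the signed measure \<mu>1 - \<mu>2, computed via densities w.r.t. \<mu>1 + \<mu>2.\<close>
definition tv_int :: "'a measure \<Rightarrow> 'a measure \<Rightarrow> ('a \<Rightarrow> real) \<Rightarrow> ennreal" where
  "tv_int \<mu>1 \<mu>2 g =
     (let lam = msum \<mu>1 \<mu>2; f1 = RN_deriv lam \<mu>1; f2 = RN_deriv lam \<mu>2
      in \<integral>\<^sup>+ u. ennreal (g u) * ((f1 u - f2 u) + (f2 u - f1 u)) \<partial>lam)"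

type_synonym 'd coef_a = "real^'d \<Rightarrow> nat \<Rightarrow> real^'d^'d"
type_synonym 'd coef_b = "real^'d \<Rightarrow> nat \<Rightarrow> real^'d"
type_synonym 'd coef_nu = "real^'d \<Rightarrow> nat \<Rightarrow> (real^'d) measure"
type_synonym 'd coef_q = "real^'d \<Rightarrow> nat \<Rightarrow> nat \<Rightarrow> real"

definition Sset :: "nat \<Rightarrow> nat set" where
  "Sset n0 = {1..n0}"

definition Lop :: "'d::finite coef_a \<Rightarrow> 'd coef_b \<Rightarrow> 'd coef_nu \<Rightarrow> real \<Rightarrow> nat
    \<Rightarrow> (real^'d \<Rightarrow> real) \<Rightarrow> real^'d \<Rightarrow> real" where
  "Lop a b \<nu> \<epsilon>0 k g x =
     (1/2) * (\<Sum>i\<in>UNIV. \<Sum>j\<in>UNIV. a x k $ i $ j * pd i (pd j g) x)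
     + b x k \<bullet> grad g x
     + (\<integral>u. (g (x + u) - g x - (grad g x \<bullet> u) * indicator (ball 0 \<epsilon>0) u) \<partial>(\<nu> x k))"

definition Aop :: "'d::finite coef_a \<Rightarrow> 'd coef_b \<Rightarrow> 'd coef_nu \<Rightarrow> 'd coef_q \<Rightarrow> real \<Rightarrow> nat
    \<Rightarrow> ((real^'d) \<times> nat \<Rightarrow> real) \<Rightarrow> (real^'d) \<times> nat \<Rightarrow> real" where
  "Aop a b \<nu> q \<epsilon>0 n0 f z =
     (case z of (x, k) \<Rightarrow>
        Lop a b \<nu> \<epsilon>0 k (\<lambda>y. f (y, k)) x
        + (\<Sum>l\<in>Sset n0. q x k l * (f (x, l) - f (x, k))))"

text \<open>Cadlag paths [0,oo) -> V; a path is represented as a function on all of real,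
  extended constantly to negative times.\<close>
definition cadlag_space :: "'a::topological_space set \<Rightarrow> (real \<Rightarrow> 'a) set" where
  "cadlag_space V = {\<omega>. (\<forall>t. \<omega> t \<in> V) \<and> (\<forall>t<0. \<omega> t = \<omega> 0)
       \<and> (\<forall>t. continuous (at_right t) \<omega>) \<and> (\<forall>t. \<exists>l. (\<omega> \<longlongrightarrow> l) (at_left t))}"

definition coord_filt :: "(real \<Rightarrow> 'a::topological_space) set \<Rightarrow> real \<Rightarrow> (real \<Rightarrow> 'a) measure" where
  "coord_filt \<Omega> t = sigma \<Omega> {{\<omega>\<in>\<Omega>. \<omega> s \<in> A} | s A. 0 \<le> s \<and> s \<le> t \<and> A \<in> sets borel}"

definition coord_sa :: "(real \<Rightarrow> 'a::topological_space) set \<Rightarrow> (real \<Rightarrow> 'a) measure" where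
  "coord_sa \<Omega> = sigma \<Omega> {{\<omega>\<in>\<Omega>. \<omega> s \<in> A} | s A. 0 \<le> s \<and> A \<in> sets borel}"

definition is_martingale :: "(real \<Rightarrow> 'a) measure \<Rightarrow> (real \<Rightarrow> (real \<Rightarrow> 'a) measure)
    \<Rightarrow> (real \<Rightarrow> (real \<Rightarrow> 'a) \<Rightarrow> real) \<Rightarrow> bool" where
  "is_martingale P F M \<longleftrightarrow>
     (\<forall>t\<ge>0. integrable P (M t) \<and> M t \<in> borel_measurable (F t)) \<and>
     (\<forall>s t A. 0 \<le> s \<longrightarrow> s \<le> t \<longrightarrow> A \<in> sets (F s) \<longrightarrow>
        (\<integral>\<omega>. indicator A \<omega> * M t \<omega> \<partial>P) = (\<integral>\<omega>. indicator A \<omega> * M s \<omega> \<partial>P))"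

definition mp_solution :: "'a::topological_space set \<Rightarrow> (('a \<Rightarrow> real) \<Rightarrow> 'a \<Rightarrow> real)
    \<Rightarrow> ('a \<Rightarrow> real) set \<Rightarrow> 'a \<Rightarrow> (real \<Rightarrow> 'a) measure \<Rightarrow> bool" where
  "mp_solution V G test z P \<longleftrightarrow>
     prob_space P \<and> space P = cadlag_space V \<and> sets P = sets (coord_sa (cadlag_space V)) \<and>
     emeasure P {\<omega> \<in> cadlag_space V. \<omega> 0 = z} = 1 \<and>
     (\<forall>g\<in>test. is_martingale P (coord_filt (cadlag_space V))
        (\<lambda>t \<omega>. g (\<omega> t) - g (\<omega> 0) - (\<integral>s. indicator {0..t} s * G g (\<omega> s) \<partial>lborel)))"

definition mp_solution_A :: "'d::finite coef_a \<Rightarrow> 'd coef_b \<Rightarrow> 'd coef_nu \<Rightarrow> 'd coef_q \<Rightarrow> real \<Rightarrow> nat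
    \<Rightarrow> (real^'d) \<times> nat \<Rightarrow> (real \<Rightarrow> (real^'d) \<times> nat) measure \<Rightarrow> bool" where
  "mp_solution_A a b \<nu> q \<epsilon>0 n0 z P \<longleftrightarrow>
     mp_solution (UNIV \<times> Sset n0) (Aop a b \<nu> q \<epsilon>0 n0)
       {f. \<forall>k\<in>Sset n0. Cc_inf (\<lambda>y. f (y, k))} z P"

definition mp_solution_L :: "'d::finite coef_a \<Rightarrow> 'd coef_b \<Rightarrow> 'd coef_nu \<Rightarrow> real \<Rightarrow> nat
    \<Rightarrow> real^'d \<Rightarrow> (real \<Rightarrow> real^'d) measure \<Rightarrow> bool" where
  "mp_solution_L a b \<nu> \<epsilon>0 k x P \<longleftrightarrow>
     mp_solution UNIV (Lop a b \<nu> \<epsilon>0 k) {g. Cc_inf g} x P"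

definition coeff_setting :: "nat \<Rightarrow> real \<Rightarrow> 'd::finite coef_a \<Rightarrow> 'd coef_b \<Rightarrow> 'd coef_nu \<Rightarrow> 'd coef_q \<Rightarrow> bool" where
  "coeff_setting n0 \<epsilon>0 a b \<nu> q \<longleftrightarrow>
     1 \<le> n0 \<and> 0 < \<epsilon>0 \<and>
     (\<forall>x. \<forall>k\<in>Sset n0. sym_psd (a x k)) \<and>
     (\<forall>x. \<forall>k\<in>Sset n0.
        sets (\<nu> x k) = sets borel \<and> emeasure (\<nu> x k) {0} = 0 \<and> sigma_finite_measure (\<nu> x k) \<and>
        (\<integral>\<^sup>+u. ennreal ((norm u)\<^sup>2 * indicator (ball 0 \<epsilon>0) u) \<partial>(\<nu> x k)) < \<infinity> \<and>
        emeasure (\<nu> x k) (- ball 0 \<epsilon>0) < \<infinity>) \<and>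
     (\<forall>k\<in>Sset n0. (\<lambda>x. a x k) \<in> borel_measurable borel \<and> (\<lambda>x. b x k) \<in> borel_measurable borel \<and>
        (\<forall>A\<in>sets borel. (\<lambda>x. emeasure (\<nu> x k) A) \<in> borel_measurable borel)) \<and>
     (\<forall>k\<in>Sset n0. \<forall>l\<in>Sset n0. (\<lambda>x. q x k l) \<in> borel_measurable borel) \<and>
     (\<forall>x. \<forall>k\<in>Sset n0. \<forall>l\<in>Sset n0. k \<noteq> l \<longrightarrow> 0 \<le> q x k l) \<and>
     (\<forall>x. \<forall>k\<in>Sset n0. (\<Sum>l\<in>Sset n0. q x k l) = 0)"

definition assumption_A :: "nat \<Rightarrow> real \<Rightarrow> 'd::finite coef_a \<Rightarrow> 'd coef_b \<Rightarrow> 'd coef_nu \<Rightarrow> 'd coef_q \<Rightarrow> bool" where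
  "assumption_A n0 \<epsilon>0 a b \<nu> q \<longleftrightarrow>
     (\<forall>k\<in>Sset n0. \<forall>x. (\<exists>P. mp_solution_L a b \<nu> \<epsilon>0 k x P) \<and>
        (\<forall>P P'. mp_solution_L a b \<nu> \<epsilon>0 k x P \<longrightarrow> mp_solution_L a b \<nu> \<epsilon>0 k x P' \<longrightarrow> P = P')) \<and>
     (\<forall>k\<in>Sset n0. \<exists>c. \<forall>x. c \<le> q x k k) \<and>
     (\<exists>C. \<forall>x. \<forall>k\<in>Sset n0. (\<integral>\<^sup>+y. ennreal (min 1 ((norm y)\<^sup>2)) \<partial>(\<nu> x k)) \<le> ennreal C)"

definition assumption_F1F2 :: "nat \<Rightarrow> 'd::finite coef_a \<Rightarrow> 'd coef_b \<Rightarrow> 'd coef_nu \<Rightarrow> 'd coef_q \<Rightarrow> bool" where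
  "assumption_F1F2 n0 a b \<nu> q \<longleftrightarrow>
     (\<exists>H>0. \<exists>\<rho> :: real \<Rightarrow> real. \<exists>\<sigma> :: 'd coef_a.
        mono_on {0..} \<rho> \<and> concave_on {0..} \<rho> \<and> (\<forall>r\<ge>0. 0 \<le> \<rho> r) \<and> (\<forall>r>0. 0 < \<rho> r) \<and>
        (\<integral>\<^sup>+r. ennreal (indicator {0<..1} r / \<rho> r) \<partial>lborel) = \<infinity> \<and>
        (\<forall>x. \<forall>k\<in>Sset n0. \<sigma> x k ** transpose (\<sigma> x k) = a x k) \<and>
        (\<forall>k\<in>Sset n0. \<forall>x z.
           (norm (\<sigma> x k - \<sigma> z k))\<^sup>2 + 2 * ((x - z) \<bullet> (b x k - b z k))
             \<le> H * norm (x - z) * \<rho> (norm (x - z)) \<and>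
           tv_int (\<nu> x k) (\<nu> z k) norm \<le> ennreal (H * \<rho> (norm (x - z)))) \<and>
        (\<forall>k\<in>Sset n0. \<forall>l\<in>Sset n0. k \<noteq> l \<longrightarrow>
           (\<forall>x z. \<bar>q x k l - q z k l\<bar> \<le> H * norm (x - z))))"

definition assumption_SF :: "nat \<Rightarrow> 'd::finite coef_a \<Rightarrow> 'd coef_b \<Rightarrow> 'd coef_nu \<Rightarrow> bool" where
  "assumption_SF n0 a b \<nu> \<longleftrightarrow>
     (\<exists>lam0>0.
        (\<forall>x \<xi>. \<forall>k\<in>Sset n0. lam0 * (norm \<xi>)\<^sup>2 \<le> \<xi> \<bullet> (a x k *v \<xi>)) \<and>
        (\<exists>\<delta>0>0. \<exists>H>0. \<exists>\<theta> :: real \<Rightarrow> real.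
           (\<forall>r\<in>{0..\<delta>0}. 0 \<le> \<theta> r) \<and> (\<theta> \<longlongrightarrow> 0) (at_right 0) \<and>
           (\<forall>k\<in>Sset n0. \<forall>x z. norm (x - z) \<le> \<delta>0 \<longrightarrow>
              2 * ((x - z) \<bullet> (b x k - b z k))
                + (norm (psd_sqrt (a x k - lam0 *\<^sub>R mat 1) - psd_sqrt (a z k - lam0 *\<^sub>R mat 1)))\<^sup>2
                \<le> 2 * H * norm (x - z) * \<theta> (norm (x - z)) \<and>
              tv_int (\<nu> x k) (\<nu> z k) norm \<le> ennreal (H / 2 * \<theta> (norm (x - z))))))"

end

theory Submission
  imports Defs
begin

text \<open>
  No coupled process is constructed. The law of a solution,
  killed on leaving a large ball and averaged over a short time window, is a flow of sub-probability measures. The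
  martingale property against smooth test functions says that one step of an explicit Markov chain acts on this flow
  up to an error of order \<open>h\<^sup>3\<close>, where \<open>h\<^sup>2\<close> is the duration of the step. By Kantorovich duality, two such flows are compared
  through pairs of functions with \<open>f z + g z' \<le> c z z'\<close>. The part of the noise that is isotropic by ellipticity is coupled by
  reflection, everything else (drift, remaining diffusion, jumps, switching) as synchronously as possible; then a
  concave cost \<open>c\<close> of the distance does not increase along a step. The cost is made to depend on time so that initially it
  is Lipschitz with a constant \<open>K\<close> depending only on the coefficients and on \<open>t\<close>, whereas at time \<open>t\<close> it dominates
  \<open>f x - f x'\<close> for a given Lipschitz \<open>f\<close> with values in the unit interval, however large the Lipschitz constant of \<open>f\<close>. Hence
  the expectations of \<open>f\<close> under the solutions started at \<open>x\<close> and \<open>x'\<close> differ by at most \<open>K * norm (x - x')\<close>, and outer regularity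
  extends this to bounded Borel functions.\<close>

section \<open>Square roots of positive semidefinite matrices\<close>

text \<open>A coupled process would have to solve a martingale problem of its own, with coefficients
  that jump where reflection is switched on; dual pairs only ever see the two marginal laws. The
  coefficients are merely locally bounded, hence the killing. The generator of a test function need
  not be continuous, so the martingale property gives a first-order expansion in time only after
  averaging over a window of fixed length. The dual functions produced by a step are only
  continuous, while the martingale problem accepts smooth ones with compact support: they are
  mollified, and the chain is frozen at \<open>x\<close> while it acts at \<open>y\<close>, so that
  it commutes with the mollification. Reflection degenerates at the diagonal, where the cost is
  rounded at scale \<open>kap\<close>; below the distance \<open>kap1\<close> the noise is shared
  and a small growth of the cost is accepted. The constant is independent of the Lipschitz constant
  of \<open>f\<close> because the curvature of the exponent 4 cost, weighted by \<open>M\<close>,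
  pays for the growth in time of the exponent \<open>p\<close> cost.\<close>

lemma symmetric_matrix_dot:
  fixes m :: "real^'n^'n"
  assumes "transpose m = m"
  shows "u \<bullet> (m *v w) = (m *v u) \<bullet> w"
  by (metis assms dot_lmul_matrix vector_transpose_matrix)

text \<open>A maximiser \<open>v\<close> of the quadratic form on the unit sphere of
  \<open>S\<close> is an eigenvector: with \<open>w\<close> the residual of the eigenvalue equation,
  moving from \<open>v\<close> to \<open>v + t *\<^sub>R w\<close> would raise the Rayleigh quotient
  to first order in \<open>t\<close> unless \<open>w = 0\<close>.\<close>

lemma symmetric_eigenvector_exists:
  fixes m :: "real^'n^'n"
  assumes sym: "transpose m = m" and S: "subspace S" "S ~= {0}"
    and inv: "!!v. v : S ==> m *v v : S"
  shows "EX v:S. norm v = 1 & (EX c. m *v v = c *\<^sub>R v)"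
proof -
  define K where "K = S \<inter> sphere 0 1"
  have "0 : S" using S(1) by (rule subspace_0)
  then obtain s where s: "s : S" "s ~= 0" using S(2) by auto
  have "(1 / norm s) *\<^sub>R s : K"
    using s S(1) by (auto simp: K_def subspace_scale)
  hence "K ~= {}" by auto
  moreover have "compact K"
    unfolding K_def using S(1) by (simp add: closed_Int_compact closed_subspace)
  moreover have "continuous_on K (%v. v \<bullet> (m *v v))"
    using continuous_on_inner[OF continuous_on_id, of K "%v. m *v v"]
      linear_continuous_on[OF matrix_vector_mul_bounded_linear[of m], of K] by simp
  ultimately obtain v where v: "v : K" "!!w. w : K ==> w \<bullet> (m *v w) <= v \<bullet> (m *v v)"
    using continuous_attains_sup[of K "%v. v \<bullet> (m *v v)"] by auto
  define c where "c = v \<bullet> (m *v v)"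
  have vS: "v : S" and nv: "norm v = 1" using v(1) by (auto simp: K_def)
  have q: "u \<bullet> (m *v u) <= c * (u \<bullet> u)" if "u : S" for u
  proof (cases "u = 0")
    case False
    have "(1 / norm u) *\<^sub>R u : K" using that False S(1) by (auto simp: K_def subspace_scale)
    from v(2)[OF this] have "(u \<bullet> (m *v u)) / (norm u)\<^sup>2 <= c"
      by (simp add: matrix_vector_mult_scaleR c_def power2_eq_square)
    thus ?thesis using False by (simp add: field_simps dot_square_norm)
  qed simp
  define w where "w = m *v v - c *\<^sub>R v"
  have wS: "w : S" unfolding w_def using S(1) inv[OF vS] vS by (intro subspace_diff subspace_scale) auto
  have key: "2 * t * (w \<bullet> w) <= t^2 * (c * (w \<bullet> w) - w \<bullet> (m *v w))" for t :: real
  proof -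
    have "v + t *\<^sub>R w : S" using S(1) vS wS by (intro subspace_add subspace_scale) auto
    from q[OF this] have "(v + t *\<^sub>R w) \<bullet> (m *v (v + t *\<^sub>R w)) <= c * ((v + t *\<^sub>R w) \<bullet> (v + t *\<^sub>R w))" .
    moreover have "v \<bullet> v = 1" using nv by (simp add: norm_eq_1)
    moreover have "w \<bullet> (m *v v) = w \<bullet> w + c * (w \<bullet> v)"
      unfolding w_def by (simp add: inner_diff_left inner_diff_right algebra_simps)
    moreover have "v \<bullet> (m *v w) = w \<bullet> (m *v v)" 
      by (simp add: symmetric_matrix_dot[OF sym, of v w] inner_commute)
    ultimately show ?thesis
      by (simp add: matrix_vector_right_distrib matrix_vector_mult_scaleR inner_add_left inner_add_right
          c_def[symmetric] inner_commute[of v w] algebra_simps power2_eq_square)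
  qed
  have "w \<bullet> w = 0"
  proof (rule ccontr)
    assume "w \<bullet> w ~= 0"
    hence pos: "w \<bullet> w > 0" by simp
    define Q where "Q = c * (w \<bullet> w) - w \<bullet> (m *v w)"
    \<comment> \<open>Small enough that the quadratic term in \<open>key\<close> is at most half of
      the linear one; the added 1 covers \<open>Q = 0\<close>.\<close>
    define t where "t = (w \<bullet> w) / (\<bar>Q\<bar> + 1)"
    have tp: "t > 0" using pos unfolding t_def by (intro divide_pos_pos) auto
    have "t * Q <= t * \<bar>Q\<bar>" using tp by (intro mult_left_mono) auto
    also have "... <= t * (\<bar>Q\<bar> + 1)" using tp by (intro mult_left_mono) auto
    also have "... = w \<bullet> w" unfolding t_def by simp
    finally have "t * (t * Q) <= t * (w \<bullet> w)" using tp by (intro mult_left_mono) auto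
    moreover have "2 * t * (w \<bullet> w) <= t * (t * Q)"
      using key[of t] by (simp add: Q_def power2_eq_square mult.assoc)
    moreover have "0 < t * (w \<bullet> w)" using tp pos by simp
    ultimately show False by linarith
  qed
  hence "m *v v = c *\<^sub>R v" unfolding w_def by simp
  thus ?thesis using vS nv by blast
qed

text \<open>Induction on the dimension: the vectors of \<open>S\<close> orthogonal to an eigenvector
  form a smaller subspace, which is invariant because \<open>m\<close> is symmetric.\<close>

lemma symmetric_eigenbasis_subspace:
  fixes m :: "real^'n^'n"
  assumes sym: "transpose m = m" and "subspace S" and "!!v. v : S ==> m *v v : S"
  shows "EX B. B \<subseteq> S & S \<subseteq> span B & pairwise orthogonal B \<and>
     (ALL v:B. norm v = 1 & (EX c. m *v v = c *\<^sub>R v))"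
  using assms(2,3)
proof (induction "dim S" arbitrary: S rule: less_induct)
  case less
  show ?case
  proof (cases "S = {0}")
    case True
    thus ?thesis by (intro exI[of _ "{}"]) auto
  next
    case False
    from symmetric_eigenvector_exists[OF sym less.prems(1) False less.prems(2)]
    obtain v c where v: "v : S" "norm v = 1" "m *v v = c *\<^sub>R v" by blast
    define S' where "S' = S \<inter> {w. v \<bullet> w = 0}"
    have sub: "subspace S'" unfolding S'_def 
      using less.prems(1) subspace_hyperplane by (rule subspace_inter)
    have inv: "m *v w : S'" if "w : S'" for w
      using that less.prems(2) unfolding S'_def
      by (auto simp: symmetric_matrix_dot[OF sym] v(3))
    have "v \<notin> S'" using v(2) by (auto simp: S'_def norm_eq_1)
    hence "S' \<subset> S" using v(1) unfolding S'_def by blast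
    hence "dim S' < dim S" using sub less.prems(1) by (metis dim_psubset span_eq_iff)
    from less.hyps[OF this sub inv] obtain B where B: "B \<subseteq> S'" "S' \<subseteq> span B" "pairwise orthogonal B"
      "ALL v:B. norm v = 1 & (EX c. m *v v = c *\<^sub>R v)" by blast
    have "S \<subseteq> span (insert v B)"
    proof
      fix w assume w: "w : S"
      have "w - (v \<bullet> w) *\<^sub>R v : S'"
        using w v(1,2) less.prems(1) unfolding S'_def
        by (auto simp: inner_diff_right norm_eq_1 intro!: subspace_diff subspace_scale)
      thus "w : span (insert v B)" using B(2) by (auto simp: span_insert)
    qed
    moreover have "pairwise orthogonal (insert v B)"
      using B(1,3) unfolding pairwise_insert S'_def by (auto simp: orthogonal_def inner_commute)
    ultimately show ?thesis using B v unfolding S'_def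
      by (intro exI[of _ "insert v B"]) auto
  qed
qed

lemma symmetric_eigenbasis:
  fixes m :: "real^'n^'n"
  assumes "transpose m = m"
  obtains B where "span B = UNIV" "pairwise orthogonal B" "finite B"
     "!!v. v : B ==> norm v = 1" "!!v. v : B ==> EX c. m *v v = c *\<^sub>R v"
proof -
  from symmetric_eigenbasis_subspace[OF assms, of UNIV] obtain B where B: "UNIV \<subseteq> span B" "pairwise orthogonal B"
     "ALL v:B. norm v = 1 & (EX c. m *v v = c *\<^sub>R v)" by auto
  have "finite B" using B by (intro pairwise_orthogonal_imp_finite) auto
  moreover have "span B = UNIV" using B(1) by auto
  ultimately show ?thesis using B(2,3) that by blast
qed

lemma matrix_eq_on_span:
  fixes r s :: "real^'n^'n"
  assumes "span B = UNIV" "!!v. v : B ==> r *v v = s *v v"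
  shows "r = s"
proof -
  have "r *v x = s *v x" for x
    using linear_eq_on_span[of "(*v) r" "(*v) s" B x] assms by auto
  thus ?thesis using matrix_eq by blast
qed

text \<open>Checked on an eigenbasis of \<open>s\<close>. If \<open>s *v v = c *\<^sub>R v\<close>,
  then \<open>r\<close> squared acts on \<open>v\<close> as \<open>c * c\<close>, so that
  \<open>w\<close>, the excess of \<open>r *v v\<close> over \<open>c *\<^sub>R v\<close>, satisfies
  \<open>r *v w = - c *\<^sub>R w\<close>; nonnegativity of \<open>r\<close> excludes this for
  \<open>c > 0\<close> unless \<open>w = 0\<close>. Uniqueness is what gives the description in
  \<open>psd_sqrt\<close> a value.\<close>

lemma psd_sqrt_unique:
  fixes r s :: "real^'n^'n"
  assumes r: "sym_psd r" and s: "sym_psd s" and eq: "r ** r = s ** s"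
  shows "r = s"
proof -
  have syms: "transpose s = s" and symr: "transpose r = r" using r s by (auto simp: sym_psd_def)
  from symmetric_eigenbasis[OF syms] obtain B where B: "span B = UNIV"
    "!!v. v : B ==> norm v = 1" "!!v. v : B ==> EX c. s *v v = c *\<^sub>R v" by metis
  show ?thesis
  proof (rule matrix_eq_on_span[OF B(1)])
    fix v assume v: "v : B"
    then obtain c where c: "s *v v = c *\<^sub>R v" using B(3) by blast
    have "0 <= v \<bullet> (s *v v)" using s by (auto simp: sym_psd_def)
    hence c0: "c >= 0" using B(2)[OF v] by (simp add: c norm_eq_1)
    have rr: "r *v (r *v v) = (c * c) *\<^sub>R v"
      unfolding matrix_vector_mul_assoc eq unfolding matrix_vector_mul_assoc[symmetric]
      by (simp add: c matrix_vector_mult_scaleR)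
    define w where "w = r *v v - c *\<^sub>R v"
    have rw: "r *v w = - c *\<^sub>R w"
      unfolding w_def by (simp add: matrix_vector_mult_diff_distrib rr matrix_vector_mult_scaleR algebra_simps)
    have "w = 0"
    proof (cases "c = 0")
      case True
      have "w \<bullet> w = v \<bullet> (r *v (r *v v))" unfolding w_def True
        by (simp add: symmetric_matrix_dot[OF symr])
      thus ?thesis by (simp add: rr True)
    next
      case False
      have "0 <= w \<bullet> (r *v w)" using r by (auto simp: sym_psd_def)
      hence "c * (w \<bullet> w) <= 0" by (simp add: rw)
      thus ?thesis using False c0 by (metis inner_gt_zero_iff less_eq_real_def mult_pos_pos not_less)
    qed
    thus "r *v v = s *v v" by (simp add: w_def c)
  qed
qed

lemma psd_sqrt_exists:
  fixes m :: "real^'n^'n"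
  assumes "sym_psd m"
  shows "EX s. sym_psd s & s ** s = m"
proof -
  have sym: "transpose m = m" and psd: "!!v. 0 <= v \<bullet> (m *v v)" using assms by (auto simp: sym_psd_def)
  from symmetric_eigenbasis[OF sym] obtain B where B: "span B = UNIV" "pairwise orthogonal B" "finite B"
     "!!v. v : B ==> norm v = 1" "!!v. v : B ==> EX c. m *v v = c *\<^sub>R v" by metis
  obtain e where e: "!!v. v : B ==> m *v v = e v *\<^sub>R v" using B(5) by metis
  have e0: "0 <= e v" if "v : B" for v using psd[of v] B(4)[OF that] e[OF that] by (simp add: norm_eq_1)
  define S where "S = (%x::real^'n. \<Sum>v\<in>B. (sqrt (e v) * (v \<bullet> x)) *\<^sub>R v)"
  have lin: "linear S" unfolding S_def
    by (intro linearI) (simp_all add: inner_add_right sum.distrib scaleR_sum_right algebra_simps)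
  define s where "s = matrix S"
  have sv: "s *v x = S x" for x unfolding s_def using lin by (simp add: matrix_works)
  have SB: "S v = sqrt (e v) *\<^sub>R v" if "v : B" for v
  proof -
    have "S v = (\<Sum>w\<in>B. if w = v then sqrt (e v) *\<^sub>R v else 0)"
      unfolding S_def using B(2,4) that
      by (intro sum.cong refl) (auto simp: pairwise_def orthogonal_def norm_eq_1)
    thus ?thesis using that B(3) by simp
  qed
  have dot: "x \<bullet> S y = (\<Sum>v\<in>B. sqrt (e v) * (v \<bullet> x) * (v \<bullet> y))" for x y
    unfolding S_def by (simp add: inner_sum_right inner_commute mult_ac)
  have "transpose s = s"
  proof -
    have "(transpose s *v x) \<bullet> y = (s *v x) \<bullet> y" for x y
    proof -
      have "(transpose s *v x) \<bullet> y = x \<bullet> (s *v y)" 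
        by (metis dot_lmul_matrix vector_transpose_matrix transpose_transpose)
      also have "... = y \<bullet> (s *v x)" by (simp add: sv dot mult_ac)
      finally show ?thesis by (simp add: inner_commute)
    qed
    hence "transpose s *v x = s *v x" for x by (metis vector_eq_rdot)
    thus ?thesis using matrix_eq by blast
  qed
  moreover have "0 <= x \<bullet> (s *v x)" for x
    unfolding sv dot mult.assoc by (intro sum_nonneg mult_nonneg_nonneg zero_le_square) (auto simp: e0)
  moreover have "s ** s = m"
  proof (rule matrix_eq_on_span[OF B(1)])
    fix v assume v: "v : B"
    show "s ** s *v v = m *v v"
      by (simp add: matrix_vector_mul_assoc[symmetric] sv SB[OF v] linear_scale[OF lin] e[OF v] e0[OF v])
  qed
  ultimately show ?thesis unfolding sym_psd_def by blast
qed

lemma psd_sqrt: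
  fixes m :: "real^'n^'n"
  assumes "sym_psd m"
  shows "sym_psd (psd_sqrt m)" "psd_sqrt m ** psd_sqrt m = m"
proof -
  have "\<exists>!s. sym_psd s & s ** s = m"
    using psd_sqrt_exists[OF assms] psd_sqrt_unique by metis
  from theI'[OF this] show "sym_psd (psd_sqrt m)" "psd_sqrt m ** psd_sqrt m = m"
    unfolding psd_sqrt_def by auto
qed

section \<open>Taylor expansion and isotropic noise\<close>

lemma line_has_derivative:
  fixes h :: "real^'d::finite => real"
  assumes "!!y. h differentiable (at y)"
  shows "((%t. h (x + t *\<^sub>R v)) has_real_derivative (\<Sum>i\<in>UNIV. v $ i * pd i h (x + t *\<^sub>R v))) (at t)"
proof -
  let ?y = "x + t *\<^sub>R v"
  obtain D where D: "(h has_derivative D) (at ?y)" using assms by (auto simp: differentiable_def)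
  have lin: "linear D" using D by (rule has_derivative_linear)
  have pd: "pd i h ?y = D (axis i 1)" for i
  proof -
    have l: "((%s. ?y + s *\<^sub>R axis i (1::real)) has_derivative (%s. s *\<^sub>R axis i 1)) (at 0)"
      by (auto intro!: derivative_eq_intros)
    have "((%s. h (?y + s *\<^sub>R axis i 1)) has_derivative (%s. D (s *\<^sub>R axis i 1))) (at 0)"
      using D by (intro has_derivative_compose[OF l]) simp
    hence "((%s. h (?y + s *\<^sub>R axis i 1)) has_real_derivative D (axis i 1)) (at 0)"
      unfolding has_field_derivative_def
      by (elim has_derivative_eq_rhs) (simp add: fun_eq_iff linear_scale[OF lin])
    thus ?thesis unfolding pd_def by (rule DERIV_imp_deriv)
  qed
  have "D v = D (\<Sum>i\<in>UNIV. v $ i *\<^sub>R axis i 1)"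
    by (simp add: basis_expansion flip: scalar_mult_eq_scaleR)
  also have "... = (\<Sum>i\<in>UNIV. v $ i * D (axis i 1))"
    by (simp add: linear_sum[OF lin] linear_scale[OF lin])
  finally have Dv: "D v = (\<Sum>i\<in>UNIV. v $ i * pd i h ?y)" by (simp add: pd)
  have l: "((%s. x + s *\<^sub>R v) has_derivative (%s. s *\<^sub>R v)) (at t)"
    by (auto intro!: derivative_eq_intros)
  have "((%s. h (x + s *\<^sub>R v)) has_derivative (%s. D (s *\<^sub>R v))) (at t)"
    using D by (intro has_derivative_compose[OF l])
  thus ?thesis unfolding has_field_derivative_def Dv[symmetric]
    by (elim has_derivative_eq_rhs) (simp add: fun_eq_iff linear_scale[OF lin])
qed

text \<open>Maclaurin's formula for \<open>g\<close> along the segment from \<open>x\<close> to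
  \<open>x + v\<close>. Each derivative along the segment is a sum of partial derivatives, with a
  factor \<open>CARD('d)\<close> in the number of terms per order, which explains the
  constants.\<close>

lemma smooth_taylor:
  fixes g :: "real^'d::finite => real"
  assumes sm: "smooth_fun g" and C: "!!is x. length is <= 3 ==> \<bar>iter_pd is g x\<bar> <= C"
  shows "\<bar>g (x + v) - g x - grad g x \<bullet> v\<bar> <= real CARD('d)^2 * C * norm v ^ 2"
    "\<bar>g (x + v) - g x - grad g x \<bullet> v - (1/2) * (\<Sum>i\<in>UNIV. \<Sum>j\<in>UNIV. v $ i * v $ j * pd i (pd j g) x)\<bar>
       <= real CARD('d)^3 * C * norm v ^ 3"
proof -
  have d: "iter_pd is g differentiable (at y)" for "is" y using sm by (simp add: smooth_fun_def)
  define d1 where "d1 t = (\<Sum>i\<in>UNIV. v $ i * iter_pd [i] g (x + t *\<^sub>R v))" for t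
  define d2 where "d2 t = (\<Sum>i\<in>UNIV. \<Sum>j\<in>UNIV. v $ i * (v $ j * iter_pd [j, i] g (x + t *\<^sub>R v)))" for t
  define d3 where "d3 t = (\<Sum>i\<in>UNIV. \<Sum>j\<in>UNIV. \<Sum>k\<in>UNIV. v $ i * (v $ j * (v $ k * iter_pd [k, j, i] g (x + t *\<^sub>R v))))" for t
  have D: "((%t. iter_pd is g (x + t *\<^sub>R v)) has_real_derivative
      (\<Sum>i\<in>UNIV. v $ i * iter_pd (i # is) g (x + t *\<^sub>R v))) (at t)" for "is" t
    using line_has_derivative[OF d, of "is" x v t] by simp
  have D0: "((%t. g (x + t *\<^sub>R v)) has_real_derivative d1 t) (at t)" for t
    using D[of "[]" t] by (simp add: d1_def)
  have D1: "(d1 has_real_derivative d2 t) (at t)" for t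
    unfolding d1_def[abs_def] d2_def sum_distrib_left[symmetric] by (intro DERIV_sum DERIV_cmult D)
  have D2: "(d2 has_real_derivative d3 t) (at t)" for t
    unfolding d2_def[abs_def] d3_def sum_distrib_left[symmetric] by (intro DERIV_sum DERIV_cmult D)
  have C0: "C >= 0" using C[of "[]" x] by simp
  have vn: "\<bar>v $ i\<bar> <= norm v" for i by (rule component_le_norm_cart)
  have b2: "\<bar>d2 t\<bar> <= real CARD('d)^2 * C * norm v ^ 2" for t
  proof -
    have "\<bar>d2 t\<bar> <= (\<Sum>i\<in>(UNIV::'d set). \<Sum>j\<in>(UNIV::'d set). norm v * (norm v * C))"
      unfolding d2_def
      by (intro order_trans[OF sum_abs] sum_mono order_trans[OF sum_abs])
         (auto simp: abs_mult simp del: iter_pd.simps intro!: mult_mono vn C)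
    thus ?thesis by (simp add: power2_eq_square mult_ac)
  qed
  have b3: "\<bar>d3 t\<bar> <= real CARD('d)^3 * C * norm v ^ 3" for t
  proof -
    have "\<bar>d3 t\<bar> <= (\<Sum>i\<in>(UNIV::'d set). \<Sum>j\<in>(UNIV::'d set). \<Sum>k\<in>(UNIV::'d set). norm v * (norm v * (norm v * C)))"
      unfolding d3_def
      by (intro order_trans[OF sum_abs] sum_mono order_trans[OF sum_abs])
         (auto simp: abs_mult simp del: iter_pd.simps intro!: mult_mono vn C C0)
    thus ?thesis by (simp add: power3_eq_cube mult_ac)
  qed
  have g1: "d1 0 = grad g x \<bullet> v" by (simp add: d1_def grad_def inner_vec_def mult.commute)
  \<comment> \<open>Renaming the summation indices stands in for the symmetry of second
    derivatives.\<close>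
  have g2: "d2 0 = (\<Sum>i\<in>UNIV. \<Sum>j\<in>UNIV. v $ i * v $ j * pd i (pd j g) x)"
    unfolding d2_def by (subst sum.swap) (simp add: mult_ac)
  define df where "df m = (if m = 0 then (%t. g (x + t *\<^sub>R v)) else if m = 1 then d1 else if m = 2 then d2 else d3)" for m :: nat
  have df: "m < 3 ==> (df m has_real_derivative df (Suc m) t) (at t)" for m t
    using D0 D1 D2 unfolding df_def by (cases m) (auto simp: less_Suc_eq numeral_3_eq_3)
  have "EX t>0. t < 1 & df 0 1 = (\<Sum>m<2. df m 0 / fact m * 1 ^ m) + df 2 t / fact 2 * 1 ^ 2"
    by (rule Maclaurin) (use df in auto)
  then obtain t where "g (x + v) = g x + d1 0 + d2 t / 2"
    by (auto simp: df_def numeral_2_eq_2)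
  thus "\<bar>g (x + v) - g x - grad g x \<bullet> v\<bar> <= real CARD('d)^2 * C * norm v ^ 2"
    using b2[of t] by (simp add: g1)
  have "EX t>0. t < 1 & df 0 1 = (\<Sum>m<3. df m 0 / fact m * 1 ^ m) + df 3 t / fact 3 * 1 ^ 3"
    by (rule Maclaurin) (use df in auto)
  then obtain t where "g (x + v) = g x + d1 0 + d2 0 / 2 + d3 t / 6"
    by (auto simp: df_def numeral_3_eq_3 fact_numeral)
  thus "\<bar>g (x + v) - g x - grad g x \<bullet> v - (1/2) * (\<Sum>i\<in>UNIV. \<Sum>j\<in>UNIV. v $ i * v $ j * pd i (pd j g) x)\<bar>
       <= real CARD('d)^3 * C * norm v ^ 3"
    using b3[of t] by (simp add: g1 g2)
qed

section \<open>Reflections in hyperplanes and a reflection-invariant noise\<close>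

definition reflect :: "'a::euclidean_space => 'a => 'a" where
  "reflect n x = x - (2 * (n \<bullet> x)) *\<^sub>R n"

lemma reflect_linear: "linear (reflect n)"
  unfolding reflect_def by (intro linearI) (auto simp: inner_add_right algebra_simps)

lemma reflect_borel [measurable]: "reflect n : borel_measurable borel"
  unfolding reflect_def by measurable

lemma reflect_reflect: "norm n = 1 ==> reflect n (reflect n x) = x"
  by (simp add: reflect_def inner_diff_right norm_eq_1 algebra_simps)

lemma norm_reflect: "norm n = 1 ==> norm (reflect n x) = norm x"
  unfolding norm_eq reflect_def
  by (simp add: inner_diff_right inner_diff_left norm_eq_1 inner_commute algebra_simps)

text \<open>Uniqueness of Haar measure in the form needed here: Fubini applied to \<open>f x * g (x + y)\<close>.\<close>
lemma lborel_reflect: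
  fixes n :: "'a::euclidean_space"
  assumes n: "norm n = 1"
  shows "distr lborel borel (reflect n) = lborel"
proof -
  define \<mu> where "\<mu> = distr lborel borel (reflect n)"
  have s: "sets \<mu> = sets borel" by (simp add: \<mu>_def)
  have tr: "(\<integral>\<^sup>+y. g (y + x) \<partial>\<mu>) = (\<integral>\<^sup>+y. g y \<partial>\<mu>)" if [measurable]: "g : borel_measurable borel" for g :: "'a => ennreal" and x
  proof -
    have "(\<integral>\<^sup>+y. g (y + x) \<partial>\<mu>) = (\<integral>\<^sup>+y. g (reflect n (reflect n x + y)) \<partial>lborel)"
      unfolding \<mu>_def by (subst nn_integral_distr) (auto simp: linear_add[OF reflect_linear] reflect_reflect[OF n] add.commute)
    also have "... = (\<integral>\<^sup>+y. g (reflect n y) \<partial>(distr lborel borel ((+) (reflect n x))))"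
      by (subst nn_integral_distr) auto
    also have "... = (\<integral>\<^sup>+y. g y \<partial>\<mu>)" unfolding \<mu>_def lborel_distr_plus by (subst nn_integral_distr) auto
    finally show ?thesis .
  qed
  have trl: "(\<integral>\<^sup>+y. g (y + x) \<partial>lborel) = (\<integral>\<^sup>+y. g y \<partial>lborel)" if [measurable]: "g : borel_measurable borel" for g :: "'a => ennreal" and x
  proof -
    have "(\<integral>\<^sup>+y. g (y + x) \<partial>lborel) = (\<integral>\<^sup>+y. g y \<partial>(distr lborel borel ((+) x)))"
      by (subst nn_integral_distr) (auto simp: add.commute)
    thus ?thesis by (simp add: lborel_distr_plus)
  qed
  have "sigma_finite_measure \<mu>"
  proof -
    have "range (%k. cball (0::'a) (real k)) \<subseteq> sets \<mu>" "(\<Union>k. cball (0::'a) (real k)) = space \<mu>"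
      by (auto simp: \<mu>_def real_arch_simple)
    moreover have "emeasure \<mu> (cball 0 (real k)) ~= \<infinity>" for k
    proof -
      have "reflect n -` cball 0 (real k) \<inter> space lborel = cball 0 (real k)"
        by (auto simp: norm_reflect[OF n])
      thus ?thesis unfolding \<mu>_def using emeasure_lborel_cball_finite[of "0::'a" "real k"]
        by (subst emeasure_distr) auto
    qed
    ultimately show ?thesis unfolding sigma_finite_measure_def
      by (intro exI[of _ "range (%k. cball (0::'a) (real k))"]) auto
  qed
  then interpret M: sigma_finite_measure \<mu> .
  interpret P: pair_sigma_finite lborel \<mu> by unfold_locales
  \<comment> \<open>The middle quantity is the double integral of \<open>f x * g (y + x)\<close>.
    Translation invariance of \<open>\<mu>\<close> turns it into the left side; invariance of
    \<open>lborel\<close> in the other order of integration, and then again that of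
    \<open>\<mu>\<close>, turns it into the right side.\<close>
  have key: "(\<integral>\<^sup>+x. f x \<partial>lborel) * (\<integral>\<^sup>+y. g y \<partial>\<mu>) = (\<integral>\<^sup>+x. g x \<partial>lborel) * (\<integral>\<^sup>+y. f (- y) \<partial>\<mu>)"
    if [measurable]: "f : borel_measurable borel" "g : borel_measurable borel" for f g :: "'a => ennreal"
  proof -
    note [measurable_cong] = s
    have "(\<integral>\<^sup>+x. f x \<partial>lborel) * (\<integral>\<^sup>+y. g y \<partial>\<mu>) = (\<integral>\<^sup>+x. f x * (\<integral>\<^sup>+y. g (y + x) \<partial>\<mu>) \<partial>lborel)"
      by (subst tr) (auto simp: nn_integral_multc)
    also have "... = (\<integral>\<^sup>+x. (\<integral>\<^sup>+y. f x * g (y + x) \<partial>\<mu>) \<partial>lborel)"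
      by (intro nn_integral_cong) (subst nn_integral_cmult, auto)
    also have "... = (\<integral>\<^sup>+y. (\<integral>\<^sup>+x. f x * g (y + x) \<partial>lborel) \<partial>\<mu>)"
      by (rule P.Fubini'[symmetric]) measurable
    also have "... = (\<integral>\<^sup>+y. (\<integral>\<^sup>+x. f (x - y) * g x \<partial>lborel) \<partial>\<mu>)"
    proof (rule nn_integral_cong)
      fix y
      show "(\<integral>\<^sup>+x. f x * g (y + x) \<partial>lborel) = (\<integral>\<^sup>+x. f (x - y) * g x \<partial>lborel)"
        using trl[of "%x. f (x - y) * g x" y] by (simp add: add.commute)
    qed
    also have "... = (\<integral>\<^sup>+x. (\<integral>\<^sup>+y. f (x - y) * g x \<partial>\<mu>) \<partial>lborel)"
      by (rule P.Fubini') measurable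
    also have "... = (\<integral>\<^sup>+x. g x * (\<integral>\<^sup>+y. f (- y) \<partial>\<mu>) \<partial>lborel)"
    proof (rule nn_integral_cong)
      fix x
      have "(\<integral>\<^sup>+y. f (x - y) * g x \<partial>\<mu>) = (\<integral>\<^sup>+y. f (x - y) \<partial>\<mu>) * g x" by (rule nn_integral_multc) measurable
      also have "(\<integral>\<^sup>+y. f (x - y) \<partial>\<mu>) = (\<integral>\<^sup>+y. f (- y) \<partial>\<mu>)"
        using tr[of "%y. f (- y)" "- x"] by (simp add: add.commute)
      finally show "(\<integral>\<^sup>+y. f (x - y) * g x \<partial>\<mu>) = g x * (\<integral>\<^sup>+y. f (- y) \<partial>\<mu>)" by (simp add: mult.commute)
    qed
    also have "... = (\<integral>\<^sup>+x. g x \<partial>lborel) * (\<integral>\<^sup>+y. f (- y) \<partial>\<mu>)" by (rule nn_integral_multc) measurable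
    finally show ?thesis .
  qed
  \<comment> \<open>The unit ball is fixed by the reflection and by the change of sign, so both
    measures give it the same finite positive volume, which cancels.\<close>
  let ?f = "indicator (cball 0 1) :: 'a => ennreal"
  let ?c = "emeasure lborel (cball (0::'a) 1)"
  have "(\<integral>\<^sup>+y. ?f (- y) \<partial>\<mu>) = ?c"
    unfolding \<mu>_def by (subst nn_integral_distr) (auto simp: indicator_def norm_reflect[OF n]
      intro!: trans[OF nn_integral_cong nn_integral_indicator])
  moreover have "(\<integral>\<^sup>+y. ?f y \<partial>lborel) = ?c" by simp
  ultimately have eq: "?c * (\<integral>\<^sup>+y. g y \<partial>\<mu>) = ?c * (\<integral>\<^sup>+x. g x \<partial>lborel)" if "g : borel_measurable borel" for g
    using key[OF borel_measurable_indicator that, of "cball 0 1"] by (simp add: mult.commute)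
  have c: "?c ~= 0" "?c ~= \<infinity>"
    by (auto simp: emeasure_cball unit_ball_vol_pos less_imp_neq[symmetric])
  show ?thesis unfolding \<mu>_def[symmetric]
  proof (rule measure_eqI)
    fix A assume "A : sets \<mu>"
    thus "emeasure \<mu> A = emeasure lborel A"
      using eq[of "indicator A"] c s by (simp add: ennreal_mult_cancel_left)
  qed (simp add: s)
qed

text \<open>The uniform distribution on the unit ball. Its moments follow from invariance under
  reflections: reflecting along a direction kills the mean in it, reflecting along one axis kills
  the mixed moments, and the reflection exchanging two unit vectors equates their variances. The
  variance is positive because otherwise all mass would sit at the origin, a null set.\<close>

lemma isotropic_noise_exists:
  obtains N :: "(real^'d::finite) measure" and v0 :: real
  where "prob_space N" "sets N = sets borel" "AE u in N. norm u <= 1" "v0 > 0"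
    "!!n h. norm n = 1 ==> h : borel_measurable borel ==> (LINT u|N. h (reflect n u)) = (LINT u|N. (h u :: real))"
    "!!e. (LINT u|N. e \<bullet> u) = 0" "!!e. norm e = 1 ==> (LINT u|N. (e \<bullet> u)\<^sup>2) = v0"
    "!!i j. i ~= j ==> (LINT u|N. u $ i * u $ j) = 0"
proof -
  define N where "N = uniform_measure lborel (cball (0::real^'d) 1)"
  have c: "emeasure lborel (cball (0::real^'d) 1) ~= 0" "emeasure lborel (cball (0::real^'d) 1) ~= \<infinity>"
    by (auto simp: emeasure_cball unit_ball_vol_pos less_imp_neq[symmetric])
  interpret N: prob_space N unfolding N_def using c by (intro prob_space_uniform_measure) auto
  have sN[measurable_cong]: "sets N = sets borel" by (simp add: N_def)
  have AEN: "AE u in N. norm u <= 1" unfolding N_def by (intro AE_uniform_measureI) auto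
  have refl: "(LINT u|N. h (reflect n u)) = (LINT u|N. h u)" if n: "norm n = 1" and [measurable]: "h : borel_measurable borel" for n and h :: "_ => real"
  proof -
    have "distr N borel (reflect n) = N"
    proof (rule measure_eqI)
      fix A assume "A : sets (distr N borel (reflect n))"
      hence [measurable]: "A : sets borel" by simp
      have "emeasure lborel (cball 0 1 \<inter> A) = emeasure (distr lborel borel (reflect n)) (cball 0 1 \<inter> A)"
        by (simp add: lborel_reflect[OF n])
      also have "... = emeasure lborel (reflect n -` (cball 0 1 \<inter> A) \<inter> space lborel)"
        by (subst emeasure_distr) auto
      also have "reflect n -` (cball 0 1 \<inter> A) \<inter> space lborel = cball 0 1 \<inter> reflect n -` A"
        by (auto simp: norm_reflect[OF n])
      finally show "emeasure (distr N borel (reflect n)) A = emeasure N A"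
        using measurable_sets[OF reflect_borel[of n], of A]
        by (subst emeasure_distr) (auto simp: N_def)
    qed (simp add: sN)
    hence "(LINT u|N. h u) = (LINT u|(distr N borel (reflect n)). h u)" by simp
    thus ?thesis by (subst (asm) integral_distr) auto
  qed
  have odd: "(LINT u|N. h u) = 0" if "norm n = 1" "h : borel_measurable borel" "!!u. h (reflect n u) = - h u" for n and h :: "_ => real"
    using refl[OF that(1,2)] that(3) by simp
  have ints: "integrable N (%u. (e \<bullet> u)\<^sup>2)" for e
  proof (rule N.integrable_const_bound[where B="(norm e)\<^sup>2"])
    show "AE u in N. norm ((e \<bullet> u)\<^sup>2) <= (norm e)\<^sup>2"
      using AEN
    proof eventually_elim
      fix u :: "real^'d" assume "norm u <= 1"
      hence "\<bar>e \<bullet> u\<bar> <= norm e * 1" using Cauchy_Schwarz_ineq2[of e u] by (meson mult_left_mono norm_ge_zero order_trans)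
      thus "norm ((e \<bullet> u)\<^sup>2) <= (norm e)\<^sup>2" by (simp add: abs_le_square_iff[symmetric])
    qed
  qed simp
  have same: "(LINT u|N. (e \<bullet> u)\<^sup>2) = (LINT u|N. (e' \<bullet> u)\<^sup>2)" if e: "norm e = 1" "norm e' = 1" for e e'
  proof (cases "e = e'")
    case False
    \<comment> \<open>The reflection along \<open>e - e'\<close> exchanges the unit vectors
      \<open>e\<close> and \<open>e'\<close>.\<close>
    define n where "n = (1 / norm (e - e')) *\<^sub>R (e - e')"
    have n: "norm n = 1" using False by (simp add: n_def)
    have "e \<bullet> reflect n u = e' \<bullet> u" for u
    proof -
      have k: "2 * ((e - e') \<bullet> e) = (norm (e - e'))\<^sup>2"
        using e by (simp add: power2_norm_eq_inner norm_eq_1 inner_diff_left inner_diff_right inner_commute)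
      have "e \<bullet> reflect n u = e \<bullet> u - (2 * ((e - e') \<bullet> e)) / (norm (e - e'))\<^sup>2 * ((e - e') \<bullet> u)"
        by (simp add: reflect_def n_def inner_diff_right[of e u] power2_eq_square inner_commute[of e "e - e'"] mult_ac
            del: inner_diff_left inner_diff_right)
      also have "... = e' \<bullet> u" using False by (subst k) (simp add: inner_diff_left)
      finally show ?thesis .
    qed
    thus ?thesis using refl[OF n, of "%u. (e \<bullet> u)\<^sup>2"] by simp
  qed simp
  define v0 where "v0 = (LINT u|N. (axis undefined 1 \<bullet> u)\<^sup>2)"
  have v: "(LINT u|N. (e \<bullet> u)\<^sup>2) = v0" if "norm e = 1" for e unfolding v0_def by (intro same that) simp
  show thesis
  proof (rule that)
    show "v0 > 0"
    proof (rule ccontr)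
      assume "\<not> v0 > 0"
      moreover have "v0 >= 0" by (simp add: v0_def)
      ultimately have "v0 = 0" by simp
      hence "AE u in N. (axis i 1 \<bullet> u)\<^sup>2 = 0" for i
        using integral_nonneg_eq_0_iff_AE[OF ints[of "axis i 1"]] v[of "axis i 1"] by simp
      hence "AE u in N. ALL i:UNIV. (axis i 1 \<bullet> u)\<^sup>2 = 0" by (subst AE_finite_all) auto
      hence "AE u in N. u = 0" by eventually_elim (simp add: inner_axis' vec_eq_iff)
      hence "N.prob {0} = 1" by (subst N.prob_eq_1) (auto simp: sN)
      moreover have "emeasure N {0} = 0" unfolding N_def by (subst emeasure_uniform_measure) auto
      ultimately show False by (simp add: measure_def)
    qed
    show "(LINT u|N. e \<bullet> u) = 0" for e
    proof (cases "e = 0")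
      case False
      show ?thesis
        by (rule odd[of "(1 / norm e) *\<^sub>R e"])
           (use False in \<open>auto simp: reflect_def inner_diff_right power2_norm_eq_inner[symmetric] power2_eq_square\<close>)
    qed simp
    show "(LINT u|N. u $ i * u $ j) = 0" if "i ~= j" for i j
    proof -
      have "(axis i (1::real)) $ i = 1" "(axis i (1::real)) $ j = 0" using that by (auto simp: axis_def)
      thus ?thesis by (intro odd[of "axis i 1"]) (auto simp: reflect_def inner_axis' algebra_simps)
    qed
  qed (use N.prob_space_axioms sN AEN refl v in auto)
qed

section \<open>Densities and coupled jumps\<close>

lemma emeasure_msum:
  assumes "sets \<mu>2 = sets \<mu>1" "A : sets \<mu>1"
  shows "emeasure (msum \<mu>1 \<mu>2) A = emeasure \<mu>1 A + emeasure \<mu>2 A"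
  unfolding msum_def
proof (rule emeasure_measure_of_sigma)
  show "sigma_algebra (space \<mu>1) (sets \<mu>1)" by (rule sets.sigma_algebra_axioms)
  show "positive (sets \<mu>1) (%A. emeasure \<mu>1 A + emeasure \<mu>2 A)" by (simp add: positive_def)
  show "countably_additive (sets \<mu>1) (%A. emeasure \<mu>1 A + emeasure \<mu>2 A)"
    unfolding countably_additive_def
    using assms(1) by (auto simp: suminf_add[symmetric] suminf_emeasure)
qed fact

lemma sets_msum [simp]: "sets (msum \<mu>1 \<mu>2) = sets \<mu>1" "space (msum \<mu>1 \<mu>2) = space \<mu>1"
  by (simp_all add: msum_def)

text \<open>Pairwise intersections of the two countable covers have finite mass under both
  measures.\<close>

lemma sigma_finite_msum:
  assumes s: "sets \<mu>2 = sets \<mu>1" and "sigma_finite_measure \<mu>1" "sigma_finite_measure \<mu>2"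
  shows "sigma_finite_measure (msum \<mu>1 \<mu>2)"
proof -
  have sp: "space \<mu>2 = space \<mu>1" using s by (rule sets_eq_imp_space_eq)
  from assms(2) obtain A where A: "countable A" "A \<subseteq> sets \<mu>1" "\<Union>A = space \<mu>1" "ALL a:A. emeasure \<mu>1 a ~= \<infinity>"
    unfolding sigma_finite_measure_def by blast
  from assms(3) obtain B where B: "countable B" "B \<subseteq> sets \<mu>2" "\<Union>B = space \<mu>2" "ALL a:B. emeasure \<mu>2 a ~= \<infinity>"
    unfolding sigma_finite_measure_def by blast
  define C where "C = (\<Union>a\<in>A. (\<inter>) a ` B)"
  have "countable C" unfolding C_def using A B by auto
  moreover have "C \<subseteq> sets \<mu>1" unfolding C_def using A B s by auto
  moreover have "\<Union>C = space \<mu>1" unfolding C_def using A(3) B(3) sp by (auto simp: set_eq_iff)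
  moreover have "emeasure (msum \<mu>1 \<mu>2) c ~= \<infinity>" if cC: "c : C" for c
  proof -
    obtain a b where ab: "a : A" "b : B" "c = a \<inter> b" using cC unfolding C_def by blast
    have "emeasure \<mu>1 c <= emeasure \<mu>1 a" "emeasure \<mu>2 c <= emeasure \<mu>2 b"
      using ab A B s by (auto intro!: emeasure_mono)
    moreover have "emeasure \<mu>1 a < \<infinity>" "emeasure \<mu>2 b < \<infinity>" using ab A(4) B(4) by (auto simp: less_top)
    ultimately have "emeasure \<mu>1 c < \<infinity>" "emeasure \<mu>2 c < \<infinity>" by (auto intro: le_less_trans)
    moreover have "c : sets \<mu>1" using ab A B s by auto
    ultimately show ?thesis by (simp add: emeasure_msum[OF s] less_top)
  qed
  ultimately show ?thesis unfolding sigma_finite_measure_def by (intro exI[of _ C]) auto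
qed

text \<open>Real densities of both measures with respect to their sum: the Radon-Nikodym derivatives
  are finite almost everywhere by \<sigma>-finiteness. Subtraction in \<open>ennreal\<close> is
  truncated at 0, so the two differences in \<open>tv_int\<close> add up to the absolute value.
  Densities over one measure allow two jump laws to be compared point by point.\<close>

lemma tv_int_densities:
  fixes \<mu>1 \<mu>2 :: "'a::euclidean_space measure"
  assumes s1: "sets \<mu>1 = sets borel" and s2: "sets \<mu>2 = sets borel"
    and sf: "sigma_finite_measure \<mu>1" "sigma_finite_measure \<mu>2"
    and tv: "tv_int \<mu>1 \<mu>2 norm <= ennreal \<theta>" and \<theta>: "\<theta> >= 0"
  obtains l :: "'a measure" and p1 p2 :: "'a => real"
  where "sets l = sets borel" "p1 : borel_measurable borel" "p2 : borel_measurable borel"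
    "!!u. 0 <= p1 u" "!!u. 0 <= p2 u" "\<mu>1 = density l p1" "\<mu>2 = density l p2"
    "integrable l (%u. norm u * \<bar>p1 u - p2 u\<bar>)" "(LINT u|l. norm u * \<bar>p1 u - p2 u\<bar>) <= \<theta>"
proof -
  define l where "l = msum \<mu>1 \<mu>2"
  have ss: "sets \<mu>2 = sets \<mu>1" using s1 s2 by simp
  have sl[measurable_cong]: "sets l = sets borel" by (simp add: l_def s1)
  interpret l: sigma_finite_measure l unfolding l_def by (rule sigma_finite_msum[OF ss sf])
  have ac1: "absolutely_continuous l \<mu>1" and ac2: "absolutely_continuous l \<mu>2"
    unfolding absolutely_continuous_def null_sets_def l_def using emeasure_msum[OF ss] s1 s2 by auto
  define f1 where "f1 = RN_deriv l \<mu>1"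
  define f2 where "f2 = RN_deriv l \<mu>2"
  have [measurable]: "f1 : borel_measurable borel" "f2 : borel_measurable borel"
    using borel_measurable_RN_deriv[of l \<mu>1] borel_measurable_RN_deriv[of l \<mu>2]
    by (simp_all add: f1_def f2_def measurable_cong_sets[OF sl refl])
  have d1: "density l f1 = \<mu>1" unfolding f1_def by (rule l.density_RN_deriv[OF ac1]) (simp add: s1 sl)
  have d2: "density l f2 = \<mu>2" unfolding f2_def by (rule l.density_RN_deriv[OF ac2]) (simp add: s2 sl)
  have fin: "AE u in l. f1 u ~= \<infinity> & f2 u ~= \<infinity>"
    unfolding f1_def f2_def using l.RN_deriv_finite[OF sf(1) ac1] l.RN_deriv_finite[OF sf(2) ac2] s1 s2 sl by auto
  define p1 where "p1 u = enn2real (f1 u)" for u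
  define p2 where "p2 u = enn2real (f2 u)" for u
  have [measurable]: "p1 : borel_measurable borel" "p2 : borel_measurable borel"
    unfolding p1_def p2_def by measurable
  have eq: "AE u in l. f1 u = ennreal (p1 u) & f2 u = ennreal (p2 u)"
    using fin by eventually_elim (simp add: p1_def p2_def less_top)
  have m1: "\<mu>1 = density l p1" unfolding d1[symmetric] using eq by (intro density_cong) auto
  have m2: "\<mu>2 = density l p2" unfolding d2[symmetric] using eq by (intro density_cong) auto
  have nn: "0 <= p1 u" "0 <= p2 u" for u by (simp_all add: p1_def p2_def)
  have "(\<integral>\<^sup>+u. ennreal (norm u * \<bar>p1 u - p2 u\<bar>) \<partial>l) = tv_int \<mu>1 \<mu>2 norm"
    unfolding tv_int_def Let_def l_def[symmetric] f1_def[symmetric] f2_def[symmetric]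
  proof (rule nn_integral_cong_AE)
    show "AE u in l. ennreal (norm u * \<bar>p1 u - p2 u\<bar>) = ennreal (norm u) * ((f1 u - f2 u) + (f2 u - f1 u))"
      using eq
    proof eventually_elim
      fix u assume "f1 u = ennreal (p1 u) & f2 u = ennreal (p2 u)"
      moreover have "ennreal (p1 u) - ennreal (p2 u) + (ennreal (p2 u) - ennreal (p1 u)) = ennreal \<bar>p1 u - p2 u\<bar>"
        using nn[of u] by (cases "p1 u <= p2 u") (auto simp: ennreal_minus ennreal_neg)
      ultimately show "ennreal (norm u * \<bar>p1 u - p2 u\<bar>) = ennreal (norm u) * ((f1 u - f2 u) + (f2 u - f1 u))"
        by (simp add: ennreal_mult)
    qed
  qed
  hence le: "(\<integral>\<^sup>+u. ennreal (norm u * \<bar>p1 u - p2 u\<bar>) \<partial>l) <= ennreal \<theta>" using tv by simp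
  hence int: "integrable l (%u. norm u * \<bar>p1 u - p2 u\<bar>)"
    by (intro integrableI_bounded) (auto intro: le_less_trans)
  have "(LINT u|l. norm u * \<bar>p1 u - p2 u\<bar>) <= \<theta>"
    using le nn_integral_eq_integral[OF int] \<theta> by (simp add: ennreal_le_iff)
  thus thesis using that[OF sl _ _ nn m1 m2 int] by simp
qed

text \<open>The dual form of a maximal coupling of two jump measures with densities
  \<open>p1\<close> and \<open>p2\<close>, both completed by null events to the mass
  \<open>L\<close>. On the common part \<open>min (p1 u) (p2 u)\<close> both sides jump by
  \<open>u\<close>; on the excess only one of them does, at the extra price \<open>G u\<close>; on
  the remaining mass neither does. \<open>f0\<close> and \<open>h0\<close> are the values without a
  jump.\<close>

lemma coupled_jump_bound:
  fixes p1 p2 F H G :: "'a => real"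
  assumes int: "integrable l p1" "integrable l p2" "integrable l (%u. F u * p1 u)" "integrable l (%u. H u * p2 u)"
      "integrable l (%u. G u * \<bar>p1 u - p2 u\<bar>)"
    and nn: "!!u. u : space l ==> 0 <= p1 u" "!!u. u : space l ==> 0 <= p2 u"
    and FH: "!!u. u : space l ==> F u + H u <= c" "!!u. u : space l ==> F u + h0 <= c + G u"
      "!!u. u : space l ==> f0 + H u <= c + G u" "f0 + h0 <= c"
    and L: "(LINT u|l. p1 u) + (LINT u|l. p2 u) <= L"
  shows "(LINT u|l. F u * p1 u) + (L - (LINT u|l. p1 u)) * f0 + ((LINT u|l. H u * p2 u) + (L - (LINT u|l. p2 u)) * h0)
     <= L * c + (LINT u|l. G u * \<bar>p1 u - p2 u\<bar>)"
proof -
  note int_max = Bochner_Integration.integrable_max[OF int(1,2)]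
  let ?m = "%u. max (p1 u) (p2 u)"
  have "(LINT u|l. ?m u) <= (LINT u|l. p1 u + p2 u)"
    using nn int int_max by (intro integral_mono) auto
  hence M: "(LINT u|l. ?m u) <= L" using L int by simp
  have "(LINT u|l. F u * p1 u + H u * p2 u + (?m u - p1 u) * f0 + (?m u - p2 u) * h0)
     <= (LINT u|l. ?m u * c + G u * \<bar>p1 u - p2 u\<bar>)"
  proof (rule integral_mono)
    fix u assume u: "u : space l"
    show "F u * p1 u + H u * p2 u + (?m u - p1 u) * f0 + (?m u - p2 u) * h0 <= ?m u * c + G u * \<bar>p1 u - p2 u\<bar>"
    proof (cases "p1 u <= p2 u")
      case True
      have "p1 u * (F u + H u) <= p1 u * c" using FH(1) nn u by (intro mult_left_mono) auto
      moreover have "(p2 u - p1 u) * (f0 + H u) <= (p2 u - p1 u) * (c + G u)" using FH(3) True u by (intro mult_left_mono) auto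
      ultimately show ?thesis using True by (simp add: max_def algebra_simps)
    next
      case False
      have "p2 u * (F u + H u) <= p2 u * c" using FH(1) nn u by (intro mult_left_mono) auto
      moreover have "(p1 u - p2 u) * (F u + h0) <= (p1 u - p2 u) * (c + G u)" using FH(2) False u by (intro mult_left_mono) auto
      ultimately show ?thesis using False by (simp add: max_def algebra_simps)
    qed
  qed (use int int_max in auto)
  moreover have "(L - (LINT u|l. ?m u)) * (f0 + h0) <= (L - (LINT u|l. ?m u)) * c"
    using M FH(4) by (intro mult_left_mono) auto
  ultimately show ?thesis using int int_max by (simp add: algebra_simps)
qed

text \<open>The same coupling for counting measure on a finite set, as needed for the
  switching.\<close>

lemma coupled_jump_bound_sum:
  fixes p1 p2 F H :: "'a => real" and G :: real
  assumes fin: "finite S" and nn: "!!u. u : S ==> 0 <= p1 u" "!!u. u : S ==> 0 <= p2 u"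
    and FH: "!!u. u : S ==> F u + H u <= c" "!!u. u : S ==> F u + h0 <= c + G"
      "!!u. u : S ==> f0 + H u <= c + G" "f0 + h0 <= c"
    and L: "(\<Sum>u\<in>S. p1 u) + (\<Sum>u\<in>S. p2 u) <= L"
  shows "(\<Sum>u\<in>S. F u * p1 u) + (L - (\<Sum>u\<in>S. p1 u)) * f0 + ((\<Sum>u\<in>S. H u * p2 u) + (L - (\<Sum>u\<in>S. p2 u)) * h0)
     <= L * c + G * (\<Sum>u\<in>S. \<bar>p1 u - p2 u\<bar>)"
  using coupled_jump_bound[of "count_space S" p1 p2 F H "%_. G" c h0 f0 L] assms
  by (simp add: lebesgue_integral_count_space_finite integrable_count_space sum_distrib_left)

lemma isotropic_second_moment:
  fixes N :: "(real^'d::finite) measure"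
  assumes N: "prob_space N" "sets N = sets borel" "AE u in N. norm u <= 1"
    and diag: "!!e. norm e = 1 ==> (LINT u|N. (e \<bullet> u)\<^sup>2) = v0"
    and off: "!!i j. i ~= j ==> (LINT u|N. u $ i * u $ j) = 0"
  shows "integrable N (%u. u $ i * u $ j)" "(LINT u|N. u $ i * u $ j) = (if i = j then v0 else 0)"
proof -
  interpret prob_space N by fact
  note [measurable_cong] = N(2)
  show "integrable N (%u. u $ i * u $ j)"
  proof (rule integrable_const_bound[where B=1])
    show "AE u in N. norm (u $ i * u $ j) <= 1"
      using N(3)
    proof eventually_elim
      fix u :: "real^'d" assume "norm u <= 1"
      hence "\<bar>u $ i\<bar> <= 1" "\<bar>u $ j\<bar> <= 1" using component_le_norm_cart order_trans by blast+
      thus "norm (u $ i * u $ j) <= 1" by (simp add: abs_mult mult_le_one)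
    qed
  qed measurable
  show "(LINT u|N. u $ i * u $ j) = (if i = j then v0 else 0)"
    using diag[of "axis i 1"] off[of i j] by (auto simp: inner_axis' power2_eq_square)
qed

text \<open>One of three moves is made, each with probability 1/3: the drift, a step along plus or
  minus a row of \<open>S\<close>, or a step of the isotropic noise. First-order terms cancel in the
  last two, the factors \<open>s1\<close> and \<open>m1\<close> make their second moments come out
  as \<open>S ** S\<close> and \<open>lam\<close> times the identity, and the Taylor remainders are
  of order \<open>h ^ 3\<close>.\<close>

lemma diffusion_step_expansion:
  fixes g :: "real^'d::finite => real" and S :: "real^'d^'d"
  assumes taylor2: "!!v. \<bar>g (x + v) - g x - G \<bullet> v\<bar> <= C * norm v ^ 2"
    and taylor3: "!!v. \<bar>g (x + v) - g x - G \<bullet> v - (1/2) * (\<Sum>i\<in>UNIV. \<Sum>j\<in>UNIV. v $ i * v $ j * Hs i j)\<bar> <= C * norm v ^ 3"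
    and gc: "continuous_on UNIV g" and gb: "!!y. \<bar>g y\<bar> <= C"
    and N: "prob_space N" "sets N = sets borel" "AE u in N. norm u <= 1" "v0 > 0"
      "!!e. (LINT u|N. e \<bullet> u) = 0" "!!e. norm e = 1 ==> (LINT u|N. (e \<bullet> u)\<^sup>2) = v0"
      "!!i j. i ~= j ==> (LINT u|N. u $ i * u $ j) = 0"
    and sym: "transpose S = S" and lam: "lam > 0"
    and B: "norm bt <= B" "norm S <= B" and h: "0 < h" "h <= 1"
    and s1: "s1 = sqrt (3 * real CARD('d))" and m1: "m1 = sqrt (3 * lam / v0)"
  shows "\<bar>(g (x + (3 * h^2) *\<^sub>R bt)
      + (\<Sum>j\<in>UNIV. g (x + (h * s1) *\<^sub>R S $ j) + g (x - (h * s1) *\<^sub>R S $ j)) / (2 * real CARD('d))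
      + (LINT u|N. g (x + (h * m1) *\<^sub>R u))) / 3
     - g x - h\<^sup>2 * (bt \<bullet> G + (1/2) * (\<Sum>i\<in>UNIV. \<Sum>j\<in>UNIV. (S ** S + lam *\<^sub>R mat 1) $ i $ j * Hs i j))\<bar>
     <= C * (9 * B^2 + (s1 * B) ^ 3 + m1 ^ 3) * h ^ 3"
proof -
  interpret prob_space N by fact
  note [measurable_cong] = N(2)
  have [measurable]: "g : borel_measurable borel" using gc by (rule borel_measurable_continuous_onI)
  have C0: "C >= 0" using gb[of x] by linarith
  have B0: "B >= 0" using B(1) norm_ge_zero order_trans by blast
  have s10: "s1 >= 0" "s1^2 = 3 * real CARD('d)" by (simp_all add: s1)
  have m10: "m1 >= 0" "m1^2 * v0 = 3 * lam" using lam N(4) by (simp_all add: m1)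
  define d where "d = real CARD('d)"
  have d: "d > 0" by (simp add: d_def)
  define q where "q v = (\<Sum>i\<in>UNIV. \<Sum>j\<in>UNIV. v $ i * v $ j * Hs i j)" for v :: "real^'d"
  have q_scale: "q (c *\<^sub>R v) = c^2 * q v" for c v
    by (simp add: q_def sum_distrib_left power2_eq_square mult_ac)
  have h3: "h ^ 4 <= h ^ 3" using h by (intro power_decreasing) auto
  have e1: "\<bar>g (x + (3 * h^2) *\<^sub>R bt) - g x - 3 * h^2 * (bt \<bullet> G)\<bar> <= C * (9 * B^2) * h ^ 3"
  proof -
    have "\<bar>g (x + (3 * h^2) *\<^sub>R bt) - g x - G \<bullet> ((3 * h^2) *\<^sub>R bt)\<bar> <= C * (norm ((3 * h^2) *\<^sub>R bt))\<^sup>2"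
      by (rule taylor2)
    also have "(norm ((3 * h^2) *\<^sub>R bt))\<^sup>2 = 9 * (h ^ 4 * (norm bt)\<^sup>2)"
      by (simp add: power_mult_distrib power_mult[symmetric])
    also have "C * (9 * (h ^ 4 * (norm bt)\<^sup>2)) <= C * (9 * (h ^ 3 * B^2))"
      using C0 B h h3 by (intro mult_left_mono mult_mono power_mono) auto
    finally show ?thesis by (simp add: inner_commute mult_ac)
  qed
  define A2 where "A2 = (\<Sum>j\<in>UNIV. g (x + (h * s1) *\<^sub>R S $ j) + g (x - (h * s1) *\<^sub>R S $ j)) / (2 * d)"
  have e2: "\<bar>A2 - g x - 3 / 2 * h^2 * (\<Sum>j\<in>UNIV. q (S $ j))\<bar> <= C * (s1 * B) ^ 3 * h ^ 3"
  proof -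
    have each: "\<bar>g (x + (h * s1) *\<^sub>R S $ j) + g (x - (h * s1) *\<^sub>R S $ j) - 2 * g x - 3 * d * h^2 * q (S $ j)\<bar> <= 2 * (C * (s1 * B) ^ 3 * h ^ 3)" for j
    proof -
      define v where "v = (h * s1) *\<^sub>R S $ j"
      have nv: "norm v <= h * (s1 * B)"
        unfolding v_def using order_trans[OF Finite_Cartesian_Product.norm_nth_le B(2), of j] h s10
        by (auto simp: abs_mult mult.assoc intro!: mult_left_mono)
      have b: "C * norm v ^ 3 <= C * (s1 * B) ^ 3 * h ^ 3"
        using power_mono[OF nv, of 3] C0 by (simp add: power_mult_distrib mult_ac mult_left_mono)
      have qv: "q v = 3 * d * h^2 * q (S $ j)" "q (- v) = q v"
        subgoal unfolding v_def q_scale using s10(2) by (simp add: power_mult_distrib d_def)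
        subgoal by (simp add: q_def)
        done
      have "\<bar>g (x + v) - g x - G \<bullet> v - (1/2) * q v\<bar> <= C * norm v ^ 3" "\<bar>g (x - v) - g x + G \<bullet> v - (1/2) * q v\<bar> <= C * norm v ^ 3"
        using taylor3[of v] taylor3[of "- v"] qv(2) unfolding q_def by simp_all
      hence "\<bar>g (x + v) + g (x - v) - 2 * g x - q v\<bar> <= 2 * (C * norm v ^ 3)" by linarith
      thus ?thesis using b unfolding v_def[symmetric] qv(1)[symmetric] by linarith
    qed
    have "\<bar>2 * d * A2 - 2 * d * g x - 3 * d * h^2 * (\<Sum>j\<in>UNIV. q (S $ j))\<bar>
        = \<bar>\<Sum>j\<in>UNIV. g (x + (h * s1) *\<^sub>R S $ j) + g (x - (h * s1) *\<^sub>R S $ j) - 2 * g x - 3 * d * h^2 * q (S $ j)\<bar>"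
    proof -
      have "2 * d * A2 = (\<Sum>j\<in>UNIV. g (x + (h * s1) *\<^sub>R S $ j) + g (x - (h * s1) *\<^sub>R S $ j))"
        using d by (simp add: A2_def)
      thus ?thesis by (simp add: sum_subtractf sum_distrib_left[symmetric] d_def)
    qed
    also have "... <= (\<Sum>j\<in>(UNIV::'d set). 2 * (C * (s1 * B) ^ 3 * h ^ 3))"
      by (intro order_trans[OF sum_abs] sum_mono each)
    also have "... = 2 * d * (C * (s1 * B) ^ 3 * h ^ 3)" by (simp add: d_def)
    finally have "\<bar>2 * d * (A2 - g x - 3 / 2 * h^2 * (\<Sum>j\<in>UNIV. q (S $ j)))\<bar> <= 2 * d * (C * (s1 * B) ^ 3 * h ^ 3)"
      by (simp add: algebra_simps)
    thus ?thesis using d by (simp add: abs_mult)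
  qed
  define A3 where "A3 = (LINT u|N. g (x + (h * m1) *\<^sub>R u))"
  have e3: "\<bar>A3 - g x - 3 / 2 * h^2 * lam * (\<Sum>i\<in>UNIV. Hs i i)\<bar> <= C * m1 ^ 3 * h ^ 3"
  proof -
    note mom = isotropic_second_moment[OF N(1-3,6,7)]
    have i1: "integrable N (%u. g (x + (h * m1) *\<^sub>R u))"
      by (rule integrable_const_bound[where B=C]) (use gb in auto)
    have i2: "integrable N (%u. G \<bullet> u)"
    proof (rule integrable_const_bound[where B="norm G"])
      show "AE u in N. norm (G \<bullet> u) <= norm G"
        using N(3) by eventually_elim (metis Cauchy_Schwarz_ineq2 mult.right_neutral mult_left_mono norm_ge_zero order_trans real_norm_def)
    qed measurable
    have i3: "integrable N q" unfolding q_def using mom(1) by (intro Bochner_Integration.integrable_sum integrable_mult_left)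
    have "(LINT u|N. q u) = (\<Sum>i\<in>UNIV. \<Sum>j\<in>UNIV. (if i = j then v0 else 0) * Hs i j)"
      unfolding q_def using mom by (simp add: Bochner_Integration.integral_sum)
    also have "... = v0 * (\<Sum>i\<in>UNIV. Hs i i)"
      by (simp add: sum_distrib_left if_distrib[of "%x. x * _"] cong: if_cong)
    finally have Iq: "(LINT u|N. q u) = v0 * (\<Sum>i\<in>UNIV. Hs i i)" .
    have "\<bar>\<integral>u. g (x + (h * m1) *\<^sub>R u) - g x - (h * m1) * (G \<bullet> u) - (1/2) * (h * m1)\<^sup>2 * q u \<partial>N\<bar> <= C * m1 ^ 3 * h ^ 3"
    proof -
      have "AE u in N. \<bar>g (x + (h * m1) *\<^sub>R u) - g x - (h * m1) * (G \<bullet> u) - (1/2) * (h * m1)\<^sup>2 * q u\<bar> <= C * m1 ^ 3 * h ^ 3"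
        using N(3)
      proof eventually_elim
        fix u :: "real^'d" assume u: "norm u <= 1"
        have "\<bar>g (x + (h * m1) *\<^sub>R u) - g x - G \<bullet> ((h * m1) *\<^sub>R u) - (1/2) * q ((h * m1) *\<^sub>R u)\<bar> <= C * norm ((h * m1) *\<^sub>R u) ^ 3"
          unfolding q_def by (rule taylor3)
        also have "... <= C * (h * m1 * 1) ^ 3"
          using u h m10 C0 by (intro mult_left_mono power_mono) (auto simp: abs_mult intro!: mult_left_le)
        finally show "\<bar>g (x + (h * m1) *\<^sub>R u) - g x - (h * m1) * (G \<bullet> u) - (1/2) * (h * m1)\<^sup>2 * q u\<bar> <= C * m1 ^ 3 * h ^ 3"
          unfolding q_scale by (simp add: power_mult_distrib mult_ac)
      qed
      hence "(LINT u|N. \<bar>g (x + (h * m1) *\<^sub>R u) - g x - (h * m1) * (G \<bullet> u) - (1/2) * (h * m1)\<^sup>2 * q u\<bar>) <= C * m1 ^ 3 * h ^ 3"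
        using i1 i2 i3 by (intro integral_le_const) auto
      thus ?thesis by (rule order_trans[OF integral_abs_bound])
    qed
    also have "(LINT u|N. g (x + (h * m1) *\<^sub>R u) - g x - (h * m1) * (G \<bullet> u) - (1/2) * (h * m1)\<^sup>2 * q u)
       = A3 - g x - (1/2) * (h * m1)\<^sup>2 * (v0 * (\<Sum>i\<in>UNIV. Hs i i))"
      using i1 i2 i3 Iq N(5) by (simp add: A3_def prob_space)
    also have "(1/2) * (h * m1)\<^sup>2 * (v0 * (\<Sum>i\<in>UNIV. Hs i i)) = 3 / 2 * h^2 * lam * (\<Sum>i\<in>UNIV. Hs i i)"
      using m10(2) by (simp add: power_mult_distrib mult_ac)
    finally show ?thesis .
  qed
  \<comment> \<open>Summing the quadratic form over the rows produces the transpose of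
    \<open>S\<close> times \<open>S\<close>, which is \<open>S ** S\<close> by symmetry.\<close>
  have tr: "(\<Sum>i\<in>UNIV. \<Sum>j\<in>UNIV. (S ** S + lam *\<^sub>R mat 1) $ i $ j * Hs i j) = (\<Sum>j\<in>UNIV. q (S $ j)) + lam * (\<Sum>i\<in>UNIV. Hs i i)"
  proof -
    have Sij: "S $ k $ i = S $ i $ k" for i k
      using arg_cong[OF sym, of "%M. M $ i $ k"] by (simp add: transpose_def)
    have "(S ** S) $ i $ j = (\<Sum>k\<in>UNIV. S $ k $ i * S $ k $ j)" for i j
      by (simp add: matrix_matrix_mult_def Sij)
    hence "(\<Sum>i\<in>UNIV. \<Sum>j\<in>UNIV. (S ** S) $ i $ j * Hs i j) = (\<Sum>i\<in>UNIV. \<Sum>j\<in>UNIV. \<Sum>k\<in>UNIV. S $ k $ i * S $ k $ j * Hs i j)"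
      by (simp add: sum_distrib_right)
    also have "... = (\<Sum>i\<in>UNIV. \<Sum>k\<in>UNIV. \<Sum>j\<in>UNIV. S $ k $ i * S $ k $ j * Hs i j)"
      by (intro sum.cong refl sum.swap)
    also have "... = (\<Sum>k\<in>UNIV. q (S $ k))" unfolding q_def by (rule sum.swap)
    finally have 1: "(\<Sum>i\<in>UNIV. \<Sum>j\<in>UNIV. (S ** S) $ i $ j * Hs i j) = (\<Sum>k\<in>UNIV. q (S $ k))" .
    have "(\<Sum>i\<in>UNIV. \<Sum>j\<in>UNIV. (lam *\<^sub>R mat 1 :: real^'d^'d) $ i $ j * Hs i j) = (\<Sum>i\<in>UNIV. \<Sum>j\<in>UNIV. if i = j then lam * Hs i j else 0)"
      by (intro sum.cong refl) (simp add: mat_def)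
    also have "... = lam * (\<Sum>i\<in>UNIV. Hs i i)" by (simp add: sum_distrib_left)
    finally show ?thesis using 1 by (simp add: distrib_right sum.distrib)
  qed
  define X where "X = (g (x + (3 * h^2) *\<^sub>R bt) + A2 + A3) / 3 - g x
      - h\<^sup>2 * (bt \<bullet> G + (1/2) * ((\<Sum>j\<in>UNIV. q (S $ j)) + lam * (\<Sum>i\<in>UNIV. Hs i i)))"
  define Y where "Y = (g (x + (3 * h^2) *\<^sub>R bt) - g x - 3 * h^2 * (bt \<bullet> G)) + (A2 - g x - 3 / 2 * h^2 * (\<Sum>j\<in>UNIV. q (S $ j)))
      + (A3 - g x - 3 / 2 * h^2 * lam * (\<Sum>i\<in>UNIV. Hs i i))"
  define R where "R = C * (9 * B^2 + (s1 * B) ^ 3 + m1 ^ 3) * h ^ 3"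
  have "X = Y / 3" by (simp add: X_def Y_def field_simps)
  moreover have "\<bar>Y\<bar> <= C * (9 * B^2) * h ^ 3 + C * (s1 * B) ^ 3 * h ^ 3 + C * m1 ^ 3 * h ^ 3"
    unfolding Y_def using e1 e2 e3 by linarith
  moreover have "C * (9 * B^2) * h ^ 3 + C * (s1 * B) ^ 3 * h ^ 3 + C * m1 ^ 3 * h ^ 3 = R"
    by (simp add: R_def algebra_simps)
  moreover have "0 <= R" unfolding R_def using C0 B0 s10 m10 h by simp
  ultimately have "\<bar>X\<bar> <= R" by linarith
  thus ?thesis unfolding tr X_def R_def A2_def A3_def d_def .
qed

section \<open>The approximating Markov chain\<close>

text \<open>The assumptions in the form in which they are used. \<open>a\<close> is split into an
  isotropic part of size \<open>lam\<close> and the square of a symmetric \<open>\<sigma>\<close>;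
  the modulus of continuity is expressed by arbitrarily small slopes \<open>th\<close> at small
  distances; \<open>N\<close> is the isotropic noise.\<close>

locale switching =
  fixes a :: "'d::finite coef_a" and b :: "'d coef_b" and \<nu> :: "'d coef_nu" and q :: "'d coef_q"
    and n0 :: nat and eps0 :: real and \<sigma> :: "'d coef_a" and lam CN CQ HQ :: real
    and N :: "(real^'d) measure" and v0 :: real
  assumes eps0: "eps0 > 0" and lam: "lam > 0"
    and a_eq: "k : Sset n0 ==> a x k = \<sigma> x k ** \<sigma> x k + lam *\<^sub>R mat 1"
    and \<sigma>_sym: "k : Sset n0 ==> transpose (\<sigma> x k) = \<sigma> x k"
    and nu_sets: "k : Sset n0 ==> sets (\<nu> x k) = sets borel"
    and nu_sf: "k : Sset n0 ==> sigma_finite_measure (\<nu> x k)"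
    and nu_bound: "k : Sset n0 ==> (\<integral>\<^sup>+y. ennreal (min 1 ((norm y)\<^sup>2)) \<partial>(\<nu> x k)) <= ennreal CN"
    and CN: "CN >= 0"
    and a_meas: "k : Sset n0 ==> (%x. a x k) : borel_measurable borel"
    and b_meas: "k : Sset n0 ==> (%x. b x k) : borel_measurable borel"
    and nu_meas: "k : Sset n0 ==> A : sets borel ==> (%x. emeasure (\<nu> x k) A) : borel_measurable borel"
    and q_meas: "k : Sset n0 ==> l : Sset n0 ==> (%x. q x k l) : borel_measurable borel"
    and q_nonneg: "k : Sset n0 ==> l : Sset n0 ==> k ~= l ==> 0 <= q x k l"
    and q_le: "k : Sset n0 ==> l : Sset n0 ==> k ~= l ==> q x k l <= CQ"
    and CQ: "CQ >= 0"
    and q_lip: "k : Sset n0 ==> l : Sset n0 ==> k ~= l ==> \<bar>q x k l - q z k l\<bar> <= HQ * norm (x - z)"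
    and HQ: "HQ >= 0"
    and loc_bound: "EX B. ALL x k. k : Sset n0 --> norm x <= r --> norm (a x k) <= B & norm (b x k) <= B & norm (\<sigma> x k) <= B"
    and SF: "th > 0 ==> EX \<delta>>0. ALL k:Sset n0. ALL x z. norm (x - z) <= \<delta> -->
       2 * ((x - z) \<bullet> (b x k - b z k)) + (norm (\<sigma> x k - \<sigma> z k))\<^sup>2 <= th * norm (x - z) \<and>
       tv_int (\<nu> x k) (\<nu> z k) norm <= ennreal th"
    and N_prob: "prob_space N" and N_sets: "sets N = sets borel" and N_AE: "AE u in N. norm u <= 1" and v0: "v0 > 0"
    and N_reflect: "norm n = 1 ==> F : borel_measurable borel ==> (LINT u|N. F (reflect n u)) = (LINT u|N. (F u :: real))"
    and N_mean: "(LINT u|N. e \<bullet> u) = 0" and N_var: "norm e = 1 ==> (LINT u|N. (e \<bullet> u)\<^sup>2) = v0"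
    and N_off: "i ~= j ==> (LINT u|N. u $ i * u $ j) = 0"
begin

definition far :: "real => (real^'d) set" where "far eps = {u. eps <= norm u}"

lemma far_borel [measurable, simp]: "far eps : sets borel" unfolding far_def by measurable

text \<open>The compensator of the jumps of length between \<open>eps\<close> and
  \<open>eps0\<close> is moved into the drift. This leaves an uncompensated jump measure of finite
  mass; shorter jumps are dropped altogether.\<close>

definition btilde :: "real => real^'d => nat => real^'d" where
  "btilde eps x k = b x k - (LINT u|(\<nu> x k). indicator (far eps \<inter> ball 0 eps0) u *\<^sub>R u)"

text \<open>The factor 3 undoes the random choice among the three moves of \<open>dif\<close>, and
  \<open>CARD('d)\<close> the choice among the rows of \<open>\<sigma>\<close>. In
  \<open>m1\<close>, \<open>v0\<close> is the variance of the noise in each direction.\<close>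

definition s1 :: real where "s1 = sqrt (3 * real CARD('d))"
definition m1 :: real where "m1 = sqrt (3 * lam / v0)"

definition dif :: "real => real => real^'d => nat => (real^'d => real) => real^'d => real" where
  "dif eps h x k f y = (f (y + (3 * h^2) *\<^sub>R btilde eps x k)
      + (\<Sum>j\<in>UNIV. f (y + (h * s1) *\<^sub>R \<sigma> x k $ j) + f (y - (h * s1) *\<^sub>R \<sigma> x k $ j)) / (2 * real CARD('d))
      + (LINT u|N. f (y + (h * m1) *\<^sub>R u))) / 3"

text \<open>Jumps and switches are padded with null events to the constant total rate \<open>L\<close>.\<close>
definition jmp :: "real => real => real^'d => nat => (real^'d => real) => real^'d => real" where
  "jmp eps L x k f y = (LINT u|(\<nu> x k). f (y + u) * indicator (far eps) u) + (L - measure (\<nu> x k) (far eps)) * f y"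

definition swi :: "real => real^'d => nat => (nat => real) => real" where
  "swi L x k F = (\<Sum>l\<in>Sset n0 - {k}. F l * q x k l) + (L - (\<Sum>l\<in>Sset n0 - {k}. q x k l)) * F k"

text \<open>One step, of duration \<open>h\<^sup>2\<close>, of a Markov chain whose coefficients are frozen at \<open>(x, k)\<close> while the particle sits at \<open>y\<close>.\<close>
definition Kop :: "real => real => real => ((real^'d) \<times> nat => real) => real^'d => nat => real^'d => real" where
  "Kop eps L h f x k y = (1 - 2 * h^2 * L) * dif eps h x k (%y. f (y, k)) y
     + h^2 * (jmp eps L x k (%y. f (y, k)) y + swi L x k (%l. f (y, l)))"

text \<open>The second moment of the dropped jumps, hence the size of the consistency error. It
  tends to 0 with \<open>eps\<close> at each point, in general not uniformly, and is therefore
  controlled in the mean under the flow.\<close>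

definition sml :: "real => (real^'d) \<times> nat => real" where
  "sml eps z = enn2real (\<integral>\<^sup>+u. ennreal ((norm u)\<^sup>2 * indicator (- far eps) u) \<partial>(\<nu> (fst z) (snd z)))"

lemma nu_space: "k : Sset n0 ==> space (\<nu> x k) = UNIV"
  using sets_eq_imp_space_eq[OF nu_sets] by simp

lemma nu_measurable: "k : Sset n0 ==> f : borel_measurable borel ==> f : borel_measurable (\<nu> x k)"
  using measurable_cong_sets[OF nu_sets refl] by blast

text \<open>Chebyshev's inequality: on \<open>far eps\<close> the integrand
  \<open>min 1 ((norm u)\<^sup>2)\<close> is at least \<open>eps^2\<close>, as
  \<open>eps <= 1\<close>.\<close>

lemma far_emeasure:
  assumes k: "k : Sset n0" and e: "0 < eps" "eps <= 1"
  shows "emeasure (\<nu> x k) (far eps) <= ennreal (CN / eps^2)"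
proof -
  have "emeasure (\<nu> x k) (far eps) = (\<integral>\<^sup>+u. indicator (far eps) u \<partial>(\<nu> x k))" by (simp add: nu_sets[OF k])
  also have "... <= (\<integral>\<^sup>+u. ennreal (1 / eps^2) * ennreal (min 1 ((norm u)\<^sup>2)) \<partial>(\<nu> x k))"
  proof (rule nn_integral_mono)
    fix u :: "real^'d"
    have "1 <= 1 / eps^2 * min 1 ((norm u)\<^sup>2)" if "eps <= norm u"
    proof -
      have "eps^2 <= (norm u)\<^sup>2" "eps^2 <= 1" using that e by (auto intro!: power_mono power_le_one)
      thus ?thesis using e by (auto simp: min_def field_simps)
    qed
    thus "indicator (far eps) u <= ennreal (1 / eps^2) * ennreal (min 1 ((norm u)\<^sup>2))"
      by (auto simp: indicator_def far_def ennreal_mult[symmetric] simp flip: ennreal_1 intro!: ennreal_leI)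
  qed
  also have "... = ennreal (1 / eps^2) * (\<integral>\<^sup>+u. ennreal (min 1 ((norm u)\<^sup>2)) \<partial>(\<nu> x k))"
    by (intro nn_integral_cmult nu_measurable k) measurable
  also have "... <= ennreal (1 / eps^2) * ennreal CN" using nu_bound[OF k] by (intro mult_left_mono) auto
  also have "... = ennreal (CN / eps^2)" using e CN by (simp add: ennreal_mult[symmetric])
  finally show ?thesis .
qed

lemma far_measure:
  assumes k: "k : Sset n0" and e: "0 < eps" "eps <= 1"
  shows "emeasure (\<nu> x k) (far eps) ~= \<infinity>" "measure (\<nu> x k) (far eps) <= CN / eps^2"
proof -
  show "emeasure (\<nu> x k) (far eps) ~= \<infinity>"
    using far_emeasure[OF assms, of x] by (metis ennreal_less_top infinity_ennreal_def leD)
  show "measure (\<nu> x k) (far eps) <= CN / eps^2"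
    unfolding measure_def using far_emeasure[OF assms, of x] CN e by (auto intro!: enn2real_leI)
qed

lemma far_integrable:
  fixes f :: "real^'d => 'b::{banach, second_countable_topology}"
  assumes k: "k : Sset n0" and e: "0 < eps" "eps <= 1"
    and f: "f : borel_measurable borel" "!!u. norm (f u) <= C * indicator (far eps) u"
  shows "integrable (\<nu> x k) f"
proof (rule Bochner_Integration.integrable_bound)
  show "integrable (\<nu> x k) (%u. C * indicator (far eps) u)"
    using far_measure(1)[OF k e, of x] nu_sets[OF k, of x] by (intro integrable_mult_right integrable_real_indicator) (auto simp: less_top)
  show "AE u in \<nu> x k. norm (f u) <= norm (C * indicator (far eps) u)"
    using f(2) by (intro AE_I2) (metis abs_ge_self order_trans real_norm_def)
qed (intro nu_measurable k f)

lemma btilde_bound: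
  assumes k: "k : Sset n0" and e: "0 < eps" "eps <= 1" and B: "norm (b x k) <= B"
  shows "norm (btilde eps x k) <= B + eps0 * (CN / eps^2)"
proof -
  have "norm (LINT u|(\<nu> x k). indicator (far eps \<inter> ball 0 eps0) u *\<^sub>R u) <= (LINT u|(\<nu> x k). eps0 * indicator (far eps) u)"
  proof (rule Bochner_Integration.integral_norm_bound_integral)
    show "integrable (\<nu> x k) (%u. indicator (far eps \<inter> ball 0 eps0) u *\<^sub>R u)"
      by (rule far_integrable[OF k e, where C=eps0]) (use eps0 in \<open>auto simp: indicator_def\<close>)
    show "integrable (\<nu> x k) (%u. eps0 * indicator (far eps) u)"
      by (rule far_integrable[OF k e, where C=eps0]) (use eps0 in \<open>auto simp: indicator_def\<close>)
  qed (use eps0 in \<open>auto simp: indicator_def\<close>)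
  also have "... = eps0 * measure (\<nu> x k) (far eps)" by (simp add: nu_sets[OF k] nu_space[OF k])
  also have "... <= eps0 * (CN / eps^2)" using far_measure(2)[OF k e] eps0 by (intro mult_left_mono) auto
  finally show ?thesis unfolding btilde_def by (rule order_trans[OF norm_triangle_ineq4 add_mono[OF B]])
qed

lemma nu_integrable_min:
  fixes f :: "real^'d => real"
  assumes k: "k : Sset n0" and f: "f : borel_measurable borel" "!!u. \<bar>f u\<bar> <= C * min 1 ((norm u)\<^sup>2)"
  shows "integrable (\<nu> x k) f" "\<bar>\<integral>u. f u \<partial>(\<nu> x k)\<bar> <= \<bar>C\<bar> * CN"
proof -
  have f2: "\<bar>f u\<bar> <= \<bar>C\<bar> * min 1 ((norm u)\<^sup>2)" for u
    by (rule order_trans[OF f(2) mult_right_mono]) auto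
  have m: "integrable (\<nu> x k) (%u. min 1 ((norm u)\<^sup>2))"
    using nu_bound[OF k, of x] by (intro integrableI_nonneg nu_measurable k) (auto intro: le_less_trans)
  hence I: "(LINT u|(\<nu> x k). min 1 ((norm u)\<^sup>2)) <= CN"
    using nu_bound[OF k, of x] CN by (simp add: nn_integral_eq_integral)
  show i: "integrable (\<nu> x k) f"
    by (rule Bochner_Integration.integrable_bound[OF integrable_mult_right[OF m, of "\<bar>C\<bar>"]])
       (use f(1) f2 nu_measurable[OF k] in \<open>auto simp: abs_mult\<close>)
  have "\<bar>\<integral>u. f u \<partial>(\<nu> x k)\<bar> <= (LINT u|(\<nu> x k). \<bar>C\<bar> * min 1 ((norm u)\<^sup>2))"
    using f2 i m by (intro order_trans[OF integral_abs_bound] integral_mono) auto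
  also have "... <= \<bar>C\<bar> * CN" using I by (simp add: mult_left_mono)
  finally show "\<bar>\<integral>u. f u \<partial>(\<nu> x k)\<bar> <= \<bar>C\<bar> * CN" .
qed

lemma sml_facts:
  assumes k: "k : Sset n0" and e: "eps <= 1"
  shows "0 <= sml eps (x, k)" "sml eps (x, k) <= CN" "integrable (\<nu> x k) (%u. (norm u)\<^sup>2 * indicator (- far eps) u)"
    "(LINT u|(\<nu> x k). (norm u)\<^sup>2 * indicator (- far eps) u) = sml eps (x, k)"
proof -
  have b: "\<bar>(norm u)\<^sup>2 * indicator (- far eps) u\<bar> <= 1 * min 1 ((norm u)\<^sup>2)" for u :: "real^'d"
    using e by (auto simp: indicator_def far_def min_def power_le_one)
  have m: "(%u::real^'d. (norm u)\<^sup>2 * indicator (- far eps) u) : borel_measurable borel" by measurable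
  note I = nu_integrable_min[OF k m b, of x]
  show i: "integrable (\<nu> x k) (%u. (norm u)\<^sup>2 * indicator (- far eps) u)" using I by simp
  show eq: "(LINT u|(\<nu> x k). (norm u)\<^sup>2 * indicator (- far eps) u) = sml eps (x, k)"
    unfolding sml_def by (simp add: integral_eq_nn_integral nu_measurable[OF k])
  show "0 <= sml eps (x, k)" by (simp add: sml_def)
  show "sml eps (x, k) <= CN" using I(2) eq by auto
qed

end

section \<open>Test functions and consistency of the chain with the generator\<close>

context switching begin

definition test_bound :: "real => (real^'d => real) => bool" where
  "test_bound C g \<longleftrightarrow> smooth_fun g & (ALL is x. length is <= 3 --> \<bar>iter_pd is g x\<bar> <= C)"

lemma test_bound_facts:
  assumes g: "test_bound C g"
  shows "C >= 0" "\<bar>g y\<bar> <= C" "continuous_on UNIV g" "g : borel_measurable borel" "\<bar>pd i g y\<bar> <= C" "\<bar>pd i (pd j g) y\<bar> <= C"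
    "norm (grad g y) <= real CARD('d) * C"
    "\<bar>g (y + v) - g y - grad g y \<bullet> v\<bar> <= real CARD('d)^3 * C * norm v ^ 2"
    "\<bar>g (y + v) - g y - grad g y \<bullet> v - (1/2) * (\<Sum>i\<in>UNIV. \<Sum>j\<in>UNIV. v $ i * v $ j * pd i (pd j g) y)\<bar> <= real CARD('d)^3 * C * norm v ^ 3"
    "pd i g : borel_measurable borel" "pd i (pd j g) : borel_measurable borel" "grad g : borel_measurable borel"
proof -
  have sm: "smooth_fun g" and bd: "!!is x. length is <= 3 ==> \<bar>iter_pd is g x\<bar> <= C"
    using g by (auto simp: test_bound_def)
  show b: "\<bar>g y\<bar> <= C" for y using bd[of "[]"] by simp
  thus C0: "C >= 0" using abs_ge_zero order_trans by blast
  show p1: "\<bar>pd i g y\<bar> <= C" for i y using bd[of "[i]"] by simp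
  show "\<bar>pd i (pd j g) y\<bar> <= C" using bd[of "[i, j]"] by simp
  have "norm (grad g y) <= (\<Sum>i\<in>UNIV. \<bar>grad g y $ i\<bar>)" by (rule norm_le_l1_cart)
  also have "... <= (\<Sum>i\<in>(UNIV::'d set). C)" by (intro sum_mono) (simp add: grad_def p1)
  finally show "norm (grad g y) <= real CARD('d) * C" by simp
  have dcont: "continuous_on UNIV (iter_pd is g)" for "is"
    using sm unfolding smooth_fun_def
    by (intro continuous_at_imp_continuous_on ballI differentiable_imp_continuous_within) auto
  show "continuous_on UNIV g" using dcont[of "[]"] by simp
  have m: "iter_pd is g : borel_measurable borel" for "is" using dcont by (rule borel_measurable_continuous_onI)
  show "g : borel_measurable borel" using m[of "[]"] by simp
  show pm: "pd i g : borel_measurable borel" for i using m[of "[i]"] by simp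
  show "pd i (pd j g) : borel_measurable borel" using m[of "[i, j]"] by simp
  show "grad g : borel_measurable borel"
    by (rule borel_measurable_euclidean_space[THEN iffD2]) (use pm in \<open>auto simp: Basis_vec_def grad_def inner_axis\<close>)
  note t = smooth_taylor[OF sm bd, of y v]
  have "real CARD('d) ^ 2 * C * norm v ^ 2 <= real CARD('d) ^ 3 * C * norm v ^ 2"
    using C0 by (intro mult_right_mono power_increasing) auto
  thus "\<bar>g (y + v) - g y - grad g y \<bullet> v\<bar> <= real CARD('d)^3 * C * norm v ^ 2" using t(1) by linarith
  show "\<bar>g (y + v) - g y - grad g y \<bullet> v - (1/2) * (\<Sum>i\<in>UNIV. \<Sum>j\<in>UNIV. v $ i * v $ j * pd i (pd j g) y)\<bar> <= real CARD('d)^3 * C * norm v ^ 3"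
    using t(2) .
qed

text \<open>Second-order Taylor expansion inside the ball of radius \<open>eps0\<close>, boundedness
  of \<open>g\<close> outside: up to a constant the integrand is dominated by the function whose
  integral is bounded by \<open>CN\<close>.\<close>

lemma jump_integrand_bound:
  assumes g: "test_bound C g"
  shows "\<bar>g (x + u) - g x - (grad g x \<bullet> u) * indicator (ball 0 eps0) u\<bar>
     <= (real CARD('d)^3 * C * (1 + eps0^2) + 2 * C * (1 + 1 / eps0^2)) * min 1 ((norm u)\<^sup>2)"
proof -
  note tb = test_bound_facts[OF g]
  have C: "C >= 0" by (rule tb(1))
  have n1: "0 <= real CARD('d)^3 * C" using C by simp
  show ?thesis
  proof (cases "norm u < eps0")
    case True
    have "\<bar>g (x + u) - g x - (grad g x \<bullet> u) * indicator (ball 0 eps0) u\<bar> <= real CARD('d)^3 * C * norm u ^ 2"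
      using tb(8)[of x u] True by simp
    also have "norm u ^ 2 <= (1 + eps0^2) * min 1 ((norm u)\<^sup>2)"
      using True power_mono[of "norm u" eps0 2] by (auto simp: min_def algebra_simps)
    also have "real CARD('d)^3 * C * ((1 + eps0^2) * min 1 ((norm u)\<^sup>2)) <= (real CARD('d)^3 * C * (1 + eps0^2) + 2 * C * (1 + 1 / eps0^2)) * min 1 ((norm u)\<^sup>2)"
      unfolding mult.assoc[symmetric] using C by (intro mult_right_mono) auto
    finally show ?thesis using n1 by (simp add: mult_left_mono)
  next
    case False
    have "\<bar>g (x + u) - g x - (grad g x \<bullet> u) * indicator (ball 0 eps0) u\<bar> <= 2 * C * 1"
      using tb(2)[of x] tb(2)[of "x + u"] False by simp
    also have "2 * C * 1 <= 2 * C * ((1 + 1 / eps0^2) * min 1 ((norm u)\<^sup>2))"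
    proof (rule mult_left_mono)
      have "eps0^2 <= (norm u)\<^sup>2" using False eps0 by (intro power_mono) auto
      hence "1 <= 1 / eps0^2 * (norm u)\<^sup>2" using eps0 by (simp add: field_simps)
      hence "1 <= (1 + 1 / eps0^2) * (norm u)\<^sup>2" unfolding distrib_right using zero_le_power2[of "norm u"] by linarith
      moreover have "1 <= (1 + 1 / eps0^2) * 1" using eps0 by simp
      ultimately show "1 <= (1 + 1 / eps0^2) * min 1 ((norm u)\<^sup>2)" by (auto simp: min_def)
    qed (use C in simp)
    also have "2 * C * ((1 + 1 / eps0^2) * min 1 ((norm u)\<^sup>2)) <= (real CARD('d)^3 * C * (1 + eps0^2) + 2 * C * (1 + 1 / eps0^2)) * min 1 ((norm u)\<^sup>2)"
      unfolding mult.assoc[symmetric] using C by (intro mult_right_mono) auto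
    finally show ?thesis .
  qed
qed

text \<open>The large jumps and the switches are reproduced exactly. The errors are the cubic one of
  the diffusion move, a fourth-order one because this move has weight \<open>1 - 2 * h^2 * L\<close>
  instead of 1, and the dropped small jumps. \<open>Kc\<close> may depend on \<open>R\<close>,
  \<open>C\<close>, \<open>eps\<close> and \<open>L\<close>, but not on \<open>g\<close> or
  \<open>h\<close>.\<close>

lemma Kop_consistent:
  assumes e: "0 < eps" "eps <= 1" "eps <= eps0" and L: "L >= 0"
  obtains Kc where "!!x k g h. k : Sset n0 ==> norm x <= R ==> (!!l. l : Sset n0 ==> test_bound C (%y. g (y, l))) ==>
     0 < h ==> h <= 1 ==> 2 * h^2 * L <= 1 ==>
     \<bar>Kop eps L h g x k x - g (x, k) - h\<^sup>2 * Aop a b \<nu> q eps0 n0 g (x, k)\<bar> <= Kc * h ^ 3 + h^2 * (real CARD('d)^3 * C * sml eps (x, k))"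
proof -
  obtain B0 where B0: "!!x k. k : Sset n0 ==> norm x <= R ==> norm (a x k) <= B0 & norm (b x k) <= B0 & norm (\<sigma> x k) <= B0"
    using loc_bound[of R] by blast
  define B where "B = B0 + eps0 * (CN / eps^2)"
  define K1 where "K1 = real CARD('d)^3 * C * (9 * B^2 + (s1 * B) ^ 3 + m1 ^ 3)"
  define K2 where "K2 = 2 * L * (B * (real CARD('d) * C) + (real CARD('d))\<^sup>2 * (B * C))"
  show thesis
  proof (rule that[of "K1 + K2"])
    fix x :: "real^'d" and k g and h :: real
    assume k: "k : Sset n0" and x: "norm x <= R" and g: "!!l. l : Sset n0 ==> test_bound C (%y. g (y, l))"
      and h: "0 < h" "h <= 1" "2 * h^2 * L <= 1"
    define gk where "gk = (%y. g (y, k))"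
    have gk: "test_bound C gk" unfolding gk_def by (rule g[OF k])
    note tb = test_bound_facts[OF gk]
    note [measurable] = tb(4)
    define G where "G = grad gk x"
    have BB: "B0 <= B" "0 <= B0" using CN eps0 B0[OF k x] order_trans[OF norm_ge_zero, of "b x k" B0] unfolding B_def by auto
    have Bt: "norm (btilde eps x k) <= B" unfolding B_def using B0[OF k x] by (intro btilde_bound k e) auto
    have Bs: "norm (\<sigma> x k) <= B" "norm (a x k) <= B" using B0[OF k x] BB by auto
    define Lc where "Lc = btilde eps x k \<bullet> G + (1/2) * (\<Sum>i\<in>UNIV. \<Sum>j\<in>UNIV. a x k $ i $ j * pd i (pd j gk) x)"
    have C0: "C >= 0" by (rule tb(1))
    have C3: "C <= real CARD('d)^3 * C" using C0 by (simp add: mult_right_mono[of 1 "real CARD('d)^3" C, simplified])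
    have E1: "\<bar>dif eps h x k gk x - gk x - h\<^sup>2 * Lc\<bar> <= K1 * h ^ 3"
      unfolding dif_def Lc_def G_def K1_def a_eq[OF k]
      by (rule diffusion_step_expansion[OF tb(8) tb(9) tb(3) order_trans[OF tb(2) C3] N_prob N_sets N_AE v0 N_mean N_var N_off \<sigma>_sym[OF k] lam Bt Bs(1) h(1,2) s1_def m1_def])
         auto
    have Lb: "\<bar>Lc\<bar> <= B * (real CARD('d) * C) + (real CARD('d))\<^sup>2 * (B * C)"
    proof -
      have "\<bar>btilde eps x k \<bullet> G\<bar> <= norm (btilde eps x k) * norm G" by (rule Cauchy_Schwarz_ineq2)
      also have "... <= B * (real CARD('d) * C)" using Bt tb(7)[of x] BB unfolding G_def by (intro mult_mono) auto
      finally have 1: "\<bar>btilde eps x k \<bullet> G\<bar> <= B * (real CARD('d) * C)" .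
      have "\<bar>a x k $ i $ j * pd i (pd j gk) x\<bar> <= B * C" for i j
        unfolding abs_mult using component_le_norm_cart[of "a x k $ i" j] Finite_Cartesian_Product.norm_nth_le[of "a x k" i] Bs(2) tb(6)[of i j x] BB
        by (intro mult_mono) auto
      hence "\<bar>\<Sum>i\<in>UNIV. \<Sum>j\<in>UNIV. a x k $ i $ j * pd i (pd j gk) x\<bar> <= (\<Sum>i\<in>(UNIV::'d set). \<Sum>j\<in>(UNIV::'d set). B * C)"
        by (intro order_trans[OF sum_abs] sum_mono)
      also have "... = (real CARD('d))\<^sup>2 * (B * C)" by (simp add: power2_eq_square)
      finally show ?thesis unfolding Lc_def using 1 C0 BB by linarith
    qed
    let ?nu = "\<nu> x k"
    define J where "J = (LINT u|?nu. (gk (x + u) - gk x) * indicator (far eps) u)"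
    define w where "w = (LINT u|?nu. indicator (far eps \<inter> ball 0 eps0) u *\<^sub>R u)"
    define sm where "sm = (LINT u|?nu. (gk (x + u) - gk x - G \<bullet> u) * indicator (- far eps) u)"
    have iJ: "integrable ?nu (%u. (gk (x + u) - gk x) * indicator (far eps) u)"
    proof (rule far_integrable[OF k e(1,2), where C="2 * C"])
      show "norm ((gk (x + u) - gk x) * indicator (far eps) u) <= 2 * C * indicator (far eps) u" for u
        using tb(2)[of x] tb(2)[of "x + u"] by (auto simp: indicator_def)
    qed measurable
    have iw: "integrable ?nu (%u. indicator (far eps \<inter> ball 0 eps0) u *\<^sub>R u)"
      by (rule far_integrable[OF k e(1,2), where C=eps0]) (use eps0 in \<open>auto simp: indicator_def\<close>)
    note sf = sml_facts[OF k e(2), of x]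
    have bsm: "\<bar>(gk (x + u) - gk x - G \<bullet> u) * indicator (- far eps) u\<bar> <= real CARD('d)^3 * C * ((norm u)\<^sup>2 * indicator (- far eps) u)" for u
      using tb(8)[of x u] by (auto simp: indicator_def G_def)
    have ism: "integrable ?nu (%u. (gk (x + u) - gk x - G \<bullet> u) * indicator (- far eps) u)"
      by (rule Bochner_Integration.integrable_bound[OF integrable_mult_right[OF sf(3), of "real CARD('d)^3 * C"]])
         (use bsm C0 in \<open>auto intro!: nu_measurable[OF k] AE_I2 simp: abs_mult\<close>)
    have "\<bar>sm\<bar> <= (LINT u|?nu. real CARD('d)^3 * C * ((norm u)\<^sup>2 * indicator (- far eps) u))"
      unfolding sm_def using bsm ism sf(3) by (intro order_trans[OF integral_abs_bound] integral_mono) auto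
    hence smb: "\<bar>sm\<bar> <= real CARD('d)^3 * C * sml eps (x, k)" using sf(4) by simp
    \<comment> \<open>Jumps of length at least \<open>eps\<close> are separated from their
      compensator, which reappears in \<open>btilde\<close>. The condition
      \<open>eps <= eps0\<close> places all shorter jumps inside the compensated ball.\<close>
    have split: "gk (x + u) - gk x - (G \<bullet> u) * indicator (ball 0 eps0) u
       = (gk (x + u) - gk x) * indicator (far eps) u - G \<bullet> (indicator (far eps \<inter> ball 0 eps0) u *\<^sub>R u)
         + (gk (x + u) - gk x - G \<bullet> u) * indicator (- far eps) u" for u
      using e(3) by (auto simp: indicator_def far_def)
    have I: "(LINT u|?nu. (gk (x + u) - gk x - (G \<bullet> u) * indicator (ball 0 eps0) u)) = J - G \<bullet> w + sm"
    proof -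
      have iG: "integrable ?nu (%u. G \<bullet> (indicator (far eps \<inter> ball 0 eps0) u *\<^sub>R u))"
        using iw by (rule integrable_inner_right)
      show ?thesis unfolding split J_def w_def sm_def
        by (subst Bochner_Integration.integral_add[OF Bochner_Integration.integrable_diff[OF iJ iG] ism],
            subst Bochner_Integration.integral_diff[OF iJ iG], subst integral_inner_right[OF iw]) (rule refl)
    qed
    define Q where "Q = (\<Sum>l\<in>Sset n0 - {k}. q x k l * (g (x, l) - g (x, k)))"
    have Aop: "Aop a b \<nu> q eps0 n0 g (x, k) = Lc + J + sm + Q"
    proof -
      have "(\<Sum>l\<in>Sset n0. q x k l * (g (x, l) - g (x, k))) = Q"
        unfolding Q_def using k by (subst sum.remove[of _ k]) (auto simp: Sset_def)
      thus ?thesis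
        unfolding Aop_def Lop_def prod.case gk_def[symmetric] G_def[symmetric] I[unfolded gk_def] Lc_def btilde_def w_def[symmetric]
        by (simp add: inner_diff_left inner_commute[of w])
    qed
    have jmp: "jmp eps L x k gk x = J + L * gk x"
    proof -
      have i1: "integrable ?nu (%u. gk (x + u) * indicator (far eps) u)"
        by (rule far_integrable[OF k e(1,2), where C="C"]) (use tb(2) in \<open>auto simp: indicator_def\<close>)
      have i2: "integrable ?nu (%u. gk x * indicator (far eps) u)"
        by (rule far_integrable[OF k e(1,2), where C="C"]) (use tb(2) in \<open>auto simp: indicator_def\<close>)
      have "J = (LINT u|?nu. gk (x + u) * indicator (far eps) u) - (LINT u|?nu. gk x * indicator (far eps) u)"
        unfolding J_def left_diff_distrib by (rule Bochner_Integration.integral_diff[OF i1 i2])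
      also have "(LINT u|?nu. gk x * indicator (far eps) u) = gk x * measure ?nu (far eps)"
        by (simp add: nu_space[OF k])
      finally show ?thesis unfolding jmp_def by (simp add: algebra_simps)
    qed
    have swi: "swi L x k (%l. g (x, l)) = Q + L * gk x"
      unfolding swi_def Q_def gk_def by (simp add: algebra_simps sum_subtractf sum_distrib_left)
    have "Kop eps L h g x k x - g (x, k) - h\<^sup>2 * Aop a b \<nu> q eps0 n0 g (x, k)
       = (1 - 2 * h^2 * L) * (dif eps h x k gk x - gk x - h\<^sup>2 * Lc) - 2 * h ^ 4 * L * Lc - h\<^sup>2 * sm"
      unfolding Kop_def Aop gk_def[symmetric] jmp swi by (simp add: gk_def power2_eq_square power4_eq_xxxx algebra_simps)
    moreover have "\<bar>(1 - 2 * h^2 * L) * (dif eps h x k gk x - gk x - h\<^sup>2 * Lc)\<bar> <= K1 * h ^ 3"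
    proof -
      have "\<bar>1 - 2 * h^2 * L\<bar> <= 1" using h L by (auto simp: abs_le_iff)
      hence "\<bar>1 - 2 * h^2 * L\<bar> * \<bar>dif eps h x k gk x - gk x - h\<^sup>2 * Lc\<bar> <= 1 * (K1 * h ^ 3)"
        using E1 by (intro mult_mono) auto
      thus ?thesis by (simp add: abs_mult)
    qed
    moreover have "\<bar>2 * h ^ 4 * L * Lc\<bar> <= K2 * h ^ 3"
    proof -
      have "h ^ 4 <= h ^ 3" using h by (intro power_decreasing) auto
      hence "h ^ 4 * (2 * L * \<bar>Lc\<bar>) <= h ^ 3 * K2" unfolding K2_def using Lb L h by (intro mult_mono) auto
      thus ?thesis using h L by (simp add: abs_mult mult_ac)
    qed
    moreover have "\<bar>h^2 * sm\<bar> <= h^2 * (real CARD('d)^3 * C * sml eps (x, k))" using smb by (simp add: abs_mult mult_left_mono)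
    ultimately show "\<bar>Kop eps L h g x k x - g (x, k) - h\<^sup>2 * Aop a b \<nu> q eps0 n0 g (x, k)\<bar> <= (K1 + K2) * h ^ 3 + h^2 * (real CARD('d)^3 * C * sml eps (x, k))"
      unfolding distrib_right by linarith
  qed
qed

end

section \<open>Measurability and boundedness of the generator\<close>

context switching begin

text \<open>\<open>\<nu> x k\<close> may have infinite mass near the origin. Its restrictions to
  \<open>far eps\<close> have mass bounded in \<open>x\<close> and become sub-probability kernels
  after scaling; letting \<open>eps\<close> decrease exhausts everything but the origin, where
  \<open>\<Phi>\<close> vanishes.\<close>

lemma kernel_nn_integral_measurable:
  fixes \<Phi> :: "real^'d => real^'d => ennreal"
  assumes k: "k : Sset n0" and \<Phi>[measurable]: "(%(x, u). \<Phi> x u) : borel_measurable (borel \<Otimes>\<^sub>M borel)"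
    and \<Phi>0: "!!x. \<Phi> x 0 = 0"
  shows "(%x. \<integral>\<^sup>+u. \<Phi> x u \<partial>(\<nu> x k)) : borel_measurable borel"
proof -
  note [measurable_cong] = nu_sets[OF k]
  have far: "(%x. \<integral>\<^sup>+u. \<Phi> x u * indicator (far eps) u \<partial>(\<nu> x k)) : borel_measurable borel" if e: "0 < eps" "eps <= 1" for eps
  proof -
    \<comment> \<open>The added 1 keeps the scaling factor positive when
      \<open>CN = 0\<close>.\<close>
    define c where "c = CN / eps^2 + 1"
    have c: "c > 0" using CN by (simp add: c_def add_nonneg_pos)
    define L where "L x = density (\<nu> x k) (%u. ennreal (1 / c) * indicator (far eps) u)" for x
    have emL: "emeasure (L x) A = ennreal (1 / c) * emeasure (\<nu> x k) (far eps \<inter> A)" if "A : sets borel" for x A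
    proof -
      have "emeasure (L x) A = (\<integral>\<^sup>+u. ennreal (1 / c) * indicator (far eps \<inter> A) u \<partial>(\<nu> x k))"
        unfolding L_def using that by (subst emeasure_density) (auto simp: nu_sets[OF k] indicator_inter_arith mult_ac intro!: nn_integral_cong)
      thus ?thesis using that by (subst (asm) nn_integral_cmult_indicator) (auto simp: nu_sets[OF k])
    qed
    have "L : measurable borel (subprob_algebra borel)"
    proof (rule measurable_subprob_algebra)
      fix x
      show "sets (L x) = sets borel" by (simp add: L_def nu_sets[OF k])
      show "subprob_space (L x)"
      proof
        have "space (L x) = UNIV" by (simp add: L_def nu_space[OF k])
        hence "emeasure (L x) (space (L x)) = ennreal (1 / c) * emeasure (\<nu> x k) (far eps)" using emL[of UNIV x] by simp
        also have "... <= ennreal (1 / c) * ennreal (CN / eps^2)" by (intro mult_left_mono far_emeasure k e) auto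
        also have "... <= 1" using c CN e by (simp add: ennreal_mult[symmetric] c_def field_simps)
        finally show "emeasure (L x) (space (L x)) <= 1" .
        show "space (L x) ~= {}" by (simp add: L_def nu_space[OF k])
      qed
    next
      fix A :: "(real^'d) set" assume "A : sets borel"
      moreover from this have [measurable]: "(%x. emeasure (\<nu> x k) (far eps \<inter> A)) : borel_measurable borel"
        by (intro nu_meas[OF k] sets.Int) auto
      ultimately show "(%x. emeasure (L x) A) : borel_measurable borel" by (simp add: emL)
    qed
    from nn_integral_measurable_subprob_algebra2[OF \<Phi> this]
    have "(%x. ennreal c * (\<integral>\<^sup>+u. \<Phi> x u \<partial>(L x))) : borel_measurable borel" by measurable
    moreover have "ennreal c * (\<integral>\<^sup>+u. \<Phi> x u \<partial>(L x)) = (\<integral>\<^sup>+u. \<Phi> x u * indicator (far eps) u \<partial>(\<nu> x k))" for x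
    proof -
      have m: "\<Phi> x : borel_measurable (\<nu> x k)" by measurable
      have "(\<integral>\<^sup>+u. \<Phi> x u \<partial>(L x)) = (\<integral>\<^sup>+u. ennreal (1 / c) * (\<Phi> x u * indicator (far eps) u) \<partial>(\<nu> x k))"
        unfolding L_def using m by (subst nn_integral_density) (auto simp: mult_ac)
      also have "... = ennreal (1 / c) * (\<integral>\<^sup>+u. \<Phi> x u * indicator (far eps) u \<partial>(\<nu> x k))"
        using m by (intro nn_integral_cmult) measurable
      finally show ?thesis using c by (simp add: mult.assoc[symmetric] ennreal_mult[symmetric])
    qed
    ultimately show ?thesis by simp
  qed
  have "(\<integral>\<^sup>+u. \<Phi> x u \<partial>(\<nu> x k)) = (SUP n. \<integral>\<^sup>+u. \<Phi> x u * indicator (far (1 / real (Suc n))) u \<partial>(\<nu> x k))" for x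
  proof -
    have m: "\<Phi> x : borel_measurable (\<nu> x k)" by measurable
    have inc: "incseq (%n u. \<Phi> x u * indicator (far (1 / real (Suc n))) u)"
    proof (intro incseq_SucI le_funI mult_left_mono)
      show "indicator (far (1 / real (Suc n))) u <= (indicator (far (1 / real (Suc (Suc n)))) u :: ennreal)" for n u
        by (auto simp: indicator_def far_def frac_le intro: order_trans[rotated])
    qed auto
    have "(SUP n. \<Phi> x u * indicator (far (1 / real (Suc n))) u) = \<Phi> x u" for u
    proof (cases "u = 0")
      case False
      then obtain n where n: "1 / real (Suc n) < norm u" using nat_approx_posE[of "norm u"] by auto
      show ?thesis
      proof (rule antisym)
        show "(SUP n. \<Phi> x u * indicator (far (1 / real (Suc n))) u) <= \<Phi> x u" by (intro SUP_least) (auto simp: indicator_def)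
        show "\<Phi> x u <= (SUP n. \<Phi> x u * indicator (far (1 / real (Suc n))) u)"
          using n by (intro SUP_upper2[of n]) (auto simp: far_def)
      qed
    qed (simp add: \<Phi>0)
    hence "(\<integral>\<^sup>+u. \<Phi> x u \<partial>(\<nu> x k)) = (\<integral>\<^sup>+u. (SUP n. \<Phi> x u * indicator (far (1 / real (Suc n))) u) \<partial>(\<nu> x k))" by simp
    also have "... = (SUP n. \<integral>\<^sup>+u. \<Phi> x u * indicator (far (1 / real (Suc n))) u \<partial>(\<nu> x k))"
      using m by (intro nn_integral_monotone_convergence_SUP inc) measurable
    finally show ?thesis .
  qed
  thus ?thesis by (simp) (intro borel_measurable_SUP far, auto)
qed

lemma kernel_integral_measurable:
  fixes \<Phi> :: "real^'d => real^'d => real"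
  assumes k: "k : Sset n0" and \<Phi>[measurable]: "(%(x, u). \<Phi> x u) : borel_measurable (borel \<Otimes>\<^sub>M borel)"
    and \<Phi>0: "!!x. \<Phi> x 0 = 0" and int: "!!x. integrable (\<nu> x k) (\<Phi> x)"
  shows "(%x. \<integral>u. \<Phi> x u \<partial>(\<nu> x k)) : borel_measurable borel"
proof -
  have "(%x. enn2real (\<integral>\<^sup>+u. ennreal (\<Phi> x u) \<partial>(\<nu> x k)) - enn2real (\<integral>\<^sup>+u. ennreal (- \<Phi> x u) \<partial>(\<nu> x k))) : borel_measurable borel"
    by (intro borel_measurable_diff borel_measurable_enn2real kernel_nn_integral_measurable[OF k]) (auto simp: \<Phi>0)
  thus ?thesis by (subst real_lebesgue_integral_def[OF int])
qed

lemma sml_measurable: "k : Sset n0 ==> (%x. sml eps (x, k)) : borel_measurable borel"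
  unfolding sml_def fst_conv snd_conv
  by (intro borel_measurable_enn2real kernel_nn_integral_measurable) auto

lemma Aop_measurable:
  assumes k: "k : Sset n0" and g: "!!l. l : Sset n0 ==> test_bound C (%y. g (y, l))"
  shows "(%x. Aop a b \<nu> q eps0 n0 g (x, k)) : borel_measurable borel"
proof -
  note tb = test_bound_facts[OF g[OF k]]
  note tbl = test_bound_facts(4)[OF g]
  define gk where "gk = (%y. g (y, k))"
  have [measurable]: "gk : borel_measurable borel" "grad gk : borel_measurable borel" "!!i j. pd i (pd j gk) : borel_measurable borel"
    unfolding gk_def using tb by auto
  have comp: "(%x. a x k $ i $ j) : borel_measurable borel" for i j
    by (intro measurable_compose[OF a_meas[OF k]] borel_measurable_continuous_onI continuous_intros)
  have [measurable]: "ball (0::real^'d) eps0 : sets borel" by simp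
  have J: "(%x. \<integral>u. (gk (x + u) - gk x - (grad gk x \<bullet> u) * indicator (ball 0 eps0) u) \<partial>(\<nu> x k)) : borel_measurable borel"
  proof (rule kernel_integral_measurable[OF k])
    fix x
    have gkb: "test_bound C gk" unfolding gk_def by (rule g[OF k])
    show "integrable (\<nu> x k) (%u. gk (x + u) - gk x - (grad gk x \<bullet> u) * indicator (ball 0 eps0) u)"
      by (rule nu_integrable_min(1)[OF k _ jump_integrand_bound[OF gkb]]) measurable
  qed (auto simp: split_beta)
  show ?thesis
    unfolding Aop_def Lop_def prod.case gk_def[symmetric]
    using J[unfolded gk_def[THEN fun_cong]] b_meas[OF k] comp q_meas[OF k] tbl
    by (intro borel_measurable_add borel_measurable_times borel_measurable_sum measurable_const borel_measurable_inner
        borel_measurable_diff) (auto simp: gk_def k intro: tb)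
qed

lemma pd_eq_0:
  fixes g :: "real^'d => real"
  assumes "open U" "x : U" "!!y. y : U ==> g y = 0"
  shows "pd i g x = 0"
proof -
  have "continuous_on UNIV (%h. x + h *\<^sub>R axis i (1::real))" by (intro continuous_intros)
  hence "open ((%h. x + h *\<^sub>R axis i (1::real)) -` U)" using assms(1) by (auto simp: continuous_on_open_vimage)
  moreover have "((%_::real. 0::real) has_real_derivative 0) (at 0)" by simp
  ultimately have "((%h. g (x + h *\<^sub>R axis i 1)) has_real_derivative 0) (at 0)"
    using has_field_derivative_transform_within_open[of "%_. 0::real" 0 0 "(%h. x + h *\<^sub>R axis i (1::real)) -` U" "%h. g (x + h *\<^sub>R axis i 1)"] assms(2,3)
    by auto
  thus ?thesis unfolding pd_def by (rule DERIV_imp_deriv)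
qed

text \<open>A bound on the whole space although the coefficients are only locally bounded: the
  derivatives of \<open>g\<close> vanish outside the ball of radius \<open>r\<close>, while the jump
  and switching terms are bounded globally through \<open>CN\<close> and \<open>CQ\<close>.\<close>

lemma Aop_bounded:
  obtains CA where "!!g z. snd z : Sset n0 ==> (!!l. l : Sset n0 ==> test_bound C (%y. g (y, l))) ==>
    (!!y l. l : Sset n0 ==> norm y > r ==> g (y, l) = 0) ==> \<bar>Aop a b \<nu> q eps0 n0 g z\<bar> <= CA" "CA >= 0"
proof -
  obtain B0 where B0: "!!x k. k : Sset n0 ==> norm x <= r ==> norm (a x k) <= B0 & norm (b x k) <= B0 & norm (\<sigma> x k) <= B0"
    using loc_bound[of r] by blast
  define B where "B = \<bar>B0\<bar>"
  define CJ where "CJ = \<bar>real CARD('d)^3 * C * (1 + eps0^2) + 2 * C * (1 + 1 / eps0^2)\<bar> * CN"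
  define CA where "CA = \<bar>(real CARD('d))\<^sup>2 * (B * C) + B * (real CARD('d) * C) + CJ + real n0 * (CQ * (2 * C))\<bar>"
  show thesis
  proof (rule that[of CA])
    fix g and z :: "(real^'d) \<times> nat"
    assume "snd z : Sset n0" and g: "!!l. l : Sset n0 ==> test_bound C (%y. g (y, l))"
      and g0: "!!y l. l : Sset n0 ==> norm y > r ==> g (y, l) = 0"
    then obtain x k where z: "z = (x, k)" and k: "k : Sset n0" by (cases z) auto
    define gk where "gk = (%y. g (y, k))"
    have gk: "test_bound C gk" unfolding gk_def by (rule g[OF k])
    note tb = test_bound_facts[OF gk]
    note [measurable] = tb(4)
    have [measurable]: "ball (0::real^'d) eps0 : sets borel" by simp
    have C0: "C >= 0" by (rule tb(1))
    have B: "B >= 0" by (simp add: B_def)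
    have out: "pd i gk y = 0" "pd i (pd j gk) y = 0" if "norm y > r" for y i j
    proof -
      have op: "open {y::real^'d. norm y > r}" by (intro open_Collect_less continuous_intros)
      have p: "pd i gk y = 0" if "norm y > r" for y i
        by (rule pd_eq_0[OF op]) (use that g0[OF k] in \<open>auto simp: gk_def\<close>)
      thus "pd i gk y = 0" using that .
      show "pd i (pd j gk) y = 0" by (rule pd_eq_0[OF op]) (use that p in auto)
    qed
    have t1: "\<bar>\<Sum>i\<in>UNIV. \<Sum>j\<in>UNIV. a x k $ i $ j * pd i (pd j gk) x\<bar> <= (real CARD('d))\<^sup>2 * (B * C)"
    proof (cases "norm x <= r")
      case True
      have "\<bar>a x k $ i $ j * pd i (pd j gk) x\<bar> <= B * C" for i j
        unfolding abs_mult using component_le_norm_cart[of "a x k $ i" j] Finite_Cartesian_Product.norm_nth_le[of "a x k" i] B0[OF k True] tb(6)[of i j x]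
        by (intro mult_mono) (auto simp: B_def)
      hence "\<bar>\<Sum>i\<in>UNIV. \<Sum>j\<in>UNIV. a x k $ i $ j * pd i (pd j gk) x\<bar> <= (\<Sum>i\<in>(UNIV::'d set). \<Sum>j\<in>(UNIV::'d set). B * C)"
        by (intro order_trans[OF sum_abs] sum_mono)
      thus ?thesis by (simp add: power2_eq_square)
    qed (use out C0 B in simp)
    have t2: "\<bar>b x k \<bullet> grad gk x\<bar> <= B * (real CARD('d) * C)"
    proof (cases "norm x <= r")
      case True
      have "\<bar>b x k \<bullet> grad gk x\<bar> <= norm (b x k) * norm (grad gk x)" by (rule Cauchy_Schwarz_ineq2)
      also have "... <= B * (real CARD('d) * C)" using B0[OF k True] tb(7)[of x] B by (intro mult_mono) (auto simp: B_def)
      finally show ?thesis .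
    next
      case False
      hence "grad gk x = 0" using out by (simp add: grad_def vec_eq_iff)
      thus ?thesis using C0 B by simp
    qed
    have t3: "\<bar>\<integral>u. (gk (x + u) - gk x - (grad gk x \<bullet> u) * indicator (ball 0 eps0) u) \<partial>(\<nu> x k)\<bar> <= CJ"
      unfolding CJ_def by (rule nu_integrable_min(2)[OF k _ jump_integrand_bound[OF gk]]) measurable
    have t4: "\<bar>\<Sum>l\<in>Sset n0. q x k l * (g (x, l) - g (x, k))\<bar> <= real n0 * (CQ * (2 * C))"
    proof -
      have "\<bar>q x k l * (g (x, l) - g (x, k))\<bar> <= CQ * (2 * C)" if "l : Sset n0" for l
      proof (cases "l = k")
        case False
        thus ?thesis unfolding abs_mult
          using q_nonneg[OF k that, of x] q_le[OF k that, of x] test_bound_facts(2)[OF g[OF that], of x] tb(2)[of x] CQ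
          by (intro mult_mono) (auto simp: gk_def)
      qed (use CQ C0 in simp)
      hence "\<bar>\<Sum>l\<in>Sset n0. q x k l * (g (x, l) - g (x, k))\<bar> <= (\<Sum>l\<in>Sset n0. CQ * (2 * C))"
        by (intro order_trans[OF sum_abs] sum_mono)
      thus ?thesis by (simp add: Sset_def)
    qed
    have "Aop a b \<nu> q eps0 n0 g z = (1/2) * (\<Sum>i\<in>UNIV. \<Sum>j\<in>UNIV. a x k $ i $ j * pd i (pd j gk) x) + b x k \<bullet> grad gk x
       + (LINT u|(\<nu> x k). (gk (x + u) - gk x - (grad gk x \<bullet> u) * indicator (ball 0 eps0) u))
       + (\<Sum>l\<in>Sset n0. q x k l * (g (x, l) - g (x, k)))"
      unfolding z Aop_def Lop_def prod.case gk_def by simp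
    thus "\<bar>Aop a b \<nu> q eps0 n0 g z\<bar> <= CA" unfolding CA_def using t1 t2 t3 t4 by linarith
  qed (simp add: CA_def)
qed

end

section \<open>The transport cost\<close>

lemma DERIV_max_0_power:
  "((%x::real. (max 0 x) ^ Suc (Suc n)) has_real_derivative real (Suc (Suc n)) * (max 0 x) ^ Suc n) (at x)"
proof -
  consider "x < 0" | "x = 0" | "x > 0" by linarith
  thus ?thesis
  proof cases
    case 1
    have "((%x. 0::real) has_real_derivative 0) (at x)" by simp
    hence "((%x::real. (max 0 x) ^ Suc (Suc n)) has_real_derivative 0) (at x)"
      by (rule has_field_derivative_transform_within_open[of _ _ _ "{..<0}"]) (use 1 in auto)
    thus ?thesis using 1 by simp
  next
    case 3
    have "((%x. x ^ Suc (Suc n)) has_real_derivative real (Suc (Suc n)) * x ^ Suc n) (at x)"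
      by (auto intro!: derivative_eq_intros simp del: power_Suc)
    hence "((%x::real. (max 0 x) ^ Suc (Suc n)) has_real_derivative real (Suc (Suc n)) * x ^ Suc n) (at x)"
      by (rule has_field_derivative_transform_within_open[of _ _ _ "{0<..}"]) (use 3 in auto)
    thus ?thesis using 3 by simp
  next
    case 2
    have "((%h::real. max 0 h ^ Suc (Suc n) / h) \<longlongrightarrow> 0) (at 0)"
    proof (rule Lim_transform_eventually)
      show "((%h::real. max 0 h ^ Suc n) \<longlongrightarrow> 0) (at 0)"
        by (rule tendsto_eq_intros refl)+ simp
      show "\<forall>\<^sub>F h::real in at 0. max 0 h ^ Suc n = max 0 h ^ Suc (Suc n) / h"
        by (auto simp: eventually_at_filter max_def)
    qed
    thus ?thesis using 2 by (simp add: DERIV_def)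
  qed
qed

text \<open>The second derivative is nonnegative, so the function lies above its tangent.\<close>

lemma max_0_power_taylor_2:
  fixes u x :: real assumes p: "p >= 4"
  shows "(max 0 u) ^ p + real p * (max 0 u) ^ (p - 1) * x <= (max 0 (u + x)) ^ p"
proof -
  define n where "n = p - 3"
  have n: "p = Suc (Suc (Suc n))" using p by (simp add: n_def)
  define df where "df m = (if m = 0 then (%x::real. (max 0 x) ^ p) else if m = 1 then (%x. real p * (max 0 x) ^ Suc (Suc n))
     else (%x. real p * (real (Suc (Suc n)) * (max 0 x) ^ Suc n)))" for m :: nat
  have df: "m < 2 ==> (df m has_real_derivative df (Suc m) t) (at t)" for m t
    using DERIV_max_0_power[of "Suc n" t] DERIV_cmult[OF DERIV_max_0_power[of n t], of "real p"]
    unfolding df_def n by (cases m) (auto simp: less_Suc_eq numeral_2_eq_2 simp del: power_Suc)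
  show ?thesis
  proof (cases "x = 0")
    case False
    have "EX t. (if u + x < u then u + x < t & t < u else u < t & t < u + x) \<and>
       df 0 (u + x) = (\<Sum>m<2. df m u / fact m * (u + x - u) ^ m) + df 2 t / fact 2 * (u + x - u) ^ 2"
      by (rule Taylor[where a="min u (u + x)" and b="max u (u + x)"]) (use df False in auto)
    then obtain t where "df 0 (u + x) = df 0 u + df 1 u * x + df 2 t / 2 * x ^ 2"
      by (auto simp: numeral_2_eq_2)
    moreover have "df 2 t / 2 * x ^ 2 >= 0" unfolding df_def by simp
    ultimately show ?thesis by (simp add: df_def n del: power_Suc)
  qed simp
qed

text \<open>Restricting \<open>u\<close> and \<open>x\<close> keeps the intermediate point of the
  remainder below 2, whence the factor \<open>2 ^ p\<close>. Only a lower bound is stated, as it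
  becomes an upper bound for the cost.\<close>

lemma max_0_power_taylor_3:
  fixes u x :: real assumes p: "p >= 4" and u: "u <= 1" and x: "\<bar>x\<bar> <= 1"
  shows "(max 0 u) ^ p + real p * (max 0 u) ^ (p - 1) * x + real p * real (p - 1) / 2 * (max 0 u) ^ (p - 2) * x^2
     - real p ^ 3 * 2 ^ p * \<bar>x\<bar> ^ 3 <= (max 0 (u + x)) ^ p"
proof -
  define n where "n = p - 4"
  have n: "p = Suc (Suc (Suc (Suc n)))" using p by (simp add: n_def)
  define df where "df m = (if m = 0 then (%x::real. (max 0 x) ^ p) else if m = 1 then (%x. real p * (max 0 x) ^ (p - 1))
     else if m = 2 then (%x. real p * (real (p - 1) * (max 0 x) ^ (p - 2)))
     else (%x. real p * (real (p - 1) * (real (p - 2) * (max 0 x) ^ (p - 3)))))" for m :: nat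
  have df: "m < 3 ==> (df m has_real_derivative df (Suc m) t) (at t)" for m t
    using DERIV_max_0_power[of "Suc (Suc n)" t] DERIV_cmult[OF DERIV_max_0_power[of "Suc n" t], of "real p"]
      DERIV_cmult[OF DERIV_cmult[OF DERIV_max_0_power[of "n" t], of "real (p - 1)"], of "real p"]
    unfolding df_def n by (cases m) (auto simp: less_Suc_eq numeral_3_eq_3 numeral_2_eq_2 simp del: power_Suc)
  show ?thesis
  proof (cases "x = 0")
    case False
    have "EX t. (if u + x < u then u + x < t & t < u else u < t & t < u + x) \<and>
       df 0 (u + x) = (\<Sum>m<3. df m u / fact m * (u + x - u) ^ m) + df 3 t / fact 3 * (u + x - u) ^ 3"
      by (rule Taylor[where a="min u (u + x)" and b="max u (u + x)"]) (use df False in auto)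
    then obtain t where t: "(if u + x < u then u + x < t & t < u else u < t & t < u + x)"
      "df 0 (u + x) = df 0 u + df 1 u * x + df 2 u / 2 * x ^ 2 + df 3 t / 6 * x ^ 3"
      by (auto simp: numeral_3_eq_3 fact_numeral numeral_2_eq_2)
    have t2: "max 0 t <= 2" using t(1) u x by (auto split: if_splits)
    have d3: "0 <= df 3 t" "df 3 t <= real p ^ 3 * 2 ^ p"
    proof -
      show "0 <= df 3 t" by (simp add: df_def)
      have "(max 0 t) ^ (p - 3) <= 2 ^ (p - 3)" using t2 by (intro power_mono) auto
      also have "... <= (2::real) ^ p" by (intro power_increasing) auto
      finally have "df 3 t <= real p * (real p * (real p * 2 ^ p))"
        unfolding df_def by (auto intro!: mult_left_mono mult_mono)
      thus "df 3 t <= real p ^ 3 * 2 ^ p" by (simp add: power3_eq_cube mult_ac)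
    qed
    have "\<bar>df 3 t / 6 * x ^ 3\<bar> = df 3 t / 6 * \<bar>x\<bar> ^ 3" using d3 by (simp add: abs_mult power_abs)
    also have "... <= real p ^ 3 * 2 ^ p * \<bar>x\<bar> ^ 3" using d3 by (intro mult_right_mono) auto
    finally have "- (real p ^ 3 * 2 ^ p * \<bar>x\<bar> ^ 3) <= df 3 t / 6 * x ^ 3" by linarith
    moreover have "df 0 (u + x) = (max 0 (u + x)) ^ p" "df 0 u = (max 0 u) ^ p"
      "df 1 u * x = real p * (max 0 u) ^ (p - 1) * x"
      "df 2 u / 2 * x ^ 2 = real p * real (p - 1) / 2 * (max 0 u) ^ (p - 2) * x^2"
      by (simp_all add: df_def)
    ultimately show ?thesis using t(2) by linarith
  qed simp
qed

text \<open>Concave and increasing, 0 at the origin and 1 from \<open>\<delta>\<close> on. The slope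
  at the origin is \<open>p / \<delta>\<close>: the exponent sets the steepness while the radius of
  saturation stays fixed. For \<open>p >= 4\<close> the function is three times continuously
  differentiable even at \<open>\<delta>\<close>.\<close>

definition capped :: "real => nat => real => real" where
  "capped \<delta> p r = 1 - (max 0 (1 - r / \<delta>)) ^ p"

lemma capped_mono: "\<delta> > 0 ==> r <= s ==> capped \<delta> p r <= capped \<delta> p s"
  unfolding capped_def by (intro diff_left_mono power_mono) (auto simp: divide_right_mono intro: max.coboundedI2)

lemma capped_bounds: "\<delta> > 0 ==> 0 <= r ==> 0 <= capped \<delta> p r" "capped \<delta> p r <= 1"
  unfolding capped_def by (auto intro!: power_le_one)

lemma capped_tangent:
  assumes "\<delta> > 0" "p >= 4"
  shows "capped \<delta> p (r + w) <= capped \<delta> p r + real p / \<delta> * (max 0 (1 - r / \<delta>)) ^ (p - 1) * w"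
proof -
  have e: "1 - (r + w) / \<delta> = (1 - r / \<delta>) + (- w / \<delta>)" by (simp add: add_divide_distrib)
  show ?thesis unfolding capped_def e
    using max_0_power_taylor_2[OF assms(2), of "1 - r / \<delta>" "- w / \<delta>"] by simp
qed

lemma capped_taylor_3:
  assumes "\<delta> > 0" "p >= 4" "r >= 0" "\<bar>w\<bar> <= \<delta>"
  shows "capped \<delta> p (r + w) <= capped \<delta> p r + real p / \<delta> * (max 0 (1 - r / \<delta>)) ^ (p - 1) * w
     - real p * real (p - 1) / (2 * \<delta>^2) * (max 0 (1 - r / \<delta>)) ^ (p - 2) * w^2 + real p ^ 3 * 2 ^ p / \<delta> ^ 3 * \<bar>w\<bar> ^ 3"
proof -
  have e: "1 - (r + w) / \<delta> = (1 - r / \<delta>) + (- w / \<delta>)" by (simp add: add_divide_distrib)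
  show ?thesis unfolding capped_def e
    using max_0_power_taylor_3[OF assms(2), of "1 - r / \<delta>" "- w / \<delta>"] assms
    by (simp add: power_divide abs_divide)
qed

text \<open>Rounding the distance at scale \<open>kap\<close> makes Taylor bounds uniform up to the
  diagonal. The price is a positive value there, of order \<open>kap\<close>.\<close>

definition smooth_cost :: "real => real => nat => real => real" where
  "smooth_cost \<delta> kap p r = capped \<delta> p (sqrt (r^2 + kap^2))"

text \<open>\<open>slope\<close> is the derivative of \<open>capped\<close> at the smoothed distance.\<close>
definition slope :: "real => real => nat => real => real" where
  "slope \<delta> kap p r = real p / \<delta> * (max 0 (1 - sqrt (r^2 + kap^2) / \<delta>)) ^ (p - 1)"

lemma slope_nonneg: "\<delta> > 0 ==> 0 <= slope \<delta> kap p r"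
  by (simp add: slope_def)

text \<open>Two tangents: the square root lies below its tangent as a function of the squared norm,
  and \<open>capped\<close> is increasing and below its own. The result is linear in the change of
  the squared distance, which is the quantity that the condition on \<open>b\<close> and
  \<open>\<sigma>\<close> controls.\<close>

lemma smooth_cost_quadratic:
  fixes D v :: "'a::real_inner"
  assumes "\<delta> > 0" "kap > 0" "p >= 4"
  shows "smooth_cost \<delta> kap p (norm (D + v)) <= smooth_cost \<delta> kap p (norm D)
     + slope \<delta> kap p (norm D) / (2 * sqrt ((norm D)\<^sup>2 + kap^2)) * (2 * (D \<bullet> v) + (norm v)\<^sup>2)"
proof -
  define rho where "rho = sqrt ((norm D)\<^sup>2 + kap^2)"
  have rho: "rho > 0" "rho^2 = (norm D)\<^sup>2 + kap^2" unfolding rho_def using assms by (auto simp: add_nonneg_pos)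
  define \<Delta> where "\<Delta> = 2 * (D \<bullet> v) + (norm v)\<^sup>2"
  have n: "(norm (D + v))\<^sup>2 = (norm D)\<^sup>2 + \<Delta>"
    unfolding \<Delta>_def power2_norm_eq_inner by (simp add: inner_add_left inner_add_right inner_commute)
  have "0 <= (norm (D + v))\<^sup>2 + kap^2" by simp
  hence pos: "0 <= rho^2 + \<Delta>" unfolding n rho(2) by simp
  have "sqrt ((norm (D + v))\<^sup>2 + kap^2) = sqrt (rho^2 + \<Delta>)" unfolding n rho(2) by (simp add: algebra_simps)
  also have "... <= rho + \<Delta> / (2 * rho)"
  proof (rule real_le_lsqrt)
    have "- rho\<^sup>2 <= \<Delta>" using pos by simp
    hence "- rho\<^sup>2 / (2 * rho) <= \<Delta> / (2 * rho)" using rho(1) by (intro divide_right_mono) auto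
    moreover have "- rho\<^sup>2 / (2 * rho) = - rho / 2" using rho(1) by (simp add: power2_eq_square)
    ultimately show "0 <= rho + \<Delta> / (2 * rho)" using rho(1) by simp
    have "(rho + \<Delta> / (2 * rho))\<^sup>2 = rho^2 + \<Delta> + (\<Delta> / (2 * rho))\<^sup>2" using rho(1) by (simp add: power2_sum)
    thus "rho^2 + \<Delta> <= (rho + \<Delta> / (2 * rho))\<^sup>2" by simp
  qed
  finally have "smooth_cost \<delta> kap p (norm (D + v)) <= capped \<delta> p (rho + \<Delta> / (2 * rho))"
    unfolding smooth_cost_def by (intro capped_mono assms)
  also have "... <= capped \<delta> p rho + real p / \<delta> * (max 0 (1 - rho / \<delta>)) ^ (p - 1) * (\<Delta> / (2 * rho))"
    by (intro capped_tangent assms)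
  finally show ?thesis by (simp add: smooth_cost_def slope_def rho_def[symmetric] \<Delta>_def)
qed

lemma smooth_cost_lipschitz:
  fixes D u :: "'a::real_inner"
  assumes "\<delta> > 0" "p >= 4"
  shows "smooth_cost \<delta> kap p (norm (D + u)) <= smooth_cost \<delta> kap p (norm D) + slope \<delta> kap p (norm D) * norm u"
proof -
  have "sqrt ((norm (D + u))\<^sup>2 + kap^2) <= sqrt ((norm D + norm u)\<^sup>2 + (kap + 0)\<^sup>2)"
    using power_mono[OF norm_triangle_ineq[of D u], of 2] by simp
  also have "... <= sqrt ((norm D)\<^sup>2 + kap^2) + sqrt ((norm u)\<^sup>2 + 0\<^sup>2)"
    by (rule real_sqrt_sum_squares_triangle_ineq)
  finally have "smooth_cost \<delta> kap p (norm (D + u)) <= capped \<delta> p (sqrt ((norm D)\<^sup>2 + kap^2) + norm u)"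
    unfolding smooth_cost_def by (intro capped_mono assms) simp
  also have "... <= smooth_cost \<delta> kap p (norm D) + slope \<delta> kap p (norm D) * norm u"
    unfolding smooth_cost_def slope_def by (intro capped_tangent assms)
  finally show ?thesis .
qed

text \<open>The second derivative of the rounded distance is \<open>kap^2 / rho ^ 3\<close>;
  allowing twice its Taylor coefficient absorbs all higher orders as long as \<open>v\<close> is at
  most half of \<open>kap\<close>.\<close>

lemma sqrt_shift_le:
  fixes r v kap :: real
  assumes k: "kap > 0" and v: "\<bar>v\<bar> <= kap / 2" and rho: "rho = sqrt (r^2 + kap^2)"
  shows "sqrt ((r + v)\<^sup>2 + kap^2) <= rho + (r * v / rho + v^2 * kap^2 / rho ^ 3)"
proof -
  have r2: "rho^2 = r^2 + kap^2" and rp: "rho > 0" unfolding rho using k by (auto simp: add_nonneg_pos)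
  have rk: "rho >= kap" "\<bar>r\<bar> <= rho" unfolding rho using k by (auto intro!: real_le_rsqrt)
  have "\<bar>r * v / rho\<bar> <= \<bar>v\<bar>" using rk rp by (simp add: abs_mult field_simps mult_right_mono)
  hence "- \<bar>v\<bar> <= r * v / rho" by linarith
  hence h: "rho + r * v / rho >= rho / 2" using v rk by linarith
  show ?thesis
  proof (rule real_le_lsqrt)
    show "0 <= rho + (r * v / rho + v^2 * kap^2 / rho ^ 3)" 
    proof -
      have "0 <= v^2 * kap^2 / rho ^ 3" using rp by simp
      thus ?thesis using h rp by linarith
    qed
    have "(rho + (r * v / rho + v^2 * kap^2 / rho ^ 3))\<^sup>2 >= (rho + r * v / rho)\<^sup>2 + 2 * (rho + r * v / rho) * (v^2 * kap^2 / rho ^ 3)"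
      by (simp add: add.assoc[symmetric] power2_sum)
    moreover have "2 * (rho + r * v / rho) * (v^2 * kap^2 / rho ^ 3) >= rho * (v^2 * kap^2 / rho ^ 3)"
    proof (rule mult_right_mono)
      show "rho <= 2 * (rho + r * v / rho)" by (rule order_trans[OF _ mult_left_mono[OF h, of 2]]) simp_all
    qed (use rp in simp)
    moreover have "rho * (v^2 * kap^2 / rho ^ 3) = v^2 * kap^2 / rho^2" using rp by (simp add: power2_eq_square power3_eq_cube)
    moreover have "(rho + r * v / rho)\<^sup>2 + v^2 * kap^2 / rho^2 = (r + v)\<^sup>2 + kap^2"
    proof -
      have "(rho + r * v / rho)\<^sup>2 + v^2 * kap^2 / rho^2 = rho^2 + 2 * r * v + v^2 * (r^2 + kap^2) / rho^2"
        using rp by (simp add: power2_sum power_divide power_mult_distrib add_divide_distrib algebra_simps)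
      also have "... = rho^2 + 2 * r * v + v^2" using rp by (simp add: r2[symmetric])
      finally show ?thesis unfolding r2 by (simp add: power2_sum)
    qed
    ultimately show "(r + v)\<^sup>2 + kap^2 <= (rho + (r * v / rho + v^2 * kap^2 / rho ^ 3))\<^sup>2" by linarith
  qed
qed

text \<open>The shift of the rounded distance is inserted into the cubic expansion of
  \<open>capped\<close>. The negative term stems from the concavity of \<open>capped\<close>, and
  its factor \<open>r^2 / rho^2\<close> is the squared derivative of the rounded distance. This is
  the term that reflection exploits.\<close>

lemma smooth_cost_taylor_3:
  fixes r v :: real
  assumes \<delta>: "\<delta> > 0" and k: "kap > 0" and p: "p >= 4" and v: "\<bar>v\<bar> <= kap / 2" "2 * \<bar>v\<bar> <= \<delta>"
    and rho: "rho = sqrt (r^2 + kap^2)"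
  shows "smooth_cost \<delta> kap p (r + v) <= smooth_cost \<delta> kap p r + slope \<delta> kap p r * (r * v / rho + v^2 * kap^2 / rho ^ 3)
     - real p * real (p - 1) / (2 * \<delta>^2) * (max 0 (1 - rho / \<delta>)) ^ (p - 2) * (r^2 / rho^2) * v^2
     + (real p ^ 3 * 2 ^ p * 8 / \<delta> ^ 3 + real p ^ 2 / (\<delta>^2 * kap)) * \<bar>v\<bar> ^ 3"
proof -
  have r2: "rho^2 = r^2 + kap^2" and rp: "rho > 0" unfolding rho using k by (auto simp: add_nonneg_pos)
  have rk: "rho >= kap" "\<bar>r\<bar> <= rho" unfolding rho using k by (auto intro!: real_le_rsqrt)
  define w where "w = r * v / rho + v^2 * kap^2 / rho ^ 3"
  define A where "A = real p * real (p - 1) / (2 * \<delta>^2) * (max 0 (1 - rho / \<delta>)) ^ (p - 2)"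
  have kr: "kap^2 / rho ^ 3 <= 1 / kap"
  proof -
    have "kap^2 * kap <= rho^2 * rho" using rk k by (intro mult_mono power_mono) auto
    thus ?thesis using rp k by (simp add: field_simps power2_eq_square power3_eq_cube)
  qed
  have w1: "\<bar>r * v / rho\<bar> <= \<bar>v\<bar>" using rk rp by (simp add: abs_mult field_simps mult_right_mono)
  have "\<bar>v^2 * kap^2 / rho ^ 3\<bar> = \<bar>v\<bar> * (\<bar>v\<bar> * (kap^2 / rho ^ 3))" using rp by (simp add: power2_eq_square abs_mult)
  also have "... <= \<bar>v\<bar> * (kap / 2 * (1 / kap))" using v(1) kr k rp by (intro mult_left_mono mult_mono) auto
  also have "... <= \<bar>v\<bar>" using k by simp
  finally have w2: "\<bar>w\<bar> <= 2 * \<bar>v\<bar>" unfolding w_def using w1 abs_triangle_ineq[of "r * v / rho" "v^2 * kap^2 / rho ^ 3"] by linarith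
  have "smooth_cost \<delta> kap p (r + v) <= capped \<delta> p (rho + w)"
    unfolding smooth_cost_def w_def by (intro capped_mono \<delta> sqrt_shift_le k v rho)
  also have "... <= capped \<delta> p rho + slope \<delta> kap p r * w - A * w^2 + real p ^ 3 * 2 ^ p / \<delta> ^ 3 * \<bar>w\<bar> ^ 3"
    using capped_taylor_3[OF \<delta> p, of rho w] w2 v(2) rp unfolding slope_def A_def rho by simp
  also have "... <= capped \<delta> p rho + slope \<delta> kap p r * w - (A * (r^2 / rho^2) * v^2 - real p ^ 2 / (\<delta>^2 * kap) * \<bar>v\<bar> ^ 3)
      + real p ^ 3 * 2 ^ p * 8 / \<delta> ^ 3 * \<bar>v\<bar> ^ 3"
  proof -
    have "\<bar>w\<bar> ^ 3 <= (2 * \<bar>v\<bar>) ^ 3" using w2 by (intro power_mono) auto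
    hence "real p ^ 3 * 2 ^ p / \<delta> ^ 3 * \<bar>w\<bar> ^ 3 <= real p ^ 3 * 2 ^ p / \<delta> ^ 3 * (8 * \<bar>v\<bar> ^ 3)"
      using \<delta> by (intro mult_left_mono) (auto simp: power_mult_distrib)
    moreover have "A * w^2 >= A * (r^2 / rho^2) * v^2 - real p ^ 2 / (\<delta>^2 * kap) * \<bar>v\<bar> ^ 3"
    proof -
      have A0: "A >= 0" "A <= real p ^ 2 / (2 * \<delta>^2)"
      proof -
        show "A >= 0" by (simp add: A_def)
        have "max 0 (1 - rho / \<delta>) ^ (p - 2) <= 1" using rp \<delta> by (intro power_le_one) auto
        hence "A <= real p * real p / (2 * \<delta>^2) * 1" unfolding A_def by (intro mult_mono divide_right_mono) auto
        thus "A <= real p ^ 2 / (2 * \<delta>^2)" by (simp add: power2_eq_square)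
      qed
      have "\<bar>2 * (r * v / rho) * (v^2 * kap^2 / rho ^ 3)\<bar> = 2 * \<bar>r * v / rho\<bar> * (v^2 * (kap^2 / rho ^ 3))"
        using rp by (simp add: abs_mult)
      also have "... <= 2 * \<bar>v\<bar> * (v^2 * (1 / kap))" using w1 kr rp by (intro mult_mono) auto
      also have "... = 2 * \<bar>v\<bar> ^ 3 / kap" by (simp add: power3_eq_cube power2_eq_square abs_mult_self_eq mult_ac)
      finally have c: "- (2 * \<bar>v\<bar> ^ 3 / kap) <= 2 * (r * v / rho) * (v^2 * kap^2 / rho ^ 3)" by linarith
      have "w^2 = (r^2 / rho^2) * v^2 + 2 * (r * v / rho) * (v^2 * kap^2 / rho ^ 3) + (v^2 * kap^2 / rho ^ 3)\<^sup>2"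
        unfolding w_def by (simp add: power2_sum power_divide power_mult_distrib)
      hence "w^2 >= (r^2 / rho^2) * v^2 - 2 * \<bar>v\<bar> ^ 3 / kap" using c zero_le_power2[of "v^2 * kap^2 / rho ^ 3"] by linarith
      hence "A * w^2 >= A * ((r^2 / rho^2) * v^2 - 2 * \<bar>v\<bar> ^ 3 / kap)" using A0 by (intro mult_left_mono) auto
      moreover have "A * (2 * \<bar>v\<bar> ^ 3 / kap) <= real p ^ 2 / (2 * \<delta>^2) * (2 * \<bar>v\<bar> ^ 3 / kap)"
        using A0 k by (intro mult_right_mono) auto
      moreover have "real p ^ 2 / (2 * \<delta>^2) * (2 * \<bar>v\<bar> ^ 3 / kap) = real p ^ 2 / (\<delta>^2 * kap) * \<bar>v\<bar> ^ 3"
        using k \<delta> by simp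
      ultimately show ?thesis by (simp add: algebra_simps)
    qed
    ultimately show ?thesis by simp
  qed
  finally show ?thesis
    unfolding A_def w_def smooth_cost_def[of \<delta> kap p r] rho[symmetric] by (simp add: algebra_simps)
qed

section \<open>The cost with two exponents\<close>

definition tcost :: "real => real => nat => real => real => real => real" where
  "tcost \<delta> kap p \<alpha> \<beta> r = \<alpha> * smooth_cost \<delta> kap p r + \<beta> * smooth_cost \<delta> kap 4 r"

definition tslope :: "real => real => nat => real => real => real => real" where
  "tslope \<delta> kap p \<alpha> \<beta> r = \<alpha> * slope \<delta> kap p r + \<beta> * slope \<delta> kap 4 r"

text \<open>Minus one half of the second derivative of \<open>capped\<close> at the rounded
  distance.\<close>

definition curv :: "real => real => nat => real => real" where
  "curv \<delta> kap p r = real p * real (p - 1) / (2 * \<delta>^2) * (max 0 (1 - sqrt (r^2 + kap^2) / \<delta>)) ^ (p - 2)"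

definition tcurv :: "real => real => nat => real => real => real => real" where
  "tcurv \<delta> kap p \<alpha> \<beta> r = \<alpha> * curv \<delta> kap p r + \<beta> * curv \<delta> kap 4 r"

definition trem :: "real => real => nat => real" where
  "trem \<delta> kap p = real p ^ 3 * 2 ^ p * 8 / \<delta> ^ 3 + real p ^ 2 / (\<delta>^2 * kap)"

lemma smooth_cost_bounds: "\<delta> > 0 ==> 0 <= smooth_cost \<delta> kap p r" "smooth_cost \<delta> kap p r <= 1"
  unfolding smooth_cost_def by (auto intro!: capped_bounds)

lemma slope_bound: "\<delta> > 0 ==> slope \<delta> kap p r <= real p / \<delta>"
proof -
  assume d: "\<delta> > 0"
  have "max 0 (1 - sqrt (r^2 + kap^2) / \<delta>) ^ (p - 1) <= 1" using d by (intro power_le_one) auto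
  hence "real p / \<delta> * max 0 (1 - sqrt (r^2 + kap^2) / \<delta>) ^ (p - 1) <= real p / \<delta> * 1" using d by (intro mult_left_mono) auto
  thus ?thesis by (simp add: slope_def)
qed

lemma curv_bounds: "\<delta> > 0 ==> 0 <= curv \<delta> kap p r" "\<delta> > 0 ==> curv \<delta> kap p r <= real p ^ 2 / \<delta>^2"
proof -
  assume d: "\<delta> > 0"
  show "0 <= curv \<delta> kap p r" by (simp add: curv_def)
  have "max 0 (1 - sqrt (r^2 + kap^2) / \<delta>) ^ (p - 2) <= 1" using d by (intro power_le_one) auto
  hence "curv \<delta> kap p r <= real p * real p / \<delta>^2 * 1"
    unfolding curv_def using d by (intro mult_mono frac_le) auto
  thus "curv \<delta> kap p r <= real p ^ 2 / \<delta>^2" by (simp add: power2_eq_square)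
qed

context
  fixes \<delta> kap \<alpha> \<beta> :: real and p :: nat
  assumes \<delta>: "\<delta> > 0" and kap: "kap > 0" and p: "p >= 4" and \<alpha>: "\<alpha> >= 0" and \<beta>: "\<beta> >= 0"
begin

lemma tcost_bounds: "0 <= tcost \<delta> kap p \<alpha> \<beta> r" "tcost \<delta> kap p \<alpha> \<beta> r <= \<alpha> + \<beta>"
  unfolding tcost_def using smooth_cost_bounds(1)[OF \<delta>, of kap p r] smooth_cost_bounds(1)[OF \<delta>, of kap 4 r]
    smooth_cost_bounds(2)[of \<delta> kap p r] smooth_cost_bounds(2)[of \<delta> kap 4 r] \<alpha> \<beta>
  by (auto intro!: add_mono mult_left_le)

lemma tslope_bounds: "0 <= tslope \<delta> kap p \<alpha> \<beta> r" "tslope \<delta> kap p \<alpha> \<beta> r <= (\<alpha> + \<beta>) * real p / \<delta>"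
proof -
  show "0 <= tslope \<delta> kap p \<alpha> \<beta> r" unfolding tslope_def using slope_nonneg[OF \<delta>] \<alpha> \<beta> by simp
  have "slope \<delta> kap 4 r <= real p / \<delta>" using slope_bound[OF \<delta>, of kap 4 r] divide_right_mono[of "real 4" "real p" \<delta>] p \<delta> by simp
  hence "\<alpha> * slope \<delta> kap p r + \<beta> * slope \<delta> kap 4 r <= \<alpha> * (real p / \<delta>) + \<beta> * (real p / \<delta>)"
    using slope_bound[OF \<delta>] \<alpha> \<beta> by (intro add_mono mult_left_mono) auto
  thus "tslope \<delta> kap p \<alpha> \<beta> r <= (\<alpha> + \<beta>) * real p / \<delta>" by (simp add: tslope_def algebra_simps add_divide_distrib)
qed

lemma tcurv_bounds: "0 <= tcurv \<delta> kap p \<alpha> \<beta> r" "tcurv \<delta> kap p \<alpha> \<beta> r <= (\<alpha> + \<beta>) * (real p)\<^sup>2 / \<delta>^2"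
proof -
  show "0 <= tcurv \<delta> kap p \<alpha> \<beta> r" unfolding tcurv_def using curv_bounds[OF \<delta>] \<alpha> \<beta> by simp
  have "(4::real)\<^sup>2 <= (real p)\<^sup>2" using p by (intro power_mono) auto
  hence "real 4 ^ 2 / \<delta>^2 <= (real p)\<^sup>2 / \<delta>^2" by (intro divide_right_mono) auto
  hence "curv \<delta> kap 4 r <= (real p)\<^sup>2 / \<delta>^2" using curv_bounds(2)[OF \<delta>, of kap 4 r] by linarith
  hence "\<alpha> * curv \<delta> kap p r + \<beta> * curv \<delta> kap 4 r <= \<alpha> * ((real p)\<^sup>2 / \<delta>^2) + \<beta> * ((real p)\<^sup>2 / \<delta>^2)"
    using curv_bounds[OF \<delta>] \<alpha> \<beta> by (intro add_mono mult_left_mono) auto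
  thus "tcurv \<delta> kap p \<alpha> \<beta> r <= (\<alpha> + \<beta>) * (real p)\<^sup>2 / \<delta>^2" by (simp add: tcurv_def algebra_simps add_divide_distrib)
qed

lemma tcost_quadratic:
  fixes D v :: "'a::real_inner"
  shows "tcost \<delta> kap p \<alpha> \<beta> (norm (D + v)) <= tcost \<delta> kap p \<alpha> \<beta> (norm D)
     + tslope \<delta> kap p \<alpha> \<beta> (norm D) / (2 * sqrt ((norm D)\<^sup>2 + kap^2)) * (2 * (D \<bullet> v) + (norm v)\<^sup>2)"
proof -
  have "\<alpha> * smooth_cost \<delta> kap p (norm (D + v)) + \<beta> * smooth_cost \<delta> kap 4 (norm (D + v)) <=
    \<alpha> * (smooth_cost \<delta> kap p (norm D) + slope \<delta> kap p (norm D) / (2 * sqrt ((norm D)\<^sup>2 + kap^2)) * (2 * (D \<bullet> v) + (norm v)\<^sup>2))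
    + \<beta> * (smooth_cost \<delta> kap 4 (norm D) + slope \<delta> kap 4 (norm D) / (2 * sqrt ((norm D)\<^sup>2 + kap^2)) * (2 * (D \<bullet> v) + (norm v)\<^sup>2))"
    using \<alpha> \<beta> p by (intro add_mono mult_left_mono smooth_cost_quadratic \<delta> kap) auto
  thus ?thesis unfolding tcost_def tslope_def by (simp add: algebra_simps add_divide_distrib)
qed

lemma tcost_lipschitz:
  fixes D u :: "'a::real_inner"
  shows "tcost \<delta> kap p \<alpha> \<beta> (norm (D + u)) <= tcost \<delta> kap p \<alpha> \<beta> (norm D) + tslope \<delta> kap p \<alpha> \<beta> (norm D) * norm u"
proof -
  have "\<alpha> * smooth_cost \<delta> kap p (norm (D + u)) + \<beta> * smooth_cost \<delta> kap 4 (norm (D + u)) <=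
    \<alpha> * (smooth_cost \<delta> kap p (norm D) + slope \<delta> kap p (norm D) * norm u) + \<beta> * (smooth_cost \<delta> kap 4 (norm D) + slope \<delta> kap 4 (norm D) * norm u)"
    using \<alpha> \<beta> p by (intro add_mono mult_left_mono smooth_cost_lipschitz \<delta>) auto
  thus ?thesis unfolding tcost_def tslope_def by (simp add: algebra_simps)
qed

lemma tcost_taylor:
  fixes r v :: real
  assumes v: "\<bar>v\<bar> <= kap / 2" "2 * \<bar>v\<bar> <= \<delta>" and rho: "rho = sqrt (r^2 + kap^2)"
  shows "tcost \<delta> kap p \<alpha> \<beta> (r + v) <= tcost \<delta> kap p \<alpha> \<beta> r + tslope \<delta> kap p \<alpha> \<beta> r * (r * v / rho + v^2 * kap^2 / rho ^ 3)
     - tcurv \<delta> kap p \<alpha> \<beta> r * (r^2 / rho^2) * v^2 + (\<alpha> * trem \<delta> kap p + \<beta> * trem \<delta> kap 4) * \<bar>v\<bar> ^ 3"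
proof -
  have each: "smooth_cost \<delta> kap n (r + v) <= smooth_cost \<delta> kap n r + slope \<delta> kap n r * (r * v / rho + v^2 * kap^2 / rho ^ 3)
      - curv \<delta> kap n r * (r^2 / rho^2) * v^2 + trem \<delta> kap n * \<bar>v\<bar> ^ 3" if "n >= 4" for n
    using smooth_cost_taylor_3[OF \<delta> kap that v rho] unfolding curv_def trem_def rho[symmetric] .
  have "tcost \<delta> kap p \<alpha> \<beta> (r + v) <= \<alpha> * (smooth_cost \<delta> kap p r + slope \<delta> kap p r * (r * v / rho + v^2 * kap^2 / rho ^ 3)
      - curv \<delta> kap p r * (r^2 / rho^2) * v^2 + trem \<delta> kap p * \<bar>v\<bar> ^ 3)
     + \<beta> * (smooth_cost \<delta> kap 4 r + slope \<delta> kap 4 r * (r * v / rho + v^2 * kap^2 / rho ^ 3)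
      - curv \<delta> kap 4 r * (r^2 / rho^2) * v^2 + trem \<delta> kap 4 * \<bar>v\<bar> ^ 3)"
    unfolding tcost_def using \<alpha> \<beta> p by (intro add_mono mult_left_mono each) auto
  thus ?thesis unfolding tcost_def tslope_def tcurv_def
    by (simp only: distrib_left distrib_right right_diff_distrib left_diff_distrib mult.assoc)
qed

lemma tcost_even: "tcost \<delta> kap p \<alpha> \<beta> \<bar>r\<bar> = tcost \<delta> kap p \<alpha> \<beta> r"
  by (simp add: tcost_def smooth_cost_def)

end

section \<open>Mollification\<close>

text \<open>Polynomials in the reciprocal times the exponential of minus the reciprocal, extended by
  0, form a class closed under differentiation, so all derivatives of the standard bump stay in
  it.\<close>

definition exp_bump :: "real poly => real => real" where
  "exp_bump p t = (if t <= 0 then 0 else poly p (1 / t) * exp (- (1 / t)))"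

lemma tendsto_poly_exp_neg: "((%y. poly p y * exp (- y)) \<longlongrightarrow> (0::real)) at_top"
proof -
  have "((%y. \<Sum>i\<le>degree p. coeff p i * (y ^ i / exp y)) \<longlongrightarrow> (\<Sum>i\<le>degree p. coeff p i * 0)) at_top"
    by (intro tendsto_intros tendsto_power_div_exp_0)
  moreover have "(%y. \<Sum>i\<le>degree p. coeff p i * (y ^ i / exp y)) = (%y. poly p y * exp (- y))"
    by (simp add: poly_altdef exp_minus sum_distrib_right divide_inverse mult.assoc)
  ultimately show ?thesis by simp
qed

lemma exp_bump_has_derivative:
  "(exp_bump p has_real_derivative exp_bump ([:0, 0, 1:] * (p - pderiv p)) t) (at t)"
proof -
  consider "t < 0" | "t = 0" | "t > 0" by linarith
  thus ?thesis
  proof cases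
    case 1
    have "((%t. 0::real) has_real_derivative 0) (at t)" by simp
    hence "(exp_bump p has_real_derivative 0) (at t)"
      by (rule has_field_derivative_transform_within_open[of _ _ _ "{..<0}"]) (use 1 in \<open>auto simp: exp_bump_def\<close>)
    thus ?thesis using 1 by (simp add: exp_bump_def)
  next
    case 3
    have "((%t. poly p (1 / t) * exp (- (1 / t))) has_real_derivative
       poly ([:0, 0, 1:] * (p - pderiv p)) (1 / t) * exp (- (1 / t))) (at t)"
      using 3 by (auto intro!: derivative_eq_intros DERIV_chain2[OF poly_DERIV] simp: field_simps power2_eq_square)
    hence "(exp_bump p has_real_derivative poly ([:0, 0, 1:] * (p - pderiv p)) (1 / t) * exp (- (1 / t))) (at t)"
      by (rule has_field_derivative_transform_within_open[of _ _ _ "{0<..}"]) (use 3 in \<open>auto simp: exp_bump_def\<close>)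
    thus ?thesis using 3 by (simp add: exp_bump_def)
  next
    case 2
    have r: "((%h. exp_bump p h / h) \<longlongrightarrow> 0) (at_right 0)"
    proof -
      have "((%h. poly ([:0,1:] * p) (1 / h) * exp (- (1 / h))) \<longlongrightarrow> 0) (at_right (0::real))"
        by (rule filterlim_compose[OF tendsto_poly_exp_neg]) 
           (simp add: divide_inverse filterlim_inverse_at_top_right)
      moreover have "\<forall>\<^sub>F h in at_right 0. poly ([:0,1:] * p) (1 / h) * exp (- (1 / h)) = exp_bump p h / h"
        using eventually_at_right_less[of 0] by eventually_elim (simp add: exp_bump_def)
      ultimately show ?thesis by (rule Lim_transform_eventually)
    qed
    have l: "((%h. exp_bump p h / h) \<longlongrightarrow> 0) (at_left 0)"
    proof (rule Lim_transform_eventually[OF tendsto_const])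
      show "\<forall>\<^sub>F h in at_left 0. 0 = exp_bump p h / h"
        unfolding eventually_at_filter by (simp add: exp_bump_def)
    qed
    have "((%h. exp_bump p h / h) \<longlongrightarrow> 0) (at 0)" using l r by (simp add: filterlim_split_at)
    thus ?thesis using 2 by (simp add: DERIV_def exp_bump_def)
  qed
qed

fun exp_bump_poly :: "nat => real poly" where
  "exp_bump_poly 0 = 1"
| "exp_bump_poly (Suc n) = [:0, 0, 1:] * (exp_bump_poly n - pderiv (exp_bump_poly n))"

text \<open>The standard bump times its mirror image at \<open>e\<close> lives on the interval from
  0 to \<open>e\<close>. All derivatives are exhibited as one family because the partial derivatives
  of product bumps are assembled from them; a list of index pairs records the summands of the
  Leibniz rule.\<close>

lemma bump_derivatives_exist:
  fixes e :: real assumes "e > 0"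
  obtains D :: "nat => real => real"
  where "!!n t. (D n has_real_derivative D (Suc n) t) (at t)"
    "!!n t. t <= 0 \<or> t >= e ==> D n t = 0" "!!t. 0 < t ==> t < e ==> 0 < D 0 t"
proof -
  define F where "F n = exp_bump (exp_bump_poly n)" for n
  define G where "G n t = (-1) ^ n * F n (e - t)" for n t
  have F: "(F n has_real_derivative F (Suc n) t) (at t)" for n t
    unfolding F_def using exp_bump_has_derivative[of "exp_bump_poly n" t] by simp
  have G: "(G n has_real_derivative G (Suc n) t) (at t)" for n t
    unfolding G_def by (auto intro!: derivative_eq_intros DERIV_chain2[OF F])
  define nxt where "nxt xs = concat (map (%(i, j). [(Suc i, j), (i, Suc j)]) xs)" for xs :: "(nat \<times> nat) list"
  define H where "H xs t = (\<Sum>(i, j)\<leftarrow>xs. F i t * G j t)" for xs :: "(nat \<times> nat) list" and t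
  have H: "(H xs has_real_derivative H (nxt xs) t) (at t)" for xs t
  proof (induction xs)
    case (Cons x xs)
    obtain i j where x: "x = (i, j)" by force
    have "((%t. F i t * G j t + H xs t) has_real_derivative
       (F (Suc i) t * G j t + F i t * G (Suc j) t) + H (nxt xs) t) (at t)"
      by (auto intro!: derivative_eq_intros F G Cons simp: mult_ac)
    thus ?case unfolding x by (simp add: H_def nxt_def add_ac)
  qed (simp add: H_def[abs_def] nxt_def)
  define D where "D n = H ((nxt ^^ n) [(0, 0)])" for n
  have z: "H xs t = 0" if "t <= 0 \<or> t >= e" for xs t
    using that by (induction xs) (auto simp: H_def F_def G_def exp_bump_def)
  show thesis
  proof
    show "(D n has_real_derivative D (Suc n) t) (at t)" for n t
      using H[of "(nxt ^^ n) [(0, 0)]" t] by (simp add: D_def)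
    show "t <= 0 \<or> t >= e ==> D n t = 0" for n t by (simp add: D_def z)
    show "0 < D 0 t" if "0 < t" "t < e" for t
      using that by (simp add: D_def H_def F_def G_def exp_bump_def)
  qed
qed

section \<open>Convolution with a product of one-dimensional bumps\<close>

locale bump_family =
  fixes D :: "nat => real => real" and e :: real
  assumes D: "!!n t. (D n has_real_derivative D (Suc n) t) (at t)"
    and D0: "!!n t. t <= 0 \<or> t >= e ==> D n t = 0"
    and Dpos: "!!t. 0 < t ==> t < e ==> 0 < D 0 t" and e: "e > 0"
begin

definition prod_bump :: "('d::finite => nat) => real^'d => real" where
  "prod_bump c w = (\<Prod>j\<in>UNIV. D (c j) (w $ j))"

lemma prod_bump_has_derivative:
  fixes c :: "'d::finite => nat"
  shows "(prod_bump c has_derivative (%v. \<Sum>i\<in>UNIV. v $ i * prod_bump (c(i := Suc (c i))) w)) (at w)"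
proof -
  have "((%w. \<Prod>j\<in>UNIV. D (c j) (w $ j)) has_derivative
     (%v. \<Sum>i\<in>UNIV. (v $ i * D (Suc (c i)) (w $ i)) * (\<Prod>j\<in>UNIV - {i}. D (c j) (w $ j)))) (at w)"
  proof (rule has_derivative_prod)
    fix j :: 'd
    have "((%w. w $ j) has_derivative (%v. v $ j)) (at w)"
      by (intro bounded_linear_imp_has_derivative bounded_linear_vec_nth)
    thus "((%w. D (c j) (w $ j)) has_derivative (%v. v $ j * D (Suc (c j)) (w $ j))) (at w)"
      using has_derivative_compose[of "%w. w $ j" "%v. v $ j" w UNIV "D (c j)" "(*) (D (Suc (c j)) (w $ j))"]
        D[of "c j" "w $ j"] by (simp add: mult.commute has_field_derivative_def)
  qed
  moreover have "D (Suc (c i)) (w $ i) * (\<Prod>j\<in>UNIV - {i}. D (c j) (w $ j)) = prod_bump (c(i := Suc (c i))) w" for i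
    unfolding prod_bump_def by (subst prod.remove[of UNIV i]) auto
  ultimately show ?thesis by (simp add: prod_bump_def[abs_def] mult.assoc)
qed

lemma prod_bump_continuous: "continuous_on S (prod_bump c)"
  by (intro continuous_at_imp_continuous_on ballI has_derivative_continuous[OF prod_bump_has_derivative])

lemma prod_bump_eq_0: "w \<notin> cbox 0 (\<chi> i. e) ==> prod_bump c w = 0"
  unfolding prod_bump_def mem_box_cart using D0 by (auto simp: not_le) (meson less_imp_le)+

lemma prod_bump_integrable: "integrable lborel (prod_bump c)"
proof -
  have "integrable lborel (%w. indicator (cbox 0 (\<chi> i. e)) w *\<^sub>R prod_bump c w)"
    by (rule borel_integrable_compact) (auto intro: prod_bump_continuous)
  moreover have "(%w. indicator (cbox 0 (\<chi> i. e)) w *\<^sub>R prod_bump c w) = prod_bump c"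
    by (auto simp: indicator_def prod_bump_eq_0 fun_eq_iff)
  ultimately show ?thesis by simp
qed

text \<open>The argument is \<open>x + w\<close>, as for an average over random displacements; each
  derivative in \<open>x\<close> therefore falls on the bump with a minus sign. The multi-index
  \<open>c\<close> counts the derivatives taken in each coordinate.\<close>

definition bump_conv :: "(real^'d => real) => ('d::finite => nat) => real^'d => real" where
  "bump_conv f c x = (LINT w|lborel. f (x + w) * prod_bump c w)"

lemma bump_conv_bound:
  assumes "!!y. \<bar>f y\<bar> <= 1" "f : borel_measurable borel"
  shows "\<bar>bump_conv f c x\<bar> <= (LINT w|lborel. \<bar>prod_bump c w\<bar>)"
proof -
  have [measurable]: "prod_bump c : borel_measurable borel"
    using prod_bump_continuous by (rule borel_measurable_continuous_onI)
  have "\<bar>bump_conv f c x\<bar> <= (LINT w|lborel. \<bar>f (x + w) * prod_bump c w\<bar>)"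
    unfolding bump_conv_def by (rule integral_abs_bound)
  also have "... <= (LINT w|lborel. \<bar>prod_bump c w\<bar>)"
  proof (rule integral_mono)
    show "\<bar>f (x + w) * prod_bump c w\<bar> <= \<bar>prod_bump c w\<bar>" for w
      using assms(1)[of "x + w"] by (simp add: abs_mult mult_left_le_one_le)
    show "integrable lborel (%w. \<bar>f (x + w) * prod_bump c w\<bar>)"
      by (rule Bochner_Integration.integrable_bound[OF prod_bump_integrable[of c]])
         (use assms in \<open>auto simp: abs_mult mult_left_le_one_le\<close>)
  qed (use prod_bump_integrable in auto)
  finally show ?thesis .
qed

text \<open>After the shift \<open>y = x + w\<close> the variable \<open>x\<close> occurs only in
  the smooth factor, and the compact support of \<open>f\<close> confines the integral to a box,
  where one may differentiate under the integral sign.\<close>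

lemma bump_conv_has_derivative:
  fixes f :: "real^'d::finite => real"
  assumes f: "continuous_on UNIV f" and supp: "bounded {y. f y ~= 0}"
  shows "(bump_conv f c has_derivative (%v. - (\<Sum>i\<in>UNIV. v $ i * bump_conv f (c(i := Suc (c i))) x))) (at x)"
proof -
  obtain a b where ab: "{y. f y ~= 0} \<subseteq> cbox a b" using supp bounded_subset_cbox_symmetric by metis
  have cf: "continuous_on S f" for S using f continuous_on_subset by blast
  have cp: "continuous_on S (%z. prod_bump c (g z))" if "continuous_on S g" for S g and c :: "'d => nat"
    using continuous_on_compose2[OF prod_bump_continuous[of UNIV c] that] by auto
  have eq: "bump_conv f c x = integral (cbox a b) (%y. f y * prod_bump c (y - x))" for c x
  proof -
    have "bump_conv f c x = (LINT w|(distr lborel borel ((+) x)). f w * prod_bump c (w - x))"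
      unfolding bump_conv_def
      by (subst integral_distr) (auto intro!: borel_measurable_continuous_onI continuous_intros cp cf)
    also have "... = (LINT w|lborel. f w * prod_bump c (w - x))"
      by (simp add: lborel_distr_plus)
    also have "... = (LINT y:cbox a b|lborel. f y * prod_bump c (y - x))"
      unfolding set_lebesgue_integral_def using ab by (intro Bochner_Integration.integral_cong) (auto simp: indicator_def)
    also have "... = integral (cbox a b) (%y. f y * prod_bump c (y - x))"
      by (intro set_borel_integral_eq_integral borel_integrable_compact[folded set_integrable_def] compact_cbox
          continuous_intros cf cp)
    finally show ?thesis .
  qed
  define fx where "fx x y = (\<Sum>i\<in>UNIV. - (f y * prod_bump (c(i := Suc (c i))) (y - x)) *\<^sub>R blinfun_inner_right (axis i 1 :: real^'d))" 
    for x y :: "real^'d"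
  have "((%x. integral (cbox a b) (%y. f y * prod_bump c (y - x))) has_derivative
      blinfun_apply (integral (cbox a b) (fx x))) (at x within UNIV)"
  proof (rule leibniz_rule)
    fix x y :: "real^'d"
    have "((%x. y - x) has_derivative (%v. - v)) (at x)" by (auto intro!: derivative_eq_intros)
    from has_derivative_mult_right[OF has_derivative_compose[OF this prod_bump_has_derivative[of c]], of "f y"]
    show "((%x. f y * prod_bump c (y - x)) has_derivative blinfun_apply (fx x y)) (at x within UNIV)"
      by (rule has_derivative_eq_rhs)
         (simp add: fx_def fun_eq_iff blinfun.sum_left blinfun.scaleR_left blinfun.minus_left inner_axis' sum_distrib_left
           sum_negf mult_ac)
  next
    show "continuous_on (UNIV \<times> cbox a b) (%(x, y). fx x y)"
      unfolding fx_def split_beta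
      by (intro continuous_intros cp continuous_on_compose2[OF f]) auto
  qed (auto intro!: integrable_continuous continuous_intros cp cf)
  moreover have "blinfun_apply (integral (cbox a b) (fx x)) = (%v. - (\<Sum>i\<in>UNIV. v $ i * bump_conv f (c(i := Suc (c i))) x))"
  proof
    fix v
    have ic: "(%y. f y * prod_bump c (y - x)) integrable_on cbox a b" for c
      by (intro integrable_continuous continuous_intros cp cf)
    have "blinfun_apply (integral (cbox a b) (fx x)) v = integral (cbox a b) (%y. blinfun_apply (fx x y) v)"
      by (rule blinfun_apply_integral) (unfold fx_def, intro integrable_continuous continuous_intros cp cf)
    also have "... = integral (cbox a b) (%y. \<Sum>i\<in>UNIV. - v $ i * (f y * prod_bump (c(i := Suc (c i))) (y - x)))"
      by (simp add: fx_def blinfun.sum_left blinfun.scaleR_left blinfun.minus_left inner_axis' mult_ac)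
    also have "... = (\<Sum>i\<in>UNIV. - v $ i * bump_conv f (c(i := Suc (c i))) x)"
      unfolding eq by (subst integral_sum) (auto intro!: integrable_neg integrable_on_mult_right ic)
    finally show "blinfun_apply (integral (cbox a b) (fx x)) v = - (\<Sum>i\<in>UNIV. v $ i * bump_conv f (c(i := Suc (c i))) x)"
      by (simp add: sum_negf)
  qed
  ultimately show ?thesis unfolding eq by simp
qed

lemma pd_bump_conv:
  fixes f :: "real^'d::finite => real"
  assumes f: "continuous_on UNIV f" and supp: "bounded {y. f y ~= 0}"
  shows "pd i (%x. s * bump_conv f c x) x = - s * bump_conv f (c(i := Suc (c i))) x"
proof -
  have l: "((%h. x + h *\<^sub>R axis i (1::real)) has_derivative (%h. h *\<^sub>R axis i 1)) (at 0)"
    by (auto intro!: derivative_eq_intros)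
  have "((%h. bump_conv f c (x + h *\<^sub>R axis i 1)) has_derivative
     (%h. - (\<Sum>j\<in>UNIV. (h *\<^sub>R axis i (1::real)) $ j * bump_conv f (c(j := Suc (c j))) x))) (at 0)"
    using bump_conv_has_derivative[OF f supp, of c x]
    by (intro has_derivative_compose[OF l]) (simp del: fun_upd_apply)
  moreover have "(\<Sum>j\<in>UNIV. (h *\<^sub>R axis i (1::real)) $ j * bump_conv f (c(j := Suc (c j))) x) = 
     bump_conv f (c(i := Suc (c i))) x * h" for h
    by (subst sum.remove[of _ i]) (auto simp: axis_def)
  ultimately have "((%h. bump_conv f c (x + h *\<^sub>R axis i 1)) has_real_derivative 
     - bump_conv f (c(i := Suc (c i))) x) (at 0)"
    unfolding has_field_derivative_def by (elim has_derivative_eq_rhs) (simp add: fun_eq_iff)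
  from DERIV_cmult[OF this, of s] show ?thesis unfolding pd_def by (intro DERIV_imp_deriv) simp
qed

text \<open>\<open>count_list is\<close> is the multi-index of the list: only the number of
  occurrences of each coordinate enters.\<close>

lemma iter_pd_bump_conv:
  fixes f :: "real^'d::finite => real"
  assumes f: "continuous_on UNIV f" and supp: "bounded {y. f y ~= 0}"
  shows "iter_pd is (%x. s * bump_conv f (%_. 0) x) = (%x. s * (- 1) ^ length is * bump_conv f (count_list is) x)"
proof (induction "is")
  case (Cons i "is")
  have "(count_list is)(i := Suc (count_list is i)) = count_list (i # is)" by (auto simp: fun_eq_iff)
  thus ?case unfolding iter_pd.simps Cons.IH by (simp only: pd_bump_conv[OF f supp] fun_eq_iff[of "pd _ _"] length_Cons power_Suc)
      (simp del: count_list.simps)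
qed (simp add: fun_eq_iff cong: if_cong)

end

text \<open>The bounds \<open>C\<close> depend on the list of derivatives but not on
  \<open>f\<close>. This uniformity matters because the dual functions change with every step of the
  chain.\<close>

lemma mollifier_exists:
  fixes e :: real assumes e: "e > 0"
  obtains W :: "(real^'d::finite) measure" and C :: "'d list => real"
  where "prob_space W" "sets W = sets borel" "AE w in W. norm w <= e"
    "!!f. continuous_on UNIV f ==> bounded {y. f y ~= 0} ==> Cc_inf (%x. \<integral>w. f (x + w) \<partial>W)"
    "!!f is x. continuous_on UNIV f ==> bounded {y. f y ~= 0} ==> (!!y. \<bar>f y\<bar> <= 1) ==>
       \<bar>iter_pd is (%x. \<integral>w. f (x + w) \<partial>W) x\<bar> <= C is"
proof -
  \<comment> \<open>The bump lives on a cube of side \<open>e'\<close>, whose points have norm at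
    most \<open>CARD('d) * e'\<close>.\<close>
  define e' where "e' = e / real CARD('d)"
  have e': "e' > 0" using e by (simp add: e'_def)
  obtain D where D: "!!n t. (D n has_real_derivative D (Suc n) t) (at t)"
    "!!n t. t <= 0 \<or> t >= e' ==> D n t = 0" "!!t. 0 < t ==> t < e' ==> 0 < D 0 t"
    using bump_derivatives_exist[OF e'] by metis
  interpret bump_family D e' using D e' by unfold_locales auto
  define B where "B = (prod_bump :: ('d => nat) => _)"
  have intg: "integrable lborel (B c)" for c unfolding B_def by (rule prod_bump_integrable)
  have nonneg: "0 <= B (%_. 0) w" for w
    unfolding B_def prod_bump_def by (intro prod_nonneg ballI) (metis D0 Dpos less_eq_real_def linorder_not_less)
  have [measurable]: "B c : borel_measurable borel" for c
    unfolding B_def by (intro borel_measurable_continuous_onI prod_bump_continuous)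
  define Z where "Z = (LINT w|lborel. B (%_. 0) w)"
  have "Z ~= 0"
  proof
    assume "Z = 0"
    hence "AE w in lborel. B (%_. 0) w = 0"
      using integral_nonneg_eq_0_iff_AE[OF intg[of "%_. 0"]] nonneg unfolding Z_def by auto
    hence "AE w in lborel. w \<notin> box (0::real^'d) (\<chi> i. e')"
      by eventually_elim (use Dpos in \<open>auto simp: B_def prod_bump_def mem_box_cart\<close>, metis less_numeral_extra(3))
    hence "emeasure lborel (box (0::real^'d) (\<chi> i. e')) = 0"
      by (subst (asm) AE_iff_measurable[of "box (0::real^'d) (\<chi> i. e')"]) auto
    moreover have "emeasure lborel (box (0::real^'d) (\<chi> i. e')) = ennreal (\<Prod>b\<in>Basis. ((\<chi> i. e') - (0::real^'d)) \<bullet> b)"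
      using e' by (intro emeasure_lborel_box) (auto simp: Basis_vec_def inner_axis)
    moreover have "0 < (\<Prod>b\<in>Basis. ((\<chi> i. e') - (0::real^'d)) \<bullet> b)"
      using e' by (intro prod_pos) (auto simp: Basis_vec_def inner_axis)
    ultimately show False by (metis ennreal_eq_0_iff not_le)
  qed
  moreover have "Z >= 0" unfolding Z_def using nonneg by (intro Bochner_Integration.integral_nonneg) auto
  ultimately have Z: "Z > 0" by simp
  define W where "W = density lborel (%w. ennreal (B (%_. 0) w / Z))"
  have Wint: "(LINT w|W. f (x + w)) = (1 / Z) * bump_conv f (%_. 0) x" if "f : borel_measurable borel" for f x
    unfolding W_def using that nonneg Z
    by (subst integral_real_density) (auto simp: bump_conv_def B_def[symmetric] mult_ac simp flip: integral_mult_right_zero)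
  show thesis
  proof (rule that)
    show "prob_space W"
    proof
      have "emeasure W (space W) = (\<integral>\<^sup>+w. ennreal (B (%_. 0) w / Z) \<partial>lborel)"
        unfolding W_def by (subst emeasure_density) auto
      also have "... = ennreal (LINT w|lborel. B (%_. 0) w / Z)"
        using intg nonneg Z by (intro nn_integral_eq_integral) auto
      also have "(LINT w|lborel. B (%_. 0) w / Z) = 1" using Z by (simp add: Z_def[symmetric])
      finally show "emeasure W (space W) = 1" by simp
    qed
    show "sets W = sets borel" by (simp add: W_def)
    show "AE w in W. norm w <= e"
      unfolding W_def
    proof (subst AE_density)
      show "AE x in lborel. 0 < ennreal (B (%_. 0) x / Z) --> norm x <= e"
      proof (intro AE_I2 impI)
        fix x assume "0 < ennreal (B (%_. 0) x / Z)"
        hence "B (%_. 0) x ~= 0" by auto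
        hence "x : cbox 0 (\<chi> i. e')" unfolding B_def using prod_bump_eq_0 by metis
        hence "\<bar>x $ i\<bar> <= e'" for i by (auto simp: mem_box_cart)
        hence "(\<Sum>i\<in>UNIV. \<bar>x $ i\<bar>) <= real CARD('d) * e'" using sum_bounded_above[of UNIV "%i. \<bar>x $ i\<bar>" e'] by simp
        thus "norm x <= e" using norm_le_l1_cart[of x] by (simp add: e'_def)
      qed
    qed auto
  next
    fix f :: "real^'d => real" assume f: "continuous_on UNIV f" "bounded {y. f y ~= 0}"
    have fm: "f : borel_measurable borel" using f(1) by (rule borel_measurable_continuous_onI)
    note it = iter_pd_bump_conv[OF f]
    have W: "(%x. \<integral>w. f (x + w) \<partial>W) = (%x. (1 / Z) * bump_conv f (%_. 0) x)" using Wint[OF fm] by auto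
    have "smooth_fun (%x. \<integral>w. f (x + w) \<partial>W)"
      unfolding smooth_fun_def W it
      by (intro allI derivative_intros differentiableI[OF bump_conv_has_derivative[OF f]])
    moreover have "bounded {x. (LINT w|W. f (x + w)) ~= 0}"
    proof -
      obtain r where r: "!!y. f y ~= 0 ==> norm y <= r" using f(2) by (auto simp: bounded_iff)
      have "norm x <= r + norm ((\<chi> i. e') :: real^'d)" if "bump_conv f (%_. 0) x ~= 0" for x
      proof -
        have "EX w. f (x + w) * prod_bump (%_. 0) w ~= 0"
        proof (rule ccontr)
          assume "\<nexists>w. f (x + w) * prod_bump (%_. 0) w ~= 0"
          hence "(%w. f (x + w) * prod_bump (%_. 0) w) = (%_. 0)" by auto
          thus False using that unfolding bump_conv_def by simp
        qed
        then obtain w where w: "f (x + w) ~= 0" "prod_bump (%_. 0) w ~= 0" by auto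
        hence "w : cbox 0 (\<chi> i. e')" using prod_bump_eq_0 by metis
        hence "norm w <= norm ((\<chi> i. e') :: real^'d)" by (intro norm_le_componentwise_cart) (auto simp: mem_box_cart intro: order_trans)
        thus ?thesis using r[OF w(1)] norm_triangle_ineq4[of "x + w" w] by simp
      qed
      thus ?thesis unfolding bounded_iff using Wint[OF fm] by fastforce
    qed
    ultimately show "Cc_inf (%x. \<integral>w. f (x + w) \<partial>W)" by (simp add: Cc_inf_def)
    fix "is" x assume b: "!!y. \<bar>f y\<bar> <= 1"
    show "\<bar>iter_pd is (%x. \<integral>w. f (x + w) \<partial>W) x\<bar> <= (1 / Z) * (LINT w|lborel. \<bar>B (count_list is) w\<bar>)"
      unfolding W it using bump_conv_bound[OF b fm, of "count_list is" x] Z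
      by (simp add: abs_mult B_def divide_right_mono)
  qed
qed

section \<open>One coupled step of the chain\<close>

context switching begin

lemma N_finite_integrable:
  assumes "f : borel_measurable borel" "!!u. \<bar>f u\<bar> <= (C::real)"
  shows "integrable N f"
proof -
  interpret prob_space N by (rule N_prob)
  show ?thesis by (rule integrable_const_bound[where B=C])
    (use assms in \<open>auto simp: measurable_cong_sets[OF N_sets refl]\<close>)
qed

lemma N_lin_integrable: "integrable N (%u. e \<bullet> u)" "integrable N (%u. (e \<bullet> u)\<^sup>2)"
proof -
  interpret prob_space N by (rule N_prob)
  note [measurable_cong] = N_sets
  have b: "AE u in N. \<bar>e \<bullet> u\<bar> <= norm e"
    using N_AE by eventually_elim (metis Cauchy_Schwarz_ineq2 mult.right_neutral mult_left_mono norm_ge_zero order_trans)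
  show "integrable N (%u. e \<bullet> u)" by (rule integrable_const_bound[where B="norm e"]) (use b in auto)
  have "AE u in N. norm ((e \<bullet> u)\<^sup>2) <= (norm e)\<^sup>2"
    using b by eventually_elim (simp add: abs_le_square_iff[symmetric])
  thus "integrable N (%u. (e \<bullet> u)\<^sup>2)" by (rule integrable_const_bound) measurable
qed

text \<open>A maximum principle: \<open>Kop\<close> is an average, since the padding makes all rates
  nonnegative and \<open>2 * h^2 * L <= 1\<close> leaves a nonnegative weight for the diffusion
  move.\<close>

lemma Kop_le:
  assumes k: "k : Sset n0" and e: "0 < eps" "eps <= 1"
    and f: "!!l. l : Sset n0 ==> (%y. f (y, l)) : borel_measurable borel" "!!z. 0 <= f z" "!!z. snd z : Sset n0 ==> f z <= c" "!!z. f z <= 1"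
    and L: "CN / eps^2 <= L" "real n0 * CQ <= L" and h: "2 * h^2 * L <= 1"
  shows "Kop eps L h f x k y <= c"
proof -
  interpret prob_space N by (rule N_prob)
  define fk where "fk = (%y. f (y, k))"
  have fk: "fk : borel_measurable borel" "!!y. 0 <= fk y" "!!y. fk y <= c" "!!y. fk y <= 1"
    unfolding fk_def using f k by auto
  note [measurable] = fk(1)
  have d: "dif eps h x k fk y <= c"
  proof -
    have "(\<Sum>j\<in>UNIV. fk (y + (h * s1) *\<^sub>R \<sigma> x k $ j) + fk (y - (h * s1) *\<^sub>R \<sigma> x k $ j)) <= (\<Sum>j\<in>(UNIV::'d set). c + c)"
      by (intro sum_mono add_mono fk)
    hence "(\<Sum>j\<in>UNIV. fk (y + (h * s1) *\<^sub>R \<sigma> x k $ j) + fk (y - (h * s1) *\<^sub>R \<sigma> x k $ j)) / (2 * real CARD('d)) <= c"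
      by (simp add: field_simps)
    moreover have "(LINT u|N. fk (y + (h * m1) *\<^sub>R u)) <= c"
      using fk by (intro integral_le_const N_finite_integrable[where C=1]) auto
    ultimately show ?thesis unfolding dif_def using fk(3)[of "y + (3 * h^2) *\<^sub>R btilde eps x k"] by simp
  qed
  have L0: "L >= 0" using L(1) CN order_trans[of 0 "CN / eps^2" L] by simp
  have j: "jmp eps L x k fk y <= L * c"
  proof -
    have "(LINT u|(\<nu> x k). fk (y + u) * indicator (far eps) u) <= (LINT u|(\<nu> x k). c * indicator (far eps) u)"
    proof (rule integral_mono)
      show "integrable (\<nu> x k) (%u. fk (y + u) * indicator (far eps) u)"
        by (rule far_integrable[OF k e, where C=1]) (use fk in \<open>auto simp: indicator_def\<close>)
      show "integrable (\<nu> x k) (%u. c * indicator (far eps) u)"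
        by (rule far_integrable[OF k e, where C="\<bar>c\<bar>"]) (auto simp: indicator_def)
    qed (use fk in \<open>auto simp: indicator_def\<close>)
    hence "(LINT u|(\<nu> x k). fk (y + u) * indicator (far eps) u) <= measure (\<nu> x k) (far eps) * c" by (simp add: nu_space[OF k] mult.commute)
    moreover have "(L - measure (\<nu> x k) (far eps)) * fk y <= (L - measure (\<nu> x k) (far eps)) * c"
      using far_measure(2)[OF k e, of x] L fk by (intro mult_left_mono) auto
    ultimately show ?thesis unfolding jmp_def by (simp add: algebra_simps)
  qed
  have s: "swi L x k (%l. f (y, l)) <= L * c"
  proof -
    have q: "0 <= q x k l" "q x k l <= CQ" if "l : Sset n0 - {k}" for l using q_nonneg[OF k, of l x] q_le[OF k, of l x] that by auto
    have "(\<Sum>l\<in>Sset n0 - {k}. q x k l) <= (\<Sum>l\<in>Sset n0 - {k}. CQ)" by (intro sum_mono q)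
    also have "... <= real n0 * CQ" using CQ k by (auto simp: Sset_def mult_right_mono)
    finally have Q: "(\<Sum>l\<in>Sset n0 - {k}. q x k l) <= L" using L by linarith
    have "(\<Sum>l\<in>Sset n0 - {k}. f (y, l) * q x k l) <= (\<Sum>l\<in>Sset n0 - {k}. c * q x k l)"
      using f q by (intro sum_mono mult_right_mono) auto
    moreover have "(L - (\<Sum>l\<in>Sset n0 - {k}. q x k l)) * f (y, k) <= (L - (\<Sum>l\<in>Sset n0 - {k}. q x k l)) * c"
      using Q f k by (intro mult_left_mono) auto
    ultimately show ?thesis unfolding swi_def by (simp add: algebra_simps sum_distrib_left)
  qed
  have "(1 - 2 * h^2 * L) * dif eps h x k fk y <= (1 - 2 * h^2 * L) * c" using d h by (intro mult_left_mono) auto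
  moreover have "h^2 * (jmp eps L x k fk y + swi L x k (%l. f (y, l))) <= h^2 * (L * c + L * c)"
    using j s by (intro mult_left_mono add_mono) auto
  ultimately show ?thesis unfolding Kop_def fk_def[symmetric] by (simp add: algebra_simps)
qed

section \<open>Dual pairs under coupled diffusion, jumps and switching\<close>

context
  fixes \<delta> kap \<alpha> \<beta> Oc :: real and p :: nat and f h :: "(real^'d) \<times> nat => real"
  assumes \<delta>: "\<delta> > 0" and kap: "kap > 0" and p: "p >= 4" and \<alpha>: "\<alpha> >= 0" and \<beta>: "\<beta> >= 0"
    and fm: "!!l. l : Sset n0 ==> (%y. f (y, l)) : borel_measurable borel" and f0: "!!z. 0 <= f z" and f1: "!!z. f z <= 1"
    and hm: "!!l. l : Sset n0 ==> (%y. h (y, l)) : borel_measurable borel" and h0: "!!z. 0 <= h z" and h1: "!!z. h z <= 1"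
    and adm: "!!l y y'. l : Sset n0 ==> f (y, l) + h (y', l) <= Oc + tcost \<delta> kap p \<alpha> \<beta> (norm (y - y'))"
    and adm2: "!!l l' y y'. l : Sset n0 ==> l' : Sset n0 ==> f (y, l) + h (y', l') <= Oc + (\<alpha> + \<beta>)"
begin

text \<open>Drift and rows of \<open>\<sigma>\<close> are matched synchronously and estimated by the
  quadratic bound. The isotropic noise is either shared, which leaves the difference of the
  positions unchanged, or reflected in the hyperplane orthogonal to \<open>D\<close>. In the latter
  case the difference becomes \<open>(r + v) *\<^sub>R n\<close> with \<open>v\<close> centred and
  of order \<open>st\<close>; the concavity of the cost gives the gain with \<open>tcurv\<close>,
  and the rounding the loss with \<open>kap^2\<close>.\<close>

lemma dif_coupled:
  assumes k: "k : Sset n0" and D: "D = y - y'" and r: "r = norm D" and rho: "rho = sqrt (r^2 + kap^2)"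
    and bt: "bt = btilde eps x k - btilde eps z k" "norm bt <= B" and st: "0 < st"
    and small: "2 * (st * m1) <= kap / 2" "4 * (st * m1) <= \<delta>" "st <= 1"
    and mode: "reflecting ==> D ~= 0"
    and Y: "Y = tslope \<delta> kap p \<alpha> \<beta> r / (2 * rho) * (2 * (D \<bullet> bt) + (norm (\<sigma> x k - \<sigma> z k))\<^sup>2)
       + (if reflecting then 4 * lam * tslope \<delta> kap p \<alpha> \<beta> r * kap^2 / rho ^ 3 - 4 * lam * tcurv \<delta> kap p \<alpha> \<beta> r * (r^2 / rho^2) else 0)"
  shows "dif eps st x k (%y. f (y, k)) y + dif eps st z k (%y. h (y, k)) y' <= Oc + tcost \<delta> kap p \<alpha> \<beta> r + st^2 * Y
     + (tslope \<delta> kap p \<alpha> \<beta> r * 3 / (2 * kap) * B^2 + (\<alpha> * trem \<delta> kap p + \<beta> * trem \<delta> kap 4) * (8 * m1 ^ 3)) * st ^ 3"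
proof -
  interpret prob_space N by (rule N_prob)
  note cp = \<delta> kap p \<alpha> \<beta>
  define fk where "fk = (%y. f (y, k))"
  define hk where "hk = (%y. h (y, k))"
  have [measurable]: "fk : borel_measurable borel" "hk : borel_measurable borel" unfolding fk_def hk_def using fm hm k by auto
  define c where "c = tcost \<delta> kap p \<alpha> \<beta>"
  define sl where "sl = tslope \<delta> kap p \<alpha> \<beta> r"
  define cv where "cv = tcurv \<delta> kap p \<alpha> \<beta> r"
  define tr where "tr = \<alpha> * trem \<delta> kap p + \<beta> * trem \<delta> kap 4"
  have sl0: "sl >= 0" unfolding sl_def by (rule tslope_bounds[OF cp])
  have tr0: "tr >= 0" unfolding tr_def trem_def using \<alpha> \<beta> \<delta> kap by simp
  have rp: "rho > 0" "rho >= kap" unfolding rho using kap by (auto simp: add_nonneg_pos intro!: real_le_rsqrt)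
  have ad: "fk (y + v) + hk (y' + v') <= Oc + c (norm (D + (v - v')))" for v v'
    using adm[OF k, of "y + v" "y' + v'"] unfolding fk_def hk_def c_def D by (simp add: algebra_simps)
  have quad: "c (norm (D + v)) <= c r + sl / (2 * rho) * (2 * (D \<bullet> v) + (norm v)\<^sup>2)" for v
    unfolding c_def sl_def r rho by (rule tcost_quadratic[OF cp])
  have m10: "m1 >= 0" "m1^2 * v0 = 3 * lam" using lam v0 by (simp_all add: m1_def)
  have A1: "fk (y + (3 * st^2) *\<^sub>R btilde eps x k) + hk (y' + (3 * st^2) *\<^sub>R btilde eps z k)
     <= Oc + c r + 3 * st^2 * (sl / (2 * rho) * (2 * (D \<bullet> bt))) + 3 * (sl * 3 / (2 * kap) * B^2) * st ^ 3"
  proof -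
    have "fk (y + (3 * st^2) *\<^sub>R btilde eps x k) + hk (y' + (3 * st^2) *\<^sub>R btilde eps z k) <= Oc + c (norm (D + (3 * st^2) *\<^sub>R bt))"
      using ad[of "(3 * st^2) *\<^sub>R btilde eps x k" "(3 * st^2) *\<^sub>R btilde eps z k"] by (simp add: bt(1) scaleR_diff_right)
    also have "... <= Oc + (c r + sl / (2 * rho) * (2 * (D \<bullet> ((3 * st^2) *\<^sub>R bt)) + (norm ((3 * st^2) *\<^sub>R bt))\<^sup>2))"
      by (intro add_left_mono quad)
    also have "... = Oc + c r + 3 * st^2 * (sl / (2 * rho) * (2 * (D \<bullet> bt))) + sl / (2 * rho) * (norm ((3 * st^2) *\<^sub>R bt))\<^sup>2"
      by (simp add: algebra_simps)
    also have "sl / (2 * rho) * (norm ((3 * st^2) *\<^sub>R bt))\<^sup>2 <= sl / (2 * kap) * (9 * (st ^ 3 * B^2))"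
    proof (rule mult_mono)
      show "sl / (2 * rho) <= sl / (2 * kap)" using sl0 rp kap by (intro divide_left_mono) auto
      have "st ^ 4 <= st ^ 3" using st small by (intro power_decreasing) auto
      hence "st ^ 4 * (norm bt)\<^sup>2 <= st ^ 3 * B^2" using st bt(2) by (intro mult_mono power_mono) auto
      thus "(norm ((3 * st^2) *\<^sub>R bt))\<^sup>2 <= 9 * (st ^ 3 * B^2)" by (simp add: power_mult_distrib power_mult[symmetric])
    qed (use sl0 kap in auto)
    finally show ?thesis by (simp add: algebra_simps)
  qed
  define sg where "sg j = \<sigma> x k $ j - \<sigma> z k $ j" for j
  have A2: "(\<Sum>j\<in>UNIV. fk (y + (st * s1) *\<^sub>R \<sigma> x k $ j) + fk (y - (st * s1) *\<^sub>R \<sigma> x k $ j)) / (2 * real CARD('d))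
      + (\<Sum>j\<in>UNIV. hk (y' + (st * s1) *\<^sub>R \<sigma> z k $ j) + hk (y' - (st * s1) *\<^sub>R \<sigma> z k $ j)) / (2 * real CARD('d))
     <= Oc + c r + 3 * st^2 * (sl / (2 * rho) * (norm (\<sigma> x k - \<sigma> z k))\<^sup>2)"
  proof -
    \<comment> \<open>Opposite moves are paired, so that the inner products with \<open>D\<close>
      cancel and only squared lengths remain.\<close>
    have each: "(fk (y + (st * s1) *\<^sub>R \<sigma> x k $ j) + fk (y - (st * s1) *\<^sub>R \<sigma> x k $ j)) + (hk (y' + (st * s1) *\<^sub>R \<sigma> z k $ j) + hk (y' - (st * s1) *\<^sub>R \<sigma> z k $ j))
       <= 2 * (Oc + c r) + 2 * (sl / (2 * rho) * ((st * s1)\<^sup>2 * (norm (sg j))\<^sup>2))" for j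
    proof -
      define v where "v = (st * s1) *\<^sub>R sg j"
      have "fk (y + (st * s1) *\<^sub>R \<sigma> x k $ j) + hk (y' + (st * s1) *\<^sub>R \<sigma> z k $ j) <= Oc + c (norm (D + v))"
        using ad[of "(st * s1) *\<^sub>R \<sigma> x k $ j" "(st * s1) *\<^sub>R \<sigma> z k $ j"] by (simp add: v_def sg_def scaleR_diff_right)
      moreover have "fk (y - (st * s1) *\<^sub>R \<sigma> x k $ j) + hk (y' - (st * s1) *\<^sub>R \<sigma> z k $ j) <= Oc + c (norm (D + - v))"
        using ad[of "- ((st * s1) *\<^sub>R \<sigma> x k $ j)" "- ((st * s1) *\<^sub>R \<sigma> z k $ j)"] by (simp add: v_def sg_def scaleR_diff_right)
      moreover have "c (norm (D + v)) + c (norm (D + - v)) <= 2 * c r + 2 * (sl / (2 * rho) * (norm v)\<^sup>2)"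
        using add_mono[OF quad[of v] quad[of "- v"]] by (simp add: algebra_simps)
      moreover have "(norm v)\<^sup>2 = (st * s1)\<^sup>2 * (norm (sg j))\<^sup>2" by (simp add: v_def power_mult_distrib)
      ultimately show ?thesis by simp
    qed
    have ns: "(\<Sum>j\<in>UNIV. (norm (sg j))\<^sup>2) = (norm (\<sigma> x k - \<sigma> z k))\<^sup>2"
      by (simp add: norm_vec_def L2_set_def sg_def sum_nonneg)
    have s1s: "(st * s1)\<^sup>2 = st^2 * (3 * real CARD('d))" by (simp add: s1_def power_mult_distrib)
    have "(\<Sum>j\<in>UNIV. fk (y + (st * s1) *\<^sub>R \<sigma> x k $ j) + fk (y - (st * s1) *\<^sub>R \<sigma> x k $ j))
      + (\<Sum>j\<in>UNIV. hk (y' + (st * s1) *\<^sub>R \<sigma> z k $ j) + hk (y' - (st * s1) *\<^sub>R \<sigma> z k $ j))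
      <= (\<Sum>j\<in>UNIV. 2 * (Oc + c r) + 2 * (sl / (2 * rho) * ((st * s1)\<^sup>2 * (norm (sg j))\<^sup>2)))"
      unfolding sum.distrib[symmetric] using each by (intro sum_mono) (simp add: algebra_simps)
    also have "... = 2 * real CARD('d) * (Oc + c r + 3 * st^2 * (sl / (2 * rho) * (norm (\<sigma> x k - \<sigma> z k))\<^sup>2))"
      unfolding ns[symmetric] s1s by (simp add: sum.distrib sum_distrib_left algebra_simps)
    finally show ?thesis unfolding add_divide_distrib[symmetric] by (subst pos_divide_le_eq) (auto simp: mult_ac)
  qed
  define GN where "GN = (if reflecting then 3 * st^2 * (4 * lam * sl * kap^2 / rho ^ 3 - 4 * lam * cv * (r^2 / rho^2)) else 0)"
  have fb: "\<bar>fk u\<bar> <= 1" and hb: "\<bar>hk u\<bar> <= 1" for u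
    using f0[of "(u, k)"] f1[of "(u, k)"] h0[of "(u, k)"] h1[of "(u, k)"] by (simp_all add: fk_def hk_def)
  have ifn: "integrable N (%u. fk (y + (st * m1) *\<^sub>R u))" "integrable N (%u. hk (y' + (st * m1) *\<^sub>R u))"
    using fb hb by (auto intro!: N_finite_integrable[where C=1])
  have A3: "(LINT u|N. fk (y + (st * m1) *\<^sub>R u)) + (LINT u|N. hk (y' + (st * m1) *\<^sub>R u)) <= Oc + c r + GN + tr * (8 * m1 ^ 3) * st ^ 3"
  proof (cases reflecting)
    case False
    have "(LINT u|N. fk (y + (st * m1) *\<^sub>R u) + hk (y' + (st * m1) *\<^sub>R u)) <= Oc + c r"
    proof (rule integral_le_const)
      show "AE u in N. fk (y + (st * m1) *\<^sub>R u) + hk (y' + (st * m1) *\<^sub>R u) <= Oc + c r"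
        using ad[of "(st * m1) *\<^sub>R u" "(st * m1) *\<^sub>R u" for u] by (intro AE_I2) (simp add: r)
    qed (use ifn in auto)
    moreover have "0 <= tr * (8 * m1 ^ 3) * st ^ 3" using tr0 m10 st by simp
    moreover have "GN = 0" using False by (simp add: GN_def)
    moreover have "(LINT u|N. fk (y + (st * m1) *\<^sub>R u) + hk (y' + (st * m1) *\<^sub>R u)) = (LINT u|N. fk (y + (st * m1) *\<^sub>R u)) + (LINT u|N. hk (y' + (st * m1) *\<^sub>R u))"
      using ifn by simp
    ultimately show ?thesis by linarith
  next
    case True
    hence D0: "D ~= 0" by (rule mode)
    define n where "n = (1 / r) *\<^sub>R D"
    have n: "norm n = 1" "D = r *\<^sub>R n" using D0 by (auto simp: n_def r)
    have nn: "n \<bullet> n = 1" using n(1) by (simp add: norm_eq_1)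
    define V where "V = 2 * (st * m1)"
    have V: "V >= 0" "V <= kap / 2" "2 * V <= \<delta>" using small st m10 by (auto simp: V_def)
    have ihr: "integrable N (%u. hk (y' + (st * m1) *\<^sub>R reflect n u))"
      using hb by (auto intro!: N_finite_integrable[where C=1])
    \<comment> \<open>The reflected noise has the law of the noise. In the dual formulation this
      substitution is the whole of the reflection coupling.\<close>
    have "(LINT u|N. hk (y' + (st * m1) *\<^sub>R u)) = (LINT u|N. hk (y' + (st * m1) *\<^sub>R reflect n u))"
      by (rule N_reflect[OF n(1), symmetric]) measurable
    hence "(LINT u|N. fk (y + (st * m1) *\<^sub>R u)) + (LINT u|N. hk (y' + (st * m1) *\<^sub>R u))
       = (LINT u|N. fk (y + (st * m1) *\<^sub>R u) + hk (y' + (st * m1) *\<^sub>R reflect n u))"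
      using ifn ihr by simp
    also have "... <= (LINT u|N. Oc + c r + sl * (r * V / rho) * (n \<bullet> u) + (sl * kap^2 / rho ^ 3 - cv * (r^2 / rho^2)) * V^2 * (n \<bullet> u)\<^sup>2 + tr * V ^ 3)"
    proof (rule integral_mono_AE)
      show "integrable N (%u. fk (y + (st * m1) *\<^sub>R u) + hk (y' + (st * m1) *\<^sub>R reflect n u))"
        using ifn(1) ihr by simp
      show "AE u in N. fk (y + (st * m1) *\<^sub>R u) + hk (y' + (st * m1) *\<^sub>R reflect n u)
         <= Oc + c r + sl * (r * V / rho) * (n \<bullet> u) + (sl * kap^2 / rho ^ 3 - cv * (r^2 / rho^2)) * V^2 * (n \<bullet> u)\<^sup>2 + tr * V ^ 3"
        using N_AE
      proof eventually_elim
        fix u :: "real^'d" assume u: "norm u <= 1"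
        define v where "v = V * (n \<bullet> u)"
        have nu: "\<bar>n \<bullet> u\<bar> <= 1" using Cauchy_Schwarz_ineq2[of n u] n(1) u by simp
        have vV: "\<bar>v\<bar> <= V" unfolding v_def abs_mult using V(1) nu by (simp add: mult_left_le)
        have "D + ((st * m1) *\<^sub>R u - (st * m1) *\<^sub>R reflect n u) = (r + v) *\<^sub>R n"
          unfolding n(2) reflect_def v_def V_def by (simp add: algebra_simps)
        hence "norm (D + ((st * m1) *\<^sub>R u - (st * m1) *\<^sub>R reflect n u)) = \<bar>r + v\<bar>" by (simp add: n(1))
        hence "fk (y + (st * m1) *\<^sub>R u) + hk (y' + (st * m1) *\<^sub>R reflect n u) <= Oc + c (r + v)"
          using ad[of "(st * m1) *\<^sub>R u" "(st * m1) *\<^sub>R reflect n u"] unfolding c_def by (simp add: tcost_even[OF cp])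
        also have "c (r + v) <= c r + sl * (r * v / rho + v^2 * kap^2 / rho ^ 3) - cv * (r^2 / rho^2) * v^2 + tr * \<bar>v\<bar> ^ 3"
          unfolding c_def sl_def cv_def tr_def by (rule tcost_taylor[OF cp _ _ rho]) (use V vV in auto)
        also have "tr * \<bar>v\<bar> ^ 3 <= tr * V ^ 3" using vV tr0 by (intro mult_left_mono power_mono) auto
        finally show "fk (y + (st * m1) *\<^sub>R u) + hk (y' + (st * m1) *\<^sub>R reflect n u)
         <= Oc + c r + sl * (r * V / rho) * (n \<bullet> u) + (sl * kap^2 / rho ^ 3 - cv * (r^2 / rho^2)) * V^2 * (n \<bullet> u)\<^sup>2 + tr * V ^ 3"
          unfolding v_def by (simp add: algebra_simps power_mult_distrib)
      qed
      show "integrable N (%u. Oc + c r + sl * (r * V / rho) * (n \<bullet> u) + (sl * kap^2 / rho ^ 3 - cv * (r^2 / rho^2)) * V^2 * (n \<bullet> u)\<^sup>2 + tr * V ^ 3)"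
        using N_lin_integrable by auto
    qed
    also have "... = Oc + c r + (sl * kap^2 / rho ^ 3 - cv * (r^2 / rho^2)) * V^2 * v0 + tr * V ^ 3"
      using N_lin_integrable N_mean[of n] N_var[OF n(1)] by (simp add: prob_space)
    also have "(sl * kap^2 / rho ^ 3 - cv * (r^2 / rho^2)) * V^2 * v0 = GN"
    proof -
      \<comment> \<open>The two positions move apart by twice the normal part of the noise, hence
        the factor 4. Together with the 3 in \<open>m1\<close> it gives 12, and the weight 1/3 of
        this move reduces it to the 4 in \<open>Y\<close>.\<close>
      have "V^2 * v0 = 4 * st^2 * (m1^2 * v0)" by (simp add: V_def power_mult_distrib)
      hence Vv: "V^2 * v0 = 12 * st^2 * lam" unfolding m10(2) by simp
      show ?thesis unfolding mult.assoc Vv using True by (simp add: GN_def algebra_simps)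
    qed
    also have "tr * V ^ 3 = tr * (8 * m1 ^ 3) * st ^ 3" by (simp add: V_def power_mult_distrib mult_ac)
    finally show ?thesis .
  qed
  have "dif eps st x k fk y + dif eps st z k hk y'
     <= Oc + c r + st^2 * Y + (sl * 3 / (2 * kap) * B^2 + tr * (8 * m1 ^ 3)) * st ^ 3"
  proof -
    define a1 where "a1 = fk (y + (3 * st^2) *\<^sub>R btilde eps x k) + hk (y' + (3 * st^2) *\<^sub>R btilde eps z k)"
    define a2 where "a2 = (\<Sum>j\<in>UNIV. fk (y + (st * s1) *\<^sub>R \<sigma> x k $ j) + fk (y - (st * s1) *\<^sub>R \<sigma> x k $ j)) / (2 * real CARD('d))
      + (\<Sum>j\<in>UNIV. hk (y' + (st * s1) *\<^sub>R \<sigma> z k $ j) + hk (y' - (st * s1) *\<^sub>R \<sigma> z k $ j)) / (2 * real CARD('d))"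
    define a3 where "a3 = (LINT u|N. fk (y + (st * m1) *\<^sub>R u)) + (LINT u|N. hk (y' + (st * m1) *\<^sub>R u))"
    have eq: "dif eps st x k fk y + dif eps st z k hk y' = (a1 + a2 + a3) / 3"
      unfolding dif_def a1_def a2_def a3_def by (simp add: add_divide_distrib)
    define u1 where "u1 = sl / (2 * rho) * (2 * (D \<bullet> bt))"
    define u2 where "u2 = sl / (2 * rho) * (norm (\<sigma> x k - \<sigma> z k))\<^sup>2"
    define w where "w = st^2"
    define sY where "sY = w * Y"
    define w1 where "w1 = w * u1"
    define w2 where "w2 = w * u2"
    have YY: "3 * sY = 3 * w1 + 3 * w2 + GN"
      unfolding sY_def w1_def w2_def u1_def u2_def w_def Y GN_def sl_def cv_def by (simp add: algebra_simps)
    define t1 where "t1 = (sl * 3 / (2 * kap) * B^2) * st ^ 3"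
    define t2 where "t2 = tr * (8 * m1 ^ 3) * st ^ 3"
    have t2: "t2 >= 0" unfolding t2_def using tr0 m10 st by simp
    have "a1 <= Oc + c r + 3 * w1 + 3 * t1"
      using A1 unfolding a1_def t1_def w1_def u1_def w_def by (simp add: mult.assoc)
    moreover have "a2 <= Oc + c r + 3 * w2" using A2 unfolding a2_def w2_def u2_def w_def by (simp add: mult.assoc)
    moreover have "a3 <= Oc + c r + GN + t2" using A3 unfolding a3_def t2_def .
    ultimately have "a1 + a2 + a3 <= 3 * (Oc + c r) + 3 * sY + 3 * t1 + 3 * t2" using t2 YY by argo
    hence "(a1 + a2 + a3) / 3 <= Oc + c r + sY + (t1 + t2)" by argo
    hence "(a1 + a2 + a3) / 3 <= Oc + c r + st^2 * Y + (t1 + t2)" by (simp add: sY_def w_def)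
    thus ?thesis unfolding eq t1_def t2_def by (simp add: distrib_right)
  qed
  thus ?thesis unfolding fk_def hk_def c_def sl_def tr_def .
qed

text \<open>Jumps of length at least \<open>eps\<close> are coupled through their densities over a
  common measure. An unmatched jump \<open>u\<close> costs at most the slope times
  \<open>norm u\<close>, which is why the total variation is weighted with \<open>norm\<close>. The
  second bound controls the difference of the compensators in \<open>btilde\<close> by the same
  quantity.\<close>

lemma jmp_coupled:
  assumes k: "k : Sset n0" and e: "0 < eps" "eps <= 1" and r: "r = norm (y - y')"
    and tv: "tv_int (\<nu> x k) (\<nu> z k) norm <= ennreal th" "th >= 0" and L: "2 * (CN / eps^2) <= L"
  shows "jmp eps L x k (%y. f (y, k)) y + jmp eps L z k (%y. h (y, k)) y' <= L * (Oc + tcost \<delta> kap p \<alpha> \<beta> r) + tslope \<delta> kap p \<alpha> \<beta> r * th"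
    "D \<bullet> (btilde eps x k - btilde eps z k) <= D \<bullet> (b x k - b z k) + norm D * th"
proof -
  note cp = \<delta> kap p \<alpha> \<beta>
  obtain l p1 p2 where l: "sets l = sets borel" and pm[measurable]: "p1 : borel_measurable borel" "p2 : borel_measurable borel"
    and pn: "!!u. 0 <= p1 u" "!!u. 0 <= p2 u" and dens: "\<nu> x k = density l p1" "\<nu> z k = density l p2"
    and I: "integrable l (%u. norm u * \<bar>p1 u - p2 u\<bar>)" "(LINT u|l. norm u * \<bar>p1 u - p2 u\<bar>) <= th"
    by (rule tv_int_densities[OF nu_sets[OF k] nu_sets[OF k] nu_sf[OF k] nu_sf[OF k] tv]) blast
  have lm: "g : borel_measurable borel ==> g : borel_measurable l" for g :: "real^'d => 'b::topological_space"
    using measurable_cong_sets[OF l refl] by blast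
  define fk where "fk = (%y. f (y, k))"
  define hk where "hk = (%y. h (y, k))"
  have [measurable]: "fk : borel_measurable borel" "hk : borel_measurable borel" unfolding fk_def hk_def using fm hm k by auto
  have fb: "\<bar>fk u\<bar> <= 1" and hb: "\<bar>hk u\<bar> <= 1" for u
    using f0[of "(u, k)"] f1[of "(u, k)"] h0[of "(u, k)"] h1[of "(u, k)"] by (simp_all add: fk_def hk_def)
  have tr1: "integrable l (%u. p1 u *\<^sub>R g u)" "(LINT u|(\<nu> x k). g u) = (LINT u|l. p1 u *\<^sub>R g u)"
    if "integrable (\<nu> x k) g" "g : borel_measurable borel" for g :: "real^'d => 'b::{banach, second_countable_topology}"
    using that unfolding dens by (simp_all add: integrable_density integral_density lm pn)
  have tr2: "integrable l (%u. p2 u *\<^sub>R g u)" "(LINT u|(\<nu> z k). g u) = (LINT u|l. p2 u *\<^sub>R g u)"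
    if "integrable (\<nu> z k) g" "g : borel_measurable borel" for g :: "real^'d => 'b::{banach, second_countable_topology}"
    using that unfolding dens by (simp_all add: integrable_density integral_density lm pn)
  define w1 where "w1 u = indicator (far eps) u * p1 u" for u
  define w2 where "w2 u = indicator (far eps) u * p2 u" for u
  have fint: "integrable (\<nu> x' k) (%u. g u * indicator (far eps) u)" if "g : borel_measurable borel" "!!u. \<bar>g u\<bar> <= 1" for g :: "real^'d => real" and x'
    by (rule far_integrable[OF k e, where C=1]) (use that in \<open>auto simp: indicator_def\<close>)
  have g1: "integrable l (%u. g u * w1 u)" "(LINT u|(\<nu> x k). g u * indicator (far eps) u) = (LINT u|l. g u * w1 u)"
    if g: "g : borel_measurable borel" "!!u. \<bar>g u\<bar> <= 1" for g :: "real^'d => real"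
    using tr1[OF fint[OF g, of x]] g(1) by (simp_all add: w1_def mult_ac)
  have g2: "integrable l (%u. g u * w2 u)" "(LINT u|(\<nu> z k). g u * indicator (far eps) u) = (LINT u|l. g u * w2 u)"
    if g: "g : borel_measurable borel" "!!u. \<bar>g u\<bar> <= 1" for g :: "real^'d => real"
    using tr2[OF fint[OF g, of z]] g(1) by (simp_all add: w2_def mult_ac)
  have iw: "integrable l w1" "integrable l w2" using g1(1)[of "%_. 1"] g2(1)[of "%_. 1"] by simp_all
  have mw: "measure (\<nu> x k) (far eps) = (LINT u|l. w1 u)" "measure (\<nu> z k) (far eps) = (LINT u|l. w2 u)"
    using g1(2)[of "%_. 1"] g2(2)[of "%_. 1"] by (simp_all add: nu_space[OF k])
  define c where "c = tcost \<delta> kap p \<alpha> \<beta>"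
  define sl where "sl = tslope \<delta> kap p \<alpha> \<beta> r"
  have sl0: "sl >= 0" unfolding sl_def by (rule tslope_bounds[OF cp])
  have ad: "fk (y + v) + hk (y' + v') <= Oc + c (norm ((y - y') + (v - v')))" for v v'
    using adm[OF k, of "y + v" "y' + v'"] unfolding fk_def hk_def c_def by (simp add: algebra_simps)
  have lip: "c (norm ((y - y') + u)) <= c r + sl * norm u" for u
    unfolding c_def sl_def r by (rule tcost_lipschitz[OF cp])
  have iG: "integrable l (%u. sl * norm u * \<bar>w1 u - w2 u\<bar>)" and IG: "(LINT u|l. sl * norm u * \<bar>w1 u - w2 u\<bar>) <= sl * th"
  proof -
    have le: "sl * norm u * \<bar>w1 u - w2 u\<bar> <= sl * (norm u * \<bar>p1 u - p2 u\<bar>)" for u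
      using sl0 by (auto simp: w1_def w2_def indicator_def)
    have m: "(%u. sl * norm u * \<bar>w1 u - w2 u\<bar>) : borel_measurable l" unfolding w1_def w2_def by (rule lm) measurable
    show iG: "integrable l (%u. sl * norm u * \<bar>w1 u - w2 u\<bar>)"
      by (rule Bochner_Integration.integrable_bound[OF integrable_mult_right[OF I(1), of sl] m])
         (use le sl0 in \<open>auto simp: abs_mult\<close>)
    have "(LINT u|l. sl * norm u * \<bar>w1 u - w2 u\<bar>) <= (LINT u|l. sl * (norm u * \<bar>p1 u - p2 u\<bar>))"
      using iG I(1) le by (intro integral_mono) auto
    also have "... <= sl * th" using I(2) sl0 by (simp add: mult_left_mono)
    finally show "(LINT u|l. sl * norm u * \<bar>w1 u - w2 u\<bar>) <= sl * th" .
  qed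
  have "(LINT u|l. fk (y + u) * w1 u) + (L - (LINT u|l. w1 u)) * fk y + ((LINT u|l. hk (y' + u) * w2 u) + (L - (LINT u|l. w2 u)) * hk y')
     <= L * (Oc + c r) + (LINT u|l. sl * norm u * \<bar>w1 u - w2 u\<bar>)"
  proof (rule coupled_jump_bound[OF iw _ _ iG])
    show "integrable l (%u. fk (y + u) * w1 u)" by (rule g1(1)) (use fb in auto)
    show "integrable l (%u. hk (y' + u) * w2 u)" by (rule g2(1)) (use hb in auto)
    show "fk (y + u) + hk (y' + u) <= Oc + c r" for u using ad[of u u] by (simp add: r)
    show "fk (y + u) + hk y' <= Oc + c r + sl * norm u" for u using ad[of u 0] lip[of u] by simp
    show "fk y + hk (y' + u) <= Oc + c r + sl * norm u" for u using ad[of 0 u] lip[of "- u"] by simp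
    show "fk y + hk y' <= Oc + c r" using ad[of 0 0] by (simp add: r)
    show "(LINT u|l. w1 u) + (LINT u|l. w2 u) <= L"
      using far_measure(2)[OF k e, of x] far_measure(2)[OF k e, of z] L unfolding mw by linarith
  qed (auto simp: w1_def w2_def pn)
  moreover have "(LINT u|(\<nu> x k). fk (y + u) * indicator (far eps) u) = (LINT u|l. fk (y + u) * w1 u)"
    by (rule g1(2)) (use fb in auto)
  moreover have "(LINT u|(\<nu> z k). hk (y' + u) * indicator (far eps) u) = (LINT u|l. hk (y' + u) * w2 u)"
    by (rule g2(2)) (use hb in auto)
  ultimately have "jmp eps L x k fk y + jmp eps L z k hk y' <= L * (Oc + c r) + sl * th"
    unfolding jmp_def mw using IG by linarith
  thus "jmp eps L x k (%y. f (y, k)) y + jmp eps L z k (%y. h (y, k)) y' <= L * (Oc + tcost \<delta> kap p \<alpha> \<beta> r) + tslope \<delta> kap p \<alpha> \<beta> r * th"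
    unfolding fk_def hk_def c_def sl_def .
  define E where "E = far eps \<inter> ball 0 eps0"
  have E[measurable]: "E : sets borel" by (auto simp: E_def)
  have vint: "integrable (\<nu> x' k) (%u. indicator E u *\<^sub>R u)" for x'
    by (rule far_integrable[OF k e, where C=eps0]) (use eps0 in \<open>auto simp: indicator_def E_def\<close>)
  have vm: "(%u. indicator E u *\<^sub>R u :: real^'d) : borel_measurable borel" by measurable
  note v1 = tr1[OF vint vm] and v2 = tr2[OF vint vm]
  have "D \<bullet> ((LINT u|(\<nu> z k). indicator E u *\<^sub>R u) - (LINT u|(\<nu> x k). indicator E u *\<^sub>R u))
     = (LINT u|l. D \<bullet> (p2 u *\<^sub>R (indicator E u *\<^sub>R u) - p1 u *\<^sub>R (indicator E u *\<^sub>R u)))"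
    unfolding v1(2) v2(2) using v1(1) v2(1) by simp
  also have "... <= (LINT u|l. norm D * (norm u * \<bar>p1 u - p2 u\<bar>))"
  proof (rule integral_mono)
    show "integrable l (%u. D \<bullet> (p2 u *\<^sub>R (indicator E u *\<^sub>R u) - p1 u *\<^sub>R (indicator E u *\<^sub>R u)))" using v1(1) v2(1) by simp
    show "integrable l (%u. norm D * (norm u * \<bar>p1 u - p2 u\<bar>))" using I(1) by simp
    show "D \<bullet> (p2 u *\<^sub>R (indicator E u *\<^sub>R u) - p1 u *\<^sub>R (indicator E u *\<^sub>R u)) <= norm D * (norm u * \<bar>p1 u - p2 u\<bar>)" for u
    proof -
      have "D \<bullet> (p2 u *\<^sub>R (indicator E u *\<^sub>R u) - p1 u *\<^sub>R (indicator E u *\<^sub>R u)) = D \<bullet> (((p2 u - p1 u) * indicator E u) *\<^sub>R u)"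
        by (simp add: algebra_simps)
      also have "... <= norm D * norm (((p2 u - p1 u) * indicator E u) *\<^sub>R u)" by (rule norm_cauchy_schwarz)
      also have "... <= norm D * (norm u * \<bar>p1 u - p2 u\<bar>)"
        by (intro mult_left_mono) (auto simp: indicator_def abs_minus_commute mult.commute)
      finally show ?thesis .
    qed
  qed
  also have "... <= norm D * th" using I(2) by (simp add: mult_left_mono)
  finally have "D \<bullet> ((LINT u|(\<nu> z k). indicator E u *\<^sub>R u) - (LINT u|(\<nu> x k). indicator E u *\<^sub>R u)) <= norm D * th" .
  thus "D \<bullet> (btilde eps x k - btilde eps z k) <= D \<bullet> (b x k - b z k) + norm D * th"
    unfolding btilde_def E_def[symmetric] by (simp add: algebra_simps)
qed

text \<open>A switch that only one side performs raises the cost to at most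
  \<open>\<alpha> + \<beta>\<close>, and the rate of such switches is controlled by the Lipschitz
  condition on \<open>q\<close>.\<close>

lemma swi_coupled:
  assumes k: "k : Sset n0" and r: "r = norm (y - y')" and L: "2 * (real n0 * CQ) <= L"
  shows "swi L x k (%l. f (y, l)) + swi L z k (%l. h (y', l)) <= L * (Oc + tcost \<delta> kap p \<alpha> \<beta> r)
     + (\<alpha> + \<beta> - tcost \<delta> kap p \<alpha> \<beta> r) * (real n0 * HQ * norm (x - z))"
proof -
  note cp = \<delta> kap p \<alpha> \<beta>
  define c where "c = tcost \<delta> kap p \<alpha> \<beta> r"
  have c: "c <= \<alpha> + \<beta>" unfolding c_def by (rule tcost_bounds[OF cp])
  have card: "real (card (Sset n0 - {k})) <= real n0" using k by (auto simp: Sset_def)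
  have Qs: "(\<Sum>l\<in>Sset n0 - {k}. q x' k l) <= real n0 * CQ" for x'
  proof -
    have "(\<Sum>l\<in>Sset n0 - {k}. q x' k l) <= (\<Sum>l\<in>Sset n0 - {k}. CQ)" using q_le[OF k] by (intro sum_mono) auto
    also have "... <= real n0 * CQ" using CQ card by (simp add: mult_right_mono)
    finally show ?thesis .
  qed
  have "(\<Sum>l\<in>Sset n0 - {k}. f (y, l) * q x k l) + (L - (\<Sum>l\<in>Sset n0 - {k}. q x k l)) * f (y, k)
     + ((\<Sum>l\<in>Sset n0 - {k}. h (y', l) * q z k l) + (L - (\<Sum>l\<in>Sset n0 - {k}. q z k l)) * h (y', k))
     <= L * (Oc + c) + (\<alpha> + \<beta> - c) * (\<Sum>l\<in>Sset n0 - {k}. \<bar>q x k l - q z k l\<bar>)"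
  proof (rule coupled_jump_bound_sum)
    show "f (y, l) + h (y', l) <= Oc + c" if "l : Sset n0 - {k}" for l using adm[of l y y'] that by (simp add: c_def r)
    show "f (y, k) + h (y', k) <= Oc + c" using adm[OF k, of y y'] by (simp add: c_def r)
    show "f (y, l) + h (y', k) <= Oc + c + (\<alpha> + \<beta> - c)" if "l : Sset n0 - {k}" for l using adm2[of l k y y'] that k by simp
    show "f (y, k) + h (y', l) <= Oc + c + (\<alpha> + \<beta> - c)" if "l : Sset n0 - {k}" for l using adm2[of k l y y'] that k by simp
    show "(\<Sum>l\<in>Sset n0 - {k}. q x k l) + (\<Sum>l\<in>Sset n0 - {k}. q z k l) <= L" using Qs[of x] Qs[of z] L by linarith
  qed (use q_nonneg[OF k] in \<open>auto simp: Sset_def\<close>)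
  also have "... <= L * (Oc + c) + (\<alpha> + \<beta> - c) * (real n0 * HQ * norm (x - z))"
  proof (intro add_left_mono mult_left_mono)
    have "(\<Sum>l\<in>Sset n0 - {k}. \<bar>q x k l - q z k l\<bar>) <= (\<Sum>l\<in>Sset n0 - {k}. HQ * norm (x - z))"
      using q_lip[OF k] by (intro sum_mono) auto
    also have "... <= real n0 * (HQ * norm (x - z))" using HQ card by (simp add: mult_right_mono)
    finally show "(\<Sum>l\<in>Sset n0 - {k}. \<bar>q x k l - q z k l\<bar>) <= real n0 * HQ * norm (x - z)" by (simp add: mult.assoc)
  qed (use c in simp)
  finally show ?thesis unfolding swi_def c_def .
qed

text \<open>\<open>x\<close> and \<open>z\<close> are the points where the coefficients are frozen,
  \<open>y\<close> and \<open>y'\<close> the positions on which the chain acts, up to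
  \<open>\<eta>\<close> away because of the mollification. \<open>W\<close> bounds the total weight,
  so that the cubic constant can be taken independent of time.\<close>

lemma Kop_coupled:
  assumes k: "k : Sset n0" and e: "0 < eps" "eps <= 1" and r: "r = norm (y - y')" and rho: "rho = sqrt (r^2 + kap^2)" and r\<delta>: "r <= \<delta>"
    and Bt: "norm (btilde eps x k - btilde eps z k) <= B" "norm (\<sigma> x k - \<sigma> z k) <= B" "norm (b x k - b z k) <= B'"
    and st: "0 < st" "2 * (st * m1) <= kap / 2" "4 * (st * m1) <= \<delta>" "st <= 1" "2 * st^2 * L <= 1"
    and refl: "reflecting ==> r > 0"
    and dis: "2 * ((x - z) \<bullet> (b x k - b z k)) + (norm (\<sigma> x k - \<sigma> z k))\<^sup>2 <= th * norm (x - z)"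
    and tv: "tv_int (\<nu> x k) (\<nu> z k) norm <= ennreal th" and th: "th >= 0"
    and L: "2 * (CN / eps^2) <= L" "2 * (real n0 * CQ) <= L"
    and \<eta>: "norm (x - y) <= \<eta>" "norm (z - y') <= \<eta>" "\<eta> * (2 * th + 4 * B') <= th * kap"
    and W: "\<alpha> + \<beta> <= W"
  shows "Kop eps L st f x k y + Kop eps L st h z k y' <= Oc + tcost \<delta> kap p \<alpha> \<beta> r
     + st^2 * (3 * th * tslope \<delta> kap p \<alpha> \<beta> r + (\<alpha> + \<beta> - tcost \<delta> kap p \<alpha> \<beta> r) * (real n0 * HQ * (r + 2 * \<eta>))
        + (if reflecting then 4 * lam * tslope \<delta> kap p \<alpha> \<beta> r * kap^2 / rho ^ 3 - 4 * lam * tcurv \<delta> kap p \<alpha> \<beta> r * (r^2 / rho^2) else 0))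
     + ((W * real p / \<delta>) * 3 / (2 * kap) * B^2 + W * (trem \<delta> kap p + trem \<delta> kap 4) * (8 * m1 ^ 3)
        + 2 * L * ((W * real p / \<delta>) / (2 * kap) * (2 * (\<delta> * B) + B^2) + 4 * lam * (W * real p / \<delta>) / kap + 4 * lam * (W * (real p)\<^sup>2 / \<delta>^2))) * st ^ 3"
proof -
  note cp = \<delta> kap p \<alpha> \<beta>
  define D where "D = y - y'"
  define bt where "bt = btilde eps x k - btilde eps z k"
  define c where "c = tcost \<delta> kap p \<alpha> \<beta> r"
  define sl where "sl = tslope \<delta> kap p \<alpha> \<beta> r"
  define cv where "cv = tcurv \<delta> kap p \<alpha> \<beta> r"
  define tr where "tr = \<alpha> * trem \<delta> kap p + \<beta> * trem \<delta> kap 4"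
  define S2 where "S2 = (norm (\<sigma> x k - \<sigma> z k))\<^sup>2"
  have rD: "r = norm D" by (simp add: r D_def)
  have W0: "W >= 0" using W \<alpha> \<beta> by simp
  have r0: "r >= 0" by (simp add: r)
  have B0: "B >= 0" using Bt(1) norm_ge_zero order_trans by blast
  have rp: "rho > 0" "rho >= kap" "rho >= r" unfolding rho using kap r0 by (auto simp: add_nonneg_pos intro!: real_le_rsqrt)
  have sl: "0 <= sl" "sl <= W * real p / \<delta>"
    using tslope_bounds[OF cp, of r] W \<delta> unfolding sl_def by (auto intro!: order_trans[OF tslope_bounds(2)[OF cp]] divide_right_mono mult_right_mono)
  have cv: "0 <= cv" "cv <= W * (real p)\<^sup>2 / \<delta>^2"
    using tcurv_bounds[OF cp, of r] W \<delta> unfolding cv_def by (auto intro!: order_trans[OF tcurv_bounds(2)[OF cp]] divide_right_mono mult_right_mono)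
  have m10: "m1 >= 0" using lam v0 by (simp add: m1_def)
  have L0: "L >= 0" using L(2) CQ by (meson mult_nonneg_nonneg of_nat_0_le_iff order_trans zero_le_numeral)
  have trp: "0 <= trem \<delta> kap n" for n unfolding trem_def using \<delta> kap by simp
  have tr: "tr <= W * (trem \<delta> kap p + trem \<delta> kap 4)"
  proof -
    have "\<alpha> * trem \<delta> kap p <= W * trem \<delta> kap p" "\<beta> * trem \<delta> kap 4 <= W * trem \<delta> kap 4"
      using W \<alpha> \<beta> trp by (auto intro!: mult_right_mono)
    thus ?thesis unfolding tr_def distrib_left by linarith
  qed
  define E where "E = (if reflecting then 4 * lam * sl * kap^2 / rho ^ 3 - 4 * lam * cv * (r^2 / rho^2) else 0)"
  define Y where "Y = sl / (2 * rho) * (2 * (D \<bullet> bt) + S2) + E"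
  define Kd where "Kd = sl * 3 / (2 * kap) * B^2 + tr * (8 * m1 ^ 3)"
  have d: "dif eps st x k (%y. f (y, k)) y + dif eps st z k (%y. h (y, k)) y' <= Oc + c + st^2 * Y + Kd * st ^ 3"
    unfolding c_def Kd_def sl_def tr_def
    by (rule dif_coupled[where D=D and bt=bt and reflecting=reflecting, OF k D_def rD rho bt_def])
       (use Bt st refl rD in \<open>auto simp: bt_def Y_def E_def sl_def cv_def S2_def\<close>)
  note j = jmp_coupled[OF k e r tv th L(1)]
  note s = swi_coupled[OF k r L(2), of x z]
  have kr: "kap^2 / rho ^ 3 <= 1 / kap"
  proof -
    have "kap^2 * kap <= rho^2 * rho" using rp kap by (intro mult_mono power_mono) auto
    thus ?thesis using rp kap by (simp add: field_simps power2_eq_square power3_eq_cube)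
  qed
  have q1: "0 <= r^2 / rho^2" "r^2 / rho^2 <= 1" using rp r0 by (auto simp: power_mono)
  define Ym where "Ym = (W * real p / \<delta>) / (2 * kap) * (2 * (\<delta> * B) + B^2) + 4 * lam * (W * real p / \<delta>) / kap + 4 * lam * (W * (real p)\<^sup>2 / \<delta>^2)"
  have Yb: "- Y <= Ym"
  proof -
    have "\<bar>D \<bullet> bt\<bar> <= norm D * norm bt" by (rule Cauchy_Schwarz_ineq2)
    also have "... <= \<delta> * B" using Bt(1) r\<delta> \<delta> unfolding rD[symmetric] bt_def by (intro mult_mono) auto
    finally have "\<bar>D \<bullet> bt\<bar> <= \<delta> * B" .
    hence i: "- (2 * (D \<bullet> bt) + S2) <= 2 * (\<delta> * B) + B^2" unfolding S2_def using zero_le_power2[of B] zero_le_power2[of "norm (\<sigma> x k - \<sigma> z k)"] by linarith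
    have "sl / (2 * rho) * - (2 * (D \<bullet> bt) + S2) <= (W * real p / \<delta>) / (2 * kap) * (2 * (\<delta> * B) + B^2)"
    proof (cases "0 <= - (2 * (D \<bullet> bt) + S2)")
      case True
      show ?thesis using sl rp kap i True W0 \<delta> by (intro mult_mono frac_le) auto
    next
      case False
      hence "sl / (2 * rho) * - (2 * (D \<bullet> bt) + S2) <= 0" using sl rp by (intro mult_nonneg_nonpos) auto
      also have "0 <= (W * real p / \<delta>) / (2 * kap) * (2 * (\<delta> * B) + B^2)" using W0 \<delta> kap B0 by simp
      finally show ?thesis .
    qed
    moreover have "- E <= 4 * lam * (W * real p / \<delta>) / kap + 4 * lam * (W * (real p)\<^sup>2 / \<delta>^2)"
    proof -
      have "cv * (r^2 / rho^2) <= (W * (real p)\<^sup>2 / \<delta>^2) * 1" using cv q1 by (intro mult_mono) auto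
      hence "4 * lam * (cv * (r^2 / rho^2)) <= 4 * lam * (W * (real p)\<^sup>2 / \<delta>^2)" using lam by (intro mult_left_mono) auto
      moreover have "0 <= 4 * lam * sl * kap^2 / rho ^ 3" using lam sl rp by simp
      moreover have "0 <= 4 * lam * (W * real p / \<delta>) / kap" "0 <= 4 * lam * (W * (real p)\<^sup>2 / \<delta>^2)" using lam W0 \<delta> kap by simp_all
      ultimately show ?thesis unfolding E_def by (simp add: mult.assoc)
    qed
    ultimately show ?thesis unfolding Y_def Ym_def by linarith
  qed
  have Y2: "Y <= 2 * th * sl + E"
  proof -
    have xz: "norm (D - (x - z)) <= 2 * \<eta>"
    proof -
      have "D - (x - z) = (y - x) - (y' - z)" by (simp add: D_def)
      hence "norm (D - (x - z)) <= norm (y - x) + norm (y' - z)" using norm_triangle_ineq4 by metis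
      thus ?thesis using \<eta>(1,2) by (simp add: norm_minus_commute)
    qed
    have xzr: "norm (x - z) <= r + 2 * \<eta>" using xz norm_triangle_ineq4[of D "D - (x - z)"] unfolding rD by simp
    have "D \<bullet> (b x k - b z k) = (x - z) \<bullet> (b x k - b z k) + (D - (x - z)) \<bullet> (b x k - b z k)" by (simp add: inner_diff_left)
    moreover have "(D - (x - z)) \<bullet> (b x k - b z k) <= 2 * \<eta> * B'"
    proof -
      have "0 <= 2 * \<eta>" using xz norm_ge_zero order_trans by blast
      hence "norm (D - (x - z)) * norm (b x k - b z k) <= 2 * \<eta> * B'" by (intro mult_mono xz Bt(3)) auto
      thus ?thesis using norm_cauchy_schwarz order_trans by blast
    qed
    ultimately have "2 * (D \<bullet> bt) + S2 <= th * norm (x - z) + 4 * \<eta> * B' + 2 * (r * th)"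
      using j(2)[of D] dis unfolding S2_def bt_def rD by linarith
    also have "th * norm (x - z) <= th * (r + 2 * \<eta>)" using xzr th by (intro mult_left_mono) auto
    finally have "2 * (D \<bullet> bt) + S2 <= 3 * (th * r) + \<eta> * (2 * th + 4 * B')" by (simp add: algebra_simps)
    \<comment> \<open>The mismatch between frozen points and positions is a multiple of
      \<open>\<eta>\<close>; it is absorbed because \<open>rho\<close> never falls below
      \<open>kap\<close>.\<close>
    also have "... <= 3 * (th * rho) + th * rho" using \<eta>(3) rp th mult_left_mono[OF rp(3) th] mult_left_mono[OF rp(2) th] by linarith
    finally have "2 * (D \<bullet> bt) + S2 <= 4 * (th * rho)" by linarith
    hence "sl / (2 * rho) * (2 * (D \<bullet> bt) + S2) <= sl / (2 * rho) * (4 * (th * rho))" using sl rp by (intro mult_left_mono) auto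
    also have "... = 2 * th * sl" using rp by simp
    finally show ?thesis unfolding Y_def by simp
  qed
  have xzr: "norm (x - z) <= r + 2 * \<eta>"
  proof -
    have "x - z = (x - y) - (z - y') + D" by (simp add: D_def)
    hence "norm (x - z) <= norm ((x - y) - (z - y')) + norm D" using norm_triangle_ineq by metis
    thus ?thesis using norm_triangle_ineq4[of "x - y" "z - y'"] \<eta>(1,2) unfolding rD by linarith
  qed
  define Q where "Q = (\<alpha> + \<beta> - c) * (real n0 * HQ * (r + 2 * \<eta>))"
  have cb: "c <= \<alpha> + \<beta>" unfolding c_def by (rule tcost_bounds[OF cp])
  have s': "swi L x k (%l. f (y, l)) + swi L z k (%l. h (y', l)) <= L * (Oc + c) + Q"
  proof -
    have "(\<alpha> + \<beta> - c) * (real n0 * HQ * norm (x - z)) <= Q" unfolding Q_def using cb HQ xzr by (intro mult_left_mono) auto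
    thus ?thesis using s unfolding c_def by linarith
  qed
  have j': "jmp eps L x k (%y. f (y, k)) y + jmp eps L z k (%y. h (y, k)) y' <= L * (Oc + c) + sl * th"
    using j(1) unfolding c_def sl_def .
  have Kd0: "Kd >= 0" unfolding Kd_def tr_def using sl kap \<alpha> \<beta> trp m10 by simp
  have "Kop eps L st f x k y + Kop eps L st h z k y'
     = (1 - 2 * st^2 * L) * (dif eps st x k (%y. f (y, k)) y + dif eps st z k (%y. h (y, k)) y')
      + st^2 * ((jmp eps L x k (%y. f (y, k)) y + jmp eps L z k (%y. h (y, k)) y') + (swi L x k (%l. f (y, l)) + swi L z k (%l. h (y', l))))"
    unfolding Kop_def by (simp add: algebra_simps)
  also have "... <= (1 - 2 * st^2 * L) * (Oc + c + st^2 * Y + Kd * st ^ 3) + st^2 * ((L * (Oc + c) + sl * th) + (L * (Oc + c) + Q))"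
    using st(5) by (intro add_mono[OF mult_left_mono[OF d] mult_left_mono[OF add_mono[OF j' s']]]) auto
  also have "... = Oc + c + st^2 * (Y + sl * th + Q) + (Kd * st ^ 3 + 2 * st^2 * L * (st^2 * - Y)) - 2 * st^2 * L * (Kd * st ^ 3)"
    by (simp add: algebra_simps)
  also have "... <= Oc + c + st^2 * (2 * th * sl + E + sl * th + Q) + (Kd * st ^ 3 + 2 * L * Ym * st ^ 3) - 0"
  proof -
    have A: "st^2 * (Y + sl * th + Q) <= st^2 * (2 * th * sl + E + sl * th + Q)"
      by (intro mult_left_mono[OF add_right_mono[OF add_right_mono[OF Y2]]]) simp
    have "0 <= Ym" unfolding Ym_def using W0 \<delta> kap B0 lam by simp
    have "st ^ 4 <= st ^ 3" using st by (intro power_decreasing) auto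
    have "2 * st^2 * L * (st^2 * - Y) <= 2 * st^2 * L * (st^2 * Ym)" using Yb L0 by (intro mult_left_mono) auto
    also have "... = 2 * L * Ym * st ^ 4" by (simp add: power2_eq_square power4_eq_xxxx mult_ac)
    also have "... <= 2 * L * Ym * st ^ 3" using \<open>0 <= Ym\<close> L0 \<open>st ^ 4 <= st ^ 3\<close> by (intro mult_left_mono) auto
    finally have B: "2 * st^2 * L * (st^2 * - Y) <= 2 * L * Ym * st ^ 3" .
    have C: "0 <= 2 * st^2 * L * (Kd * st ^ 3)" using L0 Kd0 st by simp
    show ?thesis by (rule diff_mono[OF add_mono[OF add_mono[OF order_refl A] add_mono[OF order_refl B]] C])
  qed
  \<comment> \<open>Of the three units of \<open>th\<close>, two come from drift and diffusion and
    one from the jumps.\<close>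
  also have "... = Oc + c + st^2 * (3 * th * sl + Q + E) + (Kd + 2 * L * Ym) * st ^ 3" by (simp add: algebra_simps)
  also have "... <= Oc + c + st^2 * (3 * th * sl + Q + E) + ((W * real p / \<delta>) * 3 / (2 * kap) * B^2 + W * (trem \<delta> kap p + trem \<delta> kap 4) * (8 * m1 ^ 3) + 2 * L * Ym) * st ^ 3"
  proof (intro add_left_mono mult_right_mono add_right_mono)
    have "sl * 3 / (2 * kap) * B^2 <= (W * real p / \<delta>) * 3 / (2 * kap) * B^2" using sl kap by (intro mult_right_mono divide_right_mono) auto
    moreover have "tr * (8 * m1 ^ 3) <= W * (trem \<delta> kap p + trem \<delta> kap 4) * (8 * m1 ^ 3)" using tr m10 by (intro mult_right_mono) auto
    ultimately show "Kd <= (W * real p / \<delta>) * 3 / (2 * kap) * B^2 + W * (trem \<delta> kap p + trem \<delta> kap 4) * (8 * m1 ^ 3)" unfolding Kd_def by linarith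
  qed (use st in simp)
  finally show ?thesis unfolding c_def sl_def cv_def Q_def E_def Ym_def .
qed

end

end

text \<open>Two ranges of distance are treated differently. Between \<open>kap1\<close> and
  \<open>\<delta>\<close> the noise is reflected and the modulus \<open>th\<close> suffices, because
  ellipticity beats it at scale \<open>\<delta>\<close>. Below \<open>kap1\<close> the noise is
  shared, and the modulus \<open>th1\<close> is small enough to let the cost grow at a rate of at
  most \<open>epsp / 2\<close>. \<open>\<eta>\<close> is the radius of the mollification,
  \<open>R\<close> that of the killing, and \<open>eps\<close> the truncation of the jumps.\<close>

locale coupling = switching a b \<nu> q n0 eps0 \<sigma> lam CN CQ HQ N v0
  for a :: "'d::finite coef_a" and b \<nu> q n0 eps0 \<sigma> lam CN CQ HQ N v0 +
  fixes T \<delta> kap kap1 M th th1 \<eta> R B epsp eps L :: real and p :: nat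
  assumes T: "T > 0" and \<delta>: "\<delta> > 0" and kap: "0 < kap" "kap <= kap1" and p: "p >= 4"
    and M: "M >= 3" "\<delta>^2 / (lam * T) <= M"
    and th: "th > 0" "4 * th + 2 * (real n0 * HQ) * \<delta>^2 <= lam / \<delta>"
    and SFb: "!!k x z. k : Sset n0 ==> norm (x - z) <= 2 * \<delta> ==>
       2 * ((x - z) \<bullet> (b x k - b z k)) + (norm (\<sigma> x k - \<sigma> z k))\<^sup>2 <= th * norm (x - z) \<and>
       tv_int (\<nu> x k) (\<nu> z k) norm <= ennreal th"
    and th1: "th1 > 0"
    and SFs: "!!k x z. k : Sset n0 ==> norm (x - z) <= 2 * kap1 ==>
       2 * ((x - z) \<bullet> (b x k - b z k)) + (norm (\<sigma> x k - \<sigma> z k))\<^sup>2 <= th1 * norm (x - z) \<and>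
       tv_int (\<nu> x k) (\<nu> z k) norm <= ennreal th1"
    and \<eta>: "0 < \<eta>" "2 * \<eta> <= \<delta>" "2 * \<eta> <= kap1" "\<eta> * (2 * th + 8 * B) <= th * kap" "\<eta> * (2 * th1 + 8 * B) <= th1 * kap"
    and kap1: "4 * lam * kap^2 <= th * kap1 ^ 3"
    and R: "0 <= R" and B: "!!x k. k : Sset n0 ==> norm x <= R ==> norm (b x k) <= B & norm (\<sigma> x k) <= B"
    and small: "3 * th1 * ((2 + 2 * M) * real p / \<delta>) + (2 + 2 * M) * (real n0 * HQ * (2 * kap1)) + 2 / T * (real p / \<delta> * (2 * kap1)) <= epsp / 2"
    and epsp: "epsp > 0"
    and eps: "0 < eps" "eps <= 1" "eps <= eps0" and L: "2 * (CN / eps^2) <= L" "2 * (real n0 * CQ) <= L"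
begin

text \<open>The final weight 2 makes up for the factor lost in \<open>capped_lower\<close>. The sum
  of the two weights decreases in time because \<open>M\<close> exceeds 2, so the cost across
  regimes decreases as well.\<close>

definition c\<alpha> :: "real => real" where "c\<alpha> t = 2 * t / T"
definition c\<beta> :: "real => real" where "c\<beta> t = (2 - t / T) * M"

text \<open>At time 0 only the cost of exponent 4 is charged, whose slope does not depend on \<open>p\<close>; at time \<open>T\<close> the cost
  of exponent \<open>p\<close> dominates the differences of functions with Lipschitz constant \<open>p / \<delta>\<close>.\<close>
definition cost :: "real => (real^'d) \<times> nat => (real^'d) \<times> nat => real" where
  "cost t z z' = (if snd z = snd z' then tcost \<delta> kap p (c\<alpha> t) (c\<beta> t) (norm (fst z - fst z')) else c\<alpha> t + c\<beta> t)"

lemma coef_bounds: assumes "0 <= t" "t <= T" shows "0 <= c\<alpha> t" "c\<alpha> t <= 2" "M <= c\<beta> t" "c\<beta> t <= 2 * M" "0 <= c\<beta> t" "c\<alpha> t + c\<beta> t <= 2 + 2 * M"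
proof -
  have q: "0 <= t / T" "t / T <= 1" using assms T by auto
  show "0 <= c\<alpha> t" using q by (simp add: c\<alpha>_def)
  show a: "c\<alpha> t <= 2" using q(2) by (simp add: c\<alpha>_def)
  have "1 * M <= (2 - t / T) * M" "(2 - t / T) * M <= 2 * M" using q M by (intro mult_right_mono; simp)+
  hence b: "M <= c\<beta> t" "c\<beta> t <= 2 * M" by (simp_all add: c\<beta>_def)
  show "M <= c\<beta> t" "c\<beta> t <= 2 * M" "0 <= c\<beta> t" "c\<alpha> t + c\<beta> t <= 2 + 2 * M" using a b M(1) by linarith+
qed

lemma capped_upper: "capped \<delta> p r <= real p / \<delta> * r"
  using capped_tangent[OF \<delta> p, of 0 r] by (simp add: capped_def)

text \<open>The time derivative of the cost plus the action of the coupled generator is at most 0.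
  For each exponent \<open>n\<close> the unfavourable terms are bounded by multiples of
  \<open>X\<close>, a bound for the slope; the curvature contributes \<open>X\<close> times
  \<open>lam * (n - 1) / \<delta>\<close>, and a surplus remains since \<open>n >= 4\<close>. The
  surplus of the exponent 4 part, weighted by \<open>M\<close>, covers the time derivative.\<close>

lemma reflect_numeric:
  assumes r: "kap1 <= r" and rho: "rho = sqrt (r^2 + kap^2)" "rho < \<delta>" and ab: "0 <= \<alpha>" "M <= \<beta>"
  shows "(2 * smooth_cost \<delta> kap p r - M * smooth_cost \<delta> kap 4 r) / T + (3 * th * tslope \<delta> kap p \<alpha> \<beta> r + (\<alpha> + \<beta> - tcost \<delta> kap p \<alpha> \<beta> r) * (real n0 * HQ * (r + 2 * \<eta>))
     + (4 * lam * tslope \<delta> kap p \<alpha> \<beta> r * kap^2 / rho ^ 3 - 4 * lam * tcurv \<delta> kap p \<alpha> \<beta> r * (r^2 / rho^2))) <= 0"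
proof -
  define U where "U = 1 - rho / \<delta>"
  have r0: "r > 0" using r kap by linarith
  have rp: "rho > 0" "r <= rho" "rho^2 = r^2 + kap^2" unfolding rho(1) using kap r0 by (auto simp: add_nonneg_pos intro!: real_le_rsqrt)
  have U12: "0 < U" "U <= 1" unfolding U_def using rho(2) \<delta> rp(1) by simp_all
  have U: "0 < U" "U <= 1" "max 0 (1 - sqrt (r^2 + kap^2) / \<delta>) = U"
    using U12 unfolding rho(1)[symmetric] U_def[symmetric] by simp_all
  define nh where "nh = real n0 * HQ"
  have nh: "nh >= 0" using HQ by (simp add: nh_def)
  have r2: "r + 2 * \<eta> <= 2 * \<delta>" using rp rho(2) \<eta>(2) by linarith
  have k3: "4 * lam * (kap^2 / rho ^ 3) <= th"
  proof -
    have "kap1 ^ 3 <= rho ^ 3" using r rp kap by (intro power_mono) auto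
    hence "th * kap1 ^ 3 <= th * rho ^ 3" using th by (intro mult_left_mono) auto
    hence "4 * lam * kap^2 <= th * rho ^ 3" using kap1 by linarith
    thus ?thesis using rp by (simp add: field_simps)
  qed
  \<comment> \<open>Beyond \<open>kap1\<close> the rounding costs at most half of the
    curvature.\<close>
  have half: "1/2 <= r^2 / rho^2"
  proof -
    have "kap^2 <= r^2" using r kap by (intro power_mono) auto
    hence "1/2 * rho^2 <= r^2" unfolding rp(3) by simp
    thus ?thesis using rp(1) by (subst pos_le_divide_eq) auto
  qed
  have each: "3 * th * slope \<delta> kap n r + (1 - smooth_cost \<delta> kap n r) * (nh * (r + 2 * \<eta>)) + (4 * lam * slope \<delta> kap n r * kap^2 / rho ^ 3 - 4 * lam * curv \<delta> kap n r * (r^2 / rho^2))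
     <= - (real n * U ^ (n - 2) * (2 * lam / \<delta>^2))" if n: "n >= 4" for n
  proof -
    define X where "X = real n / \<delta> * U ^ (n - 2)"
    have X0: "X >= 0" using \<delta> U by (simp add: X_def)
    have sl: "slope \<delta> kap n r <= X" "0 <= slope \<delta> kap n r"
    proof -
      have "U ^ (n - 1) <= U ^ (n - 2)" using U by (intro power_decreasing) auto
      thus "slope \<delta> kap n r <= X" unfolding slope_def U(3) X_def using \<delta> by (intro mult_left_mono) auto
      show "0 <= slope \<delta> kap n r" using \<delta> by (rule slope_nonneg)
    qed
    have t1: "3 * th * slope \<delta> kap n r <= 3 * th * X" using sl th by (intro mult_left_mono) auto
    have t2: "(1 - smooth_cost \<delta> kap n r) * (nh * (r + 2 * \<eta>)) <= X * (2 * nh * \<delta>^2)"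
    proof -
      have "1 - smooth_cost \<delta> kap n r = U ^ n" unfolding smooth_cost_def capped_def U(3) by simp
      moreover have "U ^ n <= U ^ (n - 2)" using U by (intro power_decreasing) auto
      moreover have "U ^ (n - 2) <= real n * U ^ (n - 2)" using U n by (simp add: mult_right_mono[of 1 "real n", simplified])
      ultimately have "1 - smooth_cost \<delta> kap n r <= X * \<delta>" unfolding X_def using \<delta> by simp
      moreover have "nh * (r + 2 * \<eta>) <= nh * (2 * \<delta>)" using r2 nh by (intro mult_left_mono) auto
      moreover have "0 <= 1 - smooth_cost \<delta> kap n r" using smooth_cost_bounds(2) by simp
      ultimately have "(1 - smooth_cost \<delta> kap n r) * (nh * (r + 2 * \<eta>)) <= X * \<delta> * (nh * (2 * \<delta>))"
        using nh r0 \<eta>(1) X0 \<delta> by (rule_tac mult_mono) auto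
      thus ?thesis by (simp add: power2_eq_square mult_ac)
    qed
    have t3: "4 * lam * slope \<delta> kap n r * kap^2 / rho ^ 3 <= th * X"
    proof -
      have "(4 * lam * (kap^2 / rho ^ 3)) * slope \<delta> kap n r <= th * X" using k3 sl th by (intro mult_mono) auto
      thus ?thesis by (simp add: mult_ac)
    qed
    have t4: "X * (lam * (real n - 1) / \<delta>) <= 4 * lam * curv \<delta> kap n r * (r^2 / rho^2)"
    proof -
      have nn: "real (n - 1) = real n - 1" using n by (simp add: of_nat_diff)
      have "4 * lam * curv \<delta> kap n r * (1/2) <= 4 * lam * curv \<delta> kap n r * (r^2 / rho^2)"
        using half lam curv_bounds(1)[OF \<delta>, of kap n r] by (intro mult_left_mono) auto
      moreover have "4 * lam * curv \<delta> kap n r * (1/2) = X * (lam * (real n - 1) / \<delta>)"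
        unfolding curv_def U(3) X_def nn using \<delta> by (simp add: power2_eq_square field_simps)
      ultimately show ?thesis by simp
    qed
    \<comment> \<open>Ellipticity enters here. Three units of \<open>th\<close> belong to drift,
      diffusion and jumps, the fourth to the rounding, and the last summand to the
      switching.\<close>
    have "X * (4 * th + 2 * nh * \<delta>^2) <= X * (lam / \<delta>)" using th(2) X0 unfolding nh_def by (intro mult_left_mono) auto
    moreover have "X * (lam / \<delta>) - X * (lam * (real n - 1) / \<delta>) <= - (X * (2 * lam / \<delta>))"
    proof -
      have "X * (lam / \<delta>) - X * (lam * (real n - 1) / \<delta>) = - (X * ((real n - 2) * lam / \<delta>))" using \<delta> by (simp add: field_simps)
      moreover have "2 * lam / \<delta> <= (real n - 2) * lam / \<delta>" using n lam \<delta> by (intro divide_right_mono mult_right_mono) auto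
      from mult_left_mono[OF this X0] have "X * (2 * lam / \<delta>) <= X * ((real n - 2) * lam / \<delta>)" .
      ultimately show ?thesis by linarith
    qed
    moreover have "X * (2 * lam / \<delta>) = real n * U ^ (n - 2) * (2 * lam / \<delta>^2)" unfolding X_def by (simp add: power2_eq_square)
    ultimately show ?thesis using t1 t2 t3 t4 by (simp add: algebra_simps)
  qed
  have tot: "3 * th * tslope \<delta> kap p \<alpha> \<beta> r + (\<alpha> + \<beta> - tcost \<delta> kap p \<alpha> \<beta> r) * (nh * (r + 2 * \<eta>))
     + (4 * lam * tslope \<delta> kap p \<alpha> \<beta> r * kap^2 / rho ^ 3 - 4 * lam * tcurv \<delta> kap p \<alpha> \<beta> r * (r^2 / rho^2)) <= - (M * (8 * U^2 * lam / \<delta>^2))"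
  proof -
    have b0: "\<beta> >= 0" using ab M by linarith
    define Z where "Z n = 3 * th * slope \<delta> kap n r + (1 - smooth_cost \<delta> kap n r) * (nh * (r + 2 * \<eta>)) + (4 * lam * slope \<delta> kap n r * kap^2 / rho ^ 3 - 4 * lam * curv \<delta> kap n r * (r^2 / rho^2))" for n
    have "3 * th * tslope \<delta> kap p \<alpha> \<beta> r + (\<alpha> + \<beta> - tcost \<delta> kap p \<alpha> \<beta> r) * (nh * (r + 2 * \<eta>))
     + (4 * lam * tslope \<delta> kap p \<alpha> \<beta> r * kap^2 / rho ^ 3 - 4 * lam * tcurv \<delta> kap p \<alpha> \<beta> r * (r^2 / rho^2)) = \<alpha> * Z p + \<beta> * Z 4"
      unfolding Z_def tslope_def tcost_def tcurv_def by (simp add: algebra_simps add_divide_distrib diff_divide_distrib)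
    moreover have "Z p <= 0" unfolding Z_def using U lam by (intro order_trans[OF each[OF p]]) auto
    hence "\<alpha> * Z p <= 0" using ab(1) by (simp add: mult_nonneg_nonpos)
    moreover have "Z 4 <= - (8 * U^2 * lam / \<delta>^2)" using each[of 4] unfolding Z_def by (simp add: mult_ac)
    hence "\<beta> * Z 4 <= \<beta> * - (8 * U^2 * lam / \<delta>^2)" using b0 by (intro mult_left_mono) auto
    moreover have "\<beta> * - (8 * U^2 * lam / \<delta>^2) <= M * - (8 * U^2 * lam / \<delta>^2)"
      using ab(2) lam by (intro mult_right_mono_neg) auto
    ultimately show ?thesis by simp
  qed
  have time: "(2 * smooth_cost \<delta> kap p r - M * smooth_cost \<delta> kap 4 r) / T <= M * (8 * U^2 * lam / \<delta>^2)"
  \<comment> \<open>Well inside the radius of saturation the surplus is of order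
    \<open>lam / \<delta>^2\<close>, and the choice of \<open>M\<close> makes it exceed
    \<open>2 / T\<close>. Near saturation the exponent 4 cost is at least 15/16, so that
    \<open>M >= 3\<close> makes the time derivative negative by itself.\<close>
  proof (cases "U >= 1/2")
    case True
    have "2 * smooth_cost \<delta> kap p r - M * smooth_cost \<delta> kap 4 r <= 2 * 1 - 0"
      using smooth_cost_bounds(2)[of \<delta> kap p r] smooth_cost_bounds(1)[OF \<delta>, of kap 4 r] M by (intro diff_mono mult_left_mono) auto
    hence "(2 * smooth_cost \<delta> kap p r - M * smooth_cost \<delta> kap 4 r) / T <= 2 / T" using T by (simp add: divide_right_mono)
    also have "2 / T <= M * (2 * lam / \<delta>^2)"
    proof -
      have "\<delta>^2 <= M * (lam * T)" using M(2) lam T by (simp add: pos_divide_le_eq)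
      thus ?thesis using T \<delta> lam by (simp add: field_simps)
    qed
    also have "... <= M * (8 * U^2 * lam / \<delta>^2)"
    proof -
      have "(1/2)\<^sup>2 <= U^2" using True by (intro power_mono) auto
      hence "2 * lam <= 8 * U^2 * lam" using lam by (simp add: power2_eq_square)
      thus ?thesis using M \<delta> by (intro mult_left_mono divide_right_mono) auto
    qed
    finally show ?thesis .
  next
    case False
    have "U ^ 4 <= (1/2) ^ 4" using False U by (intro power_mono) auto
    hence "15/16 <= smooth_cost \<delta> kap 4 r" unfolding smooth_cost_def capped_def U(3) by (simp add: power_divide)
    hence "3 * (15/16) <= M * smooth_cost \<delta> kap 4 r" using M by (intro mult_mono) auto
    hence "2 * smooth_cost \<delta> kap p r - M * smooth_cost \<delta> kap 4 r <= 0" using smooth_cost_bounds(2)[of \<delta> kap p r] by simp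
    hence "(2 * smooth_cost \<delta> kap p r - M * smooth_cost \<delta> kap 4 r) / T <= 0" using T by (simp add: divide_nonpos_pos)
    also have "0 <= M * (8 * U^2 * lam / \<delta>^2)" using M lam by simp
    finally show ?thesis .
  qed
  show ?thesis using tot time unfolding nh_def by linarith
qed

text \<open>Close to the diagonal nothing is gained, but every remaining term carries a factor
  \<open>th1\<close> or \<open>kap1\<close>, and \<open>small\<close> bounds their sum.\<close>

lemma sync_numeric:
  assumes r: "0 <= r" "r < kap1" and ab: "0 <= \<alpha>" "0 <= \<beta>" "\<alpha> + \<beta> <= 2 + 2 * M"
  shows "(2 * smooth_cost \<delta> kap p r - M * smooth_cost \<delta> kap 4 r) / T + (3 * th1 * tslope \<delta> kap p \<alpha> \<beta> r + (\<alpha> + \<beta> - tcost \<delta> kap p \<alpha> \<beta> r) * (real n0 * HQ * (r + 2 * \<eta>)) + 0) <= epsp / 2"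
proof -
  note cp = \<delta> kap(1) p ab(1,2)
  have s: "sqrt (r^2 + kap^2) <= 2 * kap1"
  proof -
    have "sqrt (r^2 + kap^2) <= r + kap" using sqrt_sum_squares_le_sum[of r kap] r kap by simp
    thus ?thesis using r kap by linarith
  qed
  have "smooth_cost \<delta> kap p r <= real p / \<delta> * (2 * kap1)"
    unfolding smooth_cost_def by (rule order_trans[OF capped_upper mult_left_mono[OF s]]) (use \<delta> in simp)
  moreover have "0 <= M * smooth_cost \<delta> kap 4 r" using smooth_cost_bounds(1)[OF \<delta>] M by simp
  ultimately have "2 * smooth_cost \<delta> kap p r - M * smooth_cost \<delta> kap 4 r <= 2 * (real p / \<delta> * (2 * kap1))" by linarith
  hence "(2 * smooth_cost \<delta> kap p r - M * smooth_cost \<delta> kap 4 r) / T <= 2 * (real p / \<delta> * (2 * kap1)) / T" using T by (intro divide_right_mono) auto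
  hence 1: "(2 * smooth_cost \<delta> kap p r - M * smooth_cost \<delta> kap 4 r) / T <= 2 / T * (real p / \<delta> * (2 * kap1))" by (simp add: mult.commute)
  have "tslope \<delta> kap p \<alpha> \<beta> r <= (2 + 2 * M) * real p / \<delta>"
    by (rule order_trans[OF tslope_bounds(2)[OF cp]]) (use ab \<delta> in \<open>intro divide_right_mono mult_right_mono, auto\<close>)
  hence 2: "3 * th1 * tslope \<delta> kap p \<alpha> \<beta> r <= 3 * th1 * ((2 + 2 * M) * real p / \<delta>)" using th1 by (intro mult_left_mono) auto
  have 3: "(\<alpha> + \<beta> - tcost \<delta> kap p \<alpha> \<beta> r) * (real n0 * HQ * (r + 2 * \<eta>)) <= (2 + 2 * M) * (real n0 * HQ * (2 * kap1))"
  proof (rule mult_mono)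
    show "\<alpha> + \<beta> - tcost \<delta> kap p \<alpha> \<beta> r <= 2 + 2 * M" using tcost_bounds(1)[OF cp, of r] ab by linarith
    show "real n0 * HQ * (r + 2 * \<eta>) <= real n0 * HQ * (2 * kap1)" using r \<eta>(3) HQ by (intro mult_left_mono) auto
  qed (use M HQ r \<eta> in auto)
  show ?thesis using 1 2 3 small by linarith
qed

text \<open>The cubic constant of \<open>Kop_coupled\<close>, with bounds for the weights and the
  coefficients that hold on the whole time interval and on the ball of radius
  \<open>R\<close>.\<close>

definition Kst :: real where
  "Kst = (let W = 2 + 2 * M; Bb = 2 * (B + eps0 * (CN / eps^2)) in (W * real p / \<delta>) * 3 / (2 * kap) * Bb^2 + W * (trem \<delta> kap p + trem \<delta> kap 4) * (8 * m1 ^ 3)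
        + 2 * L * ((W * real p / \<delta>) / (2 * kap) * (2 * (\<delta> * Bb) + Bb^2) + 4 * lam * (W * real p / \<delta>) / kap + 4 * lam * (W * (real p)\<^sup>2 / \<delta>^2)))"

text \<open>Where the cost is saturated, in different regimes or beyond \<open>\<delta>\<close>, the
  maximum principle suffices. Elsewhere the noise is reflected beyond \<open>kap1\<close> and shared
  below. The cost is affine in time, so passing from \<open>t + st^2\<close> back to
  \<open>t\<close> changes it by exactly \<open>st^2 * A\<close>.\<close>

lemma one_step:
  assumes st: "0 < st" "2 * (st * m1) <= kap / 2" "4 * (st * m1) <= \<delta>" "st <= 1" "2 * st^2 * L <= 1" "Kst * st <= epsp / 2"
    and t: "0 <= t" "t + st^2 <= T"
    and fm: "!!l. l : Sset n0 ==> (%y. f (y, l)) : borel_measurable borel" and f0: "!!z. 0 <= f z" and f1: "!!z. f z <= 1"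
    and hm: "!!l. l : Sset n0 ==> (%y. h (y, l)) : borel_measurable borel" and h0: "!!z. 0 <= h z" and h1: "!!z. h z <= 1"
    and adm: "!!z z'. snd z : Sset n0 ==> snd z' : Sset n0 ==> f z + h z' <= Oc + cost (t + st^2) z z'"
    and k: "k : Sset n0" and l: "l : Sset n0" and x: "norm x <= R" and z: "norm z <= R"
    and xy: "norm (x - y) <= \<eta>" and zy: "norm (z - y') <= \<eta>"
  shows "Kop eps L st f x k y + Kop eps L st h z l y' <= Oc + cost t (y, k) (y', l) + epsp * st^2"
proof -
  define t' where "t' = t + st^2"
  have t': "0 <= t'" "t' <= T" using t by (auto simp: t'_def)
  have tT: "t <= T" using t zero_le_power2[of st] by linarith
  note cb' = coef_bounds[OF t'] and cb = coef_bounds[OF t(1) tT]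
  have cp': "0 <= c\<alpha> t'" "0 <= c\<beta> t'" using cb' by auto
  have cost_le: "cost t' z z' <= c\<alpha> t' + c\<beta> t'" for z z'
    unfolding cost_def using tcost_bounds(2)[OF \<delta> kap(1) p cp'] by auto
  have adm2: "f z + h z' <= Oc + (c\<alpha> t' + c\<beta> t')" if "snd z : Sset n0" "snd z' : Sset n0" for z z'
    using adm[OF that] cost_le[of z z'] unfolding t'_def by linarith
  have L0: "L >= 0" using L(2) CQ by (meson mult_nonneg_nonneg of_nat_0_le_iff order_trans zero_le_numeral)
  have LL: "CN / eps^2 <= L" "real n0 * CQ <= L" using L CN CQ eps L0 zero_le_divide_iff[of CN "eps^2"] by auto
  have crude: "Kop eps L st f x k y + Kop eps L st h z l y' <= Oc + (c\<alpha> t + c\<beta> t)"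
  proof -
    \<comment> \<open>Under a constant cost the dual constraint decouples: the supremum of
      \<open>f\<close> separates the pair, and \<open>Kop\<close> preserves both one-sided
      bounds.\<close>
    define F where "F = (SUP z\<in>UNIV \<times> Sset n0. f z)"
    have bdd: "bdd_above (f ` (UNIV \<times> Sset n0))" using f1 by (auto intro!: bdd_aboveI[of _ 1])
    have F: "f z <= F" if "snd z : Sset n0" for z unfolding F_def using that bdd by (intro cSUP_upper) (auto simp: mem_Times_iff)
    have "h z' <= Oc + (c\<alpha> t' + c\<beta> t') - F" if "snd z' : Sset n0" for z'
    proof -
      have "F <= Oc + (c\<alpha> t' + c\<beta> t') - h z'" unfolding F_def
      proof (rule cSUP_least)
        show "UNIV \<times> Sset n0 ~= {}" using k by auto
        fix z :: "(real^'d) \<times> nat" assume "z : UNIV \<times> Sset n0"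
        thus "f z <= Oc + (c\<alpha> t' + c\<beta> t') - h z'" using adm2[of z z'] that by (auto simp: mem_Times_iff)
      qed
      thus ?thesis by simp
    qed
    hence "Kop eps L st h z l y' <= Oc + (c\<alpha> t' + c\<beta> t') - F" using hm h0 h1 LL st(5) by (intro Kop_le l eps) auto
    moreover have "Kop eps L st f x k y <= F" using fm f0 f1 F LL st(5) by (intro Kop_le k eps) auto
    moreover have "c\<alpha> t' + c\<beta> t' <= c\<alpha> t + c\<beta> t"
    proof -
      have "c\<alpha> t' + c\<beta> t' = c\<alpha> t + c\<beta> t + (2 - M) * (st^2 / T)" unfolding c\<alpha>_def c\<beta>_def t'_def by (simp add: algebra_simps add_divide_distrib diff_divide_distrib)
      moreover have "(2 - M) * (st^2 / T) <= 0" using M T by (intro mult_nonpos_nonneg) auto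
      ultimately show ?thesis by linarith
    qed
    ultimately show ?thesis by linarith
  qed
  have e0: "0 <= epsp * st^2" using epsp by simp
  define r where "r = norm (y - y')"
  define rho where "rho = sqrt (r^2 + kap^2)"
  show ?thesis
  proof (cases "k = l & rho < \<delta>")
    case False
    have "cost t (y, k) (y', l) = c\<alpha> t + c\<beta> t"
    proof (cases "k = l")
      case True
      hence "rho >= \<delta>" using False by auto
      hence "max 0 (1 - rho / \<delta>) = 0" using \<delta> by simp
      hence "smooth_cost \<delta> kap n r = 1" if "n >= 4" for n unfolding smooth_cost_def capped_def rho_def[symmetric] using that by (simp add: power_0_left)
      thus ?thesis unfolding cost_def tcost_def using True p by (simp add: r_def[symmetric])
    qed (simp add: cost_def)
    thus ?thesis using crude e0 by linarith
  next
    case True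
    hence kl: "l = k" and rho\<delta>: "rho < \<delta>" by auto
    have r0: "r >= 0" and rrho: "r <= rho" unfolding rho_def by (auto simp: r_def intro!: real_le_rsqrt)
    have xz: "norm (x - z) <= r + 2 * \<eta>"
    proof -
      have "x - z = (x - y) - (z - y') + (y - y')" by simp
      hence "norm (x - z) <= norm ((x - y) - (z - y')) + norm (y - y')" using norm_triangle_ineq by metis
      thus ?thesis using norm_triangle_ineq4[of "x - y" "z - y'"] xy zy unfolding r_def by linarith
    qed
    define reflecting where "reflecting = (kap1 <= r)"
    define tt where "tt = (if reflecting then th else th1)"
    have tt: "tt > 0" "\<eta> * (2 * tt + 8 * B) <= tt * kap" unfolding tt_def using th th1 \<eta> by auto
    have SFx: "2 * ((x - z) \<bullet> (b x k - b z k)) + (norm (\<sigma> x k - \<sigma> z k))\<^sup>2 <= tt * norm (x - z)" "tv_int (\<nu> x k) (\<nu> z k) norm <= ennreal tt"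
    proof -
      have "norm (x - z) <= 2 * \<delta>" using xz rrho rho\<delta> \<eta>(2) by linarith
      moreover have "norm (x - z) <= 2 * kap1" if "\<not> reflecting" using xz that \<eta>(3) unfolding reflecting_def by linarith
      ultimately show "2 * ((x - z) \<bullet> (b x k - b z k)) + (norm (\<sigma> x k - \<sigma> z k))\<^sup>2 <= tt * norm (x - z)" "tv_int (\<nu> x k) (\<nu> z k) norm <= ennreal tt"
        using SFb[OF k, of x z] SFs[OF k, of x z] unfolding tt_def by auto
    qed
    note Bx = B[OF k x] and Bz = B[OF k z]
    define Bb where "Bb = 2 * (B + eps0 * (CN / eps^2))"
    have e1: "0 <= eps0 * (CN / eps^2)" using eps0 CN by simp
    have B1: "norm (btilde eps x k - btilde eps z k) <= Bb"
      using norm_triangle_ineq4[of "btilde eps x k" "btilde eps z k"] btilde_bound[OF k eps(1,2) conjunct1[OF Bx]] btilde_bound[OF k eps(1,2) conjunct1[OF Bz]]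
      unfolding Bb_def by argo
    have B2: "norm (\<sigma> x k - \<sigma> z k) <= Bb" using norm_triangle_ineq4[of "\<sigma> x k" "\<sigma> z k"] conjunct2[OF Bx] conjunct2[OF Bz] e1 unfolding Bb_def by argo
    have B3: "norm (b x k - b z k) <= 2 * B" using norm_triangle_ineq4[of "b x k" "b z k"] Bx Bz by linarith
    define G where "G = 3 * tt * tslope \<delta> kap p (c\<alpha> t') (c\<beta> t') r + (c\<alpha> t' + c\<beta> t' - tcost \<delta> kap p (c\<alpha> t') (c\<beta> t') r) * (real n0 * HQ * (r + 2 * \<eta>))
        + (if reflecting then 4 * lam * tslope \<delta> kap p (c\<alpha> t') (c\<beta> t') r * kap^2 / rho ^ 3 - 4 * lam * tcurv \<delta> kap p (c\<alpha> t') (c\<beta> t') r * (r^2 / rho^2) else 0)"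
    have main: "Kop eps L st f x k y + Kop eps L st h z k y' <= Oc + tcost \<delta> kap p (c\<alpha> t') (c\<beta> t') r + st^2 * G + Kst * st ^ 3"
      unfolding G_def Kst_def Let_def Bb_def[symmetric]
    proof (rule Kop_coupled[OF \<delta> kap(1) p cp' fm f0 f1 hm h0 h1 _ _ k eps(1,2) r_def rho_def _ B1 B2 B3 st(1-5) _ SFx _ L xy zy])
      show "f (y, l) + h (y', l) <= Oc + tcost \<delta> kap p (c\<alpha> t') (c\<beta> t') (norm (y - y'))" if "l : Sset n0" for l y y'
        using adm[of "(y, l)" "(y', l)"] that unfolding t'_def[symmetric] cost_def by simp
      show "f (y, l) + h (y', l') <= Oc + (c\<alpha> t' + c\<beta> t')" if "l : Sset n0" "l' : Sset n0" for l l' y y'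
        using adm2[of "(y, l)" "(y', l')"] that by simp
      show "reflecting ==> 0 < r" using kap unfolding reflecting_def by linarith
      show "\<eta> * (2 * tt + 4 * (2 * B)) <= tt * kap" using tt by simp
    qed (use rrho rho\<delta> tt cb' in auto)
    define A where "A = (2 * smooth_cost \<delta> kap p r - M * smooth_cost \<delta> kap 4 r) / T"
    have AG: "A + G <= epsp / 2"
    proof (cases reflecting)
      case True
      hence "A + G <= 0" unfolding A_def G_def tt_def using reflect_numeric[OF _ rho_def rho\<delta> cp'(1) cb'(3)] by (simp add: reflecting_def)
      thus ?thesis using epsp by linarith
    next
      case False
      thus ?thesis unfolding A_def G_def tt_def using sync_numeric[OF r0 _ cp' cb'(6)] by (simp add: reflecting_def)
    qed
    have lin: "tcost \<delta> kap p (c\<alpha> t') (c\<beta> t') r = tcost \<delta> kap p (c\<alpha> t) (c\<beta> t) r + st^2 * A"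
      unfolding tcost_def c\<alpha>_def c\<beta>_def t'_def A_def by (simp add: algebra_simps add_divide_distrib diff_divide_distrib)
    have "st^2 * (A + G) <= st^2 * (epsp / 2)" using AG by (intro mult_left_mono) auto
    moreover have "Kst * st ^ 3 <= (epsp / 2) * st^2"
      using mult_right_mono[OF st(6), of "st^2"] by (simp add: power3_eq_cube power2_eq_square mult_ac)
    ultimately have "st^2 * A + st^2 * G + Kst * st ^ 3 <= epsp * st^2" by (simp add: algebra_simps)
    moreover have "cost t (y, k) (y', l) = tcost \<delta> kap p (c\<alpha> t) (c\<beta> t) r" by (simp add: cost_def kl r_def)
    ultimately show ?thesis using main lin unfolding kl by linarith
  qed
qed

end

section \<open>Occupation measures of a martingale solution\<close>

lemma borel_measurable_nat_of_real:
  fixes f :: "'a => nat"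
  assumes "(%x. real (f x)) : borel_measurable M"
  shows "f : borel_measurable M"
proof -
  have "(%x. \<lfloor>real (f x)\<rfloor>) : M \<rightarrow>\<^sub>M count_space UNIV" using assms by measurable
  hence "(%x. nat \<lfloor>real (f x)\<rfloor>) : M \<rightarrow>\<^sub>M borel" by (rule measurable_compose) simp
  thus ?thesis by simp
qed

text \<open>The integrals cancel except over two intervals of length \<open>v\<close> at the ends of
  the windows.\<close>

lemma window_shift:
  fixes \<beta> :: "real => real"
  assumes [measurable]: "\<beta> : borel_measurable borel" and b: "!!s. \<bar>\<beta> s\<bar> <= C" and v: "0 <= v" and tau: "0 <= tau"
  shows "\<bar>(LINT s|lborel. indicator {t+v..t+v+tau} s * \<beta> s) - (LINT s|lborel. indicator {t..t+tau} s * \<beta> s)\<bar> <= 2 * C * v"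
proof -
  have C0: "C >= 0" using b[of 0] by linarith
  have ic: "integrable lborel (%s. C * indicator {a..a'} s)" for a a' :: real
    by (intro integrable_mult_right integrable_real_indicator) (auto simp: emeasure_lborel_Icc_eq)
  have i: "integrable lborel (%s. indicator {a..a'} s * \<beta> s)" for a a'
    by (rule Bochner_Integration.integrable_bound[OF ic])
       (use b C0 in \<open>auto simp: indicator_def\<close>)
  have "(LINT s|lborel. indicator {t+v..t+v+tau} s * \<beta> s) - (LINT s|lborel. indicator {t..t+tau} s * \<beta> s)
     = (LINT s|lborel. indicator {t+v..t+v+tau} s * \<beta> s - indicator {t..t+tau} s * \<beta> s)" using i by simp
  moreover have "\<bar>\<integral>s. indicator {t+v..t+v+tau} s * \<beta> s - indicator {t..t+tau} s * \<beta> s \<partial>lborel\<bar> <= (LINT s|lborel. C * indicator {t..t+v} s + C * indicator {t+tau..t+tau+v} s)"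
  proof (rule order_trans[OF integral_abs_bound integral_mono])
    show "\<bar>indicator {t+v..t+v+tau} s * \<beta> s - indicator {t..t+tau} s * \<beta> s\<bar> <= C * indicator {t..t+v} s + C * indicator {t+tau..t+tau+v} s" for s
      using b[of s] C0 v tau by (auto simp: indicator_def)
  qed (intro integrable_abs Bochner_Integration.integrable_diff Bochner_Integration.integrable_add i ic)+
  moreover have "(LINT s|lborel. C * indicator {t..t+v} s + C * indicator {t+tau..t+tau+v} s) = 2 * C * v"
    using v by (subst Bochner_Integration.integral_add[OF ic ic]) simp
  ultimately show ?thesis by linarith
qed

locale cadlag_mp =
  fixes Q :: "(real => (real^'d::finite) \<times> nat) measure" and S :: "nat set"
    and G :: "((real^'d) \<times> nat => real) => (real^'d) \<times> nat => real" and test :: "((real^'d) \<times> nat => real) set"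
    and z0 :: "(real^'d) \<times> nat"
  assumes mp: "mp_solution (UNIV \<times> S) G test z0 Q"
begin

abbreviation "\<Omega> \<equiv> cadlag_space (UNIV \<times> S) :: (real => (real^'d) \<times> nat) set"

lemma Q_prob: "prob_space Q" and Q_space: "space Q = \<Omega>" and Q_sets: "sets Q = sets (coord_sa \<Omega>)"
  and Q_init: "emeasure Q {om : \<Omega>. om 0 = z0} = 1"
  and Q_mart: "g : test ==> is_martingale Q (coord_filt \<Omega>)
        (%t om. g (om t) - g (om 0) - (LINT s|lborel. indicator {0..t} s * G g (om s)))"
  using mp unfolding mp_solution_def by auto

sublocale prob_space Q by (rule Q_prob)

lemma path_in_S: "om : \<Omega> ==> snd (om s) : S" and path_neg: "om : \<Omega> ==> s < 0 ==> om s = om 0"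
  and path_right: "om : \<Omega> ==> (om \<longlongrightarrow> om s) (at_right s)" and path_left: "om : \<Omega> ==> EX l. (om \<longlongrightarrow> l) (at_left s)"
  unfolding cadlag_space_def by (auto simp: mem_Times_iff continuous_within)

lemma coord_gen_sub: "{{om\<in>\<Omega>. om s : A} | s A. 0 <= s & s <= t & A : sets borel} \<subseteq> Pow \<Omega>"
  "{{om\<in>\<Omega>. om s : A} | s A. 0 <= s & A : sets borel} \<subseteq> Pow \<Omega>" by auto

lemma filt_space: "space (coord_filt \<Omega> t) = \<Omega>" unfolding coord_filt_def by (rule space_measure_of[OF coord_gen_sub(1)])

lemma filt_sub: "sets (coord_filt \<Omega> t) \<subseteq> sets Q"
  unfolding Q_sets coord_filt_def coord_sa_def sets_measure_of[OF coord_gen_sub(1)] sets_measure_of[OF coord_gen_sub(2)]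
  by (rule sigma_sets_mono') auto

lemma coord_filt_measurable: "0 <= s ==> s <= t ==> (%om. om s) : coord_filt \<Omega> t \<rightarrow>\<^sub>M borel"
proof (rule measurableI)
  fix A :: "((real^'d) \<times> nat) set" assume "0 <= s" "s <= t" "A : sets borel"
  hence "{om\<in>\<Omega>. om s : A} : {{om\<in>\<Omega>. om s : A} | s A. 0 <= s & s <= t & A : sets borel}" by auto
  hence "{om\<in>\<Omega>. om s : A} : sets (coord_filt \<Omega> t)"
    unfolding coord_filt_def sets_measure_of[OF coord_gen_sub(1)] by (rule sigma_sets.Basic)
  moreover have "(%om. om s) -` A \<inter> space (coord_filt \<Omega> t) = {om\<in>\<Omega>. om s : A}" unfolding filt_space by auto
  ultimately show "(%om. om s) -` A \<inter> space (coord_filt \<Omega> t) : sets (coord_filt \<Omega> t)" by simp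
qed auto

lemma coord_measurable [measurable]: "(%om. om s) : Q \<rightarrow>\<^sub>M borel"
proof -
  have 1: "(%om. om s) : Q \<rightarrow>\<^sub>M borel" if "0 <= s" for s
    using measurable_mono[OF order_refl refl filt_sub, of s borel] coord_filt_measurable[OF that order_refl] Q_space filt_space by auto
  show ?thesis
  proof (cases "0 <= s")
    case False
    have "(%om. om s) : Q \<rightarrow>\<^sub>M borel \<longleftrightarrow> (%om. om 0) : Q \<rightarrow>\<^sub>M borel"
      using False by (intro measurable_cong path_neg) (auto simp: Q_space)
    thus ?thesis using 1 by simp
  qed (rule 1)
qed

section \<open>Joint measurability and survival in a ball\<close>

definition right_grid :: "nat => real => real" where
  "right_grid n s = (real_of_int \<lfloor>s * real (Suc n)\<rfloor> + 1) / real (Suc n)"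

lemma right_grid_tendsto: "filterlim (%n. right_grid n s) (at_right s) sequentially"
proof -
  have b: "s < right_grid n s & right_grid n s <= s + 1 / real (Suc n)" for n
  proof -
    define f where "f = real_of_int \<lfloor>s * real (Suc n)\<rfloor>"
    have "f <= s * real (Suc n)" "s * real (Suc n) < f + 1" unfolding f_def by linarith+
    hence "f / real (Suc n) <= s" "s < (f + 1) / real (Suc n)"
      by (simp_all add: pos_divide_le_eq pos_less_divide_eq del: of_nat_Suc)
    thus ?thesis unfolding right_grid_def f_def[symmetric] by (simp add: add_divide_distrib del: of_nat_Suc)
  qed
  have "(%n. right_grid n s) \<longlonglongrightarrow> s"
  proof (rule tendsto_sandwich[where f="%_. s" and h="%n. s + 1 / real (Suc n)"])
    show "(%n. s + 1 / real (Suc n)) \<longlonglongrightarrow> s"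
      using tendsto_add[OF tendsto_const LIMSEQ_inverse_real_of_nat, of s] by (simp add: inverse_eq_divide)
    show "\<forall>\<^sub>F n in sequentially. s <= right_grid n s" using b by (intro always_eventually allI less_imp_le) blast
    show "\<forall>\<^sub>F n in sequentially. right_grid n s <= s + 1 / real (Suc n)" using b by (intro always_eventually allI) blast
  qed simp
  moreover have "right_grid n s : {s<..} & right_grid n s ~= s" for n using b[of n] by (simp add: less_imp_neq[symmetric])
  ultimately show ?thesis by (simp add: filterlim_at)
qed

text \<open>By right continuity the path is the limit of its values at grid points strictly to the
  right of the given time, and each grid contains only countably many times.\<close>

lemma joint_measurable [measurable]: "(%(s, om). om s) : borel \<Otimes>\<^sub>M Q \<rightarrow>\<^sub>M borel"
proof -
  define X where "X n p = snd p (right_grid n (fst p))" for n and p :: "real \<times> (real => (real^'d) \<times> nat)"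
  have X: "X n : borel \<Otimes>\<^sub>M Q \<rightarrow>\<^sub>M borel" for n
  proof -
    have 1: "(%p. snd p ((real_of_int i + 1) / real (Suc n))) : borel \<Otimes>\<^sub>M Q \<rightarrow>\<^sub>M borel" for i
      by (rule measurable_compose[OF measurable_snd coord_measurable])
    have 2: "(%p. \<lfloor>fst p * real (Suc n)\<rfloor>) : (borel \<Otimes>\<^sub>M Q) \<rightarrow>\<^sub>M count_space UNIV" by measurable
    show ?thesis unfolding X_def right_grid_def by (rule measurable_compose_countable[OF 1 2])
  qed
  have lim: "(%n. X n p) \<longlonglongrightarrow> snd p (fst p)" if "p : space (borel \<Otimes>\<^sub>M Q)" for p
    unfolding X_def using that
    by (intro filterlim_compose[OF path_right right_grid_tendsto]) (auto simp: space_pair_measure Q_space)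
  have m1: "(%p. fst (snd p (fst p))) : borel \<Otimes>\<^sub>M Q \<rightarrow>\<^sub>M borel"
  proof (rule borel_measurable_LIMSEQ_metric)
    show "(%p. fst (X n p)) : borel \<Otimes>\<^sub>M Q \<rightarrow>\<^sub>M borel" for n
      by (rule measurable_compose[OF X]) (intro borel_measurable_continuous_onI continuous_intros)
    show "(%n. fst (X n p)) \<longlonglongrightarrow> fst (snd p (fst p))" if "p : space (borel \<Otimes>\<^sub>M Q)" for p
      using lim[OF that] by (rule tendsto_fst)
  qed
  have m2: "(%p. snd (snd p (fst p))) : borel \<Otimes>\<^sub>M Q \<rightarrow>\<^sub>M borel"
  proof (rule borel_measurable_nat_of_real, rule borel_measurable_LIMSEQ_metric)
    have cr: "continuous_on UNIV real" by (simp add: continuous_on_def tendsto_discrete)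
    show "(%p. real (snd (X n p))) : borel \<Otimes>\<^sub>M Q \<rightarrow>\<^sub>M borel" for n
      by (rule measurable_compose[OF X], rule borel_measurable_continuous_onI,
          rule continuous_on_compose2[OF cr continuous_on_snd[OF continuous_on_id]]) auto
    show "(%n. real (snd (X n p))) \<longlonglongrightarrow> real (snd (snd p (fst p)))" if "p : space (borel \<Otimes>\<^sub>M Q)" for p
      using continuous_on_tendsto_compose[OF cr tendsto_snd[OF lim[OF that]]] by simp
  qed
  have "(%p. (fst (snd p (fst p)), snd (snd p (fst p)))) : borel \<Otimes>\<^sub>M Q \<rightarrow>\<^sub>M borel \<Otimes>\<^sub>M borel"
    by (rule measurable_Pair[OF m1 m2])
  thus ?thesis by (simp add: borel_prod split_beta')
qed

definition alive :: "real => real => (real => (real^'d) \<times> nat) => bool" where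
  "alive R t om \<longleftrightarrow> (ALL s:{0..t}. norm (fst (om s)) <= R)"

text \<open>By right continuity an exit from the closed ball before time \<open>t\<close> is seen at
  a rational time. The endpoint \<open>t\<close> has to be tested separately, since times to its
  right do not count; this puts the event into the filtration at time \<open>t\<close>
  itself.\<close>

lemma alive_rational:
  assumes w: "om : \<Omega>" and t: "0 <= t"
  shows "alive R t om \<longleftrightarrow> norm (fst (om t)) <= R & (ALL s:\<rat>. 0 <= s --> s <= t --> norm (fst (om s)) <= R)"
proof
  assume r: "norm (fst (om t)) <= R & (ALL s:\<rat>. 0 <= s --> s <= t --> norm (fst (om s)) <= R)"
  show "alive R t om" unfolding alive_def
  proof
    fix s assume s: "s : {0..t}"
    show "norm (fst (om s)) <= R"
    proof (rule ccontr)
      assume c: "\<not> norm (fst (om s)) <= R"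
      hence st: "s < t" using r s by (cases "s = t") auto
      have "((%y. norm (fst (om y))) \<longlongrightarrow> norm (fst (om s))) (at_right s)"
        by (intro tendsto_norm tendsto_fst path_right w)
      hence "\<forall>\<^sub>F y in at_right s. R < norm (fst (om y))" using c by (intro order_tendstoD) auto
      then obtain c where c: "s < c" "!!y. s < y ==> y < c ==> R < norm (fst (om y))"
        unfolding eventually_at_right_field by auto
      obtain p where p: "p : \<rat>" "s < p" "p < min c t" using Rats_dense_in_real[of s "min c t"] c st by auto
      thus False using c(2)[of p] r s by fastforce
    qed
  qed
qed (use t in \<open>auto simp: alive_def\<close>)

lemma alive_filt: "0 <= t ==> {om\<in>\<Omega>. alive R t om} : sets (coord_filt \<Omega> t)"
proof -
  assume t: "0 <= t"
  have m: "{om\<in>\<Omega>. norm (fst (om s)) <= R} : sets (coord_filt \<Omega> t)" if "0 <= s" "s <= t" for s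
  proof -
    have "(%om. norm (fst (om s))) : borel_measurable (coord_filt \<Omega> t)"
      by (rule measurable_compose[OF coord_filt_measurable[OF that]]) (intro borel_measurable_continuous_onI continuous_intros)
    thus ?thesis unfolding borel_measurable_iff_le filt_space by auto
  qed
  have "{om\<in>\<Omega>. alive R t om} = {om\<in>\<Omega>. norm (fst (om t)) <= R} \<inter> (\<Inter>s\<in>\<rat> \<inter> {0..t}. {om\<in>\<Omega>. norm (fst (om s)) <= R})"
    using alive_rational[OF _ t] t Rats_0 by fastforce
  also have "... : sets (coord_filt \<Omega> t)"
    using t by (intro sets.Int m sets.countable_INT' countable_Int1 countable_rat) (auto intro!: m)
  finally show ?thesis .
qed

lemma alive_joint: "{p : space (borel \<Otimes>\<^sub>M Q). 0 <= fst p & alive R (fst p) (snd p)} : sets (borel \<Otimes>\<^sub>M Q)"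
proof -
  have nm: "(%z::(real^'d) \<times> nat. norm (fst z)) : borel_measurable borel"
    by (intro borel_measurable_continuous_onI continuous_intros)
  have [measurable]: "(%p. norm (fst (snd p (fst p)))) : borel_measurable (borel \<Otimes>\<^sub>M Q)"
    using measurable_compose[OF joint_measurable nm] by (simp add: split_beta')
  have [measurable]: "(%p. norm (fst (snd p s))) : borel_measurable (borel \<Otimes>\<^sub>M Q)" for s
    by (rule measurable_compose[OF measurable_snd measurable_compose[OF coord_measurable nm]])
  have "{p : space (borel \<Otimes>\<^sub>M Q). 0 <= fst p & alive R (fst p) (snd p)}
     = {p : space (borel \<Otimes>\<^sub>M Q). 0 <= fst p & norm (fst (snd p (fst p))) <= R} \<inter>
       (\<Inter>s\<in>\<rat>. {p : space (borel \<Otimes>\<^sub>M Q). 0 <= s --> s <= fst p --> norm (fst (snd p s)) <= R})"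
    using alive_rational Rats_0 by (fastforce simp: space_pair_measure Q_space)
  also have "... : sets (borel \<Otimes>\<^sub>M Q)"
    using Rats_0 by (intro sets.Int sets.countable_INT' countable_rat) auto
  finally show ?thesis .
qed

text \<open>One-sided limits make the path bounded near every time, and compactness of the interval
  does the rest.\<close>

lemma path_bounded:
  assumes w: "om : \<Omega>"
  shows "EX R. ALL s:{0..t}. norm (fst (om s)) <= R"
proof -
  have "EX U r. open U & s : U & (ALL y:U. norm (fst (om y)) <= r)" for s
  proof -
    obtain l where l: "(om \<longlongrightarrow> l) (at_left s)" using path_left[OF w] by blast
    define r where "r = max (norm (fst l)) (norm (fst (om s))) + 1"
    have "((%y. norm (fst (om y))) \<longlongrightarrow> norm (fst l)) (at_left s)" by (intro tendsto_norm tendsto_fst l)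
    hence L: "\<forall>\<^sub>F y in at_left s. norm (fst (om y)) < r" by (rule order_tendstoD) (auto simp: r_def)
    have "((%y. norm (fst (om y))) \<longlongrightarrow> norm (fst (om s))) (at_right s)" by (intro tendsto_norm tendsto_fst path_right w)
    hence R: "\<forall>\<^sub>F y in at_right s. norm (fst (om y)) < r" by (rule order_tendstoD) (auto simp: r_def)
    have "\<forall>\<^sub>F y in at s. norm (fst (om y)) < r" using L R by (simp add: eventually_at_split)
    then obtain U where "open U" "s : U" "ALL y:U. y ~= s --> norm (fst (om y)) < r" unfolding eventually_at_topological by blast
    moreover have "norm (fst (om s)) < r" by (auto simp: r_def)
    ultimately show ?thesis by (metis less_imp_le)
  qed
  then obtain U r where U: "!!s. open (U s)" "!!s. s : U s" "!!s y. y : U s ==> norm (fst (om y)) <= r s" by metis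
  obtain D where D: "D \<subseteq> {0..t}" "finite D" "{0..t} \<subseteq> (\<Union>s\<in>D. U s)"
    using compactE_image[OF compact_Icc[of 0 t], of "{0..t}" U] U by (metis UN_I subsetI)
  show ?thesis
  proof (intro exI[of _ "Max (insert 0 (r ` D))"] ballI)
    fix s assume "s : {0..t}"
    then obtain y where "y : D" "s : U y" using D(3) by blast
    hence "norm (fst (om s)) <= r y" "r y <= Max (insert 0 (r ` D))" using U(3) D(2) by auto
    thus "norm (fst (om s)) <= Max (insert 0 (r ` D))" by linarith
  qed
qed

lemma alive_prob:
  assumes t: "0 <= t" and e: "e > 0"
  shows "EX R0. ALL R>=R0. prob {om\<in>\<Omega>. alive R t om} >= 1 - e"
proof -
  define A where "A n = {om\<in>\<Omega>. alive (real n) t om}" for n :: nat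
  have A: "A n : sets Q" for n unfolding A_def using alive_filt[OF t] filt_sub by blast
  have "incseq A" by (auto simp: incseq_def A_def alive_def intro: order_trans)
  hence "(%n. prob (A n)) \<longlonglongrightarrow> prob (\<Union>n. A n)" using A by (intro finite_Lim_measure_incseq) auto
  also have "(\<Union>n. A n) = space Q"
  proof -
    have "EX n. alive (real n) t om" if "om : \<Omega>" for om
      using path_bounded[OF that, of t] unfolding alive_def by (meson order_trans real_arch_simple)
    thus ?thesis by (auto simp: A_def Q_space)
  qed
  finally have "(%n. prob (A n)) \<longlonglongrightarrow> 1" by (simp add: prob_space)
  hence "\<forall>\<^sub>F n in sequentially. 1 - e < prob (A n)" using e by (intro order_tendstoD) auto
  then obtain n where n: "1 - e < prob (A n)" by (auto simp: eventually_sequentially)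
  show ?thesis
  proof (intro exI[of _ "real n"] allI impI)
    fix R assume "real n <= R"
    hence "prob (A n) <= prob {om\<in>\<Omega>. alive R t om}"
      using alive_filt[OF t, of R] filt_sub by (intro finite_measure_mono) (auto simp: A_def alive_def intro: order_trans)
    thus "1 - e <= prob {om\<in>\<Omega>. alive R t om}" using n by simp
  qed
qed

end

section \<open>Killed expectations and the averaged flow\<close>

context cadlag_mp begin

definition live :: "real => real => (real => (real^'d) \<times> nat) => real" where
  "live R s om = (if 0 <= s & alive R s om then 1 else 0)"

lemma live_bounds [simp]: "0 <= live R s om" "live R s om <= 1" by (auto simp: live_def)

lemma live_antimono: "0 <= s ==> s <= t ==> live R t om <= live R s om"
  by (auto simp: live_def alive_def)

lemma live_joint [measurable]: "(%(s, om). live R s om) : borel_measurable (borel \<Otimes>\<^sub>M Q)"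
proof -
  have "(%p. indicator {p : space (borel \<Otimes>\<^sub>M Q). 0 <= fst p & alive R (fst p) (snd p)} p :: real) : borel_measurable (borel \<Otimes>\<^sub>M Q)"
    using alive_joint by simp
  thus ?thesis by (rule measurable_cong[THEN iffD1, rotated]) (auto simp: live_def indicator_def split_beta)
qed

lemma live_measurable [measurable]: "live R s : borel_measurable Q"
  using measurable_compose[OF measurable_Pair1'[of s borel Q] live_joint[of R]] by simp

definition surv :: "real => ((real^'d) \<times> nat => real) => real => real" where
  "surv R phi s = (LINT om|Q. live R s om * phi (om s))"

lemma joint_comp: "phi : borel_measurable borel ==> (%p. phi (snd p (fst p))) : borel_measurable (borel \<Otimes>\<^sub>M Q)"
  using measurable_compose[OF joint_measurable] by (simp add: split_beta')

lemma surv_measurable [measurable]: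
  assumes [measurable]: "phi : borel_measurable borel"
  shows "surv R phi : borel_measurable borel"
proof -
  have "(%(s, om). live R s om * phi (om s)) : borel_measurable (borel \<Otimes>\<^sub>M Q)"
    using joint_comp[OF assms] live_joint by (simp add: split_beta')
  thus ?thesis unfolding surv_def by (rule borel_measurable_lebesgue_integral)
qed

lemma surv_integrable:
  assumes [measurable]: "phi : borel_measurable borel" and b: "!!z. \<bar>phi z\<bar> <= C"
  shows "integrable Q (%om. live R s om * phi (om s'))"
proof (rule integrable_const_bound[where B=C])
  show "AE om in Q. norm (live R s om * phi (om s')) <= C"
  proof (rule AE_I2)
    fix om
    have "\<bar>live R s om\<bar> * \<bar>phi (om s')\<bar> <= 1 * C" using b[of "om s'"] by (intro mult_mono) auto
    thus "norm (live R s om * phi (om s')) <= C" by (simp add: abs_mult)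
  qed
qed measurable

lemma surv_bound:
  assumes "phi : borel_measurable borel" and b: "!!z. \<bar>phi z\<bar> <= C"
  shows "\<bar>surv R phi s\<bar> <= C"
proof -
  have "\<bar>live R s om * phi (om s)\<bar> <= C" for om
  proof -
    have "\<bar>live R s om\<bar> * \<bar>phi (om s)\<bar> <= 1 * C" using b[of "om s"] by (intro mult_mono) auto
    thus ?thesis by (simp add: abs_mult)
  qed
  hence "(LINT om|Q. \<bar>live R s om * phi (om s)\<bar>) <= C"
    using surv_integrable[OF assms, of R s s] by (intro integral_le_const) auto
  thus ?thesis unfolding surv_def by (rule order_trans[OF integral_abs_bound])
qed

text \<open>The law of the path killed on leaving the ball of radius \<open>R\<close>, averaged over the window from \<open>t\<close> to \<open>t + tau\<close>:
  by the averaging, the error made in a single time step is quadratic in its length.\<close>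
definition flow :: "real => real => real => ((real^'d) \<times> nat) measure" where
  "flow R tau t = distr (density (lborel \<Otimes>\<^sub>M Q) (%p. ennreal (indicator {t..t+tau} (fst p) / tau * live R (fst p) (snd p))))
     borel (%p. snd p (fst p))"

lemma sets_flow [simp, measurable_cong]: "sets (flow R tau t) = sets borel" by (simp add: flow_def)

sublocale LQ: pair_sigma_finite lborel Q by unfold_locales

lemma lQ_sets [measurable_cong]: "sets (lborel \<Otimes>\<^sub>M Q) = sets (borel \<Otimes>\<^sub>M Q)" by (rule sets_pair_measure_cong) auto

lemma lQ_measurable: "f : borel_measurable (borel \<Otimes>\<^sub>M Q) ==> f : borel_measurable (lborel \<Otimes>\<^sub>M Q)"
  using measurable_cong_sets[OF lQ_sets refl] by blast

lemma live_pair [measurable]: "(%p. live R (fst p) (snd p)) : borel_measurable (borel \<Otimes>\<^sub>M Q)"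
  using live_joint[of R] by (simp add: split_beta')

lemma flow_integral:
  assumes phi[measurable]: "phi : borel_measurable borel" and b: "!!z. \<bar>phi z\<bar> <= C" and tau: "tau > 0"
  shows "integrable (flow R tau t) phi" "(\<integral>z. phi z \<partial>flow R tau t) = (LINT s|lborel. indicator {t..t+tau} s * surv R phi s) / tau"
proof -
  have C0: "C >= 0" using b[of undefined] by linarith
  define w where "w p = indicator {t..t+tau} (fst p) / tau * live R (fst p) (snd p)" for p
  have wn: "0 <= w p" for p using tau by (simp add: w_def)
  have wm: "w : borel_measurable (borel \<Otimes>\<^sub>M Q)" unfolding w_def by measurable
  note wm' = lQ_measurable[OF wm]
  have cm: "(%p. phi (snd p (fst p))) : borel_measurable (lborel \<Otimes>\<^sub>M Q)" by (rule lQ_measurable) measurable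
  have jm: "(%p. snd p (fst p)) : density (lborel \<Otimes>\<^sub>M Q) (%p. ennreal (w p)) \<rightarrow>\<^sub>M borel"
    using joint_measurable measurable_cong_sets[of "density (lborel \<Otimes>\<^sub>M Q) (%p. ennreal (w p))" "borel \<Otimes>\<^sub>M Q" borel borel] lQ_sets
    by (simp add: split_beta')
  have f: "flow R tau t = distr (density (lborel \<Otimes>\<^sub>M Q) (%p. ennreal (w p))) borel (%p. snd p (fst p))"
    by (simp add: flow_def w_def)
  have int: "integrable (lborel \<Otimes>\<^sub>M Q) (%p. w p * phi (snd p (fst p)))"
  proof (rule Bochner_Integration.integrable_bound)
    show "integrable (lborel \<Otimes>\<^sub>M Q) (%p. (C / tau) * indicator ({t..t+tau} \<times> space Q) p)"
    proof (intro integrable_mult_right integrable_real_indicator)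
      show "emeasure (lborel \<Otimes>\<^sub>M Q) ({t..t + tau} \<times> space Q) < \<infinity>"
        using tau by (subst emeasure_pair_measure_Times) (auto simp: emeasure_space_1)
    qed auto
    show "AE p in lborel \<Otimes>\<^sub>M Q. norm (w p * phi (snd p (fst p))) <= norm ((C / tau) * indicator ({t..t+tau} \<times> space Q) p)"
    proof (rule AE_I2)
      fix p :: "real \<times> (real => (real^'d) \<times> nat)" assume p: "p : space (lborel \<Otimes>\<^sub>M Q)"
      have "w p <= (1 / tau) * indicator ({t..t+tau} \<times> space Q) p"
        using p tau live_bounds[of R "fst p" "snd p"] by (cases p) (auto simp: w_def indicator_def space_pair_measure divide_right_mono)
      hence "w p * \<bar>phi (snd p (fst p))\<bar> <= (1 / tau) * indicator ({t..t+tau} \<times> space Q) p * C"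
        using b wn tau by (intro mult_mono) auto
      thus "norm (w p * phi (snd p (fst p))) <= norm ((C / tau) * indicator ({t..t+tau} \<times> space Q) p)"
        using wn tau C0 by (simp add: abs_mult mult_ac)
    qed
  qed (intro borel_measurable_times wm' cm)
  show "integrable (flow R tau t) phi"
    unfolding f using int wn wm' cm by (subst integrable_distr_eq[OF jm phi], subst integrable_real_density) auto
  have "(\<integral>z. phi z \<partial>flow R tau t) = (LINT p|(lborel \<Otimes>\<^sub>M Q). w p * phi (snd p (fst p)))"
    unfolding f using wn wm' cm by (subst integral_distr[OF jm phi], subst integral_real_density) auto
  also have "... = (LINT s|lborel. (LINT om|Q. w (s, om) * phi (om s)))"
    using LQ.integral_fst'[OF int] by simp
  also have "... = (LINT s|lborel. indicator {t..t+tau} s * surv R phi s / tau)"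
    unfolding surv_def w_def by (simp add: mult.assoc)
  also have "... = (LINT s|lborel. indicator {t..t+tau} s * surv R phi s) / tau" by simp
  finally show "(\<integral>z. phi z \<partial>flow R tau t) = (LINT s|lborel. indicator {t..t+tau} s * surv R phi s) / tau" .
qed

lemma flow_space: "space (flow R tau t) = UNIV" by (simp add: flow_def)

lemma flow_emeasure:
  assumes tau: "tau > 0"
  shows "finite_measure (flow R tau t)" "measure (flow R tau t) UNIV <= 1"
proof -
  have i: "integrable (flow R tau t) (%_. 1::real)" by (rule flow_integral(1)[where C=1]) (use tau in auto)
  thus fm: "finite_measure (flow R tau t)"
    by (intro finite_measureI) (auto simp: integrable_iff_bounded flow_space)
  have "measure (flow R tau t) UNIV = (\<integral>z. 1 \<partial>flow R tau t)" by (simp add: flow_space)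
  also have "... = (LINT s|lborel. indicator {t..t+tau} s * surv R (%_. 1) s) / tau"
    by (rule flow_integral(2)[where C=1]) (use tau in auto)
  also have "... <= (LINT s|lborel. indicator {t..t+tau} s * 1) / tau"
  proof (intro divide_right_mono integral_mono)
    have sb: "\<bar>surv R (%_. 1) s\<bar> <= 1" for s by (rule surv_bound) auto
    have ii: "integrable lborel (%s. indicator {t..t+tau} s * 1 :: real)"
      by (auto intro!: integrable_real_indicator simp: emeasure_lborel_Icc_eq)
    thus "integrable lborel (%s. indicator {t..t+tau} s * 1 :: real)" .
    show "integrable lborel (%s. indicator {t..t+tau} s * surv R (%_. 1) s)"
      by (rule Bochner_Integration.integrable_bound[OF ii]) (use sb in \<open>auto simp: indicator_def\<close>)
    show "indicator {t..t+tau} s * surv R (%_. 1) s <= indicator {t..t+tau} s * 1" for s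
      using sb[of s] by (auto simp: indicator_def)
  qed (use tau in auto)
  also have "... = 1" using tau by simp
  finally show "measure (flow R tau t) UNIV <= 1" .
qed

lemma flow_AE:
  assumes tau: "tau > 0" and S: "finite S"
  shows "AE z in flow R tau t. norm (fst z) <= R & snd z : S"
proof -
  define N where "N = {z::(real^'d) \<times> nat. \<not> (norm (fst z) <= R & snd z : S)}"
  have "N = {z. R < norm (fst z)} \<union> snd -` (- S)" by (auto simp: N_def)
  moreover have "{z::(real^'d) \<times> nat. R < norm (fst z)} : sets borel"
    by (intro borel_open open_Collect_less continuous_intros)
  moreover have "snd -` (- S) : sets (borel :: ((real^'d) \<times> nat) measure)"
    by (intro borel_open open_vimage continuous_on_snd continuous_on_id) (rule discrete_topology_class.open_discrete)
  ultimately have N[measurable]: "N : sets borel" by (metis sets.Un)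
  have "(\<integral>z. indicator N z \<partial>flow R tau t) = (LINT s|lborel. indicator {t..t+tau} s * surv R (indicator N) s) / tau"
    by (rule flow_integral(2)[where C=1]) (use tau in auto)
  also have "surv R (indicator N) = (%_. 0)"
  proof
    fix s
    have "surv R (indicator N) s = (LINT om|Q. 0)" unfolding surv_def
      by (intro Bochner_Integration.integral_cong) (auto simp: live_def alive_def N_def indicator_def Q_space path_in_S)
    thus "surv R (indicator N) s = 0" by simp
  qed
  finally have m0: "measure (flow R tau t) N = 0" by (simp add: flow_space)
  interpret F: finite_measure "flow R tau t" by (rule flow_emeasure[OF tau])
  have em0: "emeasure (flow R tau t) N = 0" by (simp add: F.emeasure_eq_measure m0)
  show ?thesis
  proof (rule AE_I[of _ _ N])
    show "emeasure (flow R tau t) N = 0" by fact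
    show "N : sets (flow R tau t)" using N by simp
  qed (auto simp: N_def)
qed

text \<open>Survival up to \<open>s\<close> is an event of the filtration, so the martingale
  property may be integrated over it. Counting only the survivors at \<open>s + h\<close> is allowed
  in this direction since \<open>g\<close> is nonnegative. In the integral of \<open>Ag\<close>,
  replacing survival up to \<open>s\<close> by survival up to the running time costs at most the
  mass lost in between, which is the last term.\<close>

lemma surv_step:
  assumes g: "g : test" "g : borel_measurable borel" "!!z. 0 <= g z" "!!z. g z <= Cg"
    and A: "Ag : borel_measurable borel" "!!z. snd z : S ==> Ag z = G g z" "!!z. \<bar>Ag z\<bar> <= C"
    and s: "0 <= s" "0 <= h"
  shows "surv R g (s + h) <= surv R g s + (LINT r|lborel. indicator {0<..h} r * surv R Ag (s + r))
     + C * h * (surv R (%_. 1) s - surv R (%_. 1) (s + h))"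
proof -
  note [measurable] = g(2) A(1) joint_comp[OF A(1)]
  have gb: "\<bar>g z\<bar> <= Cg" for z using g(3,4) by simp
  have C0: "C >= 0" using A(3)[of undefined] by linarith
  define U where "U = {om\<in>\<Omega>. alive R s om}"
  have U: "U : sets (coord_filt \<Omega> s)" unfolding U_def by (rule alive_filt[OF s(1)])
  have UQ[measurable]: "U : sets Q" using U filt_sub by blast
  have lU: "live R s om = indicator U om" if "om : space Q" for om using that s by (auto simp: live_def U_def indicator_def Q_space)
  define I where "I t om = (LINT r|lborel. indicator {0..t} r * Ag (om r))" for t :: real and om
  have Am: "(%r. Ag (om r)) : borel_measurable borel" if "om : space Q" for om
    using measurable_compose[OF measurable_Pair2'[OF that, of borel] joint_comp[OF A(1)]] by (simp only: fst_conv snd_conv)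
  have iC: "integrable lborel (%r. K * indicator {a..t} r)" for K a t :: real
    by (intro integrable_mult_right integrable_real_indicator) (auto simp: emeasure_lborel_Icc_eq)
  have iA: "integrable lborel (%r. indicator B r * Ag (om r))" if w: "om : space Q" and B: "B : sets borel" "B \<subseteq> {0..t}" for om B t
  proof (rule Bochner_Integration.integrable_bound)
    show "integrable lborel (%r. C * indicator {0..t} r)" by (rule iC)
    show "AE r in lborel. norm (indicator B r * Ag (om r)) <= norm (C * indicator {0..t} r)"
      using A(3) C0 B(2) by (intro AE_I2) (auto simp: indicator_def)
  qed (use Am[OF w] B in measurable)
  have GI: "(LINT r|lborel. indicator {0..t} r * G g (om r)) = I t om" if "om : space Q" for t om
    unfolding I_def using that A(2) path_in_S by (intro Bochner_Integration.integral_cong) (auto simp: Q_space)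
  have Ib: "\<bar>I t om\<bar> <= C * t" if "0 <= t" "om : space Q" for t om
  proof -
    have "\<bar>I t om\<bar> <= (LINT r|lborel. C * indicator {0..t} r)"
      unfolding I_def
    proof (rule order_trans[OF integral_abs_bound integral_mono])
      show "integrable lborel (%r. \<bar>indicator {0..t} r * Ag (om r)\<bar>)"
        by (rule integrable_abs[OF iA[OF that(2), of "{0..t}" t]]) auto
      show "\<bar>indicator {0..t} r * Ag (om r)\<bar> <= C * indicator {0..t} r" for r
        using A(3)[of "om r"] by (simp add: indicator_def)
    qed (rule iC)
    thus ?thesis using that by simp
  qed
  have Im[measurable]: "I t : borel_measurable Q" for t
  proof -
    have "(%(om, r). indicator {0..t} r * Ag (om r)) : borel_measurable (Q \<Otimes>\<^sub>M lborel)"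
    proof -
      have "(%p. indicator {0..t} (fst p) * Ag (snd p (fst p))) : borel_measurable (lborel \<Otimes>\<^sub>M Q)"
        by (rule lQ_measurable) measurable
      from measurable_compose[OF measurable_pair_swap' this] show ?thesis by (simp add: split_beta')
    qed
    thus ?thesis unfolding I_def by (rule lborel.borel_measurable_lebesgue_integral)
  qed
  have iI: "integrable Q (%om. indicator U om * I t om)" if "0 <= t" for t
  proof (rule integrable_const_bound[where B="C * t"])
    show "AE om in Q. norm (indicator U om * I t om) <= C * t" 
      using Ib[OF that] C0 that by (intro AE_I2) (auto simp: indicator_def)
  qed measurable
  have ig: "integrable Q (%om. indicator U om * g (om t))" for t
    by (rule integrable_const_bound[where B=Cg]) (use gb order_trans[OF g(3,4)] in \<open>auto simp: indicator_def\<close>)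
  have mart: "(LINT om|Q. indicator U om * (g (om (s + h)) - g (om 0) - I (s + h) om))
      = (LINT om|Q. indicator U om * (g (om s) - g (om 0) - I s om))"
  proof -
    have "(LINT om|Q. indicator U om * (g (om (s + h)) - g (om 0) - (LINT r|lborel. indicator {0..s+h} r * G g (om r))))
      = (LINT om|Q. indicator U om * (g (om s) - g (om 0) - (LINT r|lborel. indicator {0..s} r * G g (om r))))"
      by (rule conjunct2[OF Q_mart[OF g(1), unfolded is_martingale_def], rule_format, OF s(1) _ U]) (use s in simp)
    moreover have "(LINT om|Q. indicator U om * (g (om t) - g (om 0) - (LINT r|lborel. indicator {0..t} r * G g (om r))))
       = (LINT om|Q. indicator U om * (g (om t) - g (om 0) - I t om))" for t
      by (rule Bochner_Integration.integral_cong[OF refl]) (simp only: GI)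
    ultimately show ?thesis by simp
  qed
  have "(LINT om|Q. indicator U om * g (om (s + h))) = (LINT om|Q. indicator U om * g (om s))
      + ((LINT om|Q. indicator U om * I (s + h) om) - (LINT om|Q. indicator U om * I s om))"
    using mart ig iI[of "s + h"] iI[of s] s by (simp add: right_diff_distrib)
  note E1 = this
  have "(LINT om|Q. indicator U om * I (s + h) om) - (LINT om|Q. indicator U om * I s om) = (LINT om|Q. indicator U om * (I (s + h) om - I s om))"
    using iI[of "s + h"] iI[of s] s by (simp add: right_diff_distrib)
  also have "... = (LINT om|Q. (LINT r|lborel. indicator {s<..s+h} r * (indicator U om * Ag (om r))))"
  proof (rule Bochner_Integration.integral_cong[OF refl])
    fix om assume w: "om : space Q"
    have "I (s + h) om - I s om = (LINT r|lborel. indicator {0..s+h} r * Ag (om r) - indicator {0..s} r * Ag (om r))"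
      unfolding I_def using iA[OF w, of "{0..s+h}" "s+h"] iA[OF w, of "{0..s}" "s"] by simp
    also have "... = (LINT r|lborel. indicator {s<..s+h} r * Ag (om r))"
      using s by (intro Bochner_Integration.integral_cong) (auto simp: indicator_def)
    finally show "indicator U om * (I (s + h) om - I s om) = (LINT r|lborel. indicator {s<..s+h} r * (indicator U om * Ag (om r)))"
      by (simp add: mult.left_commute)
  qed
  also have "... = (LINT r|lborel. (LINT om|Q. indicator {s<..s+h} r * (indicator U om * Ag (om r))))"
  proof (rule LQ.Fubini_integral[symmetric, of "%r om. indicator {s<..s+h} r * (indicator U om * Ag (om r))", symmetric])
    show "integrable (lborel \<Otimes>\<^sub>M Q) (case_prod (%r om. indicator {s<..s+h} r * (indicator U om * Ag (om r))))"
    proof (rule Bochner_Integration.integrable_bound)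
      show "integrable (lborel \<Otimes>\<^sub>M Q) (%p. C * indicator ({s..s+h} \<times> space Q) p)"
      proof (intro integrable_mult_right integrable_real_indicator)
        show "emeasure (lborel \<Otimes>\<^sub>M Q) ({s..s + h} \<times> space Q) < \<infinity>"
          using s by (subst emeasure_pair_measure_Times) (auto simp: emeasure_space_1)
      qed auto
      show "AE p in lborel \<Otimes>\<^sub>M Q. norm (case_prod (%r om. indicator {s<..s+h} r * (indicator U om * Ag (om r))) p) <= norm (C * indicator ({s..s+h} \<times> space Q) p)"
      proof (rule AE_I2)
        fix p :: "real \<times> (real => (real^'d) \<times> nat)" assume "p : space (lborel \<Otimes>\<^sub>M Q)"
        thus "norm (case_prod (%r om. indicator {s<..s+h} r * (indicator U om * Ag (om r))) p) <= norm (C * indicator ({s..s+h} \<times> space Q) p)"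
          using A(3)[of "snd p (fst p)"] C0 by (cases p) (auto simp: indicator_def space_pair_measure)
      qed
      have "(%p. indicator {s<..s+h} (fst p) * (indicator U (snd p) * Ag (snd p (fst p)))) : borel_measurable (lborel \<Otimes>\<^sub>M Q)"
        by (rule lQ_measurable) measurable
      thus "case_prod (%r om. indicator {s<..s+h} r * (indicator U om * Ag (om r))) : borel_measurable (lborel \<Otimes>\<^sub>M Q)" by (simp add: split_beta')
    qed
  qed
  also have "... = (LINT r|lborel. indicator {s<..s+h} r * (LINT om|Q. live R s om * Ag (om r)))"
    by (simp add: lU cong: Bochner_Integration.integral_cong)
  also have "... <= (LINT r|lborel. indicator {s<..s+h} r * (surv R Ag r + C * (surv R (%_. 1) s - surv R (%_. 1) (s + h))))"
  proof (rule integral_mono)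
    define D where "D = surv R (%_. 1) s - surv R (%_. 1) (s + h)"
    have i1: "integrable Q (live R r)" for r using surv_integrable[of "%_. 1" 1 R r 0] by simp
    show le: "indicator {s<..s+h} r * (LINT om|Q. live R s om * Ag (om r)) <= indicator {s<..s+h} r * (surv R Ag r + C * (surv R (%_. 1) s - surv R (%_. 1) (s + h)))" for r
    proof (cases "r : {s<..s+h}")
      case True
      have "(LINT om|Q. live R s om * Ag (om r)) <= (LINT om|Q. live R r om * Ag (om r) + C * (live R s om - live R (s + h) om))"
      proof (rule integral_mono)
        fix om
        have l1: "live R r om <= live R s om" "live R (s + h) om <= live R r om" using True s by (auto intro!: live_antimono)
        have "(live R s om - live R r om) * Ag (om r) <= (live R s om - live R r om) * C" using A(3)[of "om r"] l1 by (intro mult_left_mono) auto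
        also have "... <= (live R s om - live R (s + h) om) * C" using C0 l1 by (intro mult_right_mono) auto
        finally show "live R s om * Ag (om r) <= live R r om * Ag (om r) + C * (live R s om - live R (s + h) om)" by (simp add: algebra_simps)
      qed (use surv_integrable[OF A(1,3)] i1 in auto)
      also have "... = surv R Ag r + C * (surv R (%_. 1) s - surv R (%_. 1) (s + h))"
        unfolding surv_def using surv_integrable[OF A(1,3)] i1 by simp
      finally show ?thesis using True by simp
    qed simp
    have ic: "integrable lborel (%r. indicator {s<..s+h} r * f r)" if "f : borel_measurable borel" "!!r. \<bar>f r\<bar> <= K" for f and K :: real
      by (rule Bochner_Integration.integrable_bound[OF iC[of K s "s + h"]])
         (use that in \<open>auto simp: indicator_def intro: order_trans[OF _ abs_ge_self]\<close>)
    have sb: "\<bar>surv R Ag r\<bar> <= C" for r by (rule surv_bound[OF A(1,3)])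
    have lm: "(%r. \<integral>om. live R s om * Ag (om r) \<partial>Q) : borel_measurable borel"
    proof -
      have "(%p. live R s (snd p) * Ag (snd p (fst p))) : borel_measurable (borel \<Otimes>\<^sub>M Q)" by measurable
      thus ?thesis by (intro borel_measurable_lebesgue_integral) (simp add: split_beta')
    qed
    have lb: "\<bar>\<integral>om. live R s om * Ag (om r) \<partial>Q\<bar> <= C" for r
    proof -
      have "\<bar>live R s om * Ag (om r)\<bar> <= C" for om
        using mult_mono[of "live R s om" 1 "\<bar>Ag (om r)\<bar>" C] A(3)[of "om r"] by (simp add: abs_mult)
      hence "(LINT om|Q. \<bar>live R s om * Ag (om r)\<bar>) <= C"
        using surv_integrable[OF A(1,3), of R s r] by (intro integral_le_const) auto
      thus ?thesis by (rule order_trans[OF integral_abs_bound])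
    qed
    show "integrable lborel (%r. indicator {s<..s+h} r * (LINT om|Q. live R s om * Ag (om r)))"
      by (rule ic[OF lm lb])
    have "\<bar>surv R Ag r + C * (surv R (%_. 1) s - surv R (%_. 1) (s + h))\<bar> <= C + \<bar>C * (surv R (%_. 1) s - surv R (%_. 1) (s + h))\<bar>" for r
      using sb[of r] by linarith
    thus "integrable lborel (%r. indicator {s<..s+h} r * (surv R Ag r + C * (surv R (%_. 1) s - surv R (%_. 1) (s + h))))"
      by (intro ic) measurable
  qed
  also have "... = (LINT r|lborel. indicator {0<..h} r * (surv R Ag (s + r) + C * (surv R (%_. 1) s - surv R (%_. 1) (s + h))))"
    by (subst lborel_integral_real_affine[of 1 _ s]) (auto simp: indicator_def intro!: Bochner_Integration.integral_cong)
  also have "... = (LINT r|lborel. indicator {0<..h} r * surv R Ag (s + r)) + C * h * (surv R (%_. 1) s - surv R (%_. 1) (s + h))"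
  proof -
    have ii: "integrable lborel (%r. indicator {0<..h} r :: real)" using s
      by (intro integrable_real_indicator) (auto simp: emeasure_lborel_Ioc)
    have "integrable lborel (%r. indicator {0<..h} r * surv R Ag (s + r))"
      by (rule Bochner_Integration.integrable_bound[OF integrable_mult_right[OF ii, of C]])
         (use surv_bound[OF A(1,3)] C0 in \<open>auto simp: indicator_def\<close>)
    thus ?thesis using ii s by (simp add: distrib_left)
  qed
  finally have E2: "(LINT om|Q. indicator U om * I (s + h) om) - (LINT om|Q. indicator U om * I s om)
     <= (LINT r|lborel. indicator {0<..h} r * surv R Ag (s + r)) + C * h * (surv R (%_. 1) s - surv R (%_. 1) (s + h))" .
  have "(LINT om|Q. indicator U om * g (om s)) = surv R g s" unfolding surv_def
    by (simp add: lU cong: Bochner_Integration.integral_cong)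
  moreover have "surv R g (s + h) <= (LINT om|Q. indicator U om * g (om (s + h)))" unfolding surv_def
  proof (rule integral_mono)
    fix om assume "om : space Q"
    thus "live R (s + h) om * g (om (s + h)) <= indicator U om * g (om (s + h))"
      using live_antimono[of s "s + h" R om] s g(3)[of "om (s + h)"] by (auto simp: lU[symmetric] intro!: mult_right_mono)
  qed (use ig surv_integrable[OF g(2) gb] in auto)
  ultimately show ?thesis using E1 E2 by linarith
qed

text \<open>Under the average over the window, the lost mass becomes the difference of two shifted
  window integrals, hence of order \<open>h\<close>; the same holds for the variation of
  \<open>surv R Ag\<close> between \<open>s\<close> and \<open>s + r\<close>. Both errors carry
  another factor \<open>h\<close>. The averaging thus replaces continuity in time of
  \<open>surv R Ag\<close>.\<close>

lemma flow_step:
  assumes g: "g : test" "g : borel_measurable borel" "!!z. 0 <= g z" "!!z. g z <= Cg"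
    and A: "Ag : borel_measurable borel" "!!z. snd z : S ==> Ag z = G g z" "!!z. \<bar>Ag z\<bar> <= C"
    and t: "0 <= t" "0 <= h" and tau: "tau > 0"
  shows "(\<integral>z. g z \<partial>flow R tau (t + h)) <= (\<integral>z. g z \<partial>flow R tau t) + h * (\<integral>z. Ag z \<partial>flow R tau t) + 4 * C * h^2 / tau"
proof -
  note [measurable] = g(2) A(1)
  have gb: "\<bar>g z\<bar> <= Cg" for z using g(3,4) by simp
  have C0: "C >= 0" using A(3)[of undefined] by linarith
  have iC: "integrable lborel (%r. indicator {a..c} r * f r)" if "f : borel_measurable borel" "!!r. \<bar>f r\<bar> <= K" for a c K and f :: "real => real"
  proof (rule Bochner_Integration.integrable_bound)
    show "integrable lborel (%r. K * indicator {a..c} r)"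
      by (intro integrable_mult_right integrable_real_indicator) (auto simp: emeasure_lborel_Icc_eq)
  qed (use that in \<open>auto simp: indicator_def intro: order_trans[OF _ abs_ge_self]\<close>)
  have s1: "\<bar>surv R (%_. 1) s\<bar> <= 1" for s by (rule surv_bound) auto
  have sA: "\<bar>surv R Ag s\<bar> <= C" for s by (rule surv_bound[OF A(1,3)])
  have sg: "\<bar>surv R g s\<bar> <= Cg" for s by (rule surv_bound[OF g(2) gb])
  define W where "W f a = (LINT s|lborel. indicator {a..a+tau} s * f s)" for f :: "real => real" and a
  have Wshift: "W f (t + v) = (LINT s|lborel. indicator {t..t+tau} s * f (s + v))" for f v
    unfolding W_def by (subst lborel_integral_real_affine[of 1 _ v]) (auto simp: indicator_def add_ac intro!: Bochner_Integration.integral_cong)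
  define J where "J s = (LINT r|lborel. indicator {0<..h} r * surv R Ag (s + r))" for s
  define \<pi> where "\<pi> = surv R (%_. 1)"
  have [measurable]: "\<pi> : borel_measurable borel" unfolding \<pi>_def by measurable
  have Jm[measurable]: "J : borel_measurable borel" unfolding J_def by measurable
  have ih: "integrable lborel (%r. indicator {0<..h} r * f r)" if "f : borel_measurable borel" "!!r. \<bar>f r\<bar> <= K" for K and f :: "real => real"
  proof (rule Bochner_Integration.integrable_bound)
    show "integrable lborel (%r. K * indicator {0<..h} r)" using t by (intro integrable_mult_right integrable_real_indicator) (auto simp: emeasure_lborel_Ioc)
  qed (use that in \<open>auto simp: indicator_def intro: order_trans[OF _ abs_ge_self]\<close>)
  have Jb: "\<bar>J s\<bar> <= C * h" for s
  proof -
    have "\<bar>J s\<bar> <= (LINT r|lborel. indicator {0<..h} r * C)" unfolding J_def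
    proof (rule order_trans[OF integral_abs_bound integral_mono])
      show "integrable lborel (%r. \<bar>indicator {0<..h} r * surv R Ag (s + r)\<bar>)" by (rule integrable_abs[OF ih[OF _ sA]]) measurable
      show "integrable lborel (%r. indicator {0<..h} r * C)" by (rule ih[of "%_. C" C]) (use C0 in auto)
      show "\<bar>indicator {0<..h} r * surv R Ag (s + r)\<bar> <= indicator {0<..h} r * C" for r using sA[of "s + r"] by (simp add: indicator_def)
    qed
    thus ?thesis using t by (simp add: mult.commute)
  qed
  have pb: "\<bar>\<pi> s - \<pi> (s + h)\<bar> <= 2" for s using s1[of s] s1[of "s + h"] unfolding \<pi>_def by linarith
  have "W (surv R g) (t + h) <= (LINT s|lborel. indicator {t..t+tau} s * surv R g s + indicator {t..t+tau} s * J s + C * h * (indicator {t..t+tau} s * (\<pi> s - \<pi> (s + h))))"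
    unfolding Wshift
  proof (rule integral_mono)
    show "indicator {t..t+tau} s * surv R g (s + h) <= indicator {t..t+tau} s * surv R g s + indicator {t..t+tau} s * J s + C * h * (indicator {t..t+tau} s * (\<pi> s - \<pi> (s + h)))" for s
      using surv_step[OF g A, of s h R] t by (auto simp: indicator_def J_def \<pi>_def)
    show "integrable lborel (%s. indicator {t..t+tau} s * surv R g (s + h))" by (rule iC[OF _ sg]) measurable
    show "integrable lborel (%s. indicator {t..t+tau} s * surv R g s + indicator {t..t+tau} s * J s + C * h * (indicator {t..t+tau} s * (\<pi> s - \<pi> (s + h))))"
      by (intro Bochner_Integration.integrable_add integrable_mult_right iC[OF _ sg] iC[OF _ Jb] iC[OF _ pb]) measurable
  qed
  also have "... = W (surv R g) t + W J t + C * h * (LINT s|lborel. indicator {t..t+tau} s * (\<pi> s - \<pi> (s + h)))"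
  proof -
    have "integrable lborel (%s. indicator {t..t+tau} s * surv R g s)" "integrable lborel (%s. indicator {t..t+tau} s * J s)"
      "integrable lborel (%s. indicator {t..t+tau} s * (\<pi> s - \<pi> (s + h)))"
      by (rule iC[OF _ sg] iC[OF _ Jb] iC[OF _ pb], measurable)+
    thus ?thesis unfolding W_def by simp
  qed
  finally have main: "W (surv R g) (t + h) <= W (surv R g) t + W J t + C * h * (LINT s|lborel. indicator {t..t+tau} s * (\<pi> s - \<pi> (s + h)))" .
  have "(LINT s|lborel. indicator {t..t+tau} s * (\<pi> s - \<pi> (s + h))) = W \<pi> t - W \<pi> (t + h)"
  proof -
    have "integrable lborel (%s. indicator {t..t+tau} s * \<pi> s)" "integrable lborel (%s. indicator {t..t+tau} s * \<pi> (s + h))"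
      by (rule iC[OF _ s1[folded \<pi>_def]], measurable)+
    thus ?thesis unfolding Wshift by (simp add: W_def right_diff_distrib)
  qed
  moreover have "\<bar>W \<pi> (t + h) - W \<pi> t\<bar> <= 2 * 1 * h"
    unfolding W_def by (rule window_shift) (use s1 t tau in \<open>auto simp: \<pi>_def\<close>)
  ultimately have "(LINT s|lborel. indicator {t..t+tau} s * (\<pi> s - \<pi> (s + h))) <= 2 * h" by linarith
  hence p2: "C * h * (LINT s|lborel. indicator {t..t+tau} s * (\<pi> s - \<pi> (s + h))) <= C * h * (2 * h)"
    using C0 t by (intro mult_left_mono) auto
  have "W J t = (LINT r|lborel. indicator {0<..h} r * W (surv R Ag) (t + r))"
  proof -
    have "integrable (lborel \<Otimes>\<^sub>M lborel) (%(s, r). indicator {t..t+tau} s * (indicator {0<..h} r * surv R Ag (s + r)))"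
    proof (rule Bochner_Integration.integrable_bound)
      show "integrable (lborel \<Otimes>\<^sub>M lborel) (%p. C * indicator ({t..t+tau} \<times> {0..h}) p)"
      proof (intro integrable_mult_right integrable_real_indicator)
        show "emeasure (lborel \<Otimes>\<^sub>M lborel) ({t..t + tau} \<times> {0..h}) < \<infinity>"
          using t tau by (subst lborel.emeasure_pair_measure_Times) (auto simp: ennreal_mult[symmetric])
      qed auto
      show "AE p in lborel \<Otimes>\<^sub>M lborel. norm (case p of (s, r) => indicator {t..t+tau} s * (indicator {0<..h} r * surv R Ag (s + r)))
         <= norm (C * indicator ({t..t+tau} \<times> {0..h}) p)"
        using sA C0 by (intro AE_I2) (auto simp: indicator_def)
    qed measurable
    from lborel_pair.Fubini_integral[OF this]
    have "(LINT s|lborel. (LINT r|lborel. indicator {t..t+tau} s * (indicator {0<..h} r * surv R Ag (s + r))))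
      = (LINT r|lborel. (LINT s|lborel. indicator {t..t+tau} s * (indicator {0<..h} r * surv R Ag (s + r))))" by simp
    thus ?thesis unfolding Wshift unfolding W_def J_def
      by (simp only: mult.left_commute[of "indicator {t..t+tau} _" "indicator {0<..h} _"])
         (simp flip: integral_mult_right_zero add: mult.left_commute)
  qed
  also have "... <= (LINT r|lborel. indicator {0<..h} r * (W (surv R Ag) t + 2 * C * h))"
  proof (rule integral_mono)
    have ws: "\<bar>W (surv R Ag) (t + r) - W (surv R Ag) t\<bar> <= 2 * C * r" if "0 <= r" for r
      unfolding W_def by (rule window_shift) (use sA tau that in auto)
    show le: "indicator {0<..h} r * W (surv R Ag) (t + r) <= indicator {0<..h} r * (W (surv R Ag) t + 2 * C * h)" for r
    proof (cases "r : {0<..h}")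
      case True
      hence "2 * C * r <= 2 * C * h" using C0 by (intro mult_left_mono) auto
      thus ?thesis using True ws[of r] by simp
    qed simp
    have Wm: "(%r. W (surv R Ag) (t + r)) : borel_measurable borel" unfolding Wshift by measurable
    have Wb: "\<bar>indicator {0<..h} r * W (surv R Ag) (t + r)\<bar> <= indicator {0<..h} r * (\<bar>W (surv R Ag) t\<bar> + 2 * C * h)" for r
    proof (cases "r : {0<..h}")
      case True
      hence "2 * C * r <= 2 * C * h" using C0 by (intro mult_left_mono) auto
      thus ?thesis using True ws[of r] by simp
    qed simp
    have ic: "integrable lborel (%r. indicator {0<..h} r * c)" for c :: real by (rule ih[of "%_. c" "\<bar>c\<bar>"]) auto
    show "integrable lborel (%r. indicator {0<..h} r * (W (surv R Ag) t + 2 * C * h))" by (rule ic)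
    show "integrable lborel (%r. indicator {0<..h} r * W (surv R Ag) (t + r))"
      by (rule Bochner_Integration.integrable_bound[OF ic[of "\<bar>W (surv R Ag) t\<bar> + 2 * C * h"]])
         (use Wm Wb in \<open>auto intro!: AE_I2 intro: order_trans[OF _ abs_ge_self]\<close>)
  qed
  also have "... = h * W (surv R Ag) t + 2 * C * h^2" using t by (simp add: algebra_simps power2_eq_square)
  finally have "W (surv R g) (t + h) <= W (surv R g) t + h * W (surv R Ag) t + 4 * C * h^2"
    using main p2 by (simp add: power2_eq_square algebra_simps)
  hence "W (surv R g) (t + h) / tau <= (W (surv R g) t + h * W (surv R Ag) t + 4 * C * h^2) / tau"
    using tau by (intro divide_right_mono) auto
  thus ?thesis
    unfolding flow_integral(2)[OF g(2) gb tau] flow_integral(2)[OF A(1,3) tau] W_def[symmetric]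
    by (simp add: add_divide_distrib)
qed

end

section \<open>Duality along the chain\<close>

lemma integral_swap_bounded:
  fixes \<Phi> :: "'a => 'b => real"
  assumes M: "sigma_finite_measure M" and P: "prob_space P"
    and \<Phi>: "(%(u, w). \<Phi> u w) : borel_measurable (M \<Otimes>\<^sub>M P)" and g: "integrable M g" and b: "!!u w. \<bar>\<Phi> u w\<bar> <= g u"
  shows "(LINT u|M. (LINT w|P. \<Phi> u w)) = (LINT w|P. (LINT u|M. \<Phi> u w))" "integrable P (%w. \<integral>u. \<Phi> u w \<partial>M)"
proof -
  interpret M: sigma_finite_measure M by fact
  interpret P: prob_space P by fact
  interpret MP: pair_sigma_finite M P by unfold_locales
  have gp: "integrable (M \<Otimes>\<^sub>M P) (%p. g (fst p))"
  proof (rule MP.Fubini_integrable)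
    show "(%p. g (fst p)) : borel_measurable (M \<Otimes>\<^sub>M P)" using g by measurable
    show "integrable M (%x. LINT y|P. norm (g (fst (x, y))))" using g by (simp add: P.prob_space)
    show "AE x in M. integrable P (%y. g (fst (x, y)))" by simp
  qed
  have int: "integrable (M \<Otimes>\<^sub>M P) (case_prod \<Phi>)"
    by (rule Bochner_Integration.integrable_bound[OF gp]) (use \<Phi> b in \<open>auto intro!: AE_I2 intro: order_trans[OF _ abs_ge_self]\<close>)
  show "(LINT u|M. (LINT w|P. \<Phi> u w)) = (LINT w|P. (LINT u|M. \<Phi> u w))" by (rule MP.Fubini_integral[OF int, symmetric])
  show "integrable P (%w. \<integral>u. \<Phi> u w \<partial>M)" by (rule MP.integrable_snd[OF int])
qed

lemma measurable_slices:
  fixes F :: "(real^'d::finite) \<times> nat => real"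
  assumes S: "finite S" and F: "!!l. l : S ==> (%y. F (y, l)) : borel_measurable borel"
  shows "(%z. if snd z : S then F z else 0) : borel_measurable borel"
proof -
  have "(%z. \<Sum>l\<in>S. indicator (snd -` {l}) z * F (fst z, l)) : borel_measurable borel"
  proof (intro borel_measurable_sum borel_measurable_times)
    fix l assume l: "l : S"
    have "snd -` {l} : sets (borel :: ((real^'d) \<times> nat) measure)"
      by (intro borel_open open_vimage continuous_on_snd continuous_on_id) (rule discrete_topology_class.open_discrete)
    thus "indicator (snd -` {l}) : borel_measurable (borel :: ((real^'d) \<times> nat) measure)" by simp
    have "(fst :: (real^'d) \<times> nat => real^'d) : borel_measurable borel"
      by (intro borel_measurable_continuous_onI continuous_on_fst continuous_on_id)
    from measurable_compose[OF this F[OF l]] show "(%z::(real^'d) \<times> nat. F (fst z, l)) : borel_measurable borel" .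
  qed
  moreover have "(\<Sum>l\<in>S. indicator (snd -` {l}) z * F (fst z, l)) = (if snd z : S then F z else 0)" for z
  proof -
    have "(\<Sum>l\<in>S. indicator (snd -` {l}) z * F (fst z, l)) = (\<Sum>l\<in>S. if l = snd z then F z else 0)"
      by (intro sum.cong) (auto simp: indicator_def)
    thus ?thesis using S by simp
  qed
  ultimately show ?thesis by simp
qed

section \<open>Mollified dual functions and the backward step\<close>

locale mollified_coupling = coupling a b \<nu> q n0 eps0 \<sigma> lam CN CQ HQ N v0 T \<delta> kap kap1 M th th1 \<eta> R B epsp eps L p
  for a :: "'d::finite coef_a" and b \<nu> q n0 eps0 \<sigma> lam CN CQ HQ N v0 T \<delta> kap kap1 M th th1 \<eta> R B epsp eps L p +
  fixes W :: "(real^'d) measure" and C3 :: real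
  assumes W_prob: "prob_space W" and W_sets: "sets W = sets borel" and W_AE: "AE w in W. norm w <= \<eta>"
    and W_test: "!!f. continuous_on UNIV f ==> bounded {y. f y ~= 0} ==> (!!y. \<bar>f y\<bar> <= 1) ==>
        Cc_inf (%x. \<integral>w. f (x + w) \<partial>W) & test_bound C3 (%x. \<integral>w. f (x + w) \<partial>W)"
    and \<eta>1: "\<eta> <= 1" and n0: "1 <= n0"
begin

abbreviation "S0 \<equiv> Sset n0"

lemma S0_finite: "finite S0" by (simp add: Sset_def)
lemma S0_ne: "1 : S0" using n0 by (simp add: Sset_def)

definition moll :: "((real^'d) \<times> nat => real) => (real^'d) \<times> nat => real" where
  "moll f z = (if snd z : S0 then \<integral>w. f (fst z + w, snd z) \<partial>W else 0)"

definition adm_fun :: "((real^'d) \<times> nat => real) => bool" where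
  "adm_fun f \<longleftrightarrow> (ALL l:S0. continuous_on UNIV (%y. f (y, l))) & (ALL z. 0 <= f z & f z <= 1)"

lemma adm_funD: assumes "adm_fun f" shows "l : S0 ==> continuous_on UNIV (%y. f (y, l))" "0 <= f z" "f z <= 1"
    "l : S0 ==> (%y. f (y, l)) : borel_measurable borel"
proof -
  show c: "l : S0 ==> continuous_on UNIV (%y. f (y, l))" and "0 <= f z" "f z <= 1"
    using assms unfolding adm_fun_def by blast+
  show "l : S0 ==> (%y. f (y, l)) : borel_measurable borel" by (intro borel_measurable_continuous_onI c)
qed

lemma W_integrable:
  assumes "F : borel_measurable borel" "!!u. \<bar>F u\<bar> <= (C::real)"
  shows "integrable W F"
proof -
  interpret prob_space W by (rule W_prob)
  show ?thesis by (rule integrable_const_bound[where B=C])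
    (use assms in \<open>auto simp: measurable_cong_sets[OF W_sets refl]\<close>)
qed

lemma moll_slice_measurable:
  fixes f :: "(real^'d) \<times> nat => real"
  assumes "(%y. f (y, l)) : borel_measurable borel"
  shows "(%x. \<integral>w. f (x + w, l) \<partial>W) : borel_measurable borel"
proof -
  interpret W: prob_space W by (rule W_prob)
  have "(%p::(real^'d) \<times> (real^'d). fst p + snd p) : borel \<Otimes>\<^sub>M W \<rightarrow>\<^sub>M borel"
  proof -
    have "snd : borel \<Otimes>\<^sub>M W \<rightarrow>\<^sub>M borel" using measurable_snd[of borel W] by (simp add: measurable_cong_sets[OF refl W_sets])
    thus ?thesis by measurable
  qed
  from measurable_compose[OF this assms] have "(%(x, w). f (x + w, l)) : borel_measurable (borel \<Otimes>\<^sub>M W)" by (simp add: split_beta')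
  thus ?thesis by (rule W.borel_measurable_lebesgue_integral)
qed

lemma moll_props:
  assumes f: "!!l. l : S0 ==> (%y. f (y, l)) : borel_measurable borel" "!!z. 0 <= f z" "!!z. f z <= C"
  shows "moll f : borel_measurable borel" "0 <= moll f z" "moll f z <= C"
proof -
  interpret prob_space W by (rule W_prob)
  show "moll f : borel_measurable borel"
    unfolding moll_def[abs_def]
    by (rule measurable_slices[OF S0_finite, of "%z. \<integral>w. f (fst z + w, snd z) \<partial>W"])
       (use moll_slice_measurable[of f] f(1) in simp)
  show "0 <= moll f z" using f(2) by (simp add: moll_def)
  have "0 <= C" using f(2)[of z] f(3)[of z] by linarith
  moreover have "(LINT w|W. f (fst z + w, snd z)) <= C" if "snd z : S0"
  proof (rule integral_le_const)
    have "(%w. f (fst z + w, snd z)) : borel_measurable borel" using measurable_compose[OF _ f(1)[OF that], of "(+) (fst z)" borel] by simp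
    thus "integrable W (%w. f (fst z + w, snd z))" using f by (intro W_integrable[where C=C]) auto
  qed (use f in auto)
  ultimately show "moll f z <= C" by (simp add: moll_def)
qed

text \<open>With coefficients frozen at \<open>(x, k)\<close>, every move of \<open>Kop\<close>
  shifts the position by an amount that does not depend on the position, so \<open>Kop\<close>
  commutes with averaging over translations. This is why it takes the two points \<open>x\<close>
  and \<open>y\<close> separately.\<close>

lemma Kop_moll:
  assumes f: "!!l. l : S0 ==> (%y. f (y, l)) : borel_measurable borel" "!!z. 0 <= f z" "!!z. f z <= 1" and k: "k : S0"
  shows "Kop eps L st (moll f) x k x = (LINT w|W. Kop eps L st f x k (x + w))" "integrable W (%w. Kop eps L st f x k (x + w))"
proof -
  interpret W: prob_space W by (rule W_prob)
  interpret N: prob_space N by (rule N_prob)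
  note [measurable_cong] = W_sets N_sets
  define F where "F l y = f (y, l)" for l y
  have Fm[measurable]: "F l : borel_measurable borel" if "l : S0" for l using f(1)[OF that] by (simp add: F_def[abs_def])
  have Fb: "\<bar>F l y\<bar> <= 1" for l y using f(2)[of "(y, l)"] f(3)[of "(y, l)"] by (simp add: F_def)
  have iW: "integrable W (%w. F l (c + w))" if "l : S0" for l c
    by (rule W_integrable[where C=1]) (use Fm[OF that] Fb in auto)
  have mo: "moll f (y, l) = (LINT w|W. F l (y + w))" if "l : S0" for y l using that by (simp add: moll_def F_def)
  note Fk[measurable] = Fm[OF k]
  have Nsw: "(LINT u|N. (LINT w|W. F k (x + (st * m1) *\<^sub>R u + w))) = (LINT w|W. (LINT u|N. F k (x + w + (st * m1) *\<^sub>R u)))"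
      "integrable W (%w. \<integral>u. F k (x + w + (st * m1) *\<^sub>R u) \<partial>N)"
  proof -
    have m: "(%(u, w). F k (x + w + (st * m1) *\<^sub>R u)) : borel_measurable (N \<Otimes>\<^sub>M W)" by measurable
    note sw = integral_swap_bounded[OF N.sigma_finite_measure_axioms W_prob m, of "%_. 1"]
    show "(LINT u|N. (LINT w|W. F k (x + (st * m1) *\<^sub>R u + w))) = (LINT w|W. (LINT u|N. F k (x + w + (st * m1) *\<^sub>R u)))"
      using sw(1) Fb by (simp add: add_ac)
    show "integrable W (%w. \<integral>u. F k (x + w + (st * m1) *\<^sub>R u) \<partial>N)" using sw(2) Fb by simp
  qed
  have Jsw: "(LINT u|(\<nu> x k). (LINT w|W. F k (x + u + w)) * indicator (far eps) u) = (LINT w|W. (LINT u|(\<nu> x k). F k (x + w + u) * indicator (far eps) u))"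
      "integrable W (%w. \<integral>u. F k (x + w + u) * indicator (far eps) u \<partial>(\<nu> x k))"
  proof -
    note [measurable_cong] = nu_sets[OF k]
    have m: "(%(u, w). F k (x + w + u) * indicator (far eps) u) : borel_measurable (\<nu> x k \<Otimes>\<^sub>M W)" by measurable
    have g: "integrable (\<nu> x k) (indicator (far eps) :: _ => real)"
      by (rule far_integrable[OF k eps(1,2), where C=1]) auto
    have b: "\<bar>F k (x + w + u) * indicator (far eps) u\<bar> <= indicator (far eps) u" for u w using Fb by (simp add: indicator_def)
    note sw = integral_swap_bounded[OF nu_sf[OF k] W_prob m g b]
    show "(LINT u|(\<nu> x k). (LINT w|W. F k (x + u + w)) * indicator (far eps) u) = (LINT w|W. (LINT u|(\<nu> x k). F k (x + w + u) * indicator (far eps) u))"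
      using sw(1) by (simp add: add_ac)
    show "integrable W (%w. \<integral>u. F k (x + w + u) * indicator (far eps) u \<partial>(\<nu> x k))" using sw(2) .
  qed
  have iWc: "integrable W (%w. F l (x + w + c))" "(LINT w|W. F l (x + w + c)) = (LINT w|W. F l (x + c + w))" if "l : S0" for l c
    using iW[OF that, of "x + c"] by (simp_all add: add_ac)
  have iWm: "integrable W (%w. F l (x + w - c))" "(LINT w|W. F l (x + w - c)) = (LINT w|W. F l (x - c + w))" if "l : S0" for l c
    using iWc[OF that, of "- c"] by simp_all
  have iW0: "integrable W (%w. F l (x + w))" if "l : S0" for l using iW[OF that] .
  have d: "dif eps st x k (%y. moll f (y, k)) x = (LINT w|W. dif eps st x k (F k) (x + w))" "integrable W (%w. dif eps st x k (F k) (x + w))"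
    unfolding dif_def mo[OF k] using iWc[OF k] iWm[OF k] Nsw by (simp_all add: Bochner_Integration.integral_sum)
  have j: "jmp eps L x k (%y. moll f (y, k)) x = (LINT w|W. jmp eps L x k (F k) (x + w))" "integrable W (%w. jmp eps L x k (F k) (x + w))"
    unfolding jmp_def mo[OF k] using iW0[OF k] Jsw by simp_all
  have s: "swi L x k (%l. moll f (x, l)) = (LINT w|W. swi L x k (%l. F l (x + w)))" "integrable W (%w. swi L x k (%l. F l (x + w)))"
  proof -
    have "swi L x k (%l. moll f (x, l)) = (\<Sum>l\<in>S0 - {k}. (LINT w|W. F l (x + w)) * q x k l) + (L - (\<Sum>l\<in>S0 - {k}. q x k l)) * (LINT w|W. F k (x + w))"
      unfolding swi_def using mo k by simp
    also have "... = (LINT w|W. swi L x k (%l. F l (x + w)))"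
      unfolding swi_def using iW0 k by (subst Bochner_Integration.integral_add) (auto intro!: Bochner_Integration.integrable_sum simp: Bochner_Integration.integral_sum)
    finally show "swi L x k (%l. moll f (x, l)) = (LINT w|W. swi L x k (%l. F l (x + w)))" .
    show "integrable W (%w. swi L x k (%l. F l (x + w)))"
      unfolding swi_def using iW0 k by (auto intro!: Bochner_Integration.integrable_sum)
  qed
  have K: "Kop eps L st f x k (x + w) = (1 - 2 * st^2 * L) * dif eps st x k (F k) (x + w) + st^2 * (jmp eps L x k (F k) (x + w) + swi L x k (%l. F l (x + w)))" for w
    unfolding Kop_def F_def ..
  show "Kop eps L st (moll f) x k x = (LINT w|W. Kop eps L st f x k (x + w))"
    unfolding K using d(2) j(2) s(2) unfolding Kop_def d(1) j(1) s(1) by simp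
  show "integrable W (%w. Kop eps L st f x k (x + w))" unfolding K using d(2) j(2) s(2) by simp
qed

end

text \<open>An infimum of functions with a common Lipschitz constant inherits that constant.\<close>

lemma continuous_min_INF:
  fixes F :: "'p => 'a::real_normed_vector => real"
  assumes D: "D ~= {}" and F0: "!!p y. p : D ==> 0 <= F p y" and lip: "!!p y y'. p : D ==> F p y <= F p y' + K * norm (y - y')" and K: "K >= 0"
  shows "continuous_on UNIV (%y. min 1 (INF p\<in>D. F p y))"
proof -
  have le: "(INF p\<in>D. F p y) <= (INF p\<in>D. F p y') + K * norm (y - y')" for y y'
  proof -
    have "(INF p\<in>D. F p y) - K * norm (y - y') <= (INF p\<in>D. F p y')"
    proof (rule cINF_greatest[OF D])
      fix p assume p: "p : D"
      have "(INF p\<in>D. F p y) <= F p y" by (rule cINF_lower[OF bdd_belowI2[of _ 0] p]) (rule F0)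
      thus "(INF p\<in>D. F p y) - K * norm (y - y') <= F p y'" using lip[OF p, of y y'] by linarith
    qed
    thus ?thesis by linarith
  qed
  have "K-lipschitz_on UNIV (%y. INF p\<in>D. F p y)"
  proof (rule lipschitz_onI[OF _ K])
    fix x y :: 'a
    show "dist (INF p\<in>D. F p x) (INF p\<in>D. F p y) <= K * dist x y"
      using le[of x y] le[of y x] by (simp add: dist_real_def dist_norm norm_minus_commute abs_le_iff)
  qed
  hence "continuous_on UNIV (%y. INF p\<in>D. F p y)" by (rule lipschitz_on_continuous_on)
  thus ?thesis by (intro continuous_intros)
qed

context mollified_coupling begin

definition Lc :: real where "Lc = (2 + 2 * M) * real p / \<delta>"

lemma Lc_nonneg: "0 <= Lc" using M \<delta> by (simp add: Lc_def)

lemma cost_bounds: assumes "0 <= t" "t <= T" shows "0 <= cost t z z'" "cost t z z' <= c\<alpha> t + c\<beta> t"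
  using tcost_bounds[OF \<delta> kap(1) p coef_bounds(1,5)[OF assms]] coef_bounds[OF assms] by (auto simp: cost_def)

lemma cost_lipschitz:
  assumes t: "0 <= t" "t <= T"
  shows "cost t (y, k) (u, l) <= cost t (y1, k) (u1, l) + Lc * (norm (y - y1) + norm (u - u1))"
proof (cases "k = l")
  case True
  note cp = \<delta> kap(1) p coef_bounds(1,5)[OF t]
  have s: "tslope \<delta> kap p (c\<alpha> t) (c\<beta> t) r <= Lc" for r
    unfolding Lc_def by (rule order_trans[OF tslope_bounds(2)[OF cp]]) (use coef_bounds(6)[OF t] \<delta> in \<open>intro divide_right_mono mult_right_mono, auto\<close>)
  have "tcost \<delta> kap p (c\<alpha> t) (c\<beta> t) (norm ((y1 - u1) + ((y - y1) - (u - u1)))) <= tcost \<delta> kap p (c\<alpha> t) (c\<beta> t) (norm (y1 - u1))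
     + tslope \<delta> kap p (c\<alpha> t) (c\<beta> t) (norm (y1 - u1)) * norm ((y - y1) - (u - u1))" by (rule tcost_lipschitz[OF cp])
  moreover have "tslope \<delta> kap p (c\<alpha> t) (c\<beta> t) (norm (y1 - u1)) * norm ((y - y1) - (u - u1)) <= Lc * (norm (y - y1) + norm (u - u1))"
    by (intro mult_mono s norm_triangle_ineq4 Lc_nonneg) auto
  moreover have "(y1 - u1) + ((y - y1) - (u - u1)) = y - u" by simp
  ultimately show ?thesis using True by (simp add: cost_def)
next
  case False
  thus ?thesis using Lc_nonneg by (simp add: cost_def)
qed

text \<open>All that the duality has to know about the two flows: sub-probability measures on a
  fixed ball, and the action of one step on mollified functions up to an error \<open>E\<close>. The
  support condition on \<open>f\<close> ensures that its mollification is a test function of the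
  martingale problem.\<close>

definition sub_chain :: "real => real => (nat => ((real^'d) \<times> nat) measure) => nat => bool" where
  "sub_chain st E \<mu> n \<longleftrightarrow>
    (ALL i. sets (\<mu> i) = sets borel & finite_measure (\<mu> i) & measure (\<mu> i) UNIV <= 1 & (AE z in \<mu> i. norm (fst z) <= R & snd z : S0)) \<and>
    (ALL i f f'. i < n --> adm_fun f --> adm_fun f' --> (ALL y l. R + 2 <= norm y --> f (y, l) = 0) -->
       (ALL x k w. norm x <= R --> k : S0 --> norm w <= \<eta> --> Kop eps L st f x k (x + w) <= f' (x + w, k)) -->
       (\<integral>z. moll f z \<partial>\<mu> (Suc i)) <= (\<integral>z. moll f' z \<partial>\<mu> i) + E)"

lemma moll_local:
  assumes "!!w. norm w <= \<eta> ==> f (fst z + w, snd z) = g (fst z + w, snd z)"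
    and "!!l. l : S0 ==> (%y. f (y, l)) : borel_measurable borel" "!!l. l : S0 ==> (%y. g (y, l)) : borel_measurable borel"
  shows "moll f z = moll g z"
proof (cases "snd z : S0")
  case True
  have m: "(%w. f' (fst z + w, snd z)) : borel_measurable W" if "(%y. f' (y, snd z)) : borel_measurable borel" for f' :: "(real^'d) \<times> nat => real"
    using measurable_compose[OF _ that, of "(+) (fst z)" borel] measurable_cong_sets[OF W_sets refl] by auto
  have "AE w in W. f (fst z + w, snd z) = g (fst z + w, snd z)" using W_AE by eventually_elim (rule assms(1))
  hence "(LINT w|W. f (fst z + w, snd z)) = (LINT w|W. g (fst z + w, snd z))"
    by (intro integral_cong_AE m assms True)
  thus ?thesis by (simp add: moll_def)
qed (simp add: moll_def)

text \<open>Restores compact support without changing the function within distance 1 of the ball of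
  radius \<open>R\<close>. Since \<open>\<eta> <= 1\<close>, the mollification is unchanged on that
  ball, which carries the measures.\<close>

definition cut :: "((real^'d) \<times> nat => real) => (real^'d) \<times> nat => real" where
  "cut f z = f z * max 0 (min 1 (R + 2 - norm (fst z)))"

lemma cut:
  assumes f: "adm_fun f"
  shows "adm_fun (cut f)" "cut f z <= f z" "R + 2 <= norm y ==> cut f (y, l) = 0" "norm (fst z) <= R ==> moll (cut f) z = moll f z"
proof -
  note af = adm_funD[OF f]
  have c: "0 <= max 0 (min 1 (R + 2 - norm y))" "max 0 (min 1 (R + 2 - norm y)) <= 1" for y :: "real^'d" by auto
  show le: "cut f z <= f z" for z unfolding cut_def using af(2) c by (intro mult_left_le) auto
  have n: "0 <= cut f z" for z unfolding cut_def using af(2) c by (intro mult_nonneg_nonneg) auto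
  show ac: "adm_fun (cut f)" unfolding adm_fun_def
  proof (intro conjI ballI allI)
    show "continuous_on UNIV (%y. cut f (y, l))" if "l : S0" for l
      unfolding cut_def fst_conv by (intro continuous_intros af(1) that)
    show "0 <= cut f z" "cut f z <= 1" for z using n[of z] le[of z] af(3)[of z] by auto
  qed
  show "cut f (y, l) = 0" if "R + 2 <= norm y" using that by (simp add: cut_def)
  show "moll (cut f) z = moll f z" if "norm (fst z) <= R"
  proof (rule moll_local)
    fix w :: "real^'d" assume "norm w <= \<eta>"
    hence "norm (fst z + w) <= R + 1" using norm_triangle_ineq[of "fst z" w] that \<eta>1 by linarith
    hence "max 0 (min 1 (R + 2 - norm (fst z + w))) = 1" by linarith
    thus "cut f (fst z + w, snd z) = f (fst z + w, snd z)" by (simp add: cut_def)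
  qed (intro adm_funD(4)[OF ac] af(4); assumption)+
qed

lemma moll_adm: assumes "adm_fun f" shows "moll f : borel_measurable borel" "0 <= moll f z" "moll f z <= 1"
  by (rule moll_props[where C=1], auto intro: adm_funD[OF assms])+

text \<open>Infimal convolution with the cost restores the continuity that \<open>Kop\<close> destroys.\<close>
lemma c_transform:
  assumes st: "0 < st" "2 * (st * m1) <= kap / 2" "4 * (st * m1) <= \<delta>" "st <= 1" "2 * st^2 * L <= 1" "Kst * st <= epsp / 2"
    and t: "0 <= t" "t + st^2 <= T"
    and f: "adm_fun f" and h: "adm_fun h" and Oc: "Oc >= 1"
    and adm: "!!z z'. snd z : S0 ==> snd z' : S0 ==> f z + h z' <= Oc + cost (t + st^2) z z'"
  obtains f1 h1 where "adm_fun f1" "adm_fun h1"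
    "!!z z'. snd z : S0 ==> snd z' : S0 ==> f1 z + h1 z' <= (Oc + epsp * st^2) + cost t z z'"
    "!!x k w. norm x <= R ==> k : S0 ==> norm w <= \<eta> ==> Kop eps L st f x k (x + w) <= f1 (x + w, k)"
    "!!x k w. norm x <= R ==> k : S0 ==> norm w <= \<eta> ==> Kop eps L st h x k (x + w) <= h1 (x + w, k)"
proof -
  have tT: "0 <= t" "t <= T" using t zero_le_power2[of st] by linarith+
  define O' where "O' = Oc + epsp * st^2"
  have O': "O' >= 1" using Oc epsp by (simp add: O'_def add_increasing2)
  have L0: "L >= 0" using L(2) CQ by (meson mult_nonneg_nonneg of_nat_0_le_iff order_trans zero_le_numeral)
  have LL: "CN / eps^2 <= L" "real n0 * CQ <= L" using L CN CQ eps L0 zero_le_divide_iff[of CN "eps^2"] by auto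
  have K1: "Kop eps L st g x k y <= 1" if "adm_fun g" "k : S0" for g x k y
    using adm_funD[OF that(1)] that(2) LL st(5) by (intro Kop_le eps) auto
  \<comment> \<open>A triple consists of a frozen point, a nearby position and a regime.
    \<open>f1\<close> will be the transform of \<open>Kop\<close> applied to \<open>h\<close> over
    all such triples, \<open>h1\<close> the transform of \<open>f1\<close>. The one-step inequality
    says that \<open>f1\<close> dominates \<open>Kop\<close> applied to \<open>f\<close>; that
    \<open>h1\<close> dominates \<open>Kop\<close> applied to \<open>h\<close> follows from the
    definition of \<open>f1\<close>.\<close>
  define D where "D = {(z :: real^'d, y' :: real^'d, l). norm z <= R & norm (z - y') <= \<eta> & l : S0}"
  have "(0, 0, 1) : D" using R \<eta>(1) S0_ne by (simp add: D_def)
  hence D: "D ~= {}" by blast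
  define F where "F k pp y = O' + cost t (y, k) (fst (snd pp), snd (snd pp)) - Kop eps L st h (fst pp) (snd (snd pp)) (fst (snd pp))" for k pp y
  have F0: "0 <= F k pp y" if "pp : D" for k pp y
  proof -
    have "Kop eps L st h (fst pp) (snd (snd pp)) (fst (snd pp)) <= 1" using that by (intro K1 h) (auto simp: D_def)
    thus ?thesis unfolding F_def using cost_bounds(1)[OF tT, of "(y, k)" "(fst (snd pp), snd (snd pp))"] O' by linarith
  qed
  \<comment> \<open>Capping at 1 is harmless because the values of \<open>Kop\<close> do not exceed
    1; \<open>O' >= 1\<close> makes the infimum nonnegative.\<close>
  define f1 where "f1 z = min 1 (INF pp\<in>D. F (snd z) pp (fst z))" for z
  have f1r: "0 <= f1 z" "f1 z <= 1" for z using cINF_greatest[OF D, of 0 "%pp. F (snd z) pp (fst z)"] F0 by (auto simp: f1_def)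
  have f1c: "continuous_on UNIV (%y. f1 (y, k))" for k
    unfolding f1_def fst_conv snd_conv
  proof (rule continuous_min_INF[OF D F0 _ Lc_nonneg])
    show "F k pp y <= F k pp y' + Lc * norm (y - y')" for pp y y'
      unfolding F_def using cost_lipschitz[OF tT, of y k "fst (snd pp)" "snd (snd pp)" y' "fst (snd pp)"] by simp
  qed
  define G where "G l z y = O' + cost t z (y, l) - f1 z" for l z y
  have G0: "0 <= G l z y" for l z y
    unfolding G_def using cost_bounds(1)[OF tT, of z "(y, l)"] f1r(2)[of z] O' by linarith
  define h1 where "h1 z' = min 1 (INF z\<in>UNIV \<times> S0. G (snd z') z (fst z'))" for z'
  have U: "UNIV \<times> S0 ~= ({} :: ((real^'d) \<times> nat) set)" using S0_ne by auto
  have h1r: "0 <= h1 z" "h1 z <= 1" for z using cINF_greatest[OF U, of 0 "%y. G (snd z) y (fst z)"] G0 by (auto simp: h1_def)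
  have h1c: "continuous_on UNIV (%y. h1 (y, k))" for k
    unfolding h1_def fst_conv snd_conv
  proof (rule continuous_min_INF[OF U G0 _ Lc_nonneg])
    show "G k z y <= G k z y' + Lc * norm (y - y')" for z y y'
      unfolding G_def using cost_lipschitz[OF tT, of "fst z" "snd z" y k "fst z" y'] by simp
  qed
  show thesis
  proof (rule that)
    show "adm_fun f1" "adm_fun h1" unfolding adm_fun_def using f1c h1c f1r h1r by blast+
    show "f1 z + h1 z' <= (Oc + epsp * st^2) + cost t z z'" if "snd z : S0" "snd z' : S0" for z z'
    proof -
      have "h1 z' <= (INF z\<in>UNIV \<times> S0. G (snd z') z (fst z'))" by (simp add: h1_def)
      also have "... <= G (snd z') z (fst z')"
        by (rule cINF_lower[OF bdd_belowI2[of _ 0]]) (use G0 that in \<open>auto simp: mem_Times_iff\<close>)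
      finally show ?thesis unfolding G_def O'_def by simp
    qed
    show "Kop eps L st f x k (x + w) <= f1 (x + w, k)" if x: "norm x <= R" and k: "k : S0" and w: "norm w <= \<eta>" for x k w
      unfolding f1_def fst_conv snd_conv
    proof (rule min.boundedI[OF K1[OF f k]], rule cINF_greatest[OF D])
      fix pp assume "pp : D"
      then obtain z y' l where pp: "pp = (z, y', l)" "norm z <= R" "norm (z - y') <= \<eta>" "l : S0" by (auto simp: D_def)
      have "Kop eps L st f x k (x + w) + Kop eps L st h z l y' <= Oc + cost t (x + w, k) (y', l) + epsp * st^2"
        by (rule one_step[OF st t adm_funD(4)[OF f] adm_funD(2,3)[OF f] adm_funD(4)[OF h] adm_funD(2,3)[OF h] adm k pp(4) x pp(2) _ pp(3)]) (use w in auto)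
      thus "Kop eps L st f x k (x + w) <= F k pp (x + w)" by (simp add: F_def pp(1) O'_def)
    qed
    show "Kop eps L st h x l (x + w) <= h1 (x + w, l)" if x: "norm x <= R" and l: "l : S0" and w: "norm w <= \<eta>" for x l w
      unfolding h1_def fst_conv snd_conv
    proof (rule min.boundedI[OF K1[OF h l]], rule cINF_greatest[OF U])
      fix z :: "(real^'d) \<times> nat"
      have "f1 z <= (INF pp\<in>D. F (snd z) pp (fst z))" by (simp add: f1_def)
      also have "... <= F (snd z) (x, x + w, l) (fst z)"
        by (rule cINF_lower[OF bdd_belowI2[of _ 0]]) (use F0 x l w in \<open>auto simp: D_def\<close>)
      finally show "Kop eps L st h x l (x + w) <= G l z (x + w)" by (simp add: F_def G_def)
    qed
  qed
qed

lemma chain_integrable: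
  assumes "sub_chain st E \<mu> n" "g : borel_measurable borel" "!!z. \<bar>g z\<bar> <= (C::real)"
  shows "integrable (\<mu> i) g"
proof -
  have s: "sets (\<mu> i) = sets borel" and f: "finite_measure (\<mu> i)" using assms(1) unfolding sub_chain_def by blast+
  interpret finite_measure "\<mu> i" by (rule f)
  show ?thesis by (rule integrable_const_bound[where B=C])
    (use assms in \<open>auto simp: measurable_cong_sets[OF s refl]\<close>)
qed

text \<open>The supremum of \<open>u\<close> separates the pair into two one-sided bounds. The two
  measures may have lost different amounts of mass; that both functions are at most 1 while
  \<open>C >= 1\<close> makes up for it.\<close>

lemma dual_pair_bound:
  assumes \<mu>: "sub_chain st1 E1 \<mu>1 n1" "sub_chain st2 E2 \<mu>2 n2"
    and a: "u : borel_measurable borel" "!!z. \<bar>u z\<bar> <= Ca" "!!z. snd z : S0 ==> u z <= 1"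
    and b: "v : borel_measurable borel" "!!z. \<bar>v z\<bar> <= Ca" "!!z. snd z : S0 ==> v z <= 1"
    and ab: "!!z z'. snd z : S0 ==> snd z' : S0 ==> u z + v z' <= C" and C: "C >= 1"
  shows "(\<integral>z. u z \<partial>\<mu>1 i) + (\<integral>z. v z \<partial>\<mu>2 j) <= (C::real)"
proof -
  have int: "(\<integral>z. g z \<partial>\<mu> i) <= max 0 c"
    if m: "sub_chain st E \<mu> n" and g: "g : borel_measurable borel" "!!z. \<bar>g z\<bar> <= Ca" "!!z. snd z : S0 ==> g z <= c" for st E \<mu> n g c i
  proof -
    have s: "sets (\<mu> i) = sets borel" and f: "finite_measure (\<mu> i)" and m1: "measure (\<mu> i) UNIV <= 1" and ae: "AE z in \<mu> i. norm (fst z) <= R & snd z : S0"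
      using m unfolding sub_chain_def by blast+
    interpret finite_measure "\<mu> i" by (rule f)
    have "(\<integral>z. g z \<partial>\<mu> i) <= (\<integral>z. max 0 c \<partial>\<mu> i)"
    proof (rule integral_mono_AE[OF chain_integrable[OF m g(1,2)]])
      show "AE z in \<mu> i. g z <= max 0 c" using ae by eventually_elim (use g(3) in \<open>auto simp: le_max_iff_disj\<close>)
    qed simp
    also have "... = measure (\<mu> i) UNIV * max 0 c" using sets_eq_imp_space_eq[OF s] by simp
    also have "... <= 1 * max 0 c" using m1 by (intro mult_right_mono) auto
    finally show ?thesis by simp
  qed
  define A where "A = (SUP z\<in>UNIV \<times> S0. u z)"
  have U: "UNIV \<times> S0 ~= ({} :: ((real^'d) \<times> nat) set)" using S0_ne by auto
  have bdd: "bdd_above (u ` (UNIV \<times> S0))" using a(3) by (intro bdd_aboveI2[of _ _ 1]) (auto simp: mem_Times_iff)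
  have A: "u z <= A" if "snd z : S0" for z unfolding A_def using that by (intro cSUP_upper bdd) (auto simp: mem_Times_iff)
  have A1: "A <= 1" unfolding A_def using a(3) by (intro cSUP_least U) (auto simp: mem_Times_iff)
  have bA: "v z' <= min 1 (C - A)" if z': "snd z' : S0" for z'
  proof -
    have "A <= C - v z'" unfolding A_def
    proof (rule cSUP_least[OF U])
      fix z :: "(real^'d) \<times> nat" assume "z : UNIV \<times> S0"
      thus "u z <= C - v z'" using ab[of z z'] z' by (auto simp: mem_Times_iff)
    qed
    thus ?thesis using b(3)[OF z'] by simp
  qed
  have "(\<integral>z. u z \<partial>\<mu>1 i) <= max 0 A" by (rule int[OF \<mu>(1) a(1,2) A])
  moreover have "(\<integral>z. v z \<partial>\<mu>2 j) <= max 0 (min 1 (C - A))" by (rule int[OF \<mu>(2) b(1,2) bA])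
  ultimately show ?thesis using A1 C by linarith
qed

text \<open>Dual pairs travel backwards in time: a pair admissible at step \<open>i + 1\<close> is
  cut off and transformed into one admissible at step \<open>i\<close>, at the expense of
  \<open>epsp * st^2\<close> for the cost and \<open>E\<close> for each of the two flows. At time 0
  only the initial laws remain.\<close>

lemma chain_induction:
  assumes st: "0 < st" "2 * (st * m1) <= kap / 2" "4 * (st * m1) <= \<delta>" "st <= 1" "2 * st^2 * L <= 1" "Kst * st <= epsp / 2"
    and n: "real n * st^2 <= T"
    and \<mu>: "sub_chain st E \<mu>1 n" "sub_chain st E \<mu>2 n"
    and base: "!!f h Oc. adm_fun f ==> adm_fun h ==> Oc >= 1 ==>
      (!!z z'. snd z : S0 ==> snd z' : S0 ==> f z + h z' <= Oc + cost 0 z z') ==>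
      (\<integral>z. moll f z \<partial>\<mu>1 0) + (\<integral>z. moll h z \<partial>\<mu>2 0) <= Oc + B0"
    and f: "adm_fun f" and h: "adm_fun h" and Oc: "Oc >= 1" and i: "i <= n"
    and adm: "!!z z'. snd z : S0 ==> snd z' : S0 ==> f z + h z' <= Oc + cost (real i * st^2) z z'"
  shows "(\<integral>z. moll f z \<partial>\<mu>1 i) + (\<integral>z. moll h z \<partial>\<mu>2 i) <= Oc + real i * (epsp * st^2 + 2 * E) + B0"
  using f h Oc i adm
proof (induction i arbitrary: f h Oc)
  case 0
  thus ?case using base[of f h Oc] by simp
next
  case (Suc i)
  note af = cut[OF Suc.prems(1)] and ah = cut[OF Suc.prems(2)]
  define t where "t = real i * st^2"
  have ts: "real (Suc i) * st^2 = t + st^2" by (simp add: t_def algebra_simps)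
  have "real (Suc i) * st^2 <= real n * st^2" using Suc.prems(4) by (intro mult_right_mono) auto
  hence t: "0 <= t" "t + st^2 <= T" using n ts by (auto simp: t_def)
  have adm': "cut f z + cut h z' <= Oc + cost (t + st^2) z z'" if "snd z : S0" "snd z' : S0" for z z'
    using af(2)[of z] ah(2)[of z'] Suc.prems(5)[OF that] unfolding ts by linarith
  obtain f1 h1 where f1: "adm_fun f1" and h1: "adm_fun h1"
    and fh1: "!!z z'. snd z : S0 ==> snd z' : S0 ==> f1 z + h1 z' <= (Oc + epsp * st^2) + cost t z z'"
    and K1: "!!x k w. norm x <= R ==> k : S0 ==> norm w <= \<eta> ==> Kop eps L st (cut f) x k (x + w) <= f1 (x + w, k)"
    and K2: "!!x k w. norm x <= R ==> k : S0 ==> norm w <= \<eta> ==> Kop eps L st (cut h) x k (x + w) <= h1 (x + w, k)"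
    using c_transform[OF st t af(1) ah(1) Suc.prems(3) adm'] by metis
  have cm: "(\<integral>z. moll (cut g) z \<partial>\<mu> (Suc i)) = (\<integral>z. moll g z \<partial>\<mu> (Suc i))" if "sub_chain st E \<mu> n" "adm_fun g" for \<mu> g
  proof (rule integral_cong_AE)
    have s: "sets (\<mu> (Suc i)) = sets borel" and ae: "AE z in \<mu> (Suc i). norm (fst z) <= R & snd z : S0"
      using that(1) unfolding sub_chain_def by blast+
    show "moll (cut g) : borel_measurable (\<mu> (Suc i))" "moll g : borel_measurable (\<mu> (Suc i))"
      using moll_adm(1)[OF that(2)] moll_adm(1)[OF cut(1)[OF that(2)]] measurable_cong_sets[OF s refl] by blast+
    show "AE z in \<mu> (Suc i). moll (cut g) z = moll g z" using ae by eventually_elim (use cut(4)[OF that(2)] in auto)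
  qed
  have "(\<integral>z. moll (cut f) z \<partial>\<mu>1 (Suc i)) <= (\<integral>z. moll f1 z \<partial>\<mu>1 i) + E"
    using \<mu>(1) af(1,3) f1 K1 Suc.prems(4) unfolding sub_chain_def by (meson Suc_le_lessD)
  moreover have "(\<integral>z. moll (cut h) z \<partial>\<mu>2 (Suc i)) <= (\<integral>z. moll h1 z \<partial>\<mu>2 i) + E"
    using \<mu>(2) ah(1,3) h1 K2 Suc.prems(4) unfolding sub_chain_def by (meson Suc_le_lessD)
  moreover have "(\<integral>z. moll f1 z \<partial>\<mu>1 i) + (\<integral>z. moll h1 z \<partial>\<mu>2 i) <= (Oc + epsp * st^2) + real i * (epsp * st^2 + 2 * E) + B0"
  proof (rule Suc.IH[OF f1 h1])
    show "Oc + epsp * st^2 >= 1" using Suc.prems(3) epsp by (simp add: add_increasing2)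
    show "i <= n" using Suc.prems(4) by simp
    show "f1 z + h1 z' <= (Oc + epsp * st^2) + cost (real i * st^2) z z'" if "snd z : S0" "snd z' : S0" for z z' using fh1[OF that] by (simp add: t_def)
  qed
  ultimately show ?case unfolding cm[OF \<mu>(1) Suc.prems(1)] cm[OF \<mu>(2) Suc.prems(2)] by (simp add: algebra_simps)
qed

end

text \<open>With \<open>s = r / \<delta>\<close> below 1, Bernoulli's inequality gives
  \<open>(1 - s) ^ p * (1 + p * s) <= (1 - s^2) ^ p <= 1\<close>. Hence one minus the power is at
  least \<open>p * s / (1 + p * s)\<close>, which is at least half of
  \<open>min 1 (p * s)\<close>.\<close>

lemma capped_lower:
  assumes \<delta>: "\<delta> > 0" and r: "r >= 0" and p: "p >= 1"
  shows "min 1 (real p / \<delta> * r) <= 2 * capped \<delta> p r"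
proof (cases "r >= \<delta>")
  case True
  hence "max 0 (1 - r / \<delta>) = 0" using \<delta> by simp
  thus ?thesis using p by (simp add: capped_def power_0_left)
next
  case False
  define s where "s = r / \<delta>"
  have s: "0 <= s" "s < 1" using False r \<delta> by (auto simp: s_def)
  have b: "1 + real p * s <= (1 + s) ^ p" using Bernoulli_inequality[of s p] s by simp
  have "(1 - s) ^ p * (1 + real p * s) <= (1 - s) ^ p * (1 + s) ^ p" using b s by (intro mult_left_mono) auto
  also have "... = (1 - s\<^sup>2) ^ p" by (simp add: power_mult_distrib[symmetric] algebra_simps power2_eq_square)
  also have "... <= 1" using s by (intro power_le_one) (auto simp: power2_eq_square mult_le_one)
  finally have q: "(1 - s) ^ p * (1 + real p * s) <= 1" .
  have ps: "0 <= real p * s" using s by simp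
  have "min 1 (real p * s) <= 2 * (1 - (1 - s) ^ p)"
  proof -
    define X where "X = (1 - s) ^ p"
    define Y where "Y = real p * s"
    have X: "0 <= X" "X * (1 + Y) <= 1" and Y: "0 <= Y" using q s ps by (auto simp: X_def Y_def)
    show ?thesis unfolding X_def[symmetric] Y_def[symmetric]
    proof (cases "Y <= 1")
      case True
      have "(1 - Y / 2) * (1 + Y) >= 1" using True Y mult_left_mono[OF True Y] by (simp add: algebra_simps)
      hence "X * (1 + Y) <= (1 - Y / 2) * (1 + Y)" using X by linarith
      hence "X <= 1 - Y / 2" using Y by (simp add: mult_le_cancel_right)
      hence "Y <= 2 * (1 - X)" by argo
      thus "min 1 Y <= 2 * (1 - X)" by (rule min.coboundedI2)
    next
      case False
      have "X * 2 <= X * (1 + Y)" using False X by (intro mult_left_mono) auto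
      hence "1 <= 2 * (1 - X)" using X(2) by argo
      thus "min 1 Y <= 2 * (1 - X)" by (rule min.coboundedI1)
    qed
  qed
  moreover have "max 0 (1 - r / \<delta>) = 1 - s" using s by (simp add: s_def)
  ultimately show ?thesis by (simp add: capped_def s_def)
qed

section \<open>Initial and terminal bounds for the flows\<close>

context mollified_coupling begin

lemma moll_diff:
  assumes f: "!!l. l : S0 ==> (%y. f (y, l)) : borel_measurable borel" "!!z. \<bar>f z\<bar> <= C"
    and g: "!!l. l : S0 ==> (%y. g (y, l)) : borel_measurable borel" "!!z. \<bar>g z\<bar> <= C"
  shows "moll (%z. f z - c * g z) z = moll f z - c * moll g z"
proof (cases "snd z : S0")
  case True
  have i: "integrable W (%w. f' (fst z + w, snd z))" if "(%y. f' (y, snd z)) : borel_measurable borel" "!!z. \<bar>f' z\<bar> <= C" for f'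
    using measurable_compose[OF _ that(1), of "(+) (fst z)" borel] that(2) by (intro W_integrable[where C=C]) auto
  show ?thesis using i[OF f(1)[OF True] f(2)] i[OF g(1)[OF True] g(2)] by (simp add: moll_def)
qed (simp add: moll_def)

lemma moll_le_const:
  assumes f: "!!l. l : S0 ==> (%y. f (y, l)) : borel_measurable borel" "!!z. \<bar>f z\<bar> <= C"
    and le: "!!z. snd z : S0 ==> f z <= c" and z: "snd z : S0"
  shows "moll f z <= c"
proof -
  interpret W: prob_space W by (rule W_prob)
  have "integrable W (%w. f (fst z + w, snd z))"
    using measurable_compose[OF _ f(1)[OF z], of "(+) (fst z)" borel] f(2) by (intro W_integrable[where C=C]) auto
  hence "(LINT w|W. f (fst z + w, snd z)) <= c" using le z by (intro W.integral_le_const) auto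
  thus ?thesis using z by (simp add: moll_def)
qed

text \<open>A bounded distance to the starting point. Its mean under the initial measure of the flow
  is small but in general not 0, because the window extends beyond time 0.\<close>

definition gap :: "real^'d => nat => (real^'d) \<times> nat => real" where
  "gap x k z = min 1 (norm (fst z - x)) + (if snd z = k then 0 else 1)"

lemma gap_bounds: "0 <= gap x k z" "gap x k z <= 2" "\<bar>gap x k z\<bar> <= 2" by (auto simp: gap_def)

lemma gap_measurable: "(%y. gap x k (y, l)) : borel_measurable borel" unfolding gap_def fst_conv snd_conv by (intro borel_measurable_continuous_onI continuous_intros)

lemma cost_0_gap:
  "cost 0 z z' <= tcost \<delta> kap p 0 (2 * M) (norm (x - x')) + (2 * M + Lc) * (gap x k z + gap x' k z')"
proof -
  have c0: "c\<alpha> 0 = 0" "c\<beta> 0 = 2 * M" by (auto simp: c\<alpha>_def c\<beta>_def)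
  have M0: "M >= 0" using M by simp
  have T0: "(0::real) <= 0" "0 <= T" using T by auto
  have t0: "0 <= tcost \<delta> kap p 0 (2 * M) (norm (x - x'))" by (rule tcost_bounds(1)[OF \<delta> kap(1) p]) (use M0 in auto)
  have c2: "cost 0 z z' <= 2 * M" using cost_bounds(2)[OF T0] c0 by simp
  show ?thesis
  proof (cases "gap x k z >= 1 \<or> gap x' k z' >= 1")
    case True
    hence "1 <= gap x k z + gap x' k z'" using gap_bounds(1)[of x k z] gap_bounds(1)[of x' k z'] by linarith
    hence "(2 * M + Lc) * 1 <= (2 * M + Lc) * (gap x k z + gap x' k z')" using M0 Lc_nonneg by (intro mult_left_mono) auto
    hence "2 * M <= (2 * M + Lc) * (gap x k z + gap x' k z')" unfolding mult_1_right using Lc_nonneg by linarith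
    thus ?thesis using c2 t0 by (meson add_increasing order_trans)
  next
    case False
    hence s: "snd z = k" "snd z' = k" and g: "gap x k z = norm (fst z - x)" "gap x' k z' = norm (fst z' - x')"
      by (auto simp: gap_def split: if_splits)
    have "cost 0 (fst z, k) (fst z', k) <= cost 0 (x, k) (x', k) + Lc * (norm (fst z - x) + norm (fst z' - x'))" by (rule cost_lipschitz[OF T0])
    moreover have "Lc * (gap x k z + gap x' k z') <= (2 * M + Lc) * (gap x k z + gap x' k z')"
      using M0 gap_bounds(1)[of x k z] gap_bounds(1)[of x' k z'] by (intro mult_right_mono) auto
    moreover have "cost 0 z z' = cost 0 (fst z, k) (fst z', k)" using s by (simp add: cost_def)
    moreover have "cost 0 (x, k) (x', k) = tcost \<delta> kap p 0 (2 * M) (norm (x - x'))" by (simp add: cost_def c0)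
    ultimately show ?thesis unfolding g by linarith
  qed
qed

text \<open>Subtracting multiples of \<open>gap\<close> turns a pair admissible for the initial cost
  into one whose sum is bounded by a constant, to which \<open>dual_pair_bound\<close> applies; the
  subtracted means are controlled by \<open>E1\<close> and \<open>E2\<close>.\<close>

lemma base_estimate:
  assumes \<mu>: "sub_chain st E \<mu>1 n" "sub_chain st E \<mu>2 n"
    and E: "(\<integral>z. moll (gap x k) z \<partial>\<mu>1 0) <= E1" "(\<integral>z. moll (gap x' k) z \<partial>\<mu>2 0) <= E2"
    and f: "adm_fun f" and h: "adm_fun h" and Oc: "Oc >= 1"
    and adm: "!!z z'. snd z : S0 ==> snd z' : S0 ==> f z + h z' <= Oc + cost 0 z z'"
  shows "(\<integral>z. moll f z \<partial>\<mu>1 0) + (\<integral>z. moll h z \<partial>\<mu>2 0) <= Oc + (tcost \<delta> kap p 0 (2 * M) (norm (x - x')) + (2 * M + Lc) * (E1 + E2))"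
proof -
  define Kl where "Kl = 2 * M + Lc"
  have Kl: "Kl >= 0" using M Lc_nonneg by (simp add: Kl_def)
  define c where "c = Oc + tcost \<delta> kap p 0 (2 * M) (norm (x - x'))"
  have c1: "c >= 1" using Oc tcost_bounds(1)[OF \<delta> kap(1) p, of 0 "2 * M" "norm (x - x')"] M by (simp add: c_def)
  note af = adm_funD[OF f] and ah = adm_funD[OF h]
  have fb: "\<bar>f z\<bar> <= 2" "\<bar>h z\<bar> <= 2" for z using af(2,3)[of z] ah(2,3)[of z] by auto
  define u where "u z = f z - Kl * gap x k z" for z
  define v where "v z = h z - Kl * gap x' k z" for z
  have um: "l : S0 ==> (%y. u (y, l)) : borel_measurable borel" "l : S0 ==> (%y. v (y, l)) : borel_measurable borel" for l
    unfolding u_def v_def using af(4) ah(4) gap_measurable by (auto intro!: borel_measurable_diff borel_measurable_times)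
  have kg: "0 <= Kl * gap x k z" "Kl * gap x k z <= Kl * 2" for x z using Kl gap_bounds[of x k z] by (auto intro!: mult_left_mono)
  have ub: "\<bar>u z\<bar> <= 1 + Kl * 2" "\<bar>v z\<bar> <= 1 + Kl * 2" for z
    using kg[of x z] kg[of x' z] af(2,3)[of z] ah(2,3)[of z] by (auto simp: u_def v_def abs_le_iff)
  have u1: "u z <= 1" "v z <= 1" for z using kg(1)[of x z] kg(1)[of x' z] af(3)[of z] ah(3)[of z] by (auto simp: u_def v_def)
  have uv: "u z + v z' <= c" if "snd z : S0" "snd z' : S0" for z z'
    using adm[OF that] cost_0_gap[of z z' x x' k] unfolding Kl_def[symmetric] u_def v_def c_def by (simp add: algebra_simps)
  have mu: "moll u z = moll f z - Kl * moll (gap x k) z" "moll v z = moll h z - Kl * moll (gap x' k) z" for z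
    unfolding u_def v_def by (rule moll_diff[where C=2]; (intro af(4) ah(4) gap_measurable fb gap_bounds; assumption)?)+
  have mg: "moll (gap y k) : borel_measurable borel" "0 <= moll (gap y k) z" "moll (gap y k) z <= 2" for y z
    by (rule moll_props[where C=2]; intro gap_measurable gap_bounds)+
  have mm: "moll u : borel_measurable borel" "moll v : borel_measurable borel"
    unfolding mu using moll_adm(1)[OF f] moll_adm(1)[OF h] mg(1) by auto
  have mkg: "0 <= Kl * moll (gap y k) z" "Kl * moll (gap y k) z <= Kl * 2" for y z using mg(2,3)[of y z] Kl by (auto intro!: mult_left_mono)
  have mb: "\<bar>moll u z\<bar> <= 1 + Kl * 2" "\<bar>moll v z\<bar> <= 1 + Kl * 2" for z
    using mkg[of x z] mkg[of x' z] moll_adm(2,3)[OF f, of z] moll_adm(2,3)[OF h, of z] unfolding mu by (auto simp: abs_le_iff)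
  have "(\<integral>z. moll u z \<partial>\<mu>1 0) + (\<integral>z. moll v z \<partial>\<mu>2 0) <= c"
  proof (rule dual_pair_bound[OF \<mu> mm(1) mb(1) _ mm(2) mb(2) _ _ c1])
    show "moll u z <= 1" "moll v z <= 1" if "snd z : S0" for z
      using moll_le_const[OF um(1) ub(1) u1(1) that] moll_le_const[OF um(2) ub(2) u1(2) that] by auto
    show "moll u z + moll v z' <= c" if z: "snd z : S0" "snd z' : S0" for z z'
    proof -
      have 1: "moll u z <= c - v z'" if "snd z' : S0" for z'
        by (rule moll_le_const[OF um(1) ub(1) _ z(1)]) (use uv[OF _ that] in \<open>auto simp: le_diff_eq\<close>)
      have "moll v z' <= c - moll u z"
      proof (rule moll_le_const[OF um(2) ub(2) _ z(2)])
        show "v z' <= c - moll u z" if "snd z' : S0" for z' using 1[OF that] by linarith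
      qed
      thus ?thesis by linarith
    qed
  qed
  moreover have "(\<integral>z. moll u z \<partial>\<mu>1 0) = (\<integral>z. moll f z \<partial>\<mu>1 0) - Kl * (\<integral>z. moll (gap x k) z \<partial>\<mu>1 0)"
    unfolding mu using chain_integrable[OF \<mu>(1) moll_adm(1)[OF f], of 1] chain_integrable[OF \<mu>(1) mg(1), of x 2] moll_adm(2,3)[OF f] mg(2,3) by (simp add: abs_le_iff)
  moreover have "(\<integral>z. moll v z \<partial>\<mu>2 0) = (\<integral>z. moll h z \<partial>\<mu>2 0) - Kl * (\<integral>z. moll (gap x' k) z \<partial>\<mu>2 0)"
    unfolding mu using chain_integrable[OF \<mu>(2) moll_adm(1)[OF h], of 1] chain_integrable[OF \<mu>(2) mg(1), of x' 2] moll_adm(2,3)[OF h] mg(2,3) by (simp add: abs_le_iff)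
  moreover have "Kl * (\<integral>z. moll (gap x k) z \<partial>\<mu>1 0) <= Kl * E1" "Kl * (\<integral>z. moll (gap x' k) z \<partial>\<mu>2 0) <= Kl * E2"
    using E Kl by (auto intro!: mult_left_mono)
  ultimately show ?thesis unfolding Kl_def[symmetric] c_def by (simp add: algebra_simps)
qed

text \<open>The pair of \<open>f\<close> and \<open>1 - f\<close> is admissible at time
  \<open>T\<close>: within a regime the exponent \<open>p\<close> part, with weight 2, dominates
  differences of values of \<open>f\<close>, and across regimes the cost exceeds 1.\<close>

lemma coupled_estimate:
  assumes st: "0 < st" "2 * (st * m1) <= kap / 2" "4 * (st * m1) <= \<delta>" "st <= 1" "2 * st^2 * L <= 1" "Kst * st <= epsp / 2"
    and n: "real n * st^2 = T"
    and \<mu>: "sub_chain st E \<mu>1 n" "sub_chain st E \<mu>2 n"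
    and E: "(\<integral>z. moll (gap x k) z \<partial>\<mu>1 0) <= E1" "(\<integral>z. moll (gap x' k) z \<partial>\<mu>2 0) <= E2"
    and f: "!!z. 0 <= f z" "!!z. f z <= 1" and lip: "!!l y y'. l : S0 ==> \<bar>f (y, l) - f (y', l)\<bar> <= real p / \<delta> * norm (y - y')"
  shows "(\<integral>z. moll f z \<partial>\<mu>1 n) + (\<integral>z. moll (%z. 1 - f z) z \<partial>\<mu>2 n)
     <= 1 + T * epsp + 2 * real n * E + (tcost \<delta> kap p 0 (2 * M) (norm (x - x')) + (2 * M + Lc) * (E1 + E2))"
proof -
  have T0: "0 <= T" "T <= T" using T by auto
  have cont: "continuous_on UNIV (%y. f (y, l))" if "l : S0" for l
  proof (rule lipschitz_on_continuous_on)
    show "(real p / \<delta>)-lipschitz_on UNIV (%y. f (y, l))"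
      using lip[OF that] \<delta> by (auto intro!: lipschitz_onI simp: dist_real_def dist_norm)
  qed
  have af: "adm_fun f" "adm_fun (%z. 1 - f z)"
    unfolding adm_fun_def using f cont by (auto intro!: continuous_intros simp: diff_le_eq)
  have adm: "f z + (1 - f z') <= 1 + cost (real n * st^2) z z'" if "snd z : S0" "snd z' : S0" for z z'
  proof -
    have "f z - f z' <= 1" using f(1)[of z'] f(2)[of z] by linarith
    moreover have "f z - f z' <= cost T z z'" if eq: "snd z = snd z'"
    proof -
      define r where "r = norm (fst z - fst z')"
      have "f z - f z' <= real p / \<delta> * r" 
      proof -
        have "f z = f (fst z, snd z)" by simp
        moreover have "f z' = f (fst z', snd z)" using eq by simp
        ultimately show ?thesis using abs_le_D1[OF lip[OF \<open>snd z : S0\<close>, of "fst z" "fst z'"]] unfolding r_def by metis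
      qed
      hence "f z - f z' <= min 1 (real p / \<delta> * r)" using f(1)[of z'] f(2)[of z] by simp
      also have "... <= 2 * capped \<delta> p r" using p by (intro capped_lower \<delta>) (auto simp: r_def)
      also have "... <= 2 * smooth_cost \<delta> kap p r"
        unfolding smooth_cost_def using \<delta> by (intro mult_left_mono capped_mono) (auto intro!: real_le_rsqrt)
      also have "... <= 2 * smooth_cost \<delta> kap p r + M * smooth_cost \<delta> kap 4 r" using M smooth_cost_bounds(1)[OF \<delta>] by simp
      also have "... = cost T z z'" using T eq by (simp add: cost_def tcost_def c\<alpha>_def c\<beta>_def r_def)
      finally show ?thesis .
    qed
    moreover have "1 <= cost T z z'" if "snd z ~= snd z'" using that T M by (simp add: cost_def c\<alpha>_def c\<beta>_def)
    ultimately show ?thesis unfolding n by (cases "snd z = snd z'") auto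
  qed
  have "(\<integral>z. moll f z \<partial>\<mu>1 n) + (\<integral>z. moll (%z. 1 - f z) z \<partial>\<mu>2 n) <= 1 + real n * (epsp * st^2 + 2 * E)
     + (tcost \<delta> kap p 0 (2 * M) (norm (x - x')) + (2 * M + Lc) * (E1 + E2))"
    by (rule chain_induction[OF st _ \<mu> base_estimate[OF \<mu> E] af order_refl order_refl adm]) (use n in auto)
  moreover have "real n * (epsp * st^2 + 2 * E) = T * epsp + 2 * real n * E" unfolding n[symmetric] by (simp add: algebra_simps)
  ultimately show ?thesis by simp
qed

definition smlS :: "(real^'d) \<times> nat => real" where "smlS z = (if snd z : S0 then sml eps z else 0)"

lemma smlS: "smlS : borel_measurable borel" "0 <= smlS z" "\<bar>smlS z\<bar> <= CN"
proof -
  show "smlS : borel_measurable borel" unfolding smlS_def[abs_def] by (rule measurable_slices[OF S0_finite sml_measurable])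
  show "0 <= smlS z" "\<bar>smlS z\<bar> <= CN" using sml_facts(1,2)[OF _ eps(2), of "snd z" "fst z"] CN by (auto simp: smlS_def)
qed

abbreviation "A_mp \<equiv> (%Q z0. cadlag_mp Q S0 (Aop a b \<nu> q eps0 n0) {f. ALL k:S0. Cc_inf (%y. f (y, k))} z0)"

text \<open>Consistency of the chain is combined with the averaged martingale property.
  \<open>Kc\<close> does not depend on the solution, the window \<open>tau\<close> or the step. Over
  about \<open>T / st^2\<close> steps the first and the last part of the error vanish as
  \<open>st\<close> tends to 0, and the middle part amounts to a constant times
  \<open>T * s\<close>.\<close>

lemma sub_chain_flow:
  obtains Kc where "!!Q z0 tau n st s. A_mp Q z0 ==> tau > 0 ==> 0 < st ==> st <= 1 ==> 2 * st^2 * L <= 1 ==> real n * st^2 <= T ==>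
      (!!t. 0 <= t ==> t <= T ==> (\<integral>z. smlS z \<partial>cadlag_mp.flow Q R tau t) <= s) ==>
      sub_chain st (Kc * st ^ 3 + st^2 * (real CARD('d) ^ 3 * C3 * s) + Kc * (st^2)\<^sup>2 / tau) (%i. cadlag_mp.flow Q R tau (real i * st^2)) n"
    "Kc >= 0"
proof -
  have L0: "L >= 0" using L(2) CQ by (meson mult_nonneg_nonneg of_nat_0_le_iff order_trans zero_le_numeral)
  obtain K where K: "!!x k g h. k : Sset n0 ==> norm x <= R ==> (!!l. l : Sset n0 ==> test_bound C3 (%y. g (y, l))) ==>
     0 < h ==> h <= 1 ==> 2 * h^2 * L <= 1 ==>
     \<bar>Kop eps L h g x k x - g (x, k) - h\<^sup>2 * Aop a b \<nu> q eps0 n0 g (x, k)\<bar> <= K * h ^ 3 + h^2 * (real CARD('d)^3 * C3 * sml eps (x, k))"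
    using Kop_consistent[OF eps L0, of R C3] by metis
  obtain CA where CA: "!!g z. snd z : Sset n0 ==> (!!l. l : Sset n0 ==> test_bound C3 (%y. g (y, l))) ==>
    (!!y l. l : Sset n0 ==> norm y > R + 3 ==> g (y, l) = 0) ==> \<bar>Aop a b \<nu> q eps0 n0 g z\<bar> <= CA" "CA >= 0"
    using Aop_bounded[of C3 "R + 3"] by metis
  define Kc where "Kc = \<bar>K\<bar> + 4 * CA"
  show thesis
  proof (rule that[of Kc])
    show Kc0: "Kc >= 0" using CA(2) by (simp add: Kc_def)
    fix Q z0 tau n st s assume Q: "A_mp Q z0" and tau: "tau > 0" and st: "0 < st" "st <= 1" "2 * st^2 * L <= 1" and n: "real n * st^2 <= T"
      and sb: "!!t. 0 <= t ==> t <= T ==> (\<integral>z. smlS z \<partial>cadlag_mp.flow Q R tau t) <= s"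
    interpret Q: cadlag_mp Q S0 "Aop a b \<nu> q eps0 n0" "{f. ALL k:S0. Cc_inf (%y. f (y, k))}" z0 by (rule Q)
    interpret W: prob_space W by (rule W_prob)
    have step: "(\<integral>z. moll f z \<partial>Q.flow R tau (t + st^2)) <= (\<integral>z. moll f' z \<partial>Q.flow R tau t)
        + (Kc * st ^ 3 + st^2 * (real CARD('d) ^ 3 * C3 * s) + Kc * (st^2)\<^sup>2 / tau)"
      if f: "adm_fun f" "adm_fun f'" and supp: "!!y l. R + 2 <= norm y ==> f (y, l) = 0"
        and Kf: "!!x k w. norm x <= R ==> k : S0 ==> norm w <= \<eta> ==> Kop eps L st f x k (x + w) <= f' (x + w, k)"
        and t: "0 <= t" "t <= T" for f f' t
    proof -
      note af = adm_funD[OF f(1)] and af' = adm_funD[OF f(2)]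
      have mo: "(%y. moll f (y, l)) = (%y. \<integral>w. f (y + w, l) \<partial>W)" if "l : S0" for l using that by (simp add: moll_def)
      have T1: "Cc_inf (%y. moll f (y, l)) & test_bound C3 (%y. moll f (y, l))" if l: "l : S0" for l
        unfolding mo[OF l]
      proof (rule W_test[OF af(1)[OF l]])
        have "{y. f (y, l) ~= 0} \<subseteq> cball 0 (R + 2)" 
        proof
          fix y assume "y : {y. f (y, l) ~= 0}"
          hence "\<not> R + 2 <= norm y" using supp[of y l] by blast
          thus "y : cball 0 (R + 2)" by simp
        qed
        thus "bounded {y. f (y, l) ~= 0}" by (rule bounded_subset[OF bounded_cball])
        show "\<bar>f (y, l)\<bar> <= 1" for y using af(2,3)[of "(y, l)"] by simp
      qed
      have m0: "moll f (y, l) = 0" if "norm y > R + 3" for y l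
      proof -
        have "moll f (y, l) = moll (%_. 0) (y, l)"
        proof (rule moll_local)
          fix w :: "real^'d" assume "norm w <= \<eta>"
          hence "R + 2 <= norm (y + w)" using norm_diff_ineq[of y w] that \<eta>1 by linarith
          thus "f (fst (y, l) + w, snd (y, l)) = 0" using supp by simp
        qed (use af(4) in auto)
        thus ?thesis by (simp add: moll_def)
      qed
      define Ag where "Ag z = (if snd z : S0 then Aop a b \<nu> q eps0 n0 (moll f) z else 0)" for z
      have Agm: "Ag : borel_measurable borel" unfolding Ag_def[abs_def]
        by (rule measurable_slices[OF S0_finite Aop_measurable[of _ C3]]) (use T1 in auto)
      have Agb: "\<bar>Ag z\<bar> <= CA" for z unfolding Ag_def using CA(1)[of z "moll f"] CA(2) T1 m0 by auto
      have fs: "(\<integral>z. moll f z \<partial>Q.flow R tau (t + st^2)) <= (\<integral>z. moll f z \<partial>Q.flow R tau t) + st^2 * (\<integral>z. Ag z \<partial>Q.flow R tau t) + 4 * CA * (st^2)\<^sup>2 / tau"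
        by (rule Q.flow_step[OF _ moll_adm[OF f(1)] Agm _ Agb t(1) _ tau]) (use T1 in \<open>auto simp: Ag_def\<close>)
      have im: "integrable (Q.flow R tau t) (moll g)" if "adm_fun g" for g
        by (rule Q.flow_integral(1)[where C=1, OF moll_adm(1)[OF that] _ tau]) (use moll_adm(2,3)[OF that] in auto)
      have iA: "integrable (Q.flow R tau t) Ag" by (rule Q.flow_integral(1)[OF Agm Agb tau])
      have iS: "integrable (Q.flow R tau t) smlS" by (rule Q.flow_integral(1)[OF smlS(1,3) tau])
      interpret F: finite_measure "Q.flow R tau t" by (rule Q.flow_emeasure(1)[OF tau])
      define D where "D = real CARD('d) ^ 3 * C3"
      have D0: "D >= 0" using test_bound_facts(1)[OF conjunct2[OF T1[OF S0_ne]]] by (simp add: D_def)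
      have "(\<integral>z. moll f z + st^2 * Ag z \<partial>Q.flow R tau t) <= (\<integral>z. moll f' z + \<bar>K\<bar> * st ^ 3 + st^2 * (D * smlS z) \<partial>Q.flow R tau t)"
      proof (rule integral_mono_AE)
        show "AE z in Q.flow R tau t. moll f z + st^2 * Ag z <= moll f' z + \<bar>K\<bar> * st ^ 3 + st^2 * (D * smlS z)"
          using Q.flow_AE[OF tau S0_finite, of R t]
        proof eventually_elim
          case (elim z)
          obtain x k where z: "z = (x, k)" by (cases z)
          have x: "norm x <= R" and k: "k : S0" using elim z by auto
          note KM = Kop_moll[of f k st x, OF af(4) af(2,3) k]
          have "Kop eps L st (moll f) x k x = (LINT w|W. Kop eps L st f x k (x + w))" by (rule KM(1))
          also have "... <= (LINT w|W. f' (x + w, k))"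
          proof (rule integral_mono_AE[OF KM(2)])
            show "integrable W (%w. f' (x + w, k))"
              using measurable_compose[OF _ af'(4)[OF k], of "(+) x" borel] af'(2,3) by (intro W_integrable[where C=1]) auto
            show "AE w in W. Kop eps L st f x k (x + w) <= f' (x + w, k)" using W_AE by eventually_elim (rule Kf[OF x k])
          qed
          finally have "Kop eps L st (moll f) x k x <= moll f' z" using k z by (simp add: moll_def)
          moreover have "\<bar>Kop eps L st (moll f) x k x - moll f (x, k) - st\<^sup>2 * Aop a b \<nu> q eps0 n0 (moll f) (x, k)\<bar> <= K * st ^ 3 + st^2 * (real CARD('d)^3 * C3 * sml eps (x, k))"
            by (rule K[OF k x _ st]) (use T1 in auto)
          moreover have "K * st ^ 3 <= \<bar>K\<bar> * st ^ 3" using st by (intro mult_right_mono) auto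
          ultimately show ?case using k unfolding D_def[symmetric] Ag_def smlS_def z by simp
        qed
      qed (intro Bochner_Integration.integrable_add integrable_mult_right im f iA iS F.integrable_const)+
      also have "... = (\<integral>z. moll f' z \<partial>Q.flow R tau t) + measure (Q.flow R tau t) UNIV * (\<bar>K\<bar> * st ^ 3) + st^2 * (D * (\<integral>z. smlS z \<partial>Q.flow R tau t))"
        using im[OF f(2)] iS by (simp add: Q.flow_space)
      also have "... <= (\<integral>z. moll f' z \<partial>Q.flow R tau t) + 1 * (\<bar>K\<bar> * st ^ 3) + st^2 * (D * s)"
        using Q.flow_emeasure(2)[OF tau, of R t] sb[OF t] st D0 by (intro add_mono mult_left_mono mult_right_mono order_refl) auto
      finally have "(\<integral>z. moll f z \<partial>Q.flow R tau t) + st^2 * (\<integral>z. Ag z \<partial>Q.flow R tau t) <= (\<integral>z. moll f' z \<partial>Q.flow R tau t) + \<bar>K\<bar> * st ^ 3 + st^2 * (D * s)"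
        using im[OF f(1)] iA by simp
      moreover have "\<bar>K\<bar> * st ^ 3 <= Kc * st ^ 3" "4 * CA * (st^2)\<^sup>2 / tau <= Kc * (st^2)\<^sup>2 / tau"
        using CA(2) st tau by (auto simp: Kc_def intro!: mult_right_mono divide_right_mono)
      ultimately show ?thesis using fs unfolding D_def by linarith
    qed
    show "sub_chain st (Kc * st ^ 3 + st^2 * (real CARD('d) ^ 3 * C3 * s) + Kc * (st^2)\<^sup>2 / tau) (%i. Q.flow R tau (real i * st^2)) n"
      unfolding sub_chain_def
    proof (intro conjI allI impI)
      fix i f f' assume i: "i < n" and f: "adm_fun f" "adm_fun f'" "ALL y l. R + 2 <= norm y --> f (y, l) = 0"
        "ALL x k w. norm x <= R --> k : S0 --> norm w <= \<eta> --> Kop eps L st f x k (x + w) <= f' (x + w, k)"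
      have "real i * st^2 <= real n * st^2" using i by (intro mult_right_mono) auto
      moreover have "real (Suc i) * st^2 = real i * st^2 + st^2" by (simp add: algebra_simps)
      ultimately show "(\<integral>z. moll f z \<partial>Q.flow R tau (real (Suc i) * st^2)) <= (\<integral>z. moll f' z \<partial>Q.flow R tau (real i * st^2))
        + (Kc * st ^ 3 + st^2 * (real CARD('d) ^ 3 * C3 * s) + Kc * (st^2)\<^sup>2 / tau)"
        using step[of f f' "real i * st^2"] f n by auto
    qed (use Q.flow_emeasure[OF tau] Q.flow_AE[OF tau S0_finite] in auto)
  qed
qed

end

section \<open>Passage to the limit\<close>

context cadlag_mp begin

text \<open>Dominated convergence along a sequence decreasing the distance to \<open>t\<close>: the
  discrete regime is eventually constant, so continuity of \<open>phi\<close> within each regime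
  suffices.\<close>

lemma mean_right_continuous:
  fixes e :: real and phi :: "(real^'d) \<times> nat => real"
  assumes phi: "phi : borel_measurable borel" "!!z. \<bar>phi z\<bar> <= C" and cont: "!!l. l : S ==> continuous_on UNIV (%y. phi (y, l))" and e: "e > 0"
  shows "EX tau0>0. ALL s. t <= s & s <= t + tau0 --> \<bar>(LINT om|Q. phi (om s)) - (LINT om|Q. phi (om t))\<bar> <= e"
proof (rule ccontr)
  assume neg: "\<not> ?thesis"
  have "EX s. t <= s & s <= t + inverse (real (Suc n)) & \<not> \<bar>(LINT om|Q. phi (om s)) - (LINT om|Q. phi (om t))\<bar> <= e" for n
  proof -
    have "inverse (real (Suc n)) > 0" by simp
    thus ?thesis using neg by blast
  qed
  then obtain s where s: "!!n. t <= s n" "!!n. s n <= t + inverse (real (Suc n))"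
    "!!n. \<not> \<bar>(LINT om|Q. phi (om (s n))) - (LINT om|Q. phi (om t))\<bar> <= e" by metis
  have st: "s \<longlonglongrightarrow> t"
  proof (rule tendsto_sandwich[where f="%_. t" and h="%n. t + inverse (real (Suc n))"])
    show "(%n. t + inverse (real (Suc n))) \<longlonglongrightarrow> t" using tendsto_add[OF tendsto_const LIMSEQ_inverse_real_of_nat, of t] by simp
  qed (use s in auto)
  have lim: "(%n. phi (om (s n))) \<longlonglongrightarrow> phi (om t)" if w: "om : space Q" for om
  proof -
    have "(om \<longlongrightarrow> om t) (at_right t)" using path_right w by (auto simp: Q_space)
    have wl: "(%n. om (s n)) \<longlonglongrightarrow> om t"
    proof (rule topological_tendstoI)
      fix U assume U: "open U" "om t : U"
      have "\<forall>\<^sub>F r in at_right t. om r : U" using \<open>(om \<longlongrightarrow> om t) (at_right t)\<close> U by (rule topological_tendstoD)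
      then obtain d where d: "t < d" "!!r. t < r ==> r < d ==> om r : U" unfolding eventually_at_right_field by blast
      have "\<forall>\<^sub>F n in sequentially. s n < d" using st d(1) by (rule order_tendstoD)
      thus "\<forall>\<^sub>F n in sequentially. om (s n) : U"
      proof eventually_elim
        case (elim n)
        show ?case using d(2)[of "s n"] elim s(1)[of n] U(2) by (cases "s n = t") auto
      qed
    qed
    have "snd (om t) : S" using w path_in_S by (simp add: Q_space)
    hence "(%n. phi (fst (om (s n)), snd (om t))) \<longlonglongrightarrow> phi (fst (om t), snd (om t))"
      by (intro continuous_on_tendsto_compose[OF cont tendsto_fst[OF wl]]) auto
    moreover have "\<forall>\<^sub>F n in sequentially. snd (om (s n)) = snd (om t)" using tendsto_snd[OF wl] by (simp add: tendsto_discrete)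
    hence "\<forall>\<^sub>F n in sequentially. phi (fst (om (s n)), snd (om t)) = phi (om (s n))"
      by eventually_elim (metis prod.collapse)
    ultimately show ?thesis using tendsto_cong by fastforce
  qed
  have "(%n. \<integral>om. phi (om (s n)) \<partial>Q) \<longlonglongrightarrow> (LINT om|Q. phi (om t))"
    by (rule integral_dominated_convergence[where w="%_. C"])
       (use phi lim measurable_compose[OF coord_measurable phi(1)] in auto)
  hence "\<forall>\<^sub>F n in sequentially. dist (LINT om|Q. phi (om (s n))) (LINT om|Q. phi (om t)) < e" using e by (rule tendstoD)
  then obtain n where "dist (LINT om|Q. phi (om (s n))) (LINT om|Q. phi (om t)) < e" by (auto simp: eventually_sequentially)
  thus False using s(3)[of n] by (simp add: dist_real_def)
qed

lemma flow_mean_bounds: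
  assumes phi: "phi : borel_measurable borel" "!!z. \<bar>phi z\<bar> <= C" and tau: "tau > 0"
  shows "(!!s. t <= s ==> s <= t + tau ==> lo <= surv R phi s) ==> lo <= (\<integral>z. phi z \<partial>flow R tau t)"
    "(!!s. t <= s ==> s <= t + tau ==> surv R phi s <= hi) ==> (\<integral>z. phi z \<partial>flow R tau t) <= hi"
proof -
  have ic: "integrable lborel (%s. indicator {t..t+tau} s * c)" for c :: real
    by (intro integrable_mult_left integrable_real_indicator) (auto simp: emeasure_lborel_Icc_eq)
  have sb: "\<bar>surv R phi s\<bar> <= C" for s by (rule surv_bound[OF phi])
  have iS: "integrable lborel (%s. indicator {t..t+tau} s * surv R phi s)"
    by (rule Bochner_Integration.integrable_bound[OF ic[of C]]) (use sb surv_measurable[OF phi(1)] in \<open>auto simp: indicator_def intro: order_trans[OF _ abs_ge_self]\<close>)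
  have v: "(LINT s|lborel. indicator {t..t+tau} s * c) = tau * c" for c :: real using tau by simp
  show "lo <= (\<integral>z. phi z \<partial>flow R tau t)" if "!!s. t <= s ==> s <= t + tau ==> lo <= surv R phi s"
  proof -
    have "(LINT s|lborel. indicator {t..t+tau} s * lo) <= (LINT s|lborel. indicator {t..t+tau} s * surv R phi s)"
      by (rule integral_mono[OF ic iS]) (use that in \<open>auto simp: indicator_def\<close>)
    thus ?thesis unfolding flow_integral(2)[OF phi tau] v using tau by (simp add: pos_le_divide_eq mult.commute)
  qed
  show "(\<integral>z. phi z \<partial>flow R tau t) <= hi" if "!!s. t <= s ==> s <= t + tau ==> surv R phi s <= hi"
  proof -
    have "(LINT s|lborel. indicator {t..t+tau} s * surv R phi s) <= (LINT s|lborel. indicator {t..t+tau} s * hi)"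
      by (rule integral_mono[OF iS ic]) (use that in \<open>auto simp: indicator_def\<close>)
    thus ?thesis unfolding flow_integral(2)[OF phi tau] v using tau by (simp add: pos_divide_le_eq mult.commute)
  qed
qed

text \<open>Killing loses at most the probability of leaving the ball before \<open>t + 1\<close>,
  and averaging at most the oscillation of the mean over the window; each of the two is at most
  \<open>e\<close>.\<close>

lemma flow_terminal:
  assumes phi: "phi : borel_measurable borel" "!!z. 0 <= phi z" "!!z. phi z <= 1" and t: "0 <= t" and tau: "0 < tau" "tau <= 1"
    and rc: "!!s. t <= s ==> s <= t + tau ==> \<bar>(LINT om|Q. phi (om s)) - (LINT om|Q. phi (om t))\<bar> <= e"
    and al: "prob {om\<in>\<Omega>. alive R (t + 1) om} >= 1 - e"
  shows "(LINT om|Q. phi (om t)) - 2 * e <= (\<integral>z. phi z \<partial>flow R tau t)"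
proof (rule flow_mean_bounds(1)[where C=1])
  fix s assume s: "t <= s" "s <= t + tau"
  have phib: "\<bar>phi z\<bar> <= 1" for z using phi(2,3)[of z] by simp
  note i = surv_integrable[OF phi(1) phib]
  have ip: "integrable Q (%om. phi (om s))"
    by (rule integrable_const_bound[where B=1]) (use phib measurable_compose[OF coord_measurable phi(1)] in auto)
  have il: "integrable Q (live R (t + 1))" by (rule integrable_const_bound[where B=1]) auto
  have "(LINT om|Q. phi (om s)) - (LINT om|Q. 1 - live R (t + 1) om) = (LINT om|Q. phi (om s) - (1 - live R (t + 1) om))" using ip il by simp
  also have "... <= surv R phi s" unfolding surv_def
  proof (rule integral_mono)
    fix om
    have "live R (t + 1) om <= live R s om" using s t tau by (intro live_antimono) auto
    moreover have "live R s om = 0 \<or> live R s om = 1" "live R (t + 1) om = 0 \<or> live R (t + 1) om = 1" by (auto simp: live_def)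
    ultimately show "phi (om s) - (1 - live R (t + 1) om) <= live R s om * phi (om s)" using phi(2,3)[of "om s"] by auto
  qed (use i ip il in auto)
  finally have 1: "(LINT om|Q. phi (om s)) - (1 - (LINT om|Q. live R (t + 1) om)) <= surv R phi s" using il by (simp add: prob_space)
  have A: "{om\<in>\<Omega>. alive R (t + 1) om} : sets Q" using alive_filt[of "t + 1"] filt_sub t by auto
  have "(LINT om|Q. live R (t + 1) om) = (LINT om|Q. indicator {om\<in>\<Omega>. alive R (t + 1) om} om)"
    using t by (intro Bochner_Integration.integral_cong) (auto simp: live_def indicator_def Q_space)
  also have "... = prob {om\<in>\<Omega>. alive R (t + 1) om}" using A by simp
  finally show "(LINT om|Q. phi (om t)) - 2 * e <= surv R phi s" using 1 al rc[OF s] unfolding abs_le_iff by argo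
qed (use phi tau in auto)

lemma flow_initial:
  fixes phi :: "(real^'d) \<times> nat => real"
  assumes phi: "phi : borel_measurable borel" "!!z. 0 <= phi z" "!!z. phi z <= C" "phi z0 = 0" and tau: "0 < tau"
    and rc: "!!s. 0 <= s ==> s <= 0 + tau ==> \<bar>(LINT om|Q. phi (om s)) - (LINT om|Q. phi (om 0))\<bar> <= e"
  shows "(\<integral>z. phi z \<partial>flow R tau 0) <= e"
proof (rule flow_mean_bounds(2)[where C=C])
  have phib: "\<bar>phi z\<bar> <= C" for z using phi(2,3)[of z] by simp
  fix s assume s: "0 <= s" "s <= 0 + tau"
  have ip: "integrable Q (%om. phi (om s))"
    by (rule integrable_const_bound[where B=C]) (use phib measurable_compose[OF coord_measurable phi(1)] in auto)
  have "surv R phi s <= (LINT om|Q. phi (om s))" unfolding surv_def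
  proof (rule integral_mono[OF surv_integrable[OF phi(1) phib] ip])
    show "live R s om * phi (om s) <= phi (om s)" for om using phi(2)[of "om s"] by (intro mult_left_le_one_le) auto
  qed
  moreover have "(LINT om|Q. phi (om 0)) = 0"
  proof -
    have "AE om in Q. om 0 = z0"
    proof -
      have "measure Q {om\<in>\<Omega>. om 0 = z0} = 1" using Q_init by (simp add: measure_def)
      moreover have "{om\<in>\<Omega>. om 0 = z0} : sets Q" using measurable_sets[OF coord_measurable[of 0], of "{z0}"] by (auto simp: Q_space vimage_def Int_def conj_commute)
      ultimately have "AE om in Q. om : {om\<in>\<Omega>. om 0 = z0}" by (subst prob_Collect_eq_1[symmetric]) (auto simp: Q_space Collect_conj_eq Int_absorb1)
      thus ?thesis by eventually_elim simp
    qed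
    hence "(LINT om|Q. phi (om 0)) = (LINT om|Q. 0)"
      using measurable_compose[OF coord_measurable phi(1), of 0] phi(4) by (intro integral_cong_AE) auto
    thus ?thesis by simp
  qed
  ultimately show "surv R phi s <= e" using rc[OF s] by linarith
qed (use phi tau in auto)

text \<open>One long window controls all short ones contained in it, whatever their position, at the
  price of the ratio of the lengths.\<close>

lemma flow_compare:
  assumes phi: "phi : borel_measurable borel" "!!z. 0 <= phi z" "!!z. \<bar>phi z\<bar> <= C" and tau: "tau > 0" and t: "0 <= t" "t + tau <= T'"
  shows "(\<integral>z. phi z \<partial>flow R tau t) <= T' / tau * (LINT z|flow R T' 0. phi z)"
proof -
  have T': "T' > 0" using tau t by linarith
  have sb: "\<bar>surv R phi s\<bar> <= C" for s by (rule surv_bound[OF phi(1,3)])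
  have s0: "0 <= surv R phi s" for s unfolding surv_def using phi(2) by (intro integral_nonneg_AE) auto
  have i: "integrable lborel (%s. indicator {t..t'} s * surv R phi s)" for t t' :: real
  proof (rule Bochner_Integration.integrable_bound)
    show "integrable lborel (%s. indicator {t..t'} s * C)"
      by (intro integrable_mult_left integrable_real_indicator) (auto simp: emeasure_lborel_Icc_eq)
  qed (use sb surv_measurable[OF phi(1)] in \<open>auto simp: indicator_def intro: order_trans[OF _ abs_ge_self]\<close>)
  have "(LINT s|lborel. indicator {t..t+tau} s * surv R phi s) <= (LINT s|lborel. indicator {0..0+T'} s * surv R phi s)"
    by (rule integral_mono[OF i i]) (use s0 t in \<open>auto simp: indicator_def\<close>)
  thus ?thesis unfolding flow_integral(2)[OF phi(1,3) tau] flow_integral(2)[OF phi(1,3) T'] using tau T' by (simp add: field_simps)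
qed

end

context switching begin

lemma sml_vanishes:
  assumes k: "k : Sset n0"
  shows "(%m. sml (inverse (real (Suc m))) (x, k)) \<longlonglongrightarrow> 0"
proof -
  have e: "inverse (real (Suc m)) <= 1" for m by (simp add: inverse_le_1_iff)
  have "(%m. \<integral>u. (norm u)\<^sup>2 * indicator (- far (inverse (real (Suc m)))) u \<partial>(\<nu> x k)) \<longlonglongrightarrow> (LINT u|(\<nu> x k). 0)"
  proof (rule integral_dominated_convergence[where w="%u. (norm u)\<^sup>2 * indicator (- far 1) u"])
    show "integrable (\<nu> x k) (%u. (norm u)\<^sup>2 * indicator (- far 1) u)" by (rule sml_facts(3)[OF k order_refl])
    show "AE u in \<nu> x k. (%m. (norm u)\<^sup>2 * indicator (- far (inverse (real (Suc m)))) u) \<longlonglongrightarrow> 0"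
    proof (rule AE_I2)
      fix u :: "real^'d"
      show "(%m. (norm u)\<^sup>2 * indicator (- far (inverse (real (Suc m)))) u) \<longlonglongrightarrow> 0"
      proof (cases "u = 0")
        case False
        have "\<forall>\<^sub>F m in sequentially. inverse (real (Suc m)) < norm u" using LIMSEQ_inverse_real_of_nat False by (intro order_tendstoD) auto
        hence "\<forall>\<^sub>F m in sequentially. (norm u)\<^sup>2 * indicator (- far (inverse (real (Suc m)))) u = 0" by eventually_elim (simp add: far_def)
        thus ?thesis by (rule tendsto_eventually)
      qed simp
    qed
    show "AE u in \<nu> x k. norm ((norm u)\<^sup>2 * indicator (- far (inverse (real (Suc m)))) u) <= (norm u)\<^sup>2 * indicator (- far 1) u" for m
      using e[of m] by (intro AE_I2) (auto simp: indicator_def far_def)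
    show "(%u. (norm u)\<^sup>2 * indicator (- far (inverse (real (Suc m)))) u) : borel_measurable (\<nu> x k)" for m
      by (intro nu_measurable k) measurable
  qed simp
  thus ?thesis using sml_facts(4)[OF k e] by simp
qed

text \<open>Comparison with a single window of length \<open>T + 1\<close> reduces the uniformity in
  \<open>t\<close> to dominated convergence under one measure.\<close>

lemma flow_sml_small:
  assumes Q: "cadlag_mp Q (Sset n0) G test z0" and tau: "0 < tau" "tau <= 1" and T: "T >= 0" and e: "e > 0"
  shows "\<forall>\<^sub>F m in sequentially. ALL t. 0 <= t --> t <= T -->
     (\<integral>z. (if snd z : Sset n0 then sml (inverse (real (Suc m))) z else 0) \<partial>cadlag_mp.flow Q R tau t) <= e"
proof -
  interpret Q: cadlag_mp Q "Sset n0" G test z0 by fact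
  define phi where "phi m z = (if snd z : Sset n0 then sml (inverse (real (Suc m))) z else 0)" for m :: nat and z :: "(real^'d) \<times> nat"
  have fin: "finite (Sset n0)" by (simp add: Sset_def)
  have e1: "inverse (real (Suc m)) <= 1" for m by (simp add: inverse_le_1_iff)
  have phim: "phi m : borel_measurable borel" for m unfolding phi_def[abs_def] by (rule measurable_slices[OF fin sml_measurable])
  have phi0: "0 <= phi m z" and phib: "\<bar>phi m z\<bar> <= CN" for m z
    using sml_facts(1,2)[OF _ e1[of m], of "snd z" "fst z"] CN by (auto simp: phi_def)
  have T1: "0 < T + 1" using T by simp
  interpret F: finite_measure "Q.flow R (T + 1) 0" by (rule Q.flow_emeasure(1)[OF T1])
  have "(%m. \<integral>z. phi m z \<partial>Q.flow R (T + 1) 0) \<longlonglongrightarrow> (LINT z|Q.flow R (T + 1) 0. 0)"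
  proof (rule integral_dominated_convergence[where w="%_. CN"])
    show "AE z in Q.flow R (T + 1) 0. (%m. phi m z) \<longlonglongrightarrow> 0"
    proof (rule AE_I2)
      fix z :: "(real^'d) \<times> nat"
      show "(%m. phi m z) \<longlonglongrightarrow> 0" using sml_vanishes[of "snd z" "fst z"] by (cases "snd z : Sset n0") (simp_all add: phi_def)
    qed
    show "phi m : borel_measurable (Q.flow R (T + 1) 0)" for m using phim by (simp add: measurable_cong_sets[OF Q.sets_flow refl])
    show "AE z in Q.flow R (T + 1) 0. norm (phi m z) <= CN" for m using phib by simp
  qed simp_all
  hence "(%m. \<integral>z. phi m z \<partial>Q.flow R (T + 1) 0) \<longlonglongrightarrow> 0" by simp
  moreover have "0 < e * tau / (T + 1)" using e tau T1 by simp
  ultimately have "\<forall>\<^sub>F m in sequentially. (LINT z|Q.flow R (T + 1) 0. phi m z) < e * tau / (T + 1)" by (rule order_tendstoD(2))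
  thus ?thesis unfolding phi_def[symmetric]
  proof (eventually_elim, intro allI impI)
    fix m t assume m: "(LINT z|Q.flow R (T + 1) 0. phi m z) < e * tau / (T + 1)" and t: "0 <= t" "t <= T"
    have "(\<integral>z. phi m z \<partial>Q.flow R tau t) <= (T + 1) / tau * (LINT z|Q.flow R (T + 1) 0. phi m z)"
      by (rule Q.flow_compare[OF phim phi0 phib tau(1)]) (use t tau in auto)
    also have "... <= (T + 1) / tau * (e * tau / (T + 1))" using m T1 tau by (intro mult_left_mono) auto
    also have "... = e" using T1 tau by simp
    finally show "(\<integral>z. phi m z \<partial>Q.flow R tau t) <= e" .
  qed
qed

end

section \<open>Choice of the parameters and the estimate for Lipschitz functions\<close>

context switching begin

text \<open>The parameters are chosen so that none depends on a later one: the exponent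
  \<open>p\<close>, the tolerance \<open>s\<close>, the scales \<open>th1\<close>,
  \<open>kap1\<close> and \<open>kap\<close>, the radius \<open>R\<close>, the mollifier, the window
  \<open>tau\<close>, the truncation \<open>eps\<close>, and at last the number of steps.
  \<open>\<delta>\<close>, \<open>th\<close> and \<open>M\<close> are given beforehand, so the slope
  of the bound does not see \<open>Lf\<close>: it is the slope \<open>4 / \<delta>\<close> of the
  exponent 4 cost times its initial weight \<open>2 * M\<close>.\<close>

lemma lipschitz_estimate:
  fixes f :: "(real^'d) \<times> nat => real"
  assumes T: "T > 0" and \<delta>: "\<delta> > 0" and M: "M >= 3" "\<delta>^2 / (lam * T) <= M"
    and th: "th > 0" "4 * th + 2 * (real n0 * HQ) * \<delta>^2 <= lam / \<delta>"
    and SFb: "!!k x z. k : Sset n0 ==> norm (x - z) <= 2 * \<delta> ==>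
       2 * ((x - z) \<bullet> (b x k - b z k)) + (norm (\<sigma> x k - \<sigma> z k))\<^sup>2 <= th * norm (x - z) \<and>
       tv_int (\<nu> x k) (\<nu> z k) norm <= ennreal th"
    and n0: "1 <= n0"
    and Q1: "cadlag_mp Q1 (Sset n0) (Aop a b \<nu> q eps0 n0) {f. ALL k:Sset n0. Cc_inf (%y. f (y, k))} (x, k)"
    and Q2: "cadlag_mp Q2 (Sset n0) (Aop a b \<nu> q eps0 n0) {f. ALL k:Sset n0. Cc_inf (%y. f (y, k))} (x', k)"
    and f: "f : borel_measurable borel" "!!z. 0 <= f z" "!!z. f z <= 1"
    and lip: "!!l y y'. l : Sset n0 ==> \<bar>f (y, l) - f (y', l)\<bar> <= Lf * norm (y - y')" and e: "e > 0"
  shows "(LINT om|Q1. f (om T)) - (LINT om|Q2. f (om T)) <= 8 * M / \<delta> * norm (x - x') + e"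
proof -
  interpret Q1: cadlag_mp Q1 "Sset n0" "Aop a b \<nu> q eps0 n0" "{f. ALL k:Sset n0. Cc_inf (%y. f (y, k))}" "(x, k)" by (rule Q1)
  interpret Q2: cadlag_mp Q2 "Sset n0" "Aop a b \<nu> q eps0 n0" "{f. ALL k:Sset n0. Cc_inf (%y. f (y, k))}" "(x', k)" by (rule Q2)
  \<comment> \<open>Large enough for \<open>Lf <= p / \<delta>\<close>, the slope of
    \<open>capped\<close> at the origin, and at least 4 for the Taylor bounds.\<close>
  define p where "p = max 4 (nat \<lceil>Lf * \<delta>\<rceil>)"
  have p: "p >= 4" by (simp add: p_def)
  have "Lf * \<delta> <= real p" unfolding p_def by linarith
  hence Lfp: "Lf <= real p / \<delta>" using \<delta> by (simp add: pos_le_divide_eq)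
  have lip': "\<bar>f (y, l) - f (y', l)\<bar> <= real p / \<delta> * norm (y - y')" if "l : Sset n0" for l y y'
    by (rule order_trans[OF lip[OF that] mult_right_mono[OF Lfp norm_ge_zero]])
  define Lc where "Lc = (2 + 2 * M) * real p / \<delta>"
  have Lc: "Lc >= 0" using M \<delta> by (simp add: Lc_def)
  \<comment> \<open>Collects the multiples of \<open>s\<close> lost on the way:
    \<open>8 * M / \<delta>\<close> by the rounding of the initial cost, 4 by killing and averaging
    at the end, \<open>2 * (p / \<delta>)\<close> by mollifying \<open>f\<close> and
    \<open>1 - f\<close>, \<open>T\<close> by the growth of the cost, 2 by the one-step errors, and
    the last summand by the initial windows.\<close>
  define D where "D = 8 * M / \<delta> + 4 + 2 * (real p / \<delta>) + T + 2 + 4 * (2 * M + Lc)"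
  have "0 <= 8 * M / \<delta>" "0 <= real p / \<delta>" using M \<delta> by auto
  hence D: "D > 0" using M T Lc unfolding D_def by argo
  define s where "s = e / D"
  have s: "s > 0" using e D by (simp add: s_def)
  define th1 where "th1 = s / (12 * (Lc + 1))"
  have th1: "th1 > 0" "3 * th1 * Lc <= s / 4"
  proof -
    show "th1 > 0" using s Lc by (simp add: th1_def)
    define Y where "Y = Lc + 1"
    have Y: "Y > 0" "Lc <= Y" "th1 = s / (12 * Y)" using Lc by (auto simp: Y_def th1_def)
    have "3 * th1 * Lc <= 3 * th1 * Y" using \<open>th1 > 0\<close> Y by (intro mult_left_mono) auto
    also have "... = s / 4" using Y by simp
    finally show "3 * th1 * Lc <= s / 4" .
  qed
  obtain kap' where kap': "kap' > 0" "!!k x z. k : Sset n0 ==> norm (x - z) <= kap' ==>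
       2 * ((x - z) \<bullet> (b x k - b z k)) + (norm (\<sigma> x k - \<sigma> z k))\<^sup>2 <= th1 * norm (x - z) & tv_int (\<nu> x k) (\<nu> z k) norm <= ennreal th1"
    using SF[OF th1(1)] by blast
  define Kx where "Kx = (2 + 2 * M) * (real n0 * HQ * 2) + 2 / T * (real p / \<delta> * 2)"
  have Kx: "Kx >= 0" using M HQ T \<delta> by (simp add: Kx_def)
  define kap1 where "kap1 = min (kap' / 2) (s / (4 * (Kx + 1)))"
  have kap1: "kap1 > 0" "2 * kap1 <= kap'" using kap'(1) s Kx by (auto simp: kap1_def)
  have kap1': "Kx * kap1 <= s / 4"
  proof -
    define Y where "Y = Kx + 1"
    have Y: "Y > 0" "Kx <= Y" "kap1 <= s / (4 * Y)" using Kx by (auto simp: Y_def kap1_def)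
    have "Kx * kap1 <= Y * (s / (4 * Y))" using Kx kap1 Y by (intro mult_mono) auto
    also have "... = s / 4" using Y by simp
    finally show ?thesis .
  qed
  \<comment> \<open>Below \<open>s\<close>, so that the value of the rounded cost on the diagonal is
    negligible; below a multiple of \<open>kap1 ^ 3\<close>, so that the rounding does little harm
    where the noise is reflected; below 1, so that \<open>kap^2\<close> obeys the same
    bound.\<close>
  define kap where "kap = min kap1 (min s (min 1 (th * kap1 ^ 3 / (4 * lam))))"
  have kap: "0 < kap" "kap <= kap1" "kap <= s" "kap <= 1" "kap <= th * kap1 ^ 3 / (4 * lam)" using kap1 s th lam by (auto simp: kap_def)
  have kap2: "4 * lam * kap^2 <= th * kap1 ^ 3"
  proof -
    have "kap^2 <= kap" using kap by (simp add: power2_eq_square mult_left_le_one_le)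
    hence "kap^2 <= th * kap1 ^ 3 / (4 * lam)" using kap(5) by linarith
    thus ?thesis using lam by (simp add: pos_le_divide_eq mult_ac)
  qed
  have T1: "0 <= T + 1" using T by simp
  \<comment> \<open>Survival is required up to \<open>T + 1\<close> because the last window reaches
    beyond \<open>T\<close> by \<open>tau\<close>, which is at most 1.\<close>
  obtain R1 R2 where R12: "!!R. R >= R1 ==> Q1.prob {om\<in>cadlag_space (UNIV \<times> Sset n0). Q1.alive R (T + 1) om} >= 1 - s"
    "!!R. R >= R2 ==> Q2.prob {om\<in>cadlag_space (UNIV \<times> Sset n0). Q2.alive R (T + 1) om} >= 1 - s"
    using Q1.alive_prob[OF T1 s] Q2.alive_prob[OF T1 s] by blast
  define R where "R = max 0 (max R1 R2)"
  have R: "R >= 0" "R >= R1" "R >= R2" by (auto simp: R_def)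
  obtain B0 where B0: "!!x k. k : Sset n0 ==> norm x <= R ==> norm (a x k) <= B0 & norm (b x k) <= B0 & norm (\<sigma> x k) <= B0"
    using loc_bound[of R] by blast
  define B where "B = \<bar>B0\<bar>"
  have B: "norm (b x k) <= B & norm (\<sigma> x k) <= B" if "k : Sset n0" "norm x <= R" for x k using B0[OF that] by (auto simp: B_def)
  have B1: "0 < 2 * th + 8 * B" "0 < 2 * th1 + 8 * B" using th th1 by (auto simp: B_def add_pos_nonneg)
  define X1 where "X1 = th * kap / (2 * th + 8 * B)"
  define X2 where "X2 = th1 * kap / (2 * th1 + 8 * B)"
  have X: "X1 > 0" "X2 > 0" unfolding X1_def X2_def using th th1 kap B1 by simp_all
  define \<eta> where "\<eta> = min (\<delta> / 2) (min (kap1 / 2) (min X1 (min X2 (min 1 s))))"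
  have "\<eta> <= \<delta> / 2" "\<eta> <= kap1 / 2" "\<eta> <= X1" "\<eta> <= X2" "\<eta> <= 1" "\<eta> <= s" by (simp_all add: \<eta>_def min_le_iff_disj)
  moreover have "0 < \<eta>" using \<delta> kap1 X s by (simp add: \<eta>_def)
  ultimately have \<eta>: "0 < \<eta>" "2 * \<eta> <= \<delta>" "2 * \<eta> <= kap1" "\<eta> <= X1" "\<eta> <= X2" "\<eta> <= 1" "\<eta> <= s" by linarith+
  have \<eta>': "\<eta> * (2 * th + 8 * B) <= th * kap" "\<eta> * (2 * th1 + 8 * B) <= th1 * kap" using \<eta>(4,5) B1 unfolding X1_def X2_def by (simp_all only: pos_le_divide_eq)
  obtain W :: "(real^'d) measure" and C where W: "prob_space W" "sets W = sets borel" "AE w in W. norm w <= \<eta>"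
    "!!f. continuous_on UNIV f ==> bounded {y. f y ~= 0} ==> Cc_inf (%x. \<integral>w. f (x + w) \<partial>W)"
    "!!f is x. continuous_on UNIV f ==> bounded {y. f y ~= 0} ==> (!!y. \<bar>f y\<bar> <= 1) ==> \<bar>iter_pd is (%x. \<integral>w. f (x + w) \<partial>W) x\<bar> <= C is"
    using mollifier_exists[OF \<eta>(1)] by metis
  \<comment> \<open>There are only finitely many lists of at most three coordinates; the 0 makes the
    constant nonnegative.\<close>
  define C3 where "C3 = max 0 (Max (C ` {is::'d list. set is \<subseteq> UNIV & length is <= 3}))"
  have C3: "C is <= C3" if "length is <= 3" for "is"
    unfolding C3_def using that by (intro max.coboundedI2 Max_ge finite_imageI finite_lists_length_le) auto
  have W_test: "Cc_inf (%x. \<integral>w. f (x + w) \<partial>W) & test_bound C3 (%x. \<integral>w. f (x + w) \<partial>W)"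
    if "continuous_on UNIV f" "bounded {y. f y ~= 0}" "!!y. \<bar>f y\<bar> <= 1" for f
    using W(4)[OF that(1,2)] W(5)[OF that] C3 unfolding test_bound_def Cc_inf_def by (meson order_trans)
  define \<gamma> where "\<gamma> x z = min 1 (norm (fst z - x)) + (if snd z = k then 0 else 1)" for x :: "real^'d" and z :: "(real^'d) \<times> nat"
  have fin: "finite (Sset n0)" by (simp add: Sset_def)
  have \<gamma>c: "continuous_on UNIV (%y. \<gamma> x (y, l))" for x l unfolding \<gamma>_def fst_conv snd_conv by (intro continuous_intros)
  have \<gamma>m: "\<gamma> x : borel_measurable borel" for x
  proof -
    have o: "open ((snd :: (real^'d) \<times> nat => nat) -` A)" for A
      by (intro open_vimage continuous_on_snd continuous_on_id discrete_topology_class.open_discrete)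
    have "(%z::(real^'d) \<times> nat. min 1 (norm (fst z - x)) + (1 - indicator (snd -` {k}) z)) : borel_measurable borel"
      by (intro borel_measurable_add borel_measurable_diff borel_measurable_const borel_measurable_indicator borel_open o borel_measurable_continuous_onI continuous_intros)
    moreover have "\<gamma> x = (%z. min 1 (norm (fst z - x)) + (1 - indicator (snd -` {k}) z))" by (auto simp: \<gamma>_def indicator_def)
    ultimately show ?thesis by simp
  qed
  have \<gamma>b: "0 <= \<gamma> x z" "\<gamma> x z <= 2" "\<bar>\<gamma> x z\<bar> <= 2" "\<gamma> x (x, k) = 0" for x z by (auto simp: \<gamma>_def)
  have fc: "continuous_on UNIV (%y. f (y, l))" if "l : Sset n0" for l
  proof (rule lipschitz_on_continuous_on)
    show "(real p / \<delta>)-lipschitz_on UNIV (%y. f (y, l))"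
      using lip'[OF that] \<delta> by (auto intro!: lipschitz_onI simp: dist_real_def dist_norm)
  qed
  define g where "g z = 1 - f z" for z
  have g: "g : borel_measurable borel" "!!z. 0 <= g z" "!!z. g z <= 1" and gc: "!!l. l : Sset n0 ==> continuous_on UNIV (%y. g (y, l))"
    unfolding g_def using f(1) f(3) f(2) fc by (auto intro!: continuous_intros simp: diff_le_eq)
  have fg1: "\<bar>f z\<bar> <= 1" "\<bar>g z\<bar> <= 1" for z using f(2,3)[of z] g(2,3)[of z] by auto
  obtain t1 where t1: "t1 > 0" "!!r. T <= r ==> r <= T + t1 ==> \<bar>(LINT om|Q1. f (om r)) - (LINT om|Q1. f (om T))\<bar> <= s"
    using Q1.mean_right_continuous[OF f(1) fg1(1) fc s, of T] by blast
  obtain t2 where t2: "t2 > 0" "!!r. T <= r ==> r <= T + t2 ==> \<bar>(LINT om|Q2. g (om r)) - (LINT om|Q2. g (om T))\<bar> <= s"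
    using Q2.mean_right_continuous[OF g(1) fg1(2) gc s, of T] by blast
  obtain t3 where t3: "t3 > 0" "!!r. 0 <= r ==> r <= 0 + t3 ==> \<bar>(LINT om|Q1. \<gamma> x (om r)) - (LINT om|Q1. \<gamma> x (om 0))\<bar> <= s"
    using Q1.mean_right_continuous[OF \<gamma>m[of x] \<gamma>b(3) \<gamma>c s, of 0] by blast
  obtain t4 where t4: "t4 > 0" "!!r. 0 <= r ==> r <= 0 + t4 ==> \<bar>(LINT om|Q2. \<gamma> x' (om r)) - (LINT om|Q2. \<gamma> x' (om 0))\<bar> <= s"
    using Q2.mean_right_continuous[OF \<gamma>m[of x'] \<gamma>b(3) \<gamma>c s, of 0] by blast
  define tau where "tau = min 1 (min (min t1 t2) (min t3 t4))"
  have tau: "0 < tau" "tau <= 1" "tau <= t1" "tau <= t2" "tau <= t3" "tau <= t4" using t1(1) t2(1) t3(1) t4(1) by (auto simp: tau_def)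
  define DC where "DC = real CARD('d) ^ 3 * C3"
  have DC: "DC >= 0" by (simp add: DC_def C3_def)
  \<comment> \<open>Tolerance for the mean of the dropped jumps: summed over all steps they
    contribute \<open>T * DC * sb\<close>, at most half of \<open>s\<close>.\<close>
  define sb where "sb = s / (2 * (T * DC + 1))"
  have TD: "T * DC >= 0" using T DC by simp
  have sb: "sb > 0" "T * DC * sb <= s / 2"
  proof -
    show "sb > 0" using s TD by (simp add: sb_def add_nonneg_pos)
    define Y where "Y = T * DC + 1"
    have Y: "Y > 0" "T * DC <= Y" "sb = s / (2 * Y)" using TD by (auto simp: Y_def sb_def)
    have "T * DC * sb <= Y * sb" using \<open>sb > 0\<close> Y by (intro mult_right_mono) auto
    also have "... = s / 2" using Y by simp
    finally show "T * DC * sb <= s / 2" .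
  qed
  have T0: "T >= 0" using T by simp
  have "\<forall>\<^sub>F m in sequentially. inverse (real (Suc m)) < eps0" using LIMSEQ_inverse_real_of_nat eps0 by (intro order_tendstoD) auto
  from eventually_happens'[OF sequentially_bot eventually_conj[OF this eventually_conj[OF flow_sml_small[OF Q1 tau(1,2) T0 sb(1), of R] flow_sml_small[OF Q2 tau(1,2) T0 sb(1), of R]]]]
  obtain m where m: "inverse (real (Suc m)) < eps0"
    "!!t. 0 <= t ==> t <= T ==> (\<integral>z. (if snd z : Sset n0 then sml (inverse (real (Suc m))) z else 0) \<partial>Q1.flow R tau t) <= sb"
    "!!t. 0 <= t ==> t <= T ==> (\<integral>z. (if snd z : Sset n0 then sml (inverse (real (Suc m))) z else 0) \<partial>Q2.flow R tau t) <= sb" by blast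
  define eps where "eps = inverse (real (Suc m))"
  have eps: "0 < eps" "eps <= 1" "eps <= eps0" using m(1) by (auto simp: eps_def inverse_le_1_iff)
  define L where "L = 2 * (CN / eps^2) + 2 * (real n0 * CQ)"
  have L: "2 * (CN / eps^2) <= L" "2 * (real n0 * CQ) <= L" using CN CQ by (auto simp: L_def)
  have small: "3 * th1 * ((2 + 2 * M) * real p / \<delta>) + (2 + 2 * M) * (real n0 * HQ * (2 * kap1)) + 2 / T * (real p / \<delta> * (2 * kap1)) <= s / 2"
  proof -
    have "(2 + 2 * M) * (real n0 * HQ * (2 * kap1)) + 2 / T * (real p / \<delta> * (2 * kap1)) = Kx * kap1" by (simp add: Kx_def algebra_simps)
    thus ?thesis using th1(2) kap1' unfolding Lc_def by linarith
  qed
  interpret C: mollified_coupling a b \<nu> q n0 eps0 \<sigma> lam CN CQ HQ N v0 T \<delta> kap kap1 M th th1 \<eta> R B s eps L p W C3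
  proof (intro mollified_coupling.intro coupling.intro switching_axioms coupling_axioms.intro mollified_coupling_axioms.intro)
    show "2 * ((x - z) \<bullet> (b x k - b z k)) + (norm (\<sigma> x k - \<sigma> z k))\<^sup>2 <= th1 * norm (x - z) & tv_int (\<nu> x k) (\<nu> z k) norm <= ennreal th1"
      if "k : Sset n0" "norm (x - z) <= 2 * kap1" for k x z using kap'(2)[OF that(1), of x z] that(2) kap1(2) by linarith
  qed (fact T \<delta> kap p M th SFb th1 \<eta> \<eta>' kap2 R B small s eps L W W_test n0)+
  obtain Kc where Kc: "!!Q z0 tau n st s. C.A_mp Q z0 ==> tau > 0 ==> 0 < st ==> st <= 1 ==> 2 * st^2 * L <= 1 ==> real n * st^2 <= T ==>
      (!!t. 0 <= t ==> t <= T ==> (\<integral>z. C.smlS z \<partial>cadlag_mp.flow Q R tau t) <= s) ==>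
      C.sub_chain st (Kc * st ^ 3 + st^2 * (real CARD('d) ^ 3 * C3 * s) + Kc * (st^2)\<^sup>2 / tau) (%i. cadlag_mp.flow Q R tau (real i * st^2)) n" "Kc >= 0"
    
  proof (rule C.sub_chain_flow)
    fix Kc assume 1: "!!Q z0 tau n st s. C.A_mp Q z0 ==> tau > 0 ==> 0 < st ==> st <= 1 ==> 2 * st^2 * L <= 1 ==> real n * st^2 <= T ==>
      (!!t. 0 <= t ==> t <= T ==> (\<integral>z. C.smlS z \<partial>cadlag_mp.flow Q R tau t) <= s) ==>
      C.sub_chain st (Kc * st ^ 3 + st^2 * (real CARD('d) ^ 3 * C3 * s) + Kc * (st^2)\<^sup>2 / tau) (%i. cadlag_mp.flow Q R tau (real i * st^2)) n" and 2: "Kc >= 0"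
    show thesis by (rule that[OF 1 2])
  qed
  \<comment> \<open>\<open>Suc n\<close> steps of duration \<open>(st n)\<^sup>2\<close> fill the
    time \<open>T\<close> exactly.\<close>
  define st where "st n = sqrt (T / real (Suc n))" for n
  have st0: "st \<longlonglongrightarrow> 0"
  proof -
    have "(%n. sqrt (T * inverse (real (Suc n)))) \<longlonglongrightarrow> sqrt (T * 0)"
      by (intro tendsto_intros LIMSEQ_inverse_real_of_nat)
    thus ?thesis by (simp add: st_def[abs_def] divide_inverse)
  qed
  have stp: "st n > 0" "real (Suc n) * (st n)\<^sup>2 = T" for n using T by (auto simp: st_def)
  have ev: "\<forall>\<^sub>F n in sequentially. F (st n) < c" if "continuous_on UNIV F" "F 0 < c" for F :: "real => real" and c
    using continuous_on_tendsto_compose[OF that(1) st0] that(2) by (intro order_tendstoD(2)) auto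
  have "\<forall>\<^sub>F n in sequentially. 2 * (st n * m1) < kap / 2 & 4 * (st n * m1) < \<delta> & st n < 1 & 2 * (st n)\<^sup>2 * L < 1 & C.Kst * st n < s / 2
      & T * (Kc * st n + Kc * (st n)\<^sup>2 / tau) < s / 2"
    by (intro eventually_conj ev[of "%r. 2 * (r * m1)"] ev[of "%r. 4 * (r * m1)"] ev[of "%r. r"] ev[of "%r. 2 * r^2 * L"] ev[of "%r. C.Kst * r"]
        ev[of "%r. T * (Kc * r + Kc * r^2 / tau)"] continuous_intros) (use kap \<delta> s tau in auto)
  then obtain n' where n': "2 * (st n' * m1) < kap / 2" "4 * (st n' * m1) < \<delta>" "st n' < 1" "2 * (st n')\<^sup>2 * L < 1" "C.Kst * st n' < s / 2"
      "T * (Kc * st n' + Kc * (st n')\<^sup>2 / tau) < s / 2" using eventually_happens'[OF sequentially_bot] by blast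
  define r where "r = st n'"
  define n where "n = Suc n'"
  have r: "0 < r" "2 * (r * m1) <= kap / 2" "4 * (r * m1) <= \<delta>" "r <= 1" "2 * r^2 * L <= 1" "C.Kst * r <= s / 2" "real n * r^2 = T"
    using n' stp[of n'] by (simp_all add: r_def n_def del: of_nat_Suc)
  define E where "E = Kc * r ^ 3 + r^2 * (real CARD('d) ^ 3 * C3 * sb) + Kc * (r^2)\<^sup>2 / tau"
  have nE: "real n * E <= s"
  proof -
    have "real n * E = (real n * r^2) * (Kc * r + DC * sb + Kc * r^2 / tau)"
      by (simp add: E_def DC_def power3_eq_cube power2_eq_square algebra_simps)
    also have "... = T * (Kc * r + Kc * r^2 / tau) + T * DC * sb" unfolding r(7) by (simp add: algebra_simps)
    finally show ?thesis using n'(6) sb(2) unfolding r_def by linarith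
  qed
  have smlS: "C.smlS z = (if snd z : Sset n0 then sml (inverse (real (Suc m))) z else 0)" for z unfolding C.smlS_def unfolding eps_def ..
  have ch1: "C.sub_chain r E (%i. Q1.flow R tau (real i * r^2)) n" unfolding E_def
  proof (rule Kc(1)[OF Q1 tau(1) r(1,4,5)])
    show "(\<integral>z. C.smlS z \<partial>Q1.flow R tau t) <= sb" if "0 <= t" "t <= T" for t using m(2)[OF that] unfolding smlS .
  qed (use r(7) in simp)
  have ch2: "C.sub_chain r E (%i. Q2.flow R tau (real i * r^2)) n" unfolding E_def
  proof (rule Kc(1)[OF Q2 tau(1) r(1,4,5)])
    show "(\<integral>z. C.smlS z \<partial>Q2.flow R tau t) <= sb" if "0 <= t" "t <= T" for t using m(3)[OF that] unfolding smlS .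
  qed (use r(7) in simp)
  have gap: "C.gap x k = \<gamma> x" for x by (auto simp: C.gap_def \<gamma>_def)
  interpret W: prob_space W by (rule W(1))
  have mollc: "\<bar>C.moll phi z - phi z\<bar> <= K * \<eta>"
    if z: "snd z : Sset n0" and K: "K >= 0" "!!y y'. \<bar>phi (y, snd z) - phi (y', snd z)\<bar> <= K * norm (y - y')" and b: "!!z. \<bar>phi z\<bar> <= 2"
      and c: "continuous_on UNIV (%y. phi (y, snd z))" for phi z K
  proof -
    have i: "integrable W (%w. phi (fst z + w, snd z))"
      using measurable_compose[OF _ borel_measurable_continuous_onI[OF c], of "(+) (fst z)" borel] b by (intro C.W_integrable[where C=2]) auto
    have "C.moll phi z - phi z = (LINT w|W. phi (fst z + w, snd z) - phi z)" using i z by (simp add: C.moll_def W.prob_space)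
    also have "\<bar>...\<bar> <= (LINT w|W. \<bar>phi (fst z + w, snd z) - phi z\<bar>)" by (rule integral_abs_bound)
    also have "... <= (LINT w|W. K * \<eta>)"
    proof (rule integral_mono_AE)
      show "AE w in W. \<bar>phi (fst z + w, snd z) - phi z\<bar> <= K * \<eta>" using W(3)
      proof eventually_elim
        case (elim w)
        have "K * norm w <= K * \<eta>" using elim K(1) by (intro mult_left_mono)
        thus ?case using K(2)[of "fst z + w" "fst z"] by simp
      qed
    qed (use i in auto)
    finally show ?thesis by (simp add: W.prob_space)
  qed
  have m_int: "(\<integral>z. phi z \<partial>\<mu> i) - K * \<eta> <= (\<integral>z. C.moll phi z \<partial>\<mu> i)" "(\<integral>z. C.moll phi z \<partial>\<mu> i) <= (\<integral>z. phi z \<partial>\<mu> i) + K * \<eta>"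
    if ch: "C.sub_chain r E \<mu> n" and K: "K >= 0" "!!l y y'. l : Sset n0 ==> \<bar>phi (y, l) - phi (y', l)\<bar> <= K * norm (y - y')" and phi: "phi : borel_measurable borel" "!!z. 0 <= phi z" "!!z. phi z <= 2"
      and c: "!!l. l : Sset n0 ==> continuous_on UNIV (%y. phi (y, l))" for \<mu> phi K i
  proof -
    have fm: "finite_measure (\<mu> i)" and sets: "sets (\<mu> i) = sets borel" and m1: "measure (\<mu> i) UNIV <= 1" and ae: "AE z in \<mu> i. norm (fst z) <= R & snd z : Sset n0"
      using ch unfolding C.sub_chain_def by blast+
    interpret F: finite_measure "\<mu> i" by (rule fm)
    have b: "\<bar>phi z\<bar> <= 2" for z using phi(2,3)[of z] by simp
    have mm: "C.moll phi : borel_measurable borel" "0 <= C.moll phi z" "C.moll phi z <= 2" for z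
      by (rule C.moll_props[where C=2]; intro borel_measurable_continuous_onI c phi; assumption)+
    have i: "integrable (\<mu> i) phi" "integrable (\<mu> i) (C.moll phi)"
      using C.chain_integrable[OF ch phi(1) b] C.chain_integrable[OF ch mm(1), of 2] mm(2,3) by (auto simp: abs_le_iff)
    have me: "measure (\<mu> i) UNIV * (K * \<eta>) <= 1 * (K * \<eta>)" using m1 K(1) \<eta>(1) by (intro mult_right_mono) auto
    have ae2: "AE z in \<mu> i. \<bar>C.moll phi z - phi z\<bar> <= K * \<eta>" using ae by eventually_elim (intro mollc K b c; blast)
    have "\<bar>(\<integral>z. C.moll phi z - phi z \<partial>\<mu> i)\<bar> <= (\<integral>z. K * \<eta> \<partial>\<mu> i)"
      by (rule order_trans[OF integral_abs_bound], rule integral_mono_AE) (use i ae2 in auto)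
    also have "... = measure (\<mu> i) UNIV * (K * \<eta>)" using sets_eq_imp_space_eq[OF sets] by simp
    finally have "\<bar>(\<integral>z. C.moll phi z \<partial>\<mu> i) - (\<integral>z. phi z \<partial>\<mu> i)\<bar> <= K * \<eta>" using me i by simp
    thus "(\<integral>z. phi z \<partial>\<mu> i) - K * \<eta> <= (\<integral>z. C.moll phi z \<partial>\<mu> i)" "(\<integral>z. C.moll phi z \<partial>\<mu> i) <= (\<integral>z. phi z \<partial>\<mu> i) + K * \<eta>" by linarith+
  qed
  have \<gamma>l: "\<bar>\<gamma> x (y, l) - \<gamma> x (y', l)\<bar> <= 1 * norm (y - y')" for x y y' l
  proof -
    have "\<bar>norm (y - x) - norm (y' - x)\<bar> <= norm (y - y')" using norm_triangle_ineq3[of "y - x" "y' - x"] by simp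
    thus ?thesis by (auto simp: \<gamma>_def)
  qed
  have E1: "(\<integral>z. C.moll (C.gap x k) z \<partial>Q1.flow R tau (real 0 * r^2)) <= 2 * s"
  proof -
    have "(\<integral>z. \<gamma> x z \<partial>Q1.flow R tau 0) <= s" by (rule Q1.flow_initial[OF \<gamma>m \<gamma>b(1,2,4) tau(1) t3(2)]) (use tau in auto)
    thus ?thesis unfolding gap using m_int(2)[OF ch1 zero_le_one \<gamma>l \<gamma>m[of x] \<gamma>b(1,2) \<gamma>c, of 0] \<eta>(7) by simp
  qed
  have E2: "(\<integral>z. C.moll (C.gap x' k) z \<partial>Q2.flow R tau (real 0 * r^2)) <= 2 * s"
  proof -
    have "(\<integral>z. \<gamma> x' z \<partial>Q2.flow R tau 0) <= s" by (rule Q2.flow_initial[OF \<gamma>m \<gamma>b(1,2,4) tau(1) t4(2)]) (use tau in auto)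
    thus ?thesis unfolding gap using m_int(2)[OF ch2 zero_le_one \<gamma>l \<gamma>m[of x'] \<gamma>b(1,2) \<gamma>c, of 0] \<eta>(7) by simp
  qed
  have main: "(\<integral>z. C.moll f z \<partial>Q1.flow R tau T) + (\<integral>z. C.moll g z \<partial>Q2.flow R tau T)
     <= 1 + T * s + 2 * real n * E + (tcost \<delta> kap p 0 (2 * M) (norm (x - x')) + (2 * M + Lc) * (2 * s + 2 * s))"
    using C.coupled_estimate[OF r ch1 ch2 E1 E2 f(2,3) lip'] unfolding r(7) g_def[symmetric] C.Lc_def Lc_def .
  have pd0: "real p / \<delta> >= 0" using \<delta> by simp
  have f2: "f z <= 2" "g z <= 2" for z using f(3)[of z] g(3)[of z] by auto
  have gl: "\<bar>g (y, l) - g (y', l)\<bar> <= real p / \<delta> * norm (y - y')" if "l : Sset n0" for l y y' using lip'[OF that, of y y'] by (simp add: g_def abs_minus_commute)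
  have pe: "real p / \<delta> * \<eta> <= real p / \<delta> * s" using pd0 \<eta>(7) by (intro mult_left_mono)
  have l1: "(LINT om|Q1. f (om T)) - 2 * s - real p / \<delta> * s <= (\<integral>z. C.moll f z \<partial>Q1.flow R tau T)"
  proof -
    have "(LINT om|Q1. f (om T)) - 2 * s <= (\<integral>z. f z \<partial>Q1.flow R tau T)"
      by (rule Q1.flow_terminal[OF f T0 tau(1,2) t1(2) R12(1)[OF R(2)]]) (use tau in auto)
    thus ?thesis using m_int(1)[OF ch1 pd0 lip' f(1,2) f2(1) fc, of n] pe unfolding r(7) by linarith
  qed
  have l2: "(LINT om|Q2. g (om T)) - 2 * s - real p / \<delta> * s <= (\<integral>z. C.moll g z \<partial>Q2.flow R tau T)"
  proof -
    have "(LINT om|Q2. g (om T)) - 2 * s <= (\<integral>z. g z \<partial>Q2.flow R tau T)"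
      by (rule Q2.flow_terminal[OF g T0 tau(1,2) t2(2) R12(2)[OF R(3)]]) (use tau in auto)
    thus ?thesis using m_int(1)[OF ch2 pd0 gl g(1,2) f2(2) gc, of n] pe unfolding r(7) by linarith
  qed
  have if2: "integrable Q2 (%om. f (om T))"
    by (rule Q2.integrable_const_bound[where B=1]) (use fg1 measurable_compose[OF Q2.coord_measurable f(1)] in auto)
  have g2: "(LINT om|Q2. g (om T)) = 1 - (LINT om|Q2. f (om T))" unfolding g_def using if2 by (simp add: Q2.prob_space)
  have tc: "tcost \<delta> kap p 0 (2 * M) (norm (x - x')) <= 8 * M / \<delta> * norm (x - x') + 8 * M / \<delta> * s"
  proof -
    have "sqrt ((norm (x - x'))\<^sup>2 + kap^2) <= norm (x - x') + kap" using sqrt_sum_squares_le_sum[of "norm (x - x')" kap] kap by simp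
    hence "sqrt ((norm (x - x'))\<^sup>2 + kap^2) <= norm (x - x') + s" using kap(3) by linarith
    hence "real 4 / \<delta> * sqrt ((norm (x - x'))\<^sup>2 + kap^2) <= real 4 / \<delta> * (norm (x - x') + s)" using \<delta> by (intro mult_left_mono) auto
    moreover have "capped \<delta> 4 (sqrt ((norm (x - x'))\<^sup>2 + kap^2)) <= real 4 / \<delta> * sqrt ((norm (x - x'))\<^sup>2 + kap^2)"
      using capped_tangent[OF \<delta>, of 4 0 "sqrt ((norm (x - x'))\<^sup>2 + kap^2)"] by (simp add: capped_def)
    ultimately have "smooth_cost \<delta> kap 4 (norm (x - x')) <= real 4 / \<delta> * (norm (x - x') + s)" unfolding smooth_cost_def by linarith
    hence "2 * M * smooth_cost \<delta> kap 4 (norm (x - x')) <= 2 * M * (real 4 / \<delta> * (norm (x - x') + s))" using M by (intro mult_left_mono) auto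
    also have "... = 8 * M / \<delta> * norm (x - x') + 8 * M / \<delta> * s" by (simp add: algebra_simps add_divide_distrib)
    finally show ?thesis by (simp add: tcost_def)
  qed
  have "s * D = e" using D by (simp add: s_def)
  hence eD: "8 * M / \<delta> * s + 4 * s + 2 * (real p / \<delta> * s) + T * s + 2 * s + (2 * M + Lc) * (4 * s) = e" unfolding D_def by (simp add: algebra_simps)
  have "(2 * M + Lc) * (2 * s + 2 * s) = (2 * M + Lc) * (4 * s)" by simp
  thus ?thesis using main l1 l2 g2 tc eD nE by linarith
qed

end

section \<open>From Lipschitz to measurable test functions\<close>

text \<open>Serves the case of equal points, about which a limit of the modulus at 0 from the right
  says nothing. The density is finite almost everywhere, so its truncated difference with itself is
  0.\<close>

lemma tv_int_self:
  assumes sf: "sigma_finite_measure \<mu>"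
  shows "tv_int \<mu> \<mu> g = 0"
proof -
  interpret l: sigma_finite_measure "msum \<mu> \<mu>" by (rule sigma_finite_msum[OF refl sf sf])
  have ac: "absolutely_continuous (msum \<mu> \<mu>) \<mu>"
    unfolding absolutely_continuous_def null_sets_def using emeasure_msum[OF refl, of _ \<mu>] by auto
  have "AE u in msum \<mu> \<mu>. RN_deriv (msum \<mu> \<mu>) \<mu> u ~= \<infinity>" by (rule l.RN_deriv_finite[OF sf ac]) simp
  hence "AE u in msum \<mu> \<mu>. ennreal (g u) * ((RN_deriv (msum \<mu> \<mu>) \<mu> u - RN_deriv (msum \<mu> \<mu>) \<mu> u) + (RN_deriv (msum \<mu> \<mu>) \<mu> u - RN_deriv (msum \<mu> \<mu>) \<mu> u)) = 0"
    by eventually_elim simp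
  hence "tv_int \<mu> \<mu> g = (\<integral>\<^sup>+u. 0 \<partial>msum \<mu> \<mu>)" unfolding tv_int_def Let_def by (rule nn_integral_cong_AE)
  thus ?thesis by simp
qed

text \<open>Lipschitz functions increase to the indicator of an open set. Outer regularity is needed
  for \<open>\<mu>2\<close> alone to reach Borel sets, as monotonicity handles
  \<open>\<mu>1\<close>. A function with values in the unit interval is, up to \<open>1 / N\<close>,
  the mean of the indicators of \<open>N\<close> superlevel sets, and a mean of inequalities keeps
  the constant \<open>c\<close>.\<close>

lemma lipschitz_to_measurable:
  fixes \<mu>1 \<mu>2 :: "'a::euclidean_space measure"
  assumes s1: "sets \<mu>1 = sets borel" and s2: "sets \<mu>2 = sets borel" and fin: "finite_measure \<mu>1" "finite_measure \<mu>2"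
    and lip: "!!phi Lf. phi : borel_measurable borel ==> (!!y. 0 <= phi y) ==> (!!y. phi y <= 1) ==>
       (!!y y'. \<bar>phi y - phi y'\<bar> <= Lf * norm (y - y')) ==> (\<integral>y. phi y \<partial>\<mu>1) <= (\<integral>y. phi y \<partial>\<mu>2) + c"
    and g: "g : borel_measurable borel" "!!y. 0 <= g y" "!!y. g y <= 1"
  shows "(\<integral>y. g y \<partial>\<mu>1) <= (\<integral>y. g y \<partial>\<mu>2) + (c::real)"
proof -
  interpret \<mu>1: finite_measure \<mu>1 by fact
  interpret \<mu>2: finite_measure \<mu>2 by fact
  note [measurable_cong] = s1 s2
  have sp: "space \<mu>1 = UNIV" "space \<mu>2 = UNIV" using sets_eq_imp_space_eq[OF s1] sets_eq_imp_space_eq[OF s2] by auto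
  have opn: "measure \<mu>1 U <= measure \<mu>2 U + c" if U: "open U" for U
  proof (cases "U = UNIV")
    case True
    thus ?thesis using lip[of "%_. 1" 0] by (simp add: sp)
  next
    case False
    have [measurable]: "U : sets borel" using U by simp
    define phi where "phi n y = min 1 (real n * infdist y (- U))" for n y
    have phic: "continuous_on UNIV (phi n)" for n unfolding phi_def by (intro continuous_intros)
    have phim[measurable]: "phi n : borel_measurable borel" for n by (rule borel_measurable_continuous_onI[OF phic])
    have phib: "0 <= phi n y" "phi n y <= 1" for n y by (auto simp: phi_def infdist_nonneg)
    have le: "(\<integral>y. phi n y \<partial>\<mu>1) <= (\<integral>y. phi n y \<partial>\<mu>2) + c" for n
    proof (rule lip[OF phim phib])
      fix y y'
      have "\<bar>phi n y - phi n y'\<bar> <= \<bar>real n * infdist y (- U) - real n * infdist y' (- U)\<bar>" unfolding phi_def by linarith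
      also have "... = real n * \<bar>infdist y (- U) - infdist y' (- U)\<bar>" by (simp add: abs_mult flip: right_diff_distrib)
      also have "... <= real n * norm (y - y')" using infdist_triangle_abs[of y "- U" y'] by (intro mult_left_mono) (auto simp: dist_norm)
      finally show "\<bar>phi n y - phi n y'\<bar> <= real n * norm (y - y')" .
    qed
    have lim: "(%n. phi n y) \<longlonglongrightarrow> indicator U y" for y
    proof (cases "y : U")
      case True
      have "infdist y (- U) > 0" using infdist_pos_not_in_closed[of "- U" y] U True False by auto
      then obtain m where m: "1 < real m * infdist y (- U)" using reals_Archimedean3 by blast
      have "phi n y = 1" if "n >= m" for n
      proof -
        have "real m * infdist y (- U) <= real n * infdist y (- U)" using that by (intro mult_right_mono) (auto simp: infdist_nonneg)
        thus ?thesis using m by (simp add: phi_def)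
      qed
      thus ?thesis using True by (intro tendsto_eventually) (auto simp: eventually_sequentially)
    qed (simp add: phi_def)
    have "(%n. \<integral>y. phi n y \<partial>\<mu>1) \<longlonglongrightarrow> (\<integral>y. indicator U y \<partial>\<mu>1)"
      by (rule integral_dominated_convergence[where w="%_. 1"]) (use U lim phib in auto)
    moreover have "(%n. \<integral>y. phi n y \<partial>\<mu>2) \<longlonglongrightarrow> (\<integral>y. indicator U y \<partial>\<mu>2)"
      by (rule integral_dominated_convergence[where w="%_. 1"]) (use U lim phib in auto)
    ultimately have "(\<integral>y. indicator U y \<partial>\<mu>1) <= (\<integral>y. indicator U y \<partial>\<mu>2) + c"
      using le by (intro LIMSEQ_le[OF _ tendsto_add[OF _ tendsto_const]]) auto
    thus ?thesis by (simp add: sp)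
  qed
  have set: "measure \<mu>1 A <= measure \<mu>2 A + c" if A: "A : sets borel" for A
  proof (rule field_le_epsilon)
    fix e :: real assume e: "e > 0"
    have "emeasure \<mu>2 A < emeasure \<mu>2 A + ennreal e" using e by (simp add: \<mu>2.emeasure_eq_measure ennreal_less_iff flip: ennreal_plus)
    hence "(INF U\<in>{U. A \<subseteq> U & open U}. emeasure \<mu>2 U) < emeasure \<mu>2 A + ennreal e"
      using outer_regular[OF s2 \<mu>2.emeasure_finite[of "space \<mu>2", folded infinity_ennreal_def] A] by simp
    then obtain U where U: "A \<subseteq> U" "open U" "emeasure \<mu>2 U < emeasure \<mu>2 A + ennreal e" by (auto simp: INF_less_iff)
    hence "measure \<mu>2 U < measure \<mu>2 A + e" using e by (simp add: \<mu>2.emeasure_eq_measure ennreal_less_iff flip: ennreal_plus)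
    moreover have "measure \<mu>1 A <= measure \<mu>1 U" using U A s1 by (intro \<mu>1.finite_measure_mono) auto
    ultimately show "measure \<mu>1 A <= measure \<mu>2 A + c + e" using opn[OF U(2)] by linarith
  qed
  show ?thesis
  proof (rule field_le_epsilon)
    fix e :: real assume e: "e > 0"
    obtain N0 where N0: "measure \<mu>1 UNIV / e < real N0" using reals_Archimedean2 by blast
    define N where "N = Suc N0"
    have N: "N > 0" "measure \<mu>1 UNIV / real N <= e"
    proof -
      have "measure \<mu>1 UNIV < real N0 * e" using N0 e by (simp add: pos_divide_less_eq)
      also have "... <= real N * e" using e by (simp add: N_def)
      finally show "measure \<mu>1 UNIV / real N <= e" by (simp add: N_def divide_le_eq mult.commute)
    qed (simp add: N_def)
    define Bj where "Bj j = {y. real j <= real N * g y}" for j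
    have Bj: "Bj j : sets borel" for j unfolding Bj_def using g(1) by measurable
    \<comment> \<open>The largest multiple of \<open>1 / N\<close> not exceeding \<open>g y\<close>,
      written as a mean of indicators.\<close>
    define S where "S y = (\<Sum>j\<in>{1..N}. indicator (Bj j) y) / real N" for y
    have Sb: "S y <= g y" "g y <= S y + 1 / real N" for y
    proof -
      define v where "v = real N * g y"
      have v: "0 <= v" "v <= real N" using g(2,3)[of y] by (auto simp: v_def mult_left_le)
      have "(\<Sum>j\<in>{1..N}. indicator (Bj j) y) = real (card ({1..N} \<inter> {j. y : Bj j}))"
        by (simp add: indicator_def of_bool_def sum.If_cases Int_def)
      also have "{1..N} \<inter> {j. y : Bj j} = {1..nat \<lfloor>v\<rfloor>}"
      proof (rule set_eqI)
        fix j
        have "real j <= v \<longleftrightarrow> j <= nat \<lfloor>v\<rfloor>" using v(1) by (metis le_nat_floor le_nat_iff le_floor_iff of_int_of_nat_eq of_nat_0_le_iff zero_le_floor)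
        moreover have "j <= N" if "real j <= v" using that v(2) by linarith
        ultimately show "j : {1..N} \<inter> {j. y : Bj j} \<longleftrightarrow> j : {1..nat \<lfloor>v\<rfloor>}" by (auto simp: Bj_def v_def)
      qed
      finally have "(\<Sum>j\<in>{1..N}. indicator (Bj j) y) = real_of_int \<lfloor>v\<rfloor>" using v by simp
      hence "S y = real_of_int \<lfloor>v\<rfloor> / real N" by (simp add: S_def)
      moreover have "real_of_int \<lfloor>v\<rfloor> / real N <= v / real N" "v / real N <= (real_of_int \<lfloor>v\<rfloor> + 1) / real N" by (intro divide_right_mono; linarith)+
      moreover have "v / real N = g y" using N by (simp add: v_def)
      ultimately show "S y <= g y" "g y <= S y + 1 / real N" by (auto simp: add_divide_distrib)
    qed
    have iB: "integrable \<mu>1 (indicator (Bj j) :: 'a => real)" "integrable \<mu>2 (indicator (Bj j) :: 'a => real)" for j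
      using Bj s1 s2 by (auto intro!: integrable_real_indicator simp: less_top[symmetric])
    have ig: "integrable \<mu>1 g" "integrable \<mu>2 g"
      using g by (auto intro!: \<mu>1.integrable_const_bound[where B=1] \<mu>2.integrable_const_bound[where B=1])
    have iS: "integrable \<mu>1 S" "integrable \<mu>2 S" unfolding S_def using iB by auto
    have I: "(\<integral>y. S y \<partial>\<mu>1) = (\<Sum>j\<in>{1..N}. measure \<mu>1 (Bj j)) / real N" "(\<integral>y. S y \<partial>\<mu>2) = (\<Sum>j\<in>{1..N}. measure \<mu>2 (Bj j)) / real N"
      unfolding S_def using iB by (simp_all add: Bochner_Integration.integral_sum sp)
    have "(\<integral>y. g y \<partial>\<mu>1) <= (\<integral>y. S y + 1 / real N \<partial>\<mu>1)" using ig iS Sb by (intro integral_mono) auto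
    also have "... = (\<integral>y. S y \<partial>\<mu>1) + measure \<mu>1 UNIV / real N" using iS by (simp add: sp)
    also have "(\<integral>y. S y \<partial>\<mu>1) <= (\<Sum>j\<in>{1..N}. measure \<mu>2 (Bj j) + c) / real N"
      unfolding I using set[OF Bj] by (intro divide_right_mono sum_mono) auto
    also have "... = (\<integral>y. S y \<partial>\<mu>2) + c" unfolding I using N by (simp add: sum.distrib add_divide_distrib)
    also have "(\<integral>y. S y \<partial>\<mu>2) <= (\<integral>y. g y \<partial>\<mu>2)" using ig iS Sb by (intro integral_mono) auto
    finally show "(\<integral>y. g y \<partial>\<mu>1) <= (\<integral>y. g y \<partial>\<mu>2) + c + e" using N(2) by linarith
  qed
qed

context cadlag_mp begin

text \<open>The law of the position at time \<open>t\<close> on the event that the regime is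
  \<open>l\<close>: a finite measure on the vector space alone, to which outer regularity
  applies.\<close>

definition slice :: "real => nat => (real^'d) measure" where
  "slice t l = distr (density Q (%om. ennreal (indicator {l} (snd (om t))))) borel (%om. fst (om t))"

lemma slice_facts:
  fixes phi :: "real^'d => real"
  shows "sets (slice t l) = sets borel" "finite_measure (slice t l)"
    "phi : borel_measurable borel ==> (LINT y|slice t l. phi y) = (LINT om|Q. indicator {l} (snd (om t)) * phi (fst (om t)))"
proof -
  have fm[measurable]: "(%om. fst (om t)) : Q \<rightarrow>\<^sub>M borel"
    by (rule measurable_compose[OF coord_measurable borel_measurable_continuous_onI]) (intro continuous_intros)
  have im[measurable]: "(%om. indicator {l} (snd (om t)) :: real) : borel_measurable Q"
  proof -
    have "snd -` {l} : sets (borel :: ((real^'d) \<times> nat) measure)"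
      by (intro borel_open open_vimage continuous_on_snd continuous_on_id) (rule discrete_topology_class.open_discrete)
    hence "(%om. indicator (snd -` {l}) (om t) :: real) : borel_measurable Q" by (intro measurable_compose[OF coord_measurable]) simp
    thus ?thesis by (simp add: indicator_def)
  qed
  show "sets (slice t l) = sets borel" by (simp add: slice_def)
  show "finite_measure (slice t l)" unfolding slice_def
  proof (rule finite_measure.finite_measure_distr)
    have "(\<integral>\<^sup>+om. ennreal (indicator {l} (snd (om t))) \<partial>Q) <= (\<integral>\<^sup>+om. 1 \<partial>Q)" by (intro nn_integral_mono) (simp add: indicator_def)
    hence "(\<integral>\<^sup>+om. ennreal (indicator {l} (snd (om t))) \<partial>Q) ~= \<infinity>" by (auto simp: emeasure_space_1 top_unique)
    thus "finite_measure (density Q (%om. ennreal (indicator {l} (snd (om t)))))"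
      by (intro finite_measureI) (simp add: emeasure_density cong: nn_integral_cong)
  qed simp
  assume [measurable]: "phi : borel_measurable borel"
  show "(LINT y|slice t l. phi y) = (LINT om|Q. indicator {l} (snd (om t)) * phi (fst (om t)))"
    unfolding slice_def by (subst integral_distr, simp, simp, subst integral_real_density) auto
qed

end

context switching begin

text \<open>Rescaling \<open>f\<close> to the unit interval yields the factor \<open>2 * C\<close>;
  applying the bound for Lipschitz functions in each regime separately yields the factor
  \<open>n0\<close>.\<close>

lemma measurable_estimate:
  fixes f :: "(real^'d) \<times> nat => real"
  assumes T: "T > 0" and \<delta>: "\<delta> > 0" and M: "M >= 3" "\<delta>^2 / (lam * T) <= M"
    and th: "th > 0" "4 * th + 2 * (real n0 * HQ) * \<delta>^2 <= lam / \<delta>"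
    and SFb: "!!k x z. k : Sset n0 ==> norm (x - z) <= 2 * \<delta> ==>
       2 * ((x - z) \<bullet> (b x k - b z k)) + (norm (\<sigma> x k - \<sigma> z k))\<^sup>2 <= th * norm (x - z) \<and>
       tv_int (\<nu> x k) (\<nu> z k) norm <= ennreal th"
    and n0: "1 <= n0"
    and Q1: "cadlag_mp Q1 (Sset n0) (Aop a b \<nu> q eps0 n0) {f. ALL k:Sset n0. Cc_inf (%y. f (y, k))} (x, k)"
    and Q2: "cadlag_mp Q2 (Sset n0) (Aop a b \<nu> q eps0 n0) {f. ALL k:Sset n0. Cc_inf (%y. f (y, k))} (x', k)"
    and f: "f : borel_measurable borel" "!!z. \<bar>f z\<bar> <= C" and C: "C > 0"
  shows "(LINT om|Q1. f (om T)) - (LINT om|Q2. f (om T)) <= 2 * C * real n0 * (8 * M / \<delta>) * norm (x - x')"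
proof -
  interpret Q1: cadlag_mp Q1 "Sset n0" "Aop a b \<nu> q eps0 n0" "{f. ALL k:Sset n0. Cc_inf (%y. f (y, k))}" "(x, k)" by (rule Q1)
  interpret Q2: cadlag_mp Q2 "Sset n0" "Aop a b \<nu> q eps0 n0" "{f. ALL k:Sset n0. Cc_inf (%y. f (y, k))}" "(x', k)" by (rule Q2)
  define c where "c = 8 * M / \<delta> * norm (x - x')"
  define g where "g z = (f z + C) / (2 * C)" for z
  have g: "g : borel_measurable borel" "0 <= g z" "g z <= 1" for z
  proof -
    show "g : borel_measurable borel" unfolding g_def using f(1) by measurable
    show "0 <= g z" "g z <= 1" unfolding g_def using f(2)[of z] C by (auto simp: abs_le_iff)
  qed
  have fin: "finite (Sset n0)" by (simp add: Sset_def)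
  have gs: "(%y. g (y, l)) : borel_measurable borel" for l
    using measurable_compose[OF borel_measurable_continuous_onI g(1), of "%y. (y, l)"] by (simp add: continuous_on_Pair)
  have slice: "(LINT y|Q1.slice T l. g (y, l)) <= (LINT y|Q2.slice T l. g (y, l)) + c" for l
  proof (rule lipschitz_to_measurable[OF Q1.slice_facts(1) Q2.slice_facts(1) Q1.slice_facts(2) Q2.slice_facts(2) _ gs g(2,3)])
    fix phi :: "real^'d => real" and Lf
    assume phi: "phi : borel_measurable borel" "!!y. 0 <= phi y" "!!y. phi y <= 1" and lip: "!!y y'. \<bar>phi y - phi y'\<bar> <= Lf * norm (y - y')"
    define F where "F z = indicator {l} (snd z) * phi (fst z)" for z :: "(real^'d) \<times> nat"
    have Fm: "F : borel_measurable borel"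
    proof -
      have "snd -` {l} : sets (borel :: ((real^'d) \<times> nat) measure)"
        by (intro borel_open open_vimage continuous_on_snd continuous_on_id) (rule discrete_topology_class.open_discrete)
      moreover have "(fst :: (real^'d) \<times> nat => real^'d) : borel_measurable borel"
        by (intro borel_measurable_continuous_onI continuous_on_fst continuous_on_id)
      ultimately have "(%z. indicator (snd -` {l}) z * phi (fst z)) : borel_measurable borel"
        using measurable_compose[OF _ phi(1)] by (intro borel_measurable_times borel_measurable_indicator) auto
      thus ?thesis by (simp add: F_def[abs_def] indicator_def)
    qed
    have F: "0 <= F z" "F z <= 1" for z using phi(2,3)[of "fst z"] by (auto simp: F_def indicator_def)
    have L0: "0 <= Lf * norm (y - y')" for y y' :: "real^'d" using lip[of y y'] by linarith
    have Fl: "\<bar>F (y, l') - F (y', l')\<bar> <= Lf * norm (y - y')" for l' y y' using lip[of y y'] L0[of y y'] by (auto simp: F_def indicator_def)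
    have "(LINT om|Q1. F (om T)) - (LINT om|Q2. F (om T)) <= c"
    proof (rule field_le_epsilon)
      show "(LINT om|Q1. F (om T)) - (LINT om|Q2. F (om T)) <= c + e" if "e > 0" for e
        unfolding c_def by (rule lipschitz_estimate[OF T \<delta> M th SFb n0 Q1 Q2 Fm F Fl that])
    qed
    thus "(LINT y|Q1.slice T l. phi y) <= (LINT y|Q2.slice T l. phi y) + c"
      unfolding Q1.slice_facts(3)[OF phi(1)] Q2.slice_facts(3)[OF phi(1)] F_def by linarith
  qed
  have dec: "(LINT om|Q. g (om T)) = (\<Sum>l\<in>Sset n0. (LINT y|cadlag_mp.slice Q T l. g (y, l)))" "integrable Q (%om. g (om T))"
    if "cadlag_mp Q (Sset n0) (Aop a b \<nu> q eps0 n0) {f. ALL k:Sset n0. Cc_inf (%y. f (y, k))} z0" for Q z0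
  proof -
    interpret Q: cadlag_mp Q "Sset n0" "Aop a b \<nu> q eps0 n0" "{f. ALL k:Sset n0. Cc_inf (%y. f (y, k))}" z0 by (rule that)
    have fm: "(%om. fst (om T)) : Q \<rightarrow>\<^sub>M borel"
      by (rule measurable_compose[OF Q.coord_measurable borel_measurable_continuous_onI]) (intro continuous_intros)
    have im: "(%om. indicator {l} (snd (om T)) :: real) : borel_measurable Q" for l
    proof -
      have "snd -` {l} : sets (borel :: ((real^'d) \<times> nat) measure)"
        by (intro borel_open open_vimage continuous_on_snd continuous_on_id) (rule discrete_topology_class.open_discrete)
      hence "(%om. indicator (snd -` {l}) (om T) :: real) : borel_measurable Q" by (intro measurable_compose[OF Q.coord_measurable]) simp
      thus ?thesis by (simp add: indicator_def)
    qed
    have int: "integrable Q (%om. indicator {l} (snd (om T)) * g (fst (om T), l))" for l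
    proof (rule Q.integrable_const_bound[where B=1])
      show "AE om in Q. norm (indicator {l} (snd (om T)) * g (fst (om T), l)) <= 1"
      proof (rule AE_I2)
        fix om show "norm (indicator {l} (snd (om T)) * g (fst (om T), l)) <= 1"
          using g(2,3)[of "(fst (om T), l)"] by (simp add: indicator_def)
      qed
    qed (intro borel_measurable_times im measurable_compose[OF fm gs])
    have "(\<Sum>l\<in>Sset n0. (LINT y|Q.slice T l. g (y, l))) = (LINT om|Q. (\<Sum>l\<in>Sset n0. indicator {l} (snd (om T)) * g (fst (om T), l)))"
      unfolding Q.slice_facts(3)[OF gs] using int by (simp add: Bochner_Integration.integral_sum)
    also have "... = (LINT om|Q. g (om T))"
    proof (rule Bochner_Integration.integral_cong[OF refl])
      fix om assume "om : space Q"
      hence S: "snd (om T) : Sset n0" using Q.path_in_S by (simp add: Q.Q_space)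
      have "(\<Sum>l\<in>Sset n0. indicator {l} (snd (om T)) * g (fst (om T), l)) = (\<Sum>l\<in>Sset n0. if l = snd (om T) then g (om T) else 0)"
        by (intro sum.cong) (auto simp: indicator_def)
      thus "(\<Sum>l\<in>Sset n0. indicator {l} (snd (om T)) * g (fst (om T), l)) = g (om T)" using S fin by simp
    qed
    finally show "(LINT om|Q. g (om T)) = (\<Sum>l\<in>Sset n0. (LINT y|Q.slice T l. g (y, l)))" by simp
    show "integrable Q (%om. g (om T))"
    proof (rule Q.integrable_const_bound[where B=1])
      show "AE om in Q. norm (g (om T)) <= 1"
      proof (rule AE_I2)
        fix om show "norm (g (om T)) <= 1" using g(2,3)[of "om T"] by simp
      qed
    qed (rule measurable_compose[OF Q.coord_measurable g(1)])
  qed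
  have "(LINT om|Q1. g (om T)) <= (\<Sum>l\<in>Sset n0. (LINT y|Q2.slice T l. g (y, l)) + c)"
    unfolding dec(1)[OF Q1] by (intro sum_mono slice)
  also have "... = (LINT om|Q2. g (om T)) + real n0 * c" unfolding dec(1)[OF Q2] by (simp add: sum.distrib Sset_def)
  finally have le: "(LINT om|Q1. g (om T)) - (LINT om|Q2. g (om T)) <= real n0 * c" by simp
  have fe: "f z = 2 * C * g z - C" for z using C by (simp add: g_def)
  have "(LINT om|Q1. f (om T)) - (LINT om|Q2. f (om T)) = 2 * C * ((LINT om|Q1. g (om T)) - (LINT om|Q2. g (om T)))"
    unfolding fe using dec(2)[OF Q1] dec(2)[OF Q2] by (simp add: Q1.prob_space Q2.prob_space right_diff_distrib)
  also have "... <= 2 * C * (real n0 * c)" using le C by (intro mult_left_mono) auto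
  finally show ?thesis by (simp add: c_def mult_ac)
qed

end

text \<open>Testing the one-sided condition at the vertices of a large cross-polytope turns it into a bound on \<open>b\<close> itself.\<close>
lemma drift_local_bound:
  fixes b :: "real^'d::finite => nat => real^'d" and s :: "real^'d => nat => real^'d^'d"
  assumes S: "finite S" and H: "H > 0" and mono: "mono_on {0..} rho" and rho0: "ALL r>=0. 0 <= rho r"
    and F1: "!!k x z. k : S ==> (norm (s x k - s z k))\<^sup>2 + 2 * ((x - z) \<bullet> (b x k - b z k)) <= H * norm (x - z) * rho (norm (x - z))"
    and r: "0 <= r"
  shows "EX B. ALL x k. k : S --> norm x <= r --> norm (b x k) <= B & norm (s x k) <= B"
proof -
  define d where "d = real CARD('d)"
  have d: "d >= 1" by (simp add: d_def Suc_leI)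
  \<comment> \<open>So large that, after summing over the coordinates, the term
    \<open>r * norm (b x k)\<close>, which appears because \<open>x\<close> is not the centre of the
    cross-polytope, is absorbed by \<open>(r + 1) * norm (b x k)\<close>.\<close>
  define R' where "R' = d * (r + 1)"
  define D where "D = r + R'"
  have R': "R' > 0" and D: "D >= 0" using d r by (auto simp: R'_def D_def)
  define Z where "Z = (\<Sum>k\<in>S. \<Sum>j\<in>UNIV. norm (b (R' *\<^sub>R axis j 1) k) + norm (b (- (R' *\<^sub>R axis j 1)) k))"
  have Z: "norm (b (R' *\<^sub>R axis j 1) k) <= Z" "norm (b (- (R' *\<^sub>R axis j 1)) k) <= Z" if "k : S" for j k
  proof -
    have "norm (b (R' *\<^sub>R axis j 1) k) + norm (b (- (R' *\<^sub>R axis j 1)) k) <= (\<Sum>j\<in>UNIV. norm (b (R' *\<^sub>R axis j 1) k) + norm (b (- (R' *\<^sub>R axis j 1)) k))"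
      by (intro member_le_sum) auto
    also have "... <= Z" unfolding Z_def by (rule member_le_sum[OF that _ S]) (auto intro!: sum_nonneg)
    finally show "norm (b (R' *\<^sub>R axis j 1) k) <= Z" "norm (b (- (R' *\<^sub>R axis j 1)) k) <= Z"
      using norm_ge_zero[of "b (R' *\<^sub>R axis j 1) k"] norm_ge_zero[of "b (- (R' *\<^sub>R axis j 1)) k"] by linarith+
  qed
  have rho: "H * t * rho t <= H * t' * rho t'" "0 <= H * t * rho t" if "0 <= t" "t <= t'" for t t'
  proof -
    have le: "rho t <= rho t'" using mono that by (auto simp: mono_on_def)
    have nn: "0 <= rho t" "0 <= H * t" "0 <= H * t'" using rho0 that H by auto
    have "H * t <= H * t'" using that H by (intro mult_left_mono) auto
    thus "H * t * rho t <= H * t' * rho t'" by (rule mult_mono[OF _ le nn(3,1)])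
    show "0 <= H * t * rho t" by (rule mult_nonneg_nonneg[OF nn(2,1)])
  qed
  define C0 where "C0 = H * D * rho D + D * Z"
  have one: "(x - z) \<bullet> b x k <= C0" if k: "k : S" and x: "norm x <= r" and z: "norm z <= R'" and bz: "norm (b z k) <= Z" for x z k
  proof -
    have n: "norm (x - z) <= D" using norm_triangle_ineq4[of x z] x z by (simp add: D_def)
    have "2 * ((x - z) \<bullet> (b x k - b z k)) <= H * norm (x - z) * rho (norm (x - z))" using F1[OF k, of x z] zero_le_power2[of "norm (s x k - s z k)"] by linarith
    also have "... <= H * D * rho D" by (rule rho) (use n in auto)
    finally have "2 * ((x - z) \<bullet> (b x k - b z k)) <= H * D * rho D" .
    moreover have "(x - z) \<bullet> b z k <= D * Z"
      by (rule order_trans[OF norm_cauchy_schwarz mult_mono]) (use n bz D in auto)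
    moreover have "0 <= H * D * rho D" by (rule rho(2)[OF D order_refl])
    ultimately show ?thesis unfolding C0_def by (simp add: inner_diff_right)
  qed
  have bb: "norm (b x k) <= C0" if k: "k : S" and x: "norm x <= r" for x k
  proof -
    have e: "R' * \<bar>b x k $ j\<bar> <= C0 + r * norm (b x k)" for j
    proof -
      have n: "norm (R' *\<^sub>R axis j (1::real)) <= R'" using R' by simp
      have ax: "(R' *\<^sub>R axis j 1) \<bullet> b x k = R' * b x k $ j" by (simp add: inner_axis')
      have "- (x \<bullet> b x k) <= r * norm (b x k)"
        using Cauchy_Schwarz_ineq2[of x "b x k"] mult_right_mono[OF x norm_ge_zero[of "b x k"]] by linarith
      moreover have "(x - R' *\<^sub>R axis j 1) \<bullet> b x k <= C0" by (rule one[OF k x n Z(1)[OF k]])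
      hence "x \<bullet> b x k - R' * b x k $ j <= C0" unfolding inner_diff_left ax .
      moreover have "(x - - (R' *\<^sub>R axis j 1)) \<bullet> b x k <= C0" by (rule one[OF k x _ Z(2)[OF k]]) (use n in simp)
      hence "x \<bullet> b x k + R' * b x k $ j <= C0" unfolding diff_minus_eq_add inner_add_left ax .
      moreover have "R' * \<bar>b x k $ j\<bar> = \<bar>R' * b x k $ j\<bar>" using R' by (simp add: abs_mult)
      ultimately show ?thesis by linarith
    qed
    have "R' * (\<Sum>j\<in>UNIV. \<bar>b x k $ j\<bar>) <= (\<Sum>j\<in>(UNIV::'d set). C0 + r * norm (b x k))" unfolding sum_distrib_left by (intro sum_mono e)
    also have "... = d * (C0 + r * norm (b x k))" by (simp add: d_def)
    finally have "d * ((r + 1) * (\<Sum>j\<in>UNIV. \<bar>b x k $ j\<bar>)) <= d * (C0 + r * norm (b x k))" by (simp add: R'_def mult_ac)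
    hence "(r + 1) * (\<Sum>j\<in>UNIV. \<bar>b x k $ j\<bar>) <= C0 + r * norm (b x k)" using d by (simp add: mult_le_cancel_left)
    moreover have "(r + 1) * norm (b x k) <= (r + 1) * (\<Sum>j\<in>UNIV. \<bar>b x k $ j\<bar>)" using norm_le_l1_cart r by (intro mult_left_mono) auto
    ultimately show ?thesis by (simp add: algebra_simps)
  qed
  define Y where "Y = H * r * rho r + 4 * r * C0"
  have sb: "norm (s x k) <= Y + 1 + (\<Sum>k\<in>S. norm (s 0 k))" if k: "k : S" and x: "norm x <= r" for x k
  proof -
    have C0: "C0 >= 0" by (rule order_trans[OF norm_ge_zero bb[OF k x]])
    have "(norm (s x k - s 0 k))\<^sup>2 <= H * norm x * rho (norm x) - 2 * (x \<bullet> (b x k - b 0 k))" using F1[OF k, of x 0] by simp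
    moreover have "H * norm x * rho (norm x) <= H * r * rho r" by (rule rho) (use x in auto)
    moreover have "- (x \<bullet> (b x k - b 0 k)) <= r * (C0 + C0)"
    proof -
      have "norm (b x k - b 0 k) <= C0 + C0" using norm_triangle_ineq4[of "b x k" "b 0 k"] bb[OF k x] bb[OF k, of 0] r by simp
      hence "norm x * norm (b x k - b 0 k) <= r * (C0 + C0)" using x r by (intro mult_mono) auto
      thus ?thesis using Cauchy_Schwarz_ineq2[of x "b x k - b 0 k"] by linarith
    qed
    ultimately have sq: "(norm (s x k - s 0 k))\<^sup>2 <= Y" unfolding Y_def by (simp add: algebra_simps)
    have "norm (s x k - s 0 k) <= (norm (s x k - s 0 k))\<^sup>2 + 1"
    proof -
      have "0 <= (norm (s x k - s 0 k) - 1/2)\<^sup>2" by simp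
      thus ?thesis by (simp add: power2_eq_square algebra_simps)
    qed
    moreover have "norm (s 0 k) <= (\<Sum>k\<in>S. norm (s 0 k))" by (rule member_le_sum[OF k _ S]) auto
    moreover have "norm (s x k) <= norm (s 0 k) + norm (s x k - s 0 k)" by (rule norm_triangle_sub)
    ultimately show ?thesis using sq by linarith
  qed
  show ?thesis
    by (rule exI[of _ "max C0 (Y + 1 + (\<Sum>k\<in>S. norm (s 0 k)))"]) (use bb sb in \<open>auto simp: le_max_iff_disj\<close>)
qed

text \<open>For symmetric \<open>A\<close> the squared norm is the trace of \<open>A ** A\<close>.
  Together the two bounds carry a local bound from a given square root of the diffusion matrix to
  the matrix itself, and from there to the symmetric root of its remainder after the isotropic part
  is split off.\<close>

lemma matrix_norm_bounds:
  fixes A :: "real^'d::finite^'d"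
  shows "norm (A ** transpose A) <= real CARD('d) ^ 3 * (norm A)\<^sup>2"
    "transpose A = A ==> (norm A)\<^sup>2 <= real CARD('d) * norm (A ** A)"
proof -
  have c: "\<bar>M $ i $ j\<bar> <= norm M" for M :: "real^'d^'d" and i j
    using component_le_norm_cart[of "M $ i" j] Finite_Cartesian_Product.norm_nth_le[of M i] by linarith
  have n: "norm M <= (\<Sum>i\<in>UNIV. \<Sum>j\<in>UNIV. \<bar>M $ i $ j\<bar>)" for M :: "real^'d^'d"
  proof -
    have "norm M <= (\<Sum>i\<in>UNIV. norm (M $ i))" unfolding norm_vec_def[of M] by (rule L2_set_le_sum) simp
    also have "... <= (\<Sum>i\<in>UNIV. \<Sum>j\<in>UNIV. \<bar>M $ i $ j\<bar>)" by (intro sum_mono norm_le_l1_cart)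
    finally show ?thesis .
  qed
  have e: "\<bar>(A ** transpose A) $ i $ j\<bar> <= real CARD('d) * (norm A)\<^sup>2" for i j
  proof -
    have "\<bar>(A ** transpose A) $ i $ j\<bar> <= (\<Sum>k\<in>UNIV. \<bar>A $ i $ k * A $ j $ k\<bar>)"
      by (simp add: matrix_matrix_mult_def transpose_def sum_abs)
    also have "... <= (\<Sum>k\<in>(UNIV::'d set). (norm A)\<^sup>2)"
      unfolding abs_mult power2_eq_square by (intro sum_mono mult_mono c) auto
    finally show ?thesis by simp
  qed
  have "norm (A ** transpose A) <= (\<Sum>i\<in>(UNIV::'d set). \<Sum>j\<in>(UNIV::'d set). real CARD('d) * (norm A)\<^sup>2)"
    by (rule order_trans[OF n]) (intro sum_mono e)
  thus "norm (A ** transpose A) <= real CARD('d) ^ 3 * (norm A)\<^sup>2" by (simp add: power3_eq_cube mult_ac)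
  assume s: "transpose A = A"
  have sy: "A $ j $ i = A $ i $ j" for i j using arg_cong[OF s, of "%B. B $ i $ j"] by (simp add: transpose_def)
  have "(norm A)\<^sup>2 = (\<Sum>i\<in>UNIV. \<Sum>j\<in>UNIV. A $ i $ j * A $ i $ j)" by (simp add: power2_norm_eq_inner inner_vec_def)
  also have "... = (\<Sum>i\<in>UNIV. (A ** A) $ i $ i)" by (simp add: matrix_matrix_mult_def sy)
  also have "... <= (\<Sum>i\<in>(UNIV::'d set). norm (A ** A))" by (intro sum_mono order_trans[OF abs_ge_self c])
  finally show "(norm A)\<^sup>2 <= real CARD('d) * norm (A ** A)" by simp
qed

theorem theorem5p4:
  fixes a :: "'d::finite coef_a" and b :: "'d coef_b" and \<nu> :: "'d coef_nu" and q :: "'d coef_q"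
    and n0 :: nat and \<epsilon>0 :: real
    and P :: "real^'d \<Rightarrow> nat \<Rightarrow> (real \<Rightarrow> (real^'d) \<times> nat) measure"
  assumes setting: "coeff_setting n0 \<epsilon>0 a b \<nu> q"
    and A: "assumption_A n0 \<epsilon>0 a b \<nu> q"
    and F1F2: "assumption_F1F2 n0 a b \<nu> q"
    and SF: "assumption_SF n0 a b \<nu>"
    and P_sol: "\<forall>x. \<forall>k\<in>Sset n0. mp_solution_A a b \<nu> q \<epsilon>0 n0 (x, k) (P x k)"
  shows "\<forall>t>0. \<forall>f :: (real^'d) \<times> nat \<Rightarrow> real.
           f \<in> borel_measurable borel \<longrightarrow> bounded (range f) \<longrightarrow>
           continuous_on (UNIV \<times> Sset n0) (\<lambda>(x, k). \<integral>\<omega>. f (\<omega> t) \<partial>(P x k))"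
proof -
  have n0: "1 <= n0" and \<epsilon>0: "0 < \<epsilon>0"
    and a_psd: "!!x k. k : Sset n0 ==> sym_psd (a x k)"
    and nu: "!!x k. k : Sset n0 ==> sets (\<nu> x k) = sets borel" "!!x k. k : Sset n0 ==> sigma_finite_measure (\<nu> x k)"
    and meas: "!!k. k : Sset n0 ==> (%x. a x k) : borel_measurable borel" "!!k. k : Sset n0 ==> (%x. b x k) : borel_measurable borel"
      "!!k E. k : Sset n0 ==> E : sets borel ==> (%x. emeasure (\<nu> x k) E) : borel_measurable borel"
      "!!k l. k : Sset n0 ==> l : Sset n0 ==> (%x. q x k l) : borel_measurable borel"
    and q0: "!!x k l. k : Sset n0 ==> l : Sset n0 ==> k ~= l ==> 0 <= q x k l"
    and qs: "!!x k. k : Sset n0 ==> (\<Sum>l\<in>Sset n0. q x k l) = 0"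
    using setting unfolding coeff_setting_def by blast+
  have qb: "!!k. k : Sset n0 ==> EX c. ALL x. c <= q x k k"
    and nub: "EX C. ALL x. ALL k:Sset n0. (\<integral>\<^sup>+y. ennreal (min 1 ((norm y)\<^sup>2)) \<partial>(\<nu> x k)) <= ennreal C"
    using A unfolding assumption_A_def by blast+
  have fin: "finite (Sset n0)" by (simp add: Sset_def)
  obtain C1 where C1: "!!x k. k : Sset n0 ==> (\<integral>\<^sup>+y. ennreal (min 1 ((norm y)\<^sup>2)) \<partial>(\<nu> x k)) <= ennreal C1" using nub by blast
  define CN where "CN = \<bar>C1\<bar>"
  have CN: "(\<integral>\<^sup>+y. ennreal (min 1 ((norm y)\<^sup>2)) \<partial>(\<nu> x k)) <= ennreal CN" if "k : Sset n0" for x k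
    by (rule order_trans[OF C1[OF that] ennreal_leI]) (simp add: CN_def)
  obtain cq where cq: "!!x k. k : Sset n0 ==> cq k <= q x k k" using qb by metis
  \<comment> \<open>The rows of \<open>q\<close> sum to 0, so an off-diagonal rate is at most minus
    the diagonal one, which is bounded from below.\<close>
  define CQ where "CQ = (\<Sum>k\<in>Sset n0. \<bar>cq k\<bar>)"
  have q_le: "q x k l <= CQ" if kl: "k : Sset n0" "l : Sset n0" "k ~= l" for x k l
  proof -
    have "q x k l <= (\<Sum>l\<in>Sset n0 - {k}. q x k l)" by (rule member_le_sum) (use kl fin q0 in auto)
    also have "... = - q x k k" using qs[OF kl(1), of x] sum.remove[OF fin kl(1), of "q x k"] by simp
    also have "... <= \<bar>cq k\<bar>" using cq[OF kl(1), of x] by linarith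
    also have "... <= CQ" unfolding CQ_def by (rule member_le_sum[OF kl(1) _ fin]) auto
    finally show ?thesis .
  qed
  obtain H \<rho> and s :: "'d coef_a" where H: "H > 0" and \<rho>: "mono_on {0..} \<rho>" "ALL r>=0. 0 <= \<rho> r"
    and s: "ALL x. ALL k:Sset n0. s x k ** transpose (s x k) = a x k"
    and F1: "ALL k:Sset n0. ALL x z. (norm (s x k - s z k))\<^sup>2 + 2 * ((x - z) \<bullet> (b x k - b z k)) <= H * norm (x - z) * \<rho> (norm (x - z)) \<and>
           tv_int (\<nu> x k) (\<nu> z k) norm <= ennreal (H * \<rho> (norm (x - z)))"
    and F2: "ALL k:Sset n0. ALL l:Sset n0. k ~= l --> (ALL x z. \<bar>q x k l - q z k l\<bar> <= H * norm (x - z))"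
    using F1F2 unfolding assumption_F1F2_def by (elim exE conjE) (rule that)
  obtain lam \<delta>0 H' \<theta> where lam: "lam > 0" and ell: "ALL x \<xi>. ALL k:Sset n0. lam * (norm \<xi>)\<^sup>2 <= \<xi> \<bullet> (a x k *v \<xi>)"
    and \<delta>0: "\<delta>0 > 0" and H': "H' > 0" and \<theta>: "(\<theta> \<longlongrightarrow> 0) (at_right 0)"
    and SF': "ALL k:Sset n0. ALL x z. norm (x - z) <= \<delta>0 -->
              2 * ((x - z) \<bullet> (b x k - b z k)) + (norm (psd_sqrt (a x k - lam *\<^sub>R mat 1) - psd_sqrt (a z k - lam *\<^sub>R mat 1)))\<^sup>2
                <= 2 * H' * norm (x - z) * \<theta> (norm (x - z)) \<and>
              tv_int (\<nu> x k) (\<nu> z k) norm <= ennreal (H' / 2 * \<theta> (norm (x - z)))"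
    using SF unfolding assumption_SF_def by (elim exE conjE) (rule that)
  define \<sigma> where "\<sigma> x k = psd_sqrt (a x k - lam *\<^sub>R mat 1)" for x k
  have psd: "sym_psd (a x k - lam *\<^sub>R mat 1)" if k: "k : Sset n0" for x k
    unfolding sym_psd_def
  proof (intro conjI allI)
    have tr: "transpose (a x k) = a x k" using a_psd[OF k] by (simp add: sym_psd_def)
    have "a x k $ j $ i = a x k $ i $ j" for i j using arg_cong[OF tr, of "%B. B $ i $ j"] by (simp add: transpose_def)
    thus "transpose (a x k - lam *\<^sub>R mat 1) = a x k - lam *\<^sub>R mat 1" by (simp add: vec_eq_iff transpose_def mat_def)
    fix \<xi> :: "real^'d"
    have "(a x k - lam *\<^sub>R mat 1) *v \<xi> = a x k *v \<xi> - lam *\<^sub>R \<xi>"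
      by (simp add: matrix_vector_mult_diff_rdistrib flip: scaleR_matrix_vector_assoc)
    thus "0 <= \<xi> \<bullet> ((a x k - lam *\<^sub>R mat 1) *v \<xi>)" using ell k by (simp add: inner_diff_right dot_square_norm)
  qed
  have \<sigma>: "transpose (\<sigma> x k) = \<sigma> x k" "\<sigma> x k ** \<sigma> x k = a x k - lam *\<^sub>R mat 1" if "k : Sset n0" for x k
    using psd_sqrt[OF psd[OF that, of x]] by (auto simp: \<sigma>_def sym_psd_def)
  have loc: "EX B. ALL x k. k : Sset n0 --> norm x <= r --> norm (a x k) <= B & norm (b x k) <= B & norm (\<sigma> x k) <= B" for r
  proof -
    have "EX B. ALL x k. k : Sset n0 --> norm x <= max r 0 --> norm (b x k) <= B & norm (s x k) <= B"
      by (rule drift_local_bound[OF fin H \<rho>]) (use F1 in auto)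
    then obtain B where B: "!!x k. k : Sset n0 ==> norm x <= max r 0 ==> norm (b x k) <= B & norm (s x k) <= B" by blast
    define Ba where "Ba = real CARD('d) ^ 3 * B^2"
    define Bs where "Bs = real CARD('d) * (Ba + norm (lam *\<^sub>R (mat 1 :: real^'d^'d))) + 1"
    have "norm (a x k) <= Ba & norm (\<sigma> x k) <= Bs" if k: "k : Sset n0" and x: "norm x <= r" for x k
    proof -
      have "norm (s x k) <= B" using B[OF k, of x] x by simp
      hence "(norm (s x k))\<^sup>2 <= B^2" by (intro power_mono) auto
      hence "real CARD('d) ^ 3 * (norm (s x k))\<^sup>2 <= Ba" unfolding Ba_def by (intro mult_left_mono) auto
      moreover have "norm (a x k) <= real CARD('d) ^ 3 * (norm (s x k))\<^sup>2" using matrix_norm_bounds(1)[of "s x k"] s k by simp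
      ultimately have na: "norm (a x k) <= Ba" by linarith
      have "(norm (\<sigma> x k))\<^sup>2 <= real CARD('d) * norm (a x k - lam *\<^sub>R mat 1)" using matrix_norm_bounds(2)[OF \<sigma>(1)[OF k]] \<sigma>(2)[OF k] by simp
      also have "... <= real CARD('d) * (Ba + norm (lam *\<^sub>R (mat 1 :: real^'d^'d)))"
        by (intro mult_left_mono order_trans[OF norm_triangle_ineq4] add_mono na) auto
      finally have "(norm (\<sigma> x k))\<^sup>2 + 1 <= Bs" by (simp add: Bs_def)
      moreover have "norm (\<sigma> x k) <= (norm (\<sigma> x k))\<^sup>2 + 1"
      proof -
        have "0 <= (norm (\<sigma> x k) - 1/2)\<^sup>2" by simp
        thus ?thesis by (simp add: power2_eq_square algebra_simps)
      qed
      ultimately show ?thesis using na by linarith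
    qed
    moreover have "norm (b x k) <= B" if "k : Sset n0" "norm x <= r" for x k using B[OF that(1), of x] that(2) by simp
    ultimately show ?thesis
      by (intro exI[of _ "max Ba (max B Bs)"]) (auto simp: le_max_iff_disj)
  qed
  have SFt: "EX \<delta>>0. ALL k:Sset n0. ALL x z. norm (x - z) <= \<delta> -->
       2 * ((x - z) \<bullet> (b x k - b z k)) + (norm (\<sigma> x k - \<sigma> z k))\<^sup>2 <= th * norm (x - z) \<and>
       tv_int (\<nu> x k) (\<nu> z k) norm <= ennreal th" if th: "th > 0" for th
  proof -
    have "0 < th / (2 * H')" using th H' by simp
    with \<theta> have "\<forall>\<^sub>F r in at_right 0. \<theta> r < th / (2 * H')" by (rule order_tendstoD(2))
    then obtain d where d: "d > 0" "!!r. 0 < r ==> r < d ==> \<theta> r < th / (2 * H')" unfolding eventually_at_right_field by blast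
    show ?thesis
    \<comment> \<open>Halving \<open>d\<close> makes distances in the closed range satisfy the
      strict bound under which \<open>\<theta>\<close> is small.\<close>
    proof (intro exI[of _ "min \<delta>0 (d / 2)"] conjI ballI allI impI)
      show "0 < min \<delta>0 (d / 2)" using \<delta>0 d by simp
      fix k and x z :: "real^'d" assume k: "k : Sset n0" and n: "norm (x - z) <= min \<delta>0 (d / 2)"
      have S: "2 * ((x - z) \<bullet> (b x k - b z k)) + (norm (\<sigma> x k - \<sigma> z k))\<^sup>2 <= 2 * H' * norm (x - z) * \<theta> (norm (x - z))"
        "tv_int (\<nu> x k) (\<nu> z k) norm <= ennreal (H' / 2 * \<theta> (norm (x - z)))" using SF' k n unfolding \<sigma>_def by auto
      show "2 * ((x - z) \<bullet> (b x k - b z k)) + (norm (\<sigma> x k - \<sigma> z k))\<^sup>2 <= th * norm (x - z)"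
      proof (cases "x = z")
        case False
        have "\<theta> (norm (x - z)) < th / (2 * H')" using False n d by (intro d(2)) auto
        hence "2 * H' * \<theta> (norm (x - z)) <= th" using H' by (simp add: pos_less_divide_eq mult.commute)
        hence "2 * H' * \<theta> (norm (x - z)) * norm (x - z) <= th * norm (x - z)" by (intro mult_right_mono) auto
        thus ?thesis using S(1) by (simp add: mult_ac)
      qed simp
      show "tv_int (\<nu> x k) (\<nu> z k) norm <= ennreal th"
      proof (cases "x = z")
        case True
        thus ?thesis using tv_int_self[OF nu(2)[OF k]] by simp
      next
        case False
        have "\<theta> (norm (x - z)) < th / (2 * H')" using False n d by (intro d(2)) auto
        hence "2 * (H' * \<theta> (norm (x - z))) < th" using H' by (simp add: pos_less_divide_eq mult_ac)
        hence "H' / 2 * \<theta> (norm (x - z)) <= th" using th by simp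
        thus ?thesis using S(2) by (meson ennreal_leI order_trans)
      qed
    qed
  qed
  obtain N :: "(real^'d) measure" and v0 where N: "prob_space N" "sets N = sets borel" "AE u in N. norm u <= 1" "v0 > 0"
    "!!n h. norm n = 1 ==> h : borel_measurable borel ==> (LINT u|N. h (reflect n u)) = (LINT u|N. (h u :: real))"
    "!!e. (LINT u|N. e \<bullet> u) = 0" "!!e. norm e = 1 ==> (LINT u|N. (e \<bullet> u)\<^sup>2) = v0"
    "!!i j. i ~= j ==> (LINT u|N. u $ i * u $ j) = 0"
    using isotropic_noise_exists by blast
  interpret switching a b \<nu> q n0 \<epsilon>0 \<sigma> lam CN CQ H N v0
  proof (rule switching.intro)
    show "a x k = \<sigma> x k ** \<sigma> x k + lam *\<^sub>R mat 1" if "k : Sset n0" for k x using \<sigma>(2)[OF that] by simp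
    show "\<bar>q x k l - q z k l\<bar> <= H * norm (x - z)" if "k : Sset n0" "l : Sset n0" "k ~= l" for k l x z using F2 that by blast
    show "CN >= 0" "CQ >= 0" "H >= 0" using H by (auto simp: CN_def CQ_def intro: sum_nonneg)
  qed (fact \<epsilon>0 lam \<sigma>(1) nu CN meas q0 q_le loc SFt N)+
  show ?thesis
  proof (intro allI impI)
    fix t :: real and f :: "(real^'d) \<times> nat => real"
    assume t: "t > 0" and f: "f : borel_measurable borel" "bounded (range f)"
    obtain C0 where C0: "!!z. \<bar>f z\<bar> <= C0" using f(2) unfolding bounded_iff by auto
    define C where "C = \<bar>C0\<bar> + 1"
    have C: "C > 0" by (simp add: C_def)
    have fC: "\<bar>f z\<bar> <= C" for z using C0[of z] unfolding C_def by linarith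
    obtain \<delta>1 where \<delta>1: "\<delta>1 > 0" "!!k x z. k : Sset n0 ==> norm (x - z) <= \<delta>1 ==>
       2 * ((x - z) \<bullet> (b x k - b z k)) + (norm (\<sigma> x k - \<sigma> z k))\<^sup>2 <= 1 * norm (x - z) & tv_int (\<nu> x k) (\<nu> z k) norm <= ennreal 1"
      using SFt[of 1] by auto
    define Y where "Y = 4 + 2 * (real n0 * H)"
    have Y: "Y > 0" using H by (simp add: Y_def add_pos_nonneg)
    \<comment> \<open>Small enough for ellipticity to beat the modulus \<open>th = 1\<close>; since
      \<open>\<delta> <= 1\<close>, the constant \<open>Y\<close> bounds the left side of the
      condition. The choice involves the coefficients only, not \<open>f\<close>.\<close>
    define \<delta> where "\<delta> = min (\<delta>1 / 2) (min 1 (lam / Y))"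
    have \<delta>: "\<delta> > 0" "2 * \<delta> <= \<delta>1" "\<delta> <= 1" "\<delta> <= lam / Y" using \<delta>1(1) lam Y by (auto simp: \<delta>_def)
    have th: "4 * 1 + 2 * (real n0 * H) * \<delta>^2 <= lam / \<delta>"
    proof -
      have "2 * (real n0 * H) * \<delta>^2 <= 2 * (real n0 * H) * 1" using \<delta> H by (intro mult_left_mono power_le_one) auto
      moreover have "Y <= lam / \<delta>" using \<delta>(1,4) Y by (simp add: pos_le_divide_eq mult.commute)
      ultimately show ?thesis unfolding Y_def by linarith
    qed
    define M where "M = max 3 (\<delta>^2 / (lam * t))"
    have M: "M >= 3" "\<delta>^2 / (lam * t) <= M" by (auto simp: M_def)
    have mp: "cadlag_mp (P x k) (Sset n0) (Aop a b \<nu> q \<epsilon>0 n0) {f. ALL k:Sset n0. Cc_inf (%y. f (y, k))} (x, k)" if "k : Sset n0" for x k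
      using P_sol that unfolding mp_solution_A_def by (intro cadlag_mp.intro) auto
    define K where "K = 2 * C * real n0 * (8 * M / \<delta>)"
    have SFb: "2 * ((x - z) \<bullet> (b x k - b z k)) + (norm (\<sigma> x k - \<sigma> z k))\<^sup>2 <= 1 * norm (x - z) & tv_int (\<nu> x k) (\<nu> z k) norm <= ennreal 1"
      if "k : Sset n0" "norm (x - z) <= 2 * \<delta>" for k x z using that \<delta>(2) by (intro \<delta>1(2)) auto
    have est: "\<bar>(LINT \<omega>|P x k. f (\<omega> t)) - (LINT \<omega>|P x' k. f (\<omega> t))\<bar> <= K * norm (x - x')" if k: "k : Sset n0" for x x' k
    proof -
      have E: "(LINT \<omega>|P x k. f (\<omega> t)) - (LINT \<omega>|P x' k. f (\<omega> t)) <= K * norm (x - x')" for x x'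
        unfolding K_def by (rule measurable_estimate[OF t \<delta>(1) M zero_less_one th SFb n0 mp[OF k] mp[OF k] f(1) fC C])
      show ?thesis using E[of x x'] E[of x' x] by (simp add: abs_le_iff norm_minus_commute)
    qed
    show "continuous_on (UNIV \<times> Sset n0) (%(x, k). \<integral>\<omega>. f (\<omega> t) \<partial>P x k)"
      unfolding continuous_on_def
    proof
      fix z :: "(real^'d) \<times> nat" assume "z : UNIV \<times> Sset n0"
      then obtain x k where z: "z = (x, k)" and k: "k : Sset n0" by auto
      define F where "F = (%(x, k). \<integral>\<omega>. f (\<omega> t) \<partial>P x k)"
      have "((%z. F z - F (x, k)) \<longlongrightarrow> 0) (at (x, k) within UNIV \<times> Sset n0)"
      proof (rule Lim_null_comparison)
        \<comment> \<open>Regimes are isolated points, so near \<open>(x, k)\<close> only starting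
          points with the same regime have to be compared.\<close>
        have "open ((UNIV :: (real^'d) set) \<times> {k})" by (intro open_Times open_UNIV discrete_topology_class.open_discrete)
        thus "\<forall>\<^sub>F z in at (x, k) within UNIV \<times> Sset n0. norm (F z - F (x, k)) <= K * norm (fst z - x)"
          unfolding eventually_at_topological using est[OF k] by (intro exI[of _ "UNIV \<times> {k}"]) (auto simp: F_def)
        have "((%z. K * norm (fst z - x)) \<longlongrightarrow> K * norm (fst (x, k) - x)) (at (x, k) within UNIV \<times> Sset n0)"
          by (intro tendsto_intros)
        thus "((%z. K * norm (fst z - x)) \<longlongrightarrow> 0) (at (x, k) within UNIV \<times> Sset n0)" by simp
      qed
      thus "((%(x, k). \<integral>\<omega>. f (\<omega> t) \<partial>P x k) \<longlongrightarrow> (case z of (x, k) => \<integral>\<omega>. f (\<omega> t) \<partial>P x k)) (at z within UNIV \<times> Sset n0)"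
        unfolding z F_def[symmetric] by (simp add: LIM_zero_iff F_def)
    qed
  qed
qed

end
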